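(* Let $\mathcal{G}\rightrightarrows M$ be a Lie groupoid and let $\overline m_\epsilon$, $\epsilon$ in an open interval containing $0$, be an $s$-constant deformation of $\mathcal{G}$. Let $\xi\in C^2_{\mathrm{def}}(\mathcal{G})$ be the deformation cocycle $$\xi(g,g')=\left.\frac{d}{d\epsilon}\right|_{\epsilon=0}\overline m_\epsilon(gg',g'),\qquad (g,g')\in\mathcal{G}^{(2)},$$ and let $\beta\in C^2_{\mathrm{Hoch}}(\mathcal{A}_\mathcal{G},\mathcal{A}_\mathcal{G})$ be the Hochschild cocycle of the induced deformation of the convolution algebra, $$\beta(a_1,a_2)(g)=\left.\frac{d}{d\epsilon}\right|_{\epsilon=0}\int_{h\in s^{-1}(s(g))}a_1(\overline m_\epsilon(g,h))\,a_2(h).$$ Then the chain map $\Phi: C^\bullet_{\mathrm{def}}(\mathcal{G})\to C^\bullet_{\mathrm{Hoch}}(\mathcal{A}_\mathcal{G},\mathcal{A}_\mathcal{G})$ sends $\xi$ to $\beta$: $\Phi(\xi)=\beta$.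
   Context: Groupoid conventions: $s,t$ are source and target, $g_1g_2$ is defined when $s(g_1)=t(g_2)$, $\overline m(g,h)=gh^{-1}$ is the division map, defined on $\mathcal{G}\,{}^s\!\times^s\mathcal{G}=\{(g,h):s(g)=s(h)\}$; $\mathcal{G}^{(k)}=\{(g_1,\dots,g_k): s(g_i)=t(g_{i+1})\}$; $A=\ker(ds)|_M$; right translation identifies $\ker ds\cong t^*A$. An $s$-constant deformation of $\mathcal{G}$ is a smooth family of Lie groupoid structures on the manifold $\mathcal{G}$ over $M$, all with the same source map $s$, given by a smooth family of division maps $\overline m_\epsilon:\mathcal{G}\,{}^s\!\times^s\mathcal{G}\to\mathcal{G}$ parametrized by $\epsilon$ in an open interval containing $0$, with $\overline m_0=\overline m$. A density on an $n$-dimensional vector space is a map $a$ on $n$-tuples of vectors with $a(Bv_1,\dots,Bv_n)=|\det B|a(v_1,\dots,v_n)$. $\mathcal{D}_s$ is the bundle of densities of $\ker ds$. The convolution algebra is $\mathcal{A}_\mathcal{G}=\Gamma_c(\mathcal{D}_s)$ with $(a_1*a_2)(g)=\int_{h\in s^{-1}(s(g))}a_1(gh^{-1})a_2(h)$, where $a_1(gh^{-1})$ is regarded as a density on $\ker ds_g$ via the differential of right translation $g'\mapsto g'h^{-1}$. Likewise in $\beta$, $a_1(\overline m_\epsilon(g,h))$ is regarded as a density on $\ker ds_g$ via the differential at $g$ of $g'\mapsto\overline m_\epsilon(g',h)$ on $s^{-1}(s(h))$. $C^k_{\mathrm{def}}(\mathcal{G})$ ($k\ge1$) is the set of smooth maps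 $c:\mathcal{G}^{(k)}\to T\mathcal{G}$ with $c(g_1,\dots,g_k)\in T_{g_1}\mathcal{G}$ such that $ds(c(g_1,\dots,g_k))=s_c(g_2,\dots,g_k)$ depends only on $(g_2,\dots,g_k)$ (for $k=1$: only on $s(g_1)$). $C^k_{\mathrm{Hoch}}(\mathcal{A}_\mathcal{G},\mathcal{A}_\mathcal{G})$ consists of $k$-linear maps $\mathcal{A}_\mathcal{G}^k\to\mathcal{A}_\mathcal{G}$. An $s$-projectable vector field $X$ on $\mathcal{G}$ (i.e. $ds\circ X=Y\circ s$ for some $Y\in\mathfrak{X}(M)$) acts on $a\in\Gamma(\mathcal{D}_s)$ by $Xa=\frac{d}{dt}|_{t=0}(\Phi^t_X)^*a$ with $\Phi^t_X$ the flow of $X$; for a vector field along a single fiber $s^{-1}(y)$ with constant $s$-projection, $(Xa)_g$, $g\in s^{-1}(y)$, is defined via any extension to an $s$-projectable vector field (independent of the extension). The map $\Phi$ is defined by $$(\Phi c)(a_1,\dots,a_k)(g)=\int_{g_1\cdots g_k=g}(c(-,g_2,\dots,g_k)a_1)(g_1)a_2(g_2)\cdots a_k(g_k),$$ an iterated convolution integral; in particular for $k=2$, $(\Phi c)(a_1,a_2)(g)=\int_{h\in s^{-1}(s(g))}(c(-,h)a_1)(gh^{-1})\,a_2(h)$. *)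

theory Defs
  imports "HOL-Analysis.Analysis" "Jordan_Normal_Form.Determinant"
begin

section \<open>Smooth manifolds\<close>

primrec Ck_on :: "nat \<Rightarrow> 'a::euclidean_space set \<Rightarrow> ('a \<Rightarrow> 'b::euclidean_space) \<Rightarrow> bool" where
  "Ck_on 0 U f \<longleftrightarrow> continuous_on U f"
| "Ck_on (Suc k) U f \<longleftrightarrow> (\<forall>x\<in>U. f differentiable (at x)) \<and>
     (\<forall>v. Ck_on k U (\<lambda>x. frechet_derivative f (at x) v))"

definition Cinf_on :: "'a::euclidean_space set \<Rightarrow> ('a \<Rightarrow> 'b::euclidean_space) \<Rightarrow> bool" where
  "Cinf_on U f \<longleftrightarrow> (\<forall>k. Ck_on k U f)"

text \<open>
  Charts take values in a linear subspace \<open>model\<close> of a Euclidean space, so that the dimension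
  of a manifold is \<open>dim model\<close>. This admits dimension 0 (for instance the base of a Lie group),
  which a model space of class \<open>euclidean_space\<close> would exclude. The underlying
  set of a manifold is a whole type, whose topology is Hausdorff and second countable.
\<close>

record ('a, 'e) smooth_structure =
  charts :: "('a set \<times> ('a \<Rightarrow> 'e)) set"
  model :: "'e set"

text \<open>
  Smoothness on an arbitrary subset \<open>S\<close> means that the coordinate expression extends locally to a
  smooth map on an open set of the ambient Euclidean space. On open subsets and on embedded
  submanifolds \<open>S\<close> (the fibers of \<open>s\<close>, the composable pairs, the domain of the division map) this
  is smoothness in the usual sense.
\<close>

definition smooth_map ::
  "('a, 'e::euclidean_space) smooth_structure \<Rightarrow> ('b, 'f::euclidean_space) smooth_structure \<Rightarrow>
   'a set \<Rightarrow> ('a \<Rightarrow> 'b) \<Rightarrow> bool" where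
  "smooth_map A B S f \<longleftrightarrow>
     (\<forall>p\<in>S. \<exists>(U, \<phi>)\<in>charts A. \<exists>(V, \<psi>)\<in>charts B. \<exists>N F.
        p \<in> U \<and> f p \<in> V \<and> open N \<and> \<phi> p \<in> N \<and> Cinf_on N F \<and>
        (\<forall>q\<in>S \<inter> U. \<phi> q \<in> N \<longrightarrow> f q \<in> V \<and> F (\<phi> q) = \<psi> (f q)))"

definition eucl :: "('e, 'e::euclidean_space) smooth_structure" where
  "eucl = \<lparr>charts = {(UNIV, id)}, model = UNIV\<rparr>"

definition prod_structure ::
  "('a, 'e) smooth_structure \<Rightarrow> ('b, 'f) smooth_structure \<Rightarrow> ('a \<times> 'b, 'e \<times> 'f) smooth_structure"
  where
  "prod_structure A B =
     \<lparr>charts = {(U \<times> V, map_prod \<phi> \<psi>) | U \<phi> V \<psi>. (U, \<phi>) \<in> charts A \<and> (V, \<psi>) \<in> charts B},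
      model = model A \<times> model B\<rparr>"

definition manifold ::
  "('a::{t2_space, second_countable_topology}, 'e::euclidean_space) smooth_structure \<Rightarrow> bool" where
  "manifold A \<longleftrightarrow>
     subspace (model A) \<and>
     (\<Union>(U, \<phi>)\<in>charts A. U) = UNIV \<and>
     (\<forall>(U, \<phi>)\<in>charts A. open U \<and> openin (top_of_set (model A)) (\<phi> ` U) \<and>
        (\<exists>\<theta>. homeomorphism U (\<phi> ` U) \<phi> \<theta>)) \<and>
     (\<forall>(U, \<phi>)\<in>charts A. \<forall>(V, \<psi>)\<in>charts A.
        smooth_map eucl eucl (\<phi> ` (U \<inter> V)) (\<psi> \<circ> inv_into U \<phi>))"


section \<open>Tangent vectors\<close>

text \<open>
  A tangent vector at \<open>p\<close> is represented by its components, an element of \<open>model A\<close>, in a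
  preferred chart \<open>chart_at A p\<close> chosen once and for all for each point \<open>p\<close>. A tuple of tangent
  vectors at a common point is a list.
\<close>

definition chart_at :: "('a, 'e) smooth_structure \<Rightarrow> 'a \<Rightarrow> 'a set \<times> ('a \<Rightarrow> 'e)" where
  "chart_at A p = (SOME c. c \<in> charts A \<and> p \<in> fst c)"

definition has_velocity ::
  "('a::topological_space, 'e::euclidean_space) smooth_structure \<Rightarrow> (real \<Rightarrow> 'a) \<Rightarrow> real \<Rightarrow> 'e \<Rightarrow> bool"
  where
  "has_velocity A \<gamma> t v \<longleftrightarrow> isCont \<gamma> t \<and>
     ((\<lambda>\<tau>. snd (chart_at A (\<gamma> t)) (\<gamma> \<tau>)) has_vector_derivative v) (at t)"

definition velocity ::
  "('a::topological_space, 'e::euclidean_space) smooth_structure \<Rightarrow> (real \<Rightarrow> 'a) \<Rightarrow> real \<Rightarrow> 'e" where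
  "velocity A \<gamma> t = (THE v. has_velocity A \<gamma> t v)"

definition curve_in ::
  "('a::topological_space, 'e::euclidean_space) smooth_structure \<Rightarrow> 'a set \<Rightarrow> 'a \<Rightarrow> 'e \<Rightarrow>
   (real \<Rightarrow> 'a) \<Rightarrow> bool" where
  "curve_in A S p v \<gamma> \<longleftrightarrow> \<gamma> 0 = p \<and> has_velocity A \<gamma> 0 v \<and>
     (\<exists>\<delta>>0. \<gamma> ` {-\<delta><..<\<delta>} \<subseteq> S \<and> smooth_map eucl A {-\<delta><..<\<delta>} \<gamma>)"

text \<open>
  The differential at \<open>p\<close> of a map \<open>f\<close> defined on an (open or embedded) submanifold \<open>S\<close>, applied to
  a vector \<open>v\<close> tangent to \<open>S\<close>: the velocity of \<open>f \<circ> \<gamma>\<close> for any smooth curve \<open>\<gamma>\<close> in \<open>S\<close> with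
  velocity \<open>v\<close>.
\<close>

definition tangent_map ::
  "('a::topological_space, 'e::euclidean_space) smooth_structure \<Rightarrow>
   ('b::topological_space, 'f::euclidean_space) smooth_structure \<Rightarrow>
   'a set \<Rightarrow> ('a \<Rightarrow> 'b) \<Rightarrow> 'a \<Rightarrow> 'e \<Rightarrow> 'f" where
  "tangent_map A B S f p v = velocity B (f \<circ> (SOME \<gamma>. curve_in A S p v \<gamma>)) 0"

definition submersion ::
  "('a::topological_space, 'e::euclidean_space) smooth_structure \<Rightarrow>
   ('b::topological_space, 'f::euclidean_space) smooth_structure \<Rightarrow> ('a \<Rightarrow> 'b) \<Rightarrow> bool" where
  "submersion A B f \<longleftrightarrow> smooth_map A B UNIV f \<and>
     (\<forall>p. tangent_map A B UNIV f p ` model A = model B)"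

text \<open>The components in the chart \<open>\<phi>\<close> of the tangent vector \<open>v\<close> at \<open>p\<close>.\<close>

definition chart_comp ::
  "('a, 'e::euclidean_space) smooth_structure \<Rightarrow> ('a \<Rightarrow> 'e) \<Rightarrow> 'a \<Rightarrow> 'e \<Rightarrow> 'e" where
  "chart_comp A \<phi> p v =
     (let (V, \<psi>) = chart_at A p
      in vector_derivative (\<lambda>t. \<phi> (inv_into V \<psi> (\<psi> p + t *\<^sub>R v))) (at 0))"

text \<open>Smooth maps \<open>x \<mapsto> c x \<in> T\<^bsub>b x\<^esub> A\<close> from a subset \<open>S\<close> of a manifold \<open>N\<close> to the tangent bundle.\<close>

definition smooth_along ::
  "('n, 'd::euclidean_space) smooth_structure \<Rightarrow>
   ('a, 'e::euclidean_space) smooth_structure \<Rightarrow> 'n set \<Rightarrow> ('n \<Rightarrow> 'a) \<Rightarrow> ('n \<Rightarrow> 'e) \<Rightarrow> bool" where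
  "smooth_along N A S b c \<longleftrightarrow> smooth_map N A S b \<and> c ` S \<subseteq> model A \<and>
     (\<forall>(V, \<phi>)\<in>charts A.
        smooth_map N eucl {x \<in> S. b x \<in> V} (\<lambda>x. chart_comp A \<phi> (b x) (c x)))"

definition vector_field ::
  "('a, 'e::euclidean_space) smooth_structure \<Rightarrow> 'a set \<Rightarrow> ('a \<Rightarrow> 'e) \<Rightarrow> bool" where
  "vector_field A U X \<longleftrightarrow> smooth_along A A U id X"

text \<open>
  A local flow \<open>\<Phi>\<close>, at times in \<open>]-\<delta>, \<delta>[\<close> and starting points in \<open>W\<close>, of a vector field \<open>X\<close>
  on \<open>U\<close>. Smoothness of \<open>\<Phi>\<close> is then automatic.
\<close>

definition local_flow ::
  "('a::topological_space, 'e::euclidean_space) smooth_structure \<Rightarrow> 'a set \<Rightarrow> ('a \<Rightarrow> 'e) \<Rightarrow>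
   'a set \<Rightarrow> real \<Rightarrow> (real \<Rightarrow> 'a \<Rightarrow> 'a) \<Rightarrow> bool" where
  "local_flow A U X W \<delta> \<Phi> \<longleftrightarrow> open W \<and> 0 < \<delta> \<and>
     (\<forall>p\<in>W. \<Phi> 0 p = p \<and>
        (\<forall>t\<in>{-\<delta><..<\<delta>}. \<Phi> t p \<in> U \<and> has_velocity A (\<lambda>\<tau>. \<Phi> \<tau> p) t (X (\<Phi> t p))))"


section \<open>Lie groupoids\<close>

record ('g, 'm) groupoid =
  src :: "'g \<Rightarrow> 'm"
  tgt :: "'g \<Rightarrow> 'm"
  mul :: "'g \<Rightarrow> 'g \<Rightarrow> 'g"
  unit_at :: "'m \<Rightarrow> 'g"
  inv_of :: "'g \<Rightarrow> 'g"

definition composable :: "('g, 'm) groupoid \<Rightarrow> ('g \<times> 'g) set" where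
  "composable G = {(g, h). src G g = tgt G h}"

definition is_groupoid :: "('g, 'm) groupoid \<Rightarrow> bool" where
  "is_groupoid G \<longleftrightarrow>
     (\<forall>g h. src G g = tgt G h \<longrightarrow> src G (mul G g h) = src G h \<and> tgt G (mul G g h) = tgt G g) \<and>
     (\<forall>g h k. src G g = tgt G h \<longrightarrow> src G h = tgt G k \<longrightarrow>
        mul G (mul G g h) k = mul G g (mul G h k)) \<and>
     (\<forall>x. src G (unit_at G x) = x \<and> tgt G (unit_at G x) = x) \<and>
     (\<forall>g. mul G (unit_at G (tgt G g)) g = g \<and> mul G g (unit_at G (src G g)) = g) \<and>
     (\<forall>g. src G (inv_of G g) = tgt G g \<and> tgt G (inv_of G g) = src G g \<and>
        mul G g (inv_of G g) = unit_at G (tgt G g) \<and> mul G (inv_of G g) g = unit_at G (src G g))"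

definition lie_groupoid ::
  "('g::{t2_space, second_countable_topology}, 'e::euclidean_space) smooth_structure \<Rightarrow>
   ('m::{t2_space, second_countable_topology}, 'f::euclidean_space) smooth_structure \<Rightarrow>
   ('g, 'm) groupoid \<Rightarrow> bool" where
  "lie_groupoid A B G \<longleftrightarrow> manifold A \<and> manifold B \<and> is_groupoid G \<and>
     submersion A B (src G) \<and> submersion A B (tgt G) \<and>
     smooth_map (prod_structure A A) A (composable G) (\<lambda>(g, h). mul G g h) \<and>
     smooth_map B A UNIV (unit_at G) \<and> smooth_map A A UNIV (inv_of G)"

definition division :: "('g, 'm) groupoid \<Rightarrow> 'g \<Rightarrow> 'g \<Rightarrow> 'g" where
  "division G g h = mul G g (inv_of G h)"

definition src_fiber :: "('g, 'm) groupoid \<Rightarrow> 'm \<Rightarrow> 'g set" where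
  "src_fiber G y = {g. src G g = y}"

definition ker_ds ::
  "('g::topological_space, 'e::euclidean_space) smooth_structure \<Rightarrow>
   ('m::topological_space, 'f::euclidean_space) smooth_structure \<Rightarrow>
   ('g, 'm) groupoid \<Rightarrow> 'g \<Rightarrow> 'e set" where
  "ker_ds A B G g = {v \<in> model A. tangent_map A B UNIV (src G) g v = 0}"

text \<open>
  \<open>s\<close>-constant deformations, parametrized by an open interval \<open>I\<close> containing 0. The values
  of \<open>m \<epsilon>\<close> matter only on pairs with the same source.
\<close>

definition s_constant_deformation ::
  "('g::{t2_space, second_countable_topology}, 'e::euclidean_space) smooth_structure \<Rightarrow>
   ('m::{t2_space, second_countable_topology}, 'f::euclidean_space) smooth_structure \<Rightarrow>
   ('g, 'm) groupoid \<Rightarrow> real set \<Rightarrow> (real \<Rightarrow> 'g \<Rightarrow> 'g \<Rightarrow> 'g) \<Rightarrow> bool" where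
  "s_constant_deformation A B G I m \<longleftrightarrow>
     open I \<and> is_interval I \<and> 0 \<in> I \<and>
     (\<forall>\<epsilon>\<in>I. \<exists>H. lie_groupoid A B H \<and> src H = src G \<and>
        (\<forall>g h. src G g = src G h \<longrightarrow> m \<epsilon> g h = division H g h)) \<and>
     smooth_map (prod_structure eucl (prod_structure A A)) A
       {(\<epsilon>, g, h). \<epsilon> \<in> I \<and> src G g = src G h} (\<lambda>(\<epsilon>, g, h). m \<epsilon> g h) \<and>
     (\<forall>g h. src G g = src G h \<longrightarrow> m 0 g h = division G g h)"


section \<open>Densities and their integrals\<close>

definition tuples :: "'e::euclidean_space set \<Rightarrow> 'e list set" where
  "tuples V = {vs. set vs \<subseteq> V \<and> length vs = dim V}"

text \<open>
  Densities on the vector space \<open>V\<close>; \<open>M\<close> is the matrix of the endomorphism \<open>L\<close> in the basis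
  \<open>bs\<close> of \<open>V\<close>. Values on lists outside \<open>tuples V\<close> are irrelevant. The scalars \<open>'k\<close> are the real
  or the complex numbers.
\<close>

definition density ::
  "'e::euclidean_space set \<Rightarrow> ('e list \<Rightarrow> 'k::{real_normed_field, euclidean_space}) \<Rightarrow> bool" where
  "density V a \<longleftrightarrow>
     (\<forall>vs\<in>tuples V. \<forall>bs L M.
        distinct bs \<and> independent (set bs) \<and> span (set bs) = V \<and> linear L \<and>
        M \<in> carrier_mat (dim V) (dim V) \<and>
        (\<forall>j<dim V. L (bs ! j) = (\<Sum>i<dim V. M $$ (i, j) *\<^sub>R bs ! i))
        \<longrightarrow> a (map L vs) = \<bar>Determinant.det M\<bar> *\<^sub>R a vs)"

text \<open>
  The compactly supported smooth sections of the bundle of densities of \<open>ker ds\<close>. Smoothness is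
  tested on local smooth frames of \<open>ker ds\<close>.
\<close>

definition convolution_algebra ::
  "('g::topological_space, 'e::euclidean_space) smooth_structure \<Rightarrow>
   ('m::topological_space, 'f::euclidean_space) smooth_structure \<Rightarrow>
   ('g, 'm) groupoid \<Rightarrow> ('g \<Rightarrow> 'e list \<Rightarrow> 'k::{real_normed_field, euclidean_space}) set" where
  "convolution_algebra A B G =
     {a. (\<forall>g. density (ker_ds A B G g) (a g)) \<and>
         (\<forall>U Xs. open U \<and> (\<forall>X\<in>set Xs. vector_field A U X) \<and>
            (\<forall>g\<in>U. map (\<lambda>X. X g) Xs \<in> tuples (ker_ds A B G g) \<and>
               span (set (map (\<lambda>X. X g) Xs)) = ker_ds A B G g)
            \<longrightarrow> smooth_map A eucl U (\<lambda>g. a g (map (\<lambda>X. X g) Xs))) \<and>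
         compact (closure {g. \<exists>vs\<in>tuples (ker_ds A B G g). a g vs \<noteq> 0})}"

text \<open>
  Lebesgue measure on the coordinate subspace spanned by a list \<open>cs\<close> of basis vectors, in
  analogy with the definition of \<open>lborel\<close>; the point mass at 0 if \<open>cs\<close> is empty.
\<close>

definition coord_measure :: "'e::euclidean_space list \<Rightarrow> 'e measure" where
  "coord_measure cs =
     distr (Pi\<^sub>M (set cs) (\<lambda>_. lborel)) borel (\<lambda>x. \<Sum>b\<in>set cs. x b *\<^sub>R b)"

text \<open>
  Countably many local parametrizations \<open>\<psi> i\<close>, diffeomorphisms from the open subset \<open>W i\<close> of the
  \<open>r\<close>-dimensional coordinate space \<open>span (set cs)\<close> onto open subsets of the submanifold \<open>S\<close>,
  together with a subordinate locally finite continuous partition of unity \<open>\<rho>\<close> on \<open>S\<close>.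
\<close>

definition parametrized_partition ::
  "('a::topological_space, 'e::euclidean_space) smooth_structure \<Rightarrow> nat \<Rightarrow> 'a set \<Rightarrow>
   'e list \<Rightarrow> (nat \<Rightarrow> 'e set) \<Rightarrow> (nat \<Rightarrow> 'e \<Rightarrow> 'a) \<Rightarrow> (nat \<Rightarrow> 'a \<Rightarrow> real) \<Rightarrow> bool" where
  "parametrized_partition A r S cs W \<psi> \<rho> \<longleftrightarrow>
     distinct cs \<and> set cs \<subseteq> Basis \<and> length cs = r \<and>
     (\<forall>i. openin (top_of_set (span (set cs))) (W i) \<and>
          openin (top_of_set S) (\<psi> i ` W i) \<and> inj_on (\<psi> i) (W i) \<and>
          smooth_map eucl A (W i) (\<psi> i) \<and>
          smooth_map A eucl (\<psi> i ` W i) (inv_into (W i) (\<psi> i))) \<and>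
     (\<forall>i. continuous_on S (\<rho> i) \<and> (\<forall>p\<in>S. 0 \<le> \<rho> i p) \<and>
          (\<exists>K\<subseteq>W i. compact K \<and> (\<forall>p\<in>S. \<rho> i p \<noteq> 0 \<longrightarrow> p \<in> \<psi> i ` K))) \<and>
     (\<forall>p\<in>S. (\<lambda>i. \<rho> i p) sums 1) \<and>
     (\<forall>p\<in>S. \<exists>N. open N \<and> p \<in> N \<and> finite {i. \<exists>q\<in>N \<inter> S. \<rho> i q \<noteq> 0})"

text \<open>
  The integral of a (compactly supported continuous) density \<open>a\<close> on the \<open>r\<close>-dimensional submanifold
  \<open>S\<close>; by the transformation formula it does not depend on the chosen partition.
\<close>

definition density_integral ::
  "('a::topological_space, 'e::euclidean_space) smooth_structure \<Rightarrow> nat \<Rightarrow> 'a set \<Rightarrow>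
   ('a \<Rightarrow> 'e list \<Rightarrow> 'k::{real_normed_field, euclidean_space}) \<Rightarrow> 'k" where
  "density_integral A r S a =
     (let (cs, W, \<psi>, \<rho>) = (SOME (cs, W, \<psi>, \<rho>). parametrized_partition A r S cs W \<psi> \<rho>)
      in \<Sum>i. LINT x:W i|coord_measure cs.
           \<rho> i (\<psi> i x) *\<^sub>R a (\<psi> i x) (map (\<lambda>b. velocity A (\<lambda>t. \<psi> i (x + t *\<^sub>R b)) 0) cs))"

definition fiber_integral ::
  "('g::topological_space, 'e::euclidean_space) smooth_structure \<Rightarrow>
   ('m::topological_space, 'f::euclidean_space) smooth_structure \<Rightarrow>
   ('g, 'm) groupoid \<Rightarrow> 'm \<Rightarrow>
   ('g \<Rightarrow> 'e list \<Rightarrow> 'k::{real_normed_field, euclidean_space}) \<Rightarrow> 'k" where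
  "fiber_integral A B G y =
     density_integral A (dim (model A) - dim (model B)) (src_fiber G y)"


section \<open>Convolution and its deformation\<close>

text \<open>
  The convolution of \<open>a\<^sub>1\<close> and \<open>a\<^sub>2\<close> for the division map \<open>m\<close>, at \<open>g\<close> and \<open>vs\<close>, where \<open>a\<^sub>1 (m g h)\<close>
  is evaluated on \<open>vs\<close> via the differential of \<open>g' \<mapsto> m g' h\<close>.
\<close>

definition convolution ::
  "('g::topological_space, 'e::euclidean_space) smooth_structure \<Rightarrow>
   ('m::topological_space, 'f::euclidean_space) smooth_structure \<Rightarrow>
   ('g, 'm) groupoid \<Rightarrow> ('g \<Rightarrow> 'g \<Rightarrow> 'g) \<Rightarrow>
   ('g \<Rightarrow> 'e list \<Rightarrow> 'k::{real_normed_field, euclidean_space}) \<Rightarrow> ('g \<Rightarrow> 'e list \<Rightarrow> 'k) \<Rightarrow>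
   ('g \<Rightarrow> 'e list \<Rightarrow> 'k)" where
  "convolution A B G m a\<^sub>1 a\<^sub>2 g vs =
     fiber_integral A B G (src G g) (\<lambda>h ws.
       a\<^sub>1 (m g h) (map (tangent_map A A (src_fiber G (src G h)) (\<lambda>g'. m g' h) g) vs) * a\<^sub>2 h ws)"

definition hochschild_cocycle ::
  "('g::topological_space, 'e::euclidean_space) smooth_structure \<Rightarrow>
   ('m::topological_space, 'f::euclidean_space) smooth_structure \<Rightarrow>
   ('g, 'm) groupoid \<Rightarrow> (real \<Rightarrow> 'g \<Rightarrow> 'g \<Rightarrow> 'g) \<Rightarrow>
   ('g \<Rightarrow> 'e list \<Rightarrow> 'k::{real_normed_field, euclidean_space}) \<Rightarrow> ('g \<Rightarrow> 'e list \<Rightarrow> 'k) \<Rightarrow>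
   ('g \<Rightarrow> 'e list \<Rightarrow> 'k)" where
  "hochschild_cocycle A B G m a\<^sub>1 a\<^sub>2 g vs =
     vector_derivative (\<lambda>\<epsilon>. convolution A B G (m \<epsilon>) a\<^sub>1 a\<^sub>2 g vs) (at 0)"


section \<open>The deformation complex in degree 2 and the map to Hochschild cochains\<close>

definition Cdef2 ::
  "('g::topological_space, 'e::euclidean_space) smooth_structure \<Rightarrow>
   ('m::topological_space, 'f::euclidean_space) smooth_structure \<Rightarrow>
   ('g, 'm) groupoid \<Rightarrow> ('g \<Rightarrow> 'g \<Rightarrow> 'e) set" where
  "Cdef2 A B G =
     {c. smooth_along (prod_structure A A) A (composable G) fst (\<lambda>(g, h). c g h) \<and>
         (\<exists>s\<^sub>c. \<forall>(g, h)\<in>composable G. tangent_map A B UNIV (src G) g (c g h) = s\<^sub>c h)}"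

text \<open>Note that \<open>m \<epsilon> (mul G g h) h = g\<close> for \<open>\<epsilon> = 0\<close>, so that the velocity lies over \<open>g\<close>.\<close>

definition deformation_cocycle ::
  "('g::topological_space, 'e::euclidean_space) smooth_structure \<Rightarrow> ('g, 'm) groupoid \<Rightarrow>
   (real \<Rightarrow> 'g \<Rightarrow> 'g \<Rightarrow> 'g) \<Rightarrow> 'g \<Rightarrow> 'g \<Rightarrow> 'e" where
  "deformation_cocycle A G m g h = velocity A (\<lambda>\<epsilon>. m \<epsilon> (mul G g h) h) 0"

definition s_projectable ::
  "('g::topological_space, 'e::euclidean_space) smooth_structure \<Rightarrow>
   ('m::topological_space, 'f::euclidean_space) smooth_structure \<Rightarrow>
   ('g, 'm) groupoid \<Rightarrow> 'g set \<Rightarrow> ('g \<Rightarrow> 'e) \<Rightarrow> bool" where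
  "s_projectable A B G U X \<longleftrightarrow> open U \<and> vector_field A U X \<and>
     (\<exists>Y. vector_field B (src G ` U) Y \<and>
        (\<forall>g\<in>U. tangent_map A B UNIV (src G) g (X g) = Y (src G g)))"

text \<open>
  The value \<open>(X a)\<^sub>g\<close> for a vector field \<open>X\<close> along the fiber \<open>s\<^sup>-\<^sup>1(s(g))\<close> with constant
  \<open>s\<close>-projection: the derivative at \<open>t = 0\<close> of the pullback of \<open>a\<close> by the flow of an arbitrary
  extension of \<open>X\<close> to an \<open>s\<close>-projectable vector field. As the value depends on the germ of the
  extension at \<open>g\<close> only, extensions to open neighborhoods \<open>U\<close> of \<open>g\<close> are allowed.
\<close>

definition vf_action ::
  "('g::topological_space, 'e::euclidean_space) smooth_structure \<Rightarrow>
   ('m::topological_space, 'f::euclidean_space) smooth_structure \<Rightarrow>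
   ('g, 'm) groupoid \<Rightarrow> ('g \<Rightarrow> 'e) \<Rightarrow>
   ('g \<Rightarrow> 'e list \<Rightarrow> 'k::{real_normed_field, euclidean_space}) \<Rightarrow> ('g \<Rightarrow> 'e list \<Rightarrow> 'k)" where
  "vf_action A B G X a g vs =
     (THE r. \<forall>U Z W \<delta> \<Phi>.
        s_projectable A B G U Z \<and> (\<forall>g'\<in>U \<inter> src_fiber G (src G g). Z g' = X g') \<and>
        local_flow A U Z W \<delta> \<Phi> \<and> g \<in> W \<longrightarrow>
        ((\<lambda>t. a (\<Phi> t g) (map (tangent_map A A W (\<Phi> t) g) vs)) has_vector_derivative r) (at 0))"

definition Phi2 ::
  "('g::topological_space, 'e::euclidean_space) smooth_structure \<Rightarrow>
   ('m::topological_space, 'f::euclidean_space) smooth_structure \<Rightarrow>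
   ('g, 'm) groupoid \<Rightarrow> ('g \<Rightarrow> 'g \<Rightarrow> 'e) \<Rightarrow>
   ('g \<Rightarrow> 'e list \<Rightarrow> 'k::{real_normed_field, euclidean_space}) \<Rightarrow> ('g \<Rightarrow> 'e list \<Rightarrow> 'k) \<Rightarrow>
   ('g \<Rightarrow> 'e list \<Rightarrow> 'k)" where
  "Phi2 A B G c a\<^sub>1 a\<^sub>2 =
     (\<lambda>g vs. fiber_integral A B G (src G g) (\<lambda>h ws.
        vf_action A B G (\<lambda>k. c k h) a\<^sub>1 (division G g h)
          (map (tangent_map A A (src_fiber G (src G h)) (\<lambda>g'. division G g' h) g) vs) * a\<^sub>2 h ws))"

end

theory Submission
  imports Defs
begin

text \<open>
  Since \<open>g = (g h\<^sup>-\<^sup>1) h\<close>, the curve \<open>\<epsilon> \<mapsto> m \<epsilon> g h\<close> starts at \<open>k = g h\<^sup>-\<^sup>1\<close> with velocity \<open>\<xi> (k, h)\<close>.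
  For fixed \<open>h\<close>, the family \<open>g' \<mapsto> m \<epsilon> g' h\<close> on the source fiber of \<open>g\<close> therefore has the same first-order part at
  \<open>\<epsilon> = 0\<close> as \<open>\<Phi> \<epsilon> \<circ> m 0 (-) h\<close>, where \<open>\<Phi>\<close> is the flow of any \<open>s\<close>-projectable extension of \<open>\<xi> (-, h)\<close>: in
  coordinates adapted to \<open>s\<close> a density is \<open>\<bar>det\<bar>\<close> times a smooth function, and both the function and the
  determinant depend only on the 1-jet of these families. Hence the derivative of the integrand of
  the deformed convolution is the integrand of \<open>\<Phi> \<xi>\<close>. The second factor has compact support, so that only
  finitely many patches of the partition of unity contribute, and on each of them the integrand and
  its derivative are bounded locally uniformly in \<open>\<epsilon>\<close>; dominated convergence moves the derivative
  under the integral.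
\<close>

section \<open>Calculus of smooth functions\<close>

text \<open>Three definitions by choice shape the work. \<open>tangent_map\<close> picks a curve, so
  its value must be shown independent of the curve. \<open>vf_action\<close> is a description over
  all extensions and flows: it needs one extension with a flow, and the same derivative for every
  flow. A flow is known only through the velocities of its orbits, so its differential in the
  starting point and the invariance of \<open>ker ds\<close> come from the differential equation.
  \<open>density_integral\<close> picks a partition, whose existence must be proved. The other
  obstacle is the absolute value of a determinant, not differentiable at 0. For
  \<open>\<epsilon> = 0\<close> the map \<open>g' \<mapsto> m 0 g' h\<close> is a right translation,
  injective on vertical vectors: if the determinant is 0 there, the given vectors are dependent and
  it is 0 at all nearby parameters; otherwise its sign is locally constant. The same dichotomy holds
  along a flow, so \<open>sgn d0\<close> replaces the absolute value on both sides. The two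
  determinants have the same derivative by symmetry of second derivatives: one side differentiates
  along the fiber and then in \<open>\<epsilon>\<close>, the other in the opposite order.\<close>

lemma isCont_openD:
  assumes "isCont f x" "open S" "f x \<in> S"
  obtains T where "open T" "x \<in> T" "\<And>y. y \<in> T \<Longrightarrow> f y \<in> S"
  using assms continuous_at_open[of x f] by blast

section \<open>Differentiability classes on open sets: congruence and closure properties\<close>

lemma Ck_on_cong:
  assumes "open U" "\<And>x. x \<in> U \<Longrightarrow> f x = g x"
  shows "Ck_on k U f \<longleftrightarrow> Ck_on k U g"
proof -
  have *: "Ck_on k U g" if "\<And>x. x \<in> U \<Longrightarrow> f x = g x" "Ck_on k U f" for f g :: "'a \<Rightarrow> 'b"
    using that
  proof (induction k arbitrary: f g)
    case 0
    then show ?case by (simp cong: continuous_on_cong)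
  next
    case (Suc k)
    have hd: "(g has_derivative frechet_derivative f (at x)) (at x)" if "x \<in> U" for x
    proof (rule has_derivative_transform_within_open[OF _ \<open>open U\<close> that Suc.prems(1)])
      show "(f has_derivative frechet_derivative f (at x)) (at x)"
        using Suc.prems(2) that by (simp add: frechet_derivative_works[symmetric])
    qed
    then have "frechet_derivative f (at x) v = frechet_derivative g (at x) v" if "x \<in> U" for x v
      using frechet_derivative_at that by metis
    then have "Ck_on k U (\<lambda>x. frechet_derivative g (at x) v)" for v
      using Suc.IH[of "\<lambda>x. frechet_derivative f (at x) v" "\<lambda>x. frechet_derivative g (at x) v"]
        Suc.prems(2) by simp
    then show ?case using hd by (auto simp: differentiable_def)
  qed
  show ?thesis using *[of f g] *[of g f] assms(2) by metis
qed

lemma Ck_on_subset: "Ck_on k U f \<Longrightarrow> V \<subseteq> U \<Longrightarrow> Ck_on k V f"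
  by (induction k arbitrary: f) (auto intro: continuous_on_subset)

lemma Ck_on_SucD: "Ck_on (Suc k) U f \<Longrightarrow> Ck_on k U f"
proof (induction k arbitrary: f)
  case 0
  then show ?case
    by (auto intro!: continuous_at_imp_continuous_on differentiable_imp_continuous_within)
next
  case (Suc k)
  then show ?case by simp
qed

lemma Ck_on_const: "Ck_on k U (\<lambda>x. c)"
  by (induction k arbitrary: c) auto

text \<open>Lets an induction on the class work with an explicit derivative \<open>f'\<close>
  instead of the choice operator behind \<open>frechet_derivative\<close>: the two agree on
  \<open>U\<close>, and \<open>Ck_on_cong\<close> transfers the class because \<open>U\<close> is
  open.\<close>

lemma Ck_on_SucI:
  assumes "open U" "\<And>x. x \<in> U \<Longrightarrow> (f has_derivative f' x) (at x)"
    "\<And>v. Ck_on k U (\<lambda>x. f' x v)"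
  shows "Ck_on (Suc k) U f"
proof -
  have "Ck_on k U (\<lambda>x. frechet_derivative f (at x) v)" for v
    by (rule Ck_on_cong[OF assms(1), THEN iffD1, OF _ assms(3)])
      (use frechet_derivative_at[OF assms(2)] in auto)
  then show ?thesis using assms(2) by (auto simp: differentiable_def)
qed

lemma Ck_on_Suc_deriv:
  "Ck_on (Suc k) U f \<Longrightarrow> x \<in> U \<Longrightarrow> (f has_derivative frechet_derivative f (at x)) (at x)"
  by (simp add: frechet_derivative_works[symmetric])

lemma Ck_on_add:
  assumes "open U" "Ck_on k U f" "Ck_on k U g"
  shows "Ck_on k U (\<lambda>x. f x + g x)"
  using assms(2,3)
proof (induction k arbitrary: f g)
  case 0
  then show ?case by (auto intro: continuous_on_add)
next
  case (Suc k)
  show ?case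
  proof (rule Ck_on_SucI[OF assms(1)])
    show "((\<lambda>x. f x + g x) has_derivative
        (\<lambda>v. frechet_derivative f (at x) v + frechet_derivative g (at x) v)) (at x)" if "x \<in> U" for x
      using that by (intro has_derivative_add Ck_on_Suc_deriv[OF Suc.prems(1)] Ck_on_Suc_deriv[OF Suc.prems(2)])
  qed (use Suc in auto)
qed

lemma Ck_on_sum:
  assumes "open U" "\<And>i. i \<in> S \<Longrightarrow> Ck_on k U (f i)"
  shows "Ck_on k U (\<lambda>x. \<Sum>i\<in>S. f i x)"
  using assms(2)
  by (induction S rule: infinite_finite_induct) (auto intro: Ck_on_const Ck_on_add[OF assms(1)])

lemma Ck_on_bounded_linear:
  assumes "open U" "bounded_linear L" "Ck_on k U f"
  shows "Ck_on k U (\<lambda>x. L (f x))"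
  using assms(3)
proof (induction k arbitrary: f)
  case 0
  then show ?case by (simp add: bounded_linear.continuous_on[OF assms(2)])
next
  case (Suc k)
  show ?case
  proof (rule Ck_on_SucI[OF assms(1)])
    show "((\<lambda>x. L (f x)) has_derivative (\<lambda>v. L (frechet_derivative f (at x) v))) (at x)"
      if "x \<in> U" for x
      by (intro bounded_linear.has_derivative[OF assms(2)] Ck_on_Suc_deriv[OF Suc.prems that])
  qed (use Suc in auto)
qed

lemma Ck_on_bilinear:
  assumes "open U" "bounded_bilinear bop" "Ck_on k U f" "Ck_on k U g"
  shows "Ck_on k U (\<lambda>x. bop (f x) (g x))"
  using assms(3,4)
proof (induction k arbitrary: f g)
  case 0
  then show ?case by (simp add: bounded_bilinear.continuous_on[OF assms(2)])
next
  case (Suc k)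
  show ?case
  proof (rule Ck_on_SucI[OF assms(1)])
    show "((\<lambda>x. bop (f x) (g x)) has_derivative (\<lambda>v. bop (f x) (frechet_derivative g (at x) v)
        + bop (frechet_derivative f (at x) v) (g x))) (at x)" if "x \<in> U" for x
      using that by (intro bounded_bilinear.FDERIV[OF assms(2)] Ck_on_Suc_deriv[OF Suc.prems(1)]
          Ck_on_Suc_deriv[OF Suc.prems(2)])
  next
    show "Ck_on k U (\<lambda>x. bop (f x) (frechet_derivative g (at x) v)
        + bop (frechet_derivative f (at x) v) (g x))" for v
      using Suc.prems Ck_on_SucD[OF Suc.prems(1)] Ck_on_SucD[OF Suc.prems(2)]
      by (intro Ck_on_add[OF assms(1)] Suc.IH) auto
  qed
qed

lemma Ck_on_id: "open U \<Longrightarrow> Ck_on k U (\<lambda>x. x)"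
proof (cases k)
  case (Suc l)
  assume "open U"
  then show ?thesis unfolding Suc
    by (intro Ck_on_SucI[where f'="\<lambda>x v. v"]) (auto intro: Ck_on_const has_derivative_ident)
qed simp

text \<open>\<open>Ck_on\<close> tests derivatives in fixed directions. Expanding in
  \<open>Basis\<close> reduces a derivative in a moving direction to finitely many derivatives in
  fixed directions with variable coefficients; many later smoothness proofs and norm estimates for
  families of linear maps rest on this.\<close>

lemma linear_Basis_expansion:
  fixes L :: "'a::euclidean_space \<Rightarrow> 'b::real_vector"
  assumes "linear L"
  shows "L v = (\<Sum>b\<in>Basis. (inner v b) *\<^sub>R L b)"
proof -
  have "L v = L (\<Sum>b\<in>Basis. inner v b *\<^sub>R b)" by (simp add: euclidean_representation)
  also have "\<dots> = (\<Sum>b\<in>Basis. inner v b *\<^sub>R L b)"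
    by (simp add: linear_sum[OF assms] linear_cmul[OF assms])
  finally show ?thesis .
qed

lemma Ck_on_compose:
  fixes f :: "'a::euclidean_space \<Rightarrow> 'b::euclidean_space" and g :: "'b \<Rightarrow> 'c::euclidean_space"
  assumes "open U" "open V" "f ` U \<subseteq> V" "Ck_on k U f" "Ck_on k V g"
  shows "Ck_on k U (\<lambda>x. g (f x))"
  using assms(4,5)
proof (induction k arbitrary: g)
  case 0
  then show ?case using assms(3) continuous_on_compose2 by auto
next
  case (Suc k)
  let ?f' = "\<lambda>x. frechet_derivative f (at x)" and ?g' = "\<lambda>x. frechet_derivative g (at x)"
  have eq: "?g' (f x) (?f' x v) = (\<Sum>b\<in>Basis. (inner (?f' x v) b) *\<^sub>R ?g' (f x) b)" if "x \<in> U" for x v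
    by (rule linear_Basis_expansion)
      (use Suc.prems(2) assms(3) that in \<open>auto intro!: linear_frechet_derivative\<close>)
  show ?case
  proof (rule Ck_on_SucI[OF assms(1)])
    show "((\<lambda>x. g (f x)) has_derivative (\<lambda>v. ?g' (f x) (?f' x v))) (at x)" if "x \<in> U" for x
      using has_derivative_compose[OF Ck_on_Suc_deriv[OF Suc.prems(1) that]
          Ck_on_Suc_deriv[OF Suc.prems(2)]] assms(3) that by blast
    show "Ck_on k U (\<lambda>x. ?g' (f x) (?f' x v))" for v
    proof (subst Ck_on_cong[OF assms(1) eq])
      show "Ck_on k U (\<lambda>x. \<Sum>b\<in>Basis. (inner (?f' x v) b) *\<^sub>R ?g' (f x) b)"
        using Suc.prems Ck_on_SucD[OF Suc.prems(1)]
        by (intro Ck_on_sum[OF assms(1)] Ck_on_bilinear[OF assms(1) bounded_bilinear_scaleR]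
            Ck_on_bilinear[OF assms(1) bounded_bilinear_inner] Ck_on_const Suc.IH) auto
    qed auto
  qed
qed

lemma Cinf_on_cong:
  "open U \<Longrightarrow> (\<And>x. x \<in> U \<Longrightarrow> f x = g x) \<Longrightarrow> Cinf_on U f \<longleftrightarrow> Cinf_on U g"
  unfolding Cinf_on_def using Ck_on_cong by blast

lemma Cinf_on_subset: "Cinf_on U f \<Longrightarrow> V \<subseteq> U \<Longrightarrow> Cinf_on V f"
  unfolding Cinf_on_def using Ck_on_subset by blast

lemma Cinf_on_const: "Cinf_on U (\<lambda>x. c)"
  by (simp add: Cinf_on_def Ck_on_const)

lemma Cinf_on_id: "open U \<Longrightarrow> Cinf_on U (\<lambda>x. x)"
  by (simp add: Cinf_on_def Ck_on_id)

lemma Cinf_on_add: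
  "open U \<Longrightarrow> Cinf_on U f \<Longrightarrow> Cinf_on U g \<Longrightarrow> Cinf_on U (\<lambda>x. f x + g x)"
  by (simp add: Cinf_on_def Ck_on_add)

lemma Cinf_on_sum:
  "open U \<Longrightarrow> (\<And>i. i \<in> S \<Longrightarrow> Cinf_on U (f i)) \<Longrightarrow> Cinf_on U (\<lambda>x. \<Sum>i\<in>S. f i x)"
  by (simp add: Cinf_on_def Ck_on_sum)

lemma Cinf_on_bounded_linear:
  "open U \<Longrightarrow> bounded_linear L \<Longrightarrow> Cinf_on U f \<Longrightarrow> Cinf_on U (\<lambda>x. L (f x))"
  by (simp add: Cinf_on_def Ck_on_bounded_linear)

lemma Cinf_on_linear:
  "open U \<Longrightarrow> linear (L :: 'a::euclidean_space \<Rightarrow> 'b::euclidean_space) \<Longrightarrow> Cinf_on U L"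
  using Cinf_on_bounded_linear[OF _ _ Cinf_on_id] by (simp add: linear_conv_bounded_linear)

lemma Cinf_on_bilinear:
  "open U \<Longrightarrow> bounded_bilinear bop \<Longrightarrow> Cinf_on U f \<Longrightarrow> Cinf_on U g \<Longrightarrow>
    Cinf_on U (\<lambda>x. bop (f x) (g x))"
  by (simp add: Cinf_on_def Ck_on_bilinear)

lemmas Cinf_on_scaleR = Cinf_on_bilinear[OF _ bounded_bilinear_scaleR]
lemmas Cinf_on_mult = Cinf_on_bilinear[OF _ bounded_bilinear_mult]
lemmas Cinf_on_inner = Cinf_on_bilinear[OF _ bounded_bilinear_inner]

lemma Cinf_on_minus:
  "open U \<Longrightarrow> Cinf_on U f \<Longrightarrow> Cinf_on U (\<lambda>x. - f x)"
  by (rule Cinf_on_bounded_linear[OF _ bounded_linear_minus[OF bounded_linear_ident]])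

lemma Cinf_on_diff:
  "open U \<Longrightarrow> Cinf_on U f \<Longrightarrow> Cinf_on U g \<Longrightarrow> Cinf_on U (\<lambda>x. f x - g x)"
  using Cinf_on_add[OF _ _ Cinf_on_minus] by fastforce

lemma Cinf_on_Pair:
  assumes "open U" "Cinf_on U f" "Cinf_on U g" shows "Cinf_on U (\<lambda>x. (f x, g x))"
proof -
  have "bounded_linear (\<lambda>x::'b. (x, 0::'c))" "bounded_linear (\<lambda>x::'c. (0::'b, x))"
    by (auto intro!: bounded_linear_Pair bounded_linear_ident bounded_linear_zero)
  then have "Cinf_on U (\<lambda>x. (f x, 0) + (0, g x))"
    by (intro Cinf_on_add[OF assms(1)] Cinf_on_bounded_linear[OF assms(1) _ assms(2)]
        Cinf_on_bounded_linear[OF assms(1) _ assms(3)])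
  then show ?thesis by simp
qed

lemma Cinf_on_prod:
  fixes f :: "'i \<Rightarrow> 'a::euclidean_space \<Rightarrow> real"
  assumes "open U" "\<And>i. i \<in> S \<Longrightarrow> Cinf_on U (f i)"
  shows "Cinf_on U (\<lambda>x. \<Prod>i\<in>S. f i x)"
  using assms(2)
proof (induction S rule: infinite_finite_induct)
  case (insert i S)
  then show ?case using Cinf_on_mult[OF assms(1), of "f i" "\<lambda>x. \<Prod>i\<in>S. f i x"] by simp
qed (auto intro: Cinf_on_const)

lemma Cinf_on_compose:
  fixes f :: "'a::euclidean_space \<Rightarrow> 'b::euclidean_space" and g :: "'b \<Rightarrow> 'c::euclidean_space"
  shows "open U \<Longrightarrow> open V \<Longrightarrow> f ` U \<subseteq> V \<Longrightarrow> Cinf_on U f \<Longrightarrow> Cinf_on V g \<Longrightarrow> Cinf_on U (\<lambda>x. g (f x))"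
  unfolding Cinf_on_def using Ck_on_compose by blast

lemma Cinf_on_continuous: "Cinf_on U f \<Longrightarrow> continuous_on U f"
  unfolding Cinf_on_def using Ck_on.simps(1) by blast

lemma Cinf_on_has_derivative:
  "Cinf_on U f \<Longrightarrow> x \<in> U \<Longrightarrow> (f has_derivative frechet_derivative f (at x)) (at x)"
  unfolding Cinf_on_def using Ck_on_Suc_deriv by blast

lemma Cinf_on_frechet: "Cinf_on U f \<Longrightarrow> Cinf_on U (\<lambda>x. frechet_derivative f (at x) v)"
  unfolding Cinf_on_def by (metis Ck_on.simps(2))

lemma Cinf_on_frechet_at:
  fixes f :: "'a::euclidean_space \<Rightarrow> 'b::euclidean_space"
  assumes "open U" "open V" "g ` U \<subseteq> V" "Cinf_on U g" "Cinf_on U w" "Cinf_on V f"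
  shows "Cinf_on U (\<lambda>x. frechet_derivative f (at (g x)) (w x))"
proof -
  have eq: "frechet_derivative f (at (g x)) (w x)
      = (\<Sum>b\<in>Basis. (inner (w x) b) *\<^sub>R frechet_derivative f (at (g x)) b)" if "x \<in> U" for x
    by (rule linear_Basis_expansion)
      (use assms(3,6) that Cinf_on_has_derivative has_derivative_linear in blast)
  have "Cinf_on U (\<lambda>x. \<Sum>b\<in>Basis. (inner (w x) b) *\<^sub>R frechet_derivative f (at (g x)) b)"
    by (intro Cinf_on_sum[OF assms(1)] Cinf_on_scaleR[OF assms(1)] Cinf_on_inner[OF assms(1,5) Cinf_on_const]
      Cinf_on_compose[OF assms(1-4)] Cinf_on_frechet[OF assms(6)])
  moreover have "Cinf_on U (\<lambda>x. frechet_derivative f (at (g x)) (w x)) \<longleftrightarrow>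
      Cinf_on U (\<lambda>x. \<Sum>b\<in>Basis. (inner (w x) b) *\<^sub>R frechet_derivative f (at (g x)) b)"
    using eq by (rule Cinf_on_cong[OF assms(1)])
  ultimately show ?thesis by simp
qed

lemma Cinf_on_isCont: "open U \<Longrightarrow> Cinf_on U f \<Longrightarrow> x \<in> U \<Longrightarrow> isCont f x"
  using Cinf_on_continuous continuous_on_eq_continuous_at by blast

lemma Cinf_on_linear_frechet:
  "Cinf_on U f \<Longrightarrow> x \<in> U \<Longrightarrow> linear (frechet_derivative f (at x))"
  using Cinf_on_has_derivative has_derivative_linear by blast

lemma Cinf_on_vector_derivative:
  assumes "Cinf_on U f" "(g has_vector_derivative v) (at t)" "g t \<in> U"
  shows "((\<lambda>t. f (g t)) has_vector_derivative frechet_derivative f (at (g t)) v) (at t)"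
proof -
  have "(f \<circ> g has_derivative frechet_derivative f (at (g t)) \<circ> (\<lambda>x. x *\<^sub>R v)) (at t)"
    using assms Cinf_on_has_derivative unfolding has_vector_derivative_def
    by (intro diff_chain_at) auto
  then show ?thesis
    using linear_cmul[OF Cinf_on_linear_frechet[OF assms(1,3)]]
    by (simp add: has_vector_derivative_def o_def)
qed

subsection \<open>Inverse functions\<close>

text \<open>With \<open>K x\<close> the inverse of \<open>L x\<close>, the identity
  \<open>K y - K x = - K y (L y - L x) K x\<close>, products being compositions, and the uniform
  bound \<open>c\<close> give continuity and then the derivative \<open>- K L' K\<close>. This
  formula expresses the derivative of \<open>K\<close> by \<open>K\<close> and \<open>L'\<close>, so
  every further class follows by induction.\<close>

lemma Cinf_on_inverse_linear:
  fixes L K :: "'a::euclidean_space \<Rightarrow> 'b::euclidean_space \<Rightarrow> 'b"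
  assumes "open U" and L: "\<And>v. Cinf_on U (\<lambda>x. L x v)"
    and lin: "\<And>x. x \<in> U \<Longrightarrow> linear (L x)" "\<And>x. x \<in> U \<Longrightarrow> linear (K x)"
    and inv: "\<And>x v. x \<in> U \<Longrightarrow> K x (L x v) = v" "\<And>x v. x \<in> U \<Longrightarrow> L x (K x v) = v"
    and bound: "\<And>x v. x \<in> U \<Longrightarrow> norm (K x v) \<le> c * norm v"
  shows "Cinf_on U (\<lambda>x. K x v)"
proof -
  have cont: "continuous_on U (\<lambda>x. K x v)" for v
  proof -
    have "((\<lambda>y. K y v) \<longlongrightarrow> K x v) (at x)" if "x \<in> U" for x
    proof -
      have "isCont (\<lambda>y. L y (K x v)) x" by (rule Cinf_on_isCont[OF \<open>open U\<close> L that])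
      then have "((\<lambda>y. c * norm (L y (K x v) - L x (K x v))) \<longlongrightarrow> c * norm (0::'b)) (at x)"
        unfolding isCont_def by (rule tendsto_mult[OF tendsto_const tendsto_norm[OF LIM_zero]])
      moreover have "\<forall>\<^sub>F y in at x. norm (K y v - K x v) \<le> c * norm (L y (K x v) - L x (K x v))"
      proof (rule eventually_at_in_open'[OF \<open>open U\<close> that, THEN eventually_mono])
        fix y assume y: "y \<in> U"
        have "K y v - K x v = - K y (L y (K x v) - L x (K x v))"
          using inv y that by (simp add: linear_diff[OF lin(2)[OF y]])
        then show "norm (K y v - K x v) \<le> c * norm (L y (K x v) - L x (K x v))"
          using bound[OF y, of "L y (K x v) - L x (K x v)"] by simp
      qed
      ultimately have "((\<lambda>y. K y v - K x v) \<longlongrightarrow> 0) (at x)"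
        using Lim_null_comparison[of "\<lambda>y. K y v - K x v" "\<lambda>y. c * norm (L y (K x v) - L x (K x v))" "at x"]
        by simp
      then show ?thesis by (rule LIM_zero_cancel)
    qed
    then show ?thesis
      using \<open>open U\<close> by (simp add: continuous_on_eq_continuous_at isCont_def)
  qed
  let ?L' = "\<lambda>x u w. frechet_derivative (\<lambda>x. L x w) (at x) u"
  have sum_tendsto: "((\<lambda>y. K y (r y)) \<longlongrightarrow> K x s) (at x)" if "x \<in> U" "(r \<longlongrightarrow> s) (at x)" for r s x
  proof -
    have "((\<lambda>y. \<Sum>b\<in>Basis. inner (r y) b *\<^sub>R K y b) \<longlongrightarrow> (\<Sum>b\<in>Basis. inner s b *\<^sub>R K x b)) (at x)"
      using that cont \<open>open U\<close>
      by (intro tendsto_sum tendsto_scaleR tendsto_inner tendsto_const)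
        (auto simp: continuous_on_eq_continuous_at isCont_def)
    then show ?thesis
      unfolding linear_Basis_expansion[OF lin(2)[OF \<open>x \<in> U\<close>], of s, symmetric]
      by (rule Lim_transform_within_open[OF _ \<open>open U\<close> \<open>x \<in> U\<close>])
        (rule linear_Basis_expansion[OF lin(2), symmetric])
  qed
  have deriv: "((\<lambda>x. K x v) has_derivative (\<lambda>u. - K x (?L' x u (K x v)))) (at x)" if "x \<in> U" for x v
  proof -
    let ?w = "K x v"
    have D: "((\<lambda>x. L x ?w) has_derivative (\<lambda>u. ?L' x u ?w)) (at x)"
      using Cinf_on_has_derivative[OF L that] .
    note lD = has_derivative_linear[OF D]
    \<comment> \<open>The normalized first-order remainder of \<open>\<lambda>y. L y ?w\<close>.
      \<open>K y\<close> may be applied to it because \<open>sum_tendsto\<close> allows the argument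
      to move along with \<open>y\<close>.\<close>
    define R where "R y = (L y ?w - L x ?w - ?L' x (y - x) ?w) /\<^sub>R norm (y - x)" for y
    have R: "(R \<longlongrightarrow> 0) (at x)"
      using D unfolding has_derivative_within R_def diff_diff_eq inverse_eq_divide by blast
    have KR: "((\<lambda>y. K y (R y)) \<longlongrightarrow> K x 0) (at x)" by (rule sum_tendsto[OF that R])
    \<comment> \<open>The normalized increment is a unit vector, or 0 when \<open>y = x\<close>, so
      its coordinates are at most 1 in absolute value; convergence of \<open>K y - K x\<close> on
      the finitely many vectors \<open>?L' x b ?w\<close> then suffices.\<close>
    have sph: "((\<lambda>y. K y (?L' x ((y - x) /\<^sub>R norm (y - x)) ?w) - K x (?L' x ((y - x) /\<^sub>R norm (y - x)) ?w)) \<longlongrightarrow> 0) (at x)"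
    proof -
      let ?q = "\<lambda>y. (y - x) /\<^sub>R norm (y - x)"
      have lq: "K z (?L' x (?q y) ?w) = (\<Sum>b\<in>Basis. inner (?q y) b *\<^sub>R K z (?L' x b ?w))" if "z \<in> U" for z y
        using linear_Basis_expansion[OF linear_compose[OF lD lin(2)[OF that]], of "?q y"] by (simp only: o_def)
      have "((\<lambda>y. \<Sum>b\<in>Basis. inner (?q y) b *\<^sub>R (K y (?L' x b ?w) - K x (?L' x b ?w))) \<longlongrightarrow> (\<Sum>b\<in>(Basis::'a set). 0)) (at x)"
      proof (rule tendsto_sum)
        fix b :: 'a assume b: "b \<in> Basis"
        have "((\<lambda>y. K y (?L' x b ?w) - K x (?L' x b ?w)) \<longlongrightarrow> 0) (at x)"
          by (rule LIM_zero[OF sum_tendsto[OF that tendsto_const]])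
        then have "((\<lambda>y. norm (K y (?L' x b ?w) - K x (?L' x b ?w))) \<longlongrightarrow> 0) (at x)"
          using tendsto_norm_zero by blast
        moreover have "norm (inner (?q y) b) \<le> 1" for y
        proof -
          have "\<bar>inner (?q y) b\<bar> \<le> norm (?q y) * norm b" by (rule Cauchy_Schwarz_ineq2)
          also have "\<dots> \<le> 1" using b by (cases "y = x") auto
          finally show ?thesis by simp
        qed
        ultimately show "((\<lambda>y. inner (?q y) b *\<^sub>R (K y (?L' x b ?w) - K x (?L' x b ?w))) \<longlongrightarrow> 0) (at x)"
          by (elim Lim_null_comparison[rotated]) (auto intro!: eventuallyI mult_left_le_one_le)
      qed
      then show ?thesis
      proof (simp only: sum.neutral_const, elim Lim_transform_within_open[OF _ \<open>open U\<close> that])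
        fix y assume "y \<in> U"
        then show "(\<Sum>b\<in>Basis. inner (?q y) b *\<^sub>R (K y (?L' x b ?w) - K x (?L' x b ?w)))
            = K y (?L' x (?q y) ?w) - K x (?L' x (?q y) ?w)"
          using lq that by (simp add: scaleR_diff_right sum_subtractf)
      qed
    qed
    have "((\<lambda>y. - (K y (R y)) - (K y (?L' x ((y - x) /\<^sub>R norm (y - x)) ?w) - K x (?L' x ((y - x) /\<^sub>R norm (y - x)) ?w))) \<longlongrightarrow> 0) (at x)"
      using tendsto_diff[OF tendsto_minus[OF KR] sph] by (simp only: linear_0[OF lin(2)[OF that]] minus_zero diff_zero)
    moreover have "- (K y (R y)) - (K y (?L' x ((y - x) /\<^sub>R norm (y - x)) ?w) - K x (?L' x ((y - x) /\<^sub>R norm (y - x)) ?w))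
        = (K y v - K x v - (- K x (?L' x (y - x) ?w))) /\<^sub>R norm (y - x)" if "y \<in> U" for y
    proof -
      note lK = lin(2)[OF that] and lKx = lin(2)[OF \<open>x \<in> U\<close>]
      define n a where "n = norm (y - x)" and "a = ?L' x (y - x) ?w"
      have eqs: "K y (L y ?w) = ?w" "L x ?w = v" using inv that \<open>x \<in> U\<close> by auto
      have "?L' x ((y - x) /\<^sub>R n) ?w = a /\<^sub>R n"
        unfolding a_def by (rule linear_cmul[OF lD])
      then show ?thesis
        unfolding R_def n_def[symmetric] a_def[symmetric]
        by (simp add: eqs linear_cmul[OF lK] linear_cmul[OF lKx] linear_diff[OF lK] linear_add[OF lK] algebra_simps)
    qed
    ultimately have "((\<lambda>y. (K y v - K x v - (- K x (?L' x (y - x) ?w))) /\<^sub>R norm (y - x)) \<longlongrightarrow> 0) (at x)"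
      by (elim Lim_transform_within_open[OF _ \<open>open U\<close> that])
    moreover have "bounded_linear (\<lambda>u. - K x (?L' x u ?w))"
      using linear_compose[OF linear_compose[OF lD lin(2)[OF that]] linear_uminus]
      by (simp add: linear_conv_bounded_linear o_def)
    ultimately show ?thesis unfolding has_derivative_within diff_diff_eq inverse_eq_divide by blast
  qed
  have "Ck_on k U (\<lambda>x. K x v)" for k v
  proof (induction k arbitrary: v)
    case 0
    then show ?case using cont by simp
  next
    case (Suc k)
    show ?case
    proof (rule Ck_on_SucI[OF \<open>open U\<close> deriv])
      fix u
      \<comment> \<open>In coordinates the derivative is a polynomial expression in values of
        \<open>K x\<close> at fixed vectors with coefficients from \<open>?L'\<close>, to which the
        induction hypothesis applies.\<close>
      have eq: "- K x (?L' x u (K x v)) = (\<Sum>c\<in>Basis. - (\<Sum>b\<in>Basis. inner (K x v) b * inner (?L' x u b) c) *\<^sub>R K x c)"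
        if "x \<in> U" for x
      proof -
        have "?L' x u (K x v) = (\<Sum>b\<in>Basis. inner (K x v) b *\<^sub>R ?L' x u b)"
        proof -
          have "((\<lambda>y. \<Sum>b\<in>Basis. inner (K x v) b *\<^sub>R L y b) has_derivative
              (\<lambda>u. \<Sum>b\<in>Basis. inner (K x v) b *\<^sub>R ?L' x u b)) (at x)"
            by (intro has_derivative_sum has_derivative_scaleR_right Cinf_on_has_derivative[OF L that])
          then have "((\<lambda>y. L y (K x v)) has_derivative
              (\<lambda>u. \<Sum>b\<in>Basis. inner (K x v) b *\<^sub>R ?L' x u b)) (at x)"
            by (rule has_derivative_transform_within_open[OF _ \<open>open U\<close> that])
              (rule linear_Basis_expansion[OF lin(1), symmetric])
          then show ?thesis by (rule frechet_derivative_at[symmetric, THEN fun_cong])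
        qed
        then have L': "inner (?L' x u (K x v)) c = (\<Sum>b\<in>Basis. inner (K x v) b * inner (?L' x u b) c)" for c
          using inner_sum_left[of "\<lambda>b. inner (K x v) b *\<^sub>R ?L' x u b" Basis c] by (simp only: inner_scaleR_left)
        have "K x (?L' x u (K x v)) = (\<Sum>c\<in>Basis. inner (?L' x u (K x v)) c *\<^sub>R K x c)"
          by (rule linear_Basis_expansion[OF lin(2)[OF that]])
        then show ?thesis unfolding L' by (simp only: scaleR_minus_left sum_negf)
      qed
      have "Ck_on k U (\<lambda>x. ?L' x u b)" for b
        using Cinf_on_frechet[OF L] by (simp add: Cinf_on_def)
      then have "Ck_on k U (\<lambda>x. \<Sum>c\<in>Basis. - (\<Sum>b\<in>Basis. inner (K x v) b * inner (?L' x u b) c) *\<^sub>R K x c)"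
        by (intro Ck_on_sum[OF \<open>open U\<close>] Ck_on_bilinear[OF \<open>open U\<close> bounded_bilinear_scaleR]
            Ck_on_bounded_linear[OF \<open>open U\<close> bounded_linear_minus[OF bounded_linear_ident]]
            Ck_on_bilinear[OF \<open>open U\<close> bounded_bilinear_mult]
            Ck_on_bilinear[OF \<open>open U\<close> bounded_bilinear_inner] Ck_on_const Suc.IH)
      moreover have "Ck_on k U (\<lambda>x. - K x (?L' x u (K x v))) \<longleftrightarrow>
          Ck_on k U (\<lambda>x. \<Sum>c\<in>Basis. - (\<Sum>b\<in>Basis. inner (K x v) b * inner (?L' x u b) c) *\<^sub>R K x c)"
        using eq by (rule Ck_on_cong[OF \<open>open U\<close>])
      ultimately show "Ck_on k U (\<lambda>x. - K x (?L' x u (K x v)))" by simp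
    qed
  qed
  then show ?thesis by (simp add: Cinf_on_def)
qed

text \<open>The derivative at \<open>x0\<close> is normalized to the identity, as it is for the map
  that straightens a submersion. The inverse is first differentiable; the formula for its
  derivative, with \<open>Cinf_on_inverse_linear\<close>, then raises its class step by
  step.\<close>

lemma smooth_inverse_function:
  fixes f :: "'a::euclidean_space \<Rightarrow> 'a"
  assumes "open N" "Cinf_on N f" "x0 \<in> N" and id: "\<And>v. frechet_derivative f (at x0) v = v"
  obtains U V g where "open U" "U \<subseteq> N" "x0 \<in> U" "open V" "homeomorphism U V f g" "Cinf_on V g"
proof -
  let ?f' = "\<lambda>x. frechet_derivative f (at x)"
  have bl: "bounded_linear (?f' x)" if "x \<in> N" for x
    using Cinf_on_has_derivative[OF assms(2) that] by (rule has_derivative_bounded_linear)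
  have cont: "continuous_on N (\<lambda>x. Blinfun (?f' x))"
  proof (rule continuous_on_blinfun_componentwise)
    fix i :: 'a
    have "continuous_on N (\<lambda>x. ?f' x i)"
      by (rule Cinf_on_continuous[OF Cinf_on_frechet[OF assms(2)]])
    then show "continuous_on N (\<lambda>x. blinfun_apply (Blinfun (?f' x)) i)"
      by (rule continuous_on_eq) (simp add: bounded_linear_Blinfun_apply[OF bl])
  qed
  have inv: "id_blinfun o\<^sub>L Blinfun (?f' x0) = id_blinfun"
    by (rule blinfun_eqI) (simp add: bounded_linear_Blinfun_apply[OF bl[OF assms(3)]] id)
  have der: "(f has_derivative blinfun_apply (Blinfun (?f' x))) (at x)" if "x \<in> N" for x
    using Cinf_on_has_derivative[OF assms(2) that] bounded_linear_Blinfun_apply[OF bl[OF that]] by simp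
  obtain U V g g' where UV: "open U" "U \<subseteq> N" "x0 \<in> U" "open V" "f x0 \<in> V" "homeomorphism U V f g"
    and g: "\<And>y. y \<in> V \<Longrightarrow> (g has_derivative (g' y)) (at y)"
    "\<And>y. y \<in> V \<Longrightarrow> g' y = inv_into UNIV (blinfun_apply (Blinfun (?f' (g y))))"
    "\<And>y. y \<in> V \<Longrightarrow> bij (blinfun_apply (Blinfun (?f' (g y))))"
    using inverse_function_theorem[OF assms(1) der cont assms(3) inv] by metis
  have gU: "g y \<in> U" and fg: "f (g y) = y" if "y \<in> V" for y
    using UV(6) that by (auto simp: homeomorphism_def)
  have fV: "f x \<in> V" and gf: "g (f x) = x" if "x \<in> U" for x
    using UV(6) that by (auto simp: homeomorphism_def)
  have g'K: "g' y = inv_into UNIV (?f' (g y))" and bij: "bij (?f' (g y))" if "y \<in> V" for y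
    using g(2,3)[OF that] bounded_linear_Blinfun_apply[OF bl] gU[OF that] UV(2) by auto
  \<comment> \<open>\<open>d x\<close> dominates the operator norm of \<open>?f' x - id\<close>.
    From \<open>d x < 1/2\<close> follows \<open>norm (?f' x w) \<ge> norm w / 2\<close>, which is
    the source of the bound 2 for the inverse.\<close>
  define d where "d x = (\<Sum>b\<in>Basis. norm (?f' x b - b))" for x
  have "isCont d x0"
    unfolding d_def using Cinf_on_isCont[OF assms(1) Cinf_on_frechet[OF assms(2)] assms(3)]
    by (intro continuous_intros) auto
  moreover have "d x0 = 0" by (simp add: d_def id)
  ultimately obtain D where D: "open D" "x0 \<in> D" "\<And>x. x \<in> D \<Longrightarrow> d x < 1/2"
    using isCont_openD[of x0 d "{..<1/2}"] by auto
  define U' where "U' = U \<inter> D"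
  define V' where "V' = V \<inter> g -` D"
  have "open U'" using UV D by (auto simp: U'_def)
  have "continuous_on V g" using UV(6) by (auto simp: homeomorphism_def)
  then have "open V'"
    using UV(4) D(1) by (metis V'_def continuous_on_open_vimage inf_commute)
  have hom: "homeomorphism U' V' f g"
    by (rule homeomorphism_of_subsets[OF UV(6)]) (use gf fV gU fg in \<open>force simp: U'_def V'_def\<close>)+
  have lin: "linear (?f' x)" if "x \<in> U'" for x
    using bl that UV(2) by (auto simp: U'_def intro: bounded_linear.linear)
  have bij': "bij (?f' x)" if "x \<in> U'" for x
    using bij[OF fV] gf that by (auto simp: U'_def)
  have near: "norm (?f' x w) \<ge> norm w / 2" if "x \<in> U'" for x w
  proof -
    have "?f' x w - w = (\<Sum>b\<in>Basis. inner w b *\<^sub>R (?f' x b - b))"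
      using linear_Basis_expansion[OF linear_compose_sub[OF lin[OF that] linear_id], of w] by (simp only: id_apply)
    then have "norm (?f' x w - w) \<le> (\<Sum>b\<in>Basis. norm (inner w b *\<^sub>R (?f' x b - b)))"
      by (simp only: norm_sum)
    also have "\<dots> \<le> (\<Sum>b\<in>Basis. norm w * norm (?f' x b - b))"
      by (intro sum_mono) (simp add: Basis_le_norm mult_right_mono)
    also have "\<dots> = norm w * d x" by (simp add: d_def sum_distrib_left)
    also have "\<dots> \<le> norm w * (1/2)"
      using D(3)[of x] that by (intro mult_left_mono) (auto simp: U'_def)
    finally show ?thesis using norm_triangle_ineq2[of w "w - ?f' x w"]
      by (simp add: norm_minus_commute)
  qed
  have K: "Cinf_on U' (\<lambda>x. inv_into UNIV (?f' x) v)" for v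
  proof (rule Cinf_on_inverse_linear[where c=2])
    show "Cinf_on U' (\<lambda>x. ?f' x v)" for v
      by (rule Cinf_on_subset[OF Cinf_on_frechet[OF assms(2)]]) (use UV(2) in \<open>auto simp: U'_def\<close>)
    show "linear (inv_into UNIV (?f' x))" if "x \<in> U'" for x
      using g(1)[OF fV] g'K[OF fV] gf that by (metis (no_types) IntD1 U'_def has_derivative_linear)
    show "norm (inv_into UNIV (?f' x) v) \<le> 2 * norm v" if "x \<in> U'" for x v
      using near[OF that, of "inv_into UNIV (?f' x) v"] bij'[OF that] by (simp add: surj_f_inv_f bij_is_surj)
  qed (use \<open>open U'\<close> lin bij' in \<open>auto simp: bij_is_inj surj_f_inv_f bij_is_surj\<close>)
  have "Ck_on k V' g" for k
  proof (induction k)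
    case 0
    then show ?case using \<open>continuous_on V g\<close> by (auto simp: V'_def intro: continuous_on_subset)
  next
    case (Suc k)
    show ?case
    proof (rule Ck_on_SucI[OF \<open>open V'\<close>])
      show "(g has_derivative (\<lambda>v. inv_into UNIV (?f' (g y)) v)) (at y)" if "y \<in> V'" for y
        using g(1)[of y] g'K[of y] that by (auto simp: V'_def)
      show "Ck_on k V' (\<lambda>x. inv_into UNIV (?f' (g x)) v)" for v
        by (rule Ck_on_compose[OF \<open>open V'\<close> \<open>open U'\<close> _ Suc])
          (use gU K in \<open>auto simp: V'_def U'_def Cinf_on_def\<close>)
    qed
  qed
  then show ?thesis
    using that[of U' V' g] \<open>open U'\<close> \<open>open V'\<close> hom UV D by (auto simp: U'_def Cinf_on_def)
qed

text \<open>Integrate the derivative in the direction \<open>w\<close> along \<open>w\<close> and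
  differentiate under the integral in the direction \<open>v\<close>: the increment of
  \<open>?D v\<close> from \<open>?q 0 0\<close> to \<open>?q 0 t\<close> becomes the integral of
  \<open>?E w v\<close>. Differentiating in \<open>t\<close> at 0 from the right yields the
  symmetry.\<close>

lemma frechet_derivative_commute:
  fixes F :: "'a::euclidean_space \<Rightarrow> 'b::euclidean_space"
  assumes "open N" "Cinf_on N F" "p \<in> N"
  shows "frechet_derivative (\<lambda>x. frechet_derivative F (at x) v) (at p) w
       = frechet_derivative (\<lambda>x. frechet_derivative F (at x) w) (at p) v"
proof -
  let ?D = "\<lambda>v x. frechet_derivative F (at x) v"
  let ?E = "\<lambda>v w x. frechet_derivative (?D v) (at x) w"
  let ?q = "\<lambda>s t::real. p + s *\<^sub>R v + t *\<^sub>R w"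
  note CD = Cinf_on_frechet[OF assms(2)]
  have "isCont (\<lambda>z. ?q (fst z) (snd z)) (0,0)" by (intro continuous_intros)
  then obtain S where S: "open S" "(0,0) \<in> S" "\<And>z. z \<in> S \<Longrightarrow> ?q (fst z) (snd z) \<in> N"
    using isCont_openD[of "(0,0)" "\<lambda>z. ?q (fst z) (snd z)" N] assms(1,3) by auto
  then obtain A B where AB: "open A" "open B" "0 \<in> A" "0 \<in> B" "A \<times> B \<subseteq> S"
    by (auto elim: open_prod_elim)
  then obtain e1 e2 where e: "e1 > 0" "cball 0 e1 \<subseteq> A" "e2 > 0" "cball 0 e2 \<subseteq> B"
    by (meson open_contains_cball)
  define d where "d = min e1 e2"
  have d: "d > 0" and inN: "?q s t \<in> N" if "\<bar>s\<bar> \<le> d" "\<bar>t\<bar> \<le> d" for s t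
    using e AB S(3)[of "(s,t)"] that by (auto simp: d_def subset_iff dist_real_def)
  then have d: "d > 0" by (auto simp: d_def e)
  have ds: "((\<lambda>s. H (?q s t)) has_vector_derivative frechet_derivative H (at (?q s t)) v) (at s)"
    and dt: "((\<lambda>t. H (?q s t)) has_vector_derivative frechet_derivative H (at (?q s t)) w) (at t)"
    if "Cinf_on N H" "\<bar>s\<bar> \<le> d" "\<bar>t\<bar> \<le> d" for s t and H :: "'a \<Rightarrow> 'b"
    by (rule Cinf_on_vector_derivative[OF that(1)], auto intro!: derivative_eq_intros inN that)+
  have qcont: "continuous_on ({-d..d} \<times> {-d..d}) (\<lambda>z. H (?q (fst z) (snd z)))"
    if "Cinf_on N H" for H :: "'a \<Rightarrow> 'b"
    by (rule continuous_on_compose2[OF Cinf_on_continuous[OF that]])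
      (auto intro!: continuous_intros inN)
  have qcont1: "continuous_on {-d..d} (\<lambda>t. H (?q s t))"
    if "Cinf_on N H" "\<bar>s\<bar> \<le> d" for H :: "'a \<Rightarrow> 'b" and s
    by (rule continuous_on_compose2[OF Cinf_on_continuous[OF that(1)]])
      (use that in \<open>auto intro!: continuous_intros inN\<close>)
  have int: "integral {0..t} (\<lambda>t. ?D w (?q s t)) = F (?q s t) - F (?q s 0)"
    if "0 \<le> t" "t \<le> d" "\<bar>s\<bar> \<le> d" for s t
    by (rule integral_unique, rule fundamental_theorem_of_calculus[OF that(1)])
      (rule has_vector_derivative_at_within[OF dt[OF assms(2)]], use that in auto)
  have key: "?D v (?q 0 t) - ?D v (?q 0 0) = integral {0..t} (\<lambda>t. ?E w v (?q 0 t))"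
    if "0 \<le> t" "t \<le> d" for t
  proof -
    have "((\<lambda>s. integral (cbox 0 t) (\<lambda>t. ?D w (?q s t))) has_vector_derivative
        integral (cbox 0 t) (\<lambda>t. ?E w v (?q 0 t))) (at 0 within {-d<..<d})"
    proof (rule leibniz_rule_vector_derivative[where fx="\<lambda>s t. ?E w v (?q s t)"])
      show "((\<lambda>s. ?D w (?q s t')) has_vector_derivative ?E w v (?q s t')) (at s within {-d<..<d})"
        if "s \<in> {-d<..<d}" "t' \<in> cbox 0 t" for s t'
        by (rule has_vector_derivative_at_within[OF ds[OF CD]]) (use that \<open>t \<le> d\<close> in auto)
      show "(\<lambda>t. ?D w (?q s t)) integrable_on cbox 0 t" if "s \<in> {-d<..<d}" for s
        unfolding cbox_interval using that \<open>0 \<le> t\<close> \<open>t \<le> d\<close>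
        by (intro integrable_continuous_real continuous_on_subset[OF qcont1[OF CD]]) auto
      show "continuous_on ({-d<..<d} \<times> cbox 0 t) (\<lambda>(s, t). ?E w v (?q s t))"
        unfolding case_prod_beta using \<open>t \<le> d\<close> \<open>0 \<le> t\<close>
        by (intro continuous_on_subset[OF qcont[OF Cinf_on_frechet[OF CD]]]) auto
    qed (use d in auto)
    moreover have "((\<lambda>s. integral (cbox 0 t) (\<lambda>t. ?D w (?q s t))) has_vector_derivative
        (?D v (?q 0 t) - ?D v (?q 0 0))) (at 0 within {-d<..<d})"
    proof (rule has_vector_derivative_transform[OF _ _ has_vector_derivative_at_within[OF has_vector_derivative_diff[OF ds ds]]])
      show "integral (cbox 0 t) (\<lambda>t. ?D w (?q s t)) = F (?q s t) - F (?q s 0)" if "s \<in> {-d<..<d}" for s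
        using int[of t s] that \<open>0 \<le> t\<close> \<open>t \<le> d\<close> by (simp add: abs_le_iff)
    qed (use d that assms(2) in auto)
    moreover have "at (0::real) within {-d<..<d} = at 0"
      using d by (intro at_within_open) auto
    ultimately show ?thesis by (auto dest: vector_derivative_unique_at)
  qed
  have "((\<lambda>t. ?D v (?q 0 t) - ?D v (?q 0 0)) has_vector_derivative (?E v w (?q 0 0) - 0)) (at 0 within {0..d})"
    using d by (intro has_vector_derivative_diff has_vector_derivative_at_within[OF dt[OF CD]] has_vector_derivative_const) auto
  moreover have "((\<lambda>t. ?D v (?q 0 t) - ?D v (?q 0 0)) has_vector_derivative ?E w v (?q 0 0)) (at 0 within {0..d})"
  proof (rule has_vector_derivative_transform[OF _ key])
    have "continuous_on {0..d} (\<lambda>t. ?E w v (?q 0 t))"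
      using d by (intro continuous_on_subset[OF qcont1[OF Cinf_on_frechet[OF CD]]]) auto
    then show "((\<lambda>t. integral {0..t} (\<lambda>t. ?E w v (?q 0 t))) has_vector_derivative ?E w v (?q 0 0)) (at 0 within {0..d})"
      using d by (intro integral_has_vector_derivative) auto
  qed (use d in auto)
  ultimately show ?thesis
    using vector_derivative_unique_within_closed_interval[of 0 d 0] d by fastforce
qed

section \<open>Ordinary differential equations\<close>

lemma vector_derivative_bound:
  fixes f :: "real \<Rightarrow> 'a::real_normed_vector"
  assumes "convex S" "\<And>t. t \<in> S \<Longrightarrow> (f has_vector_derivative f' t) (at t within S)"
    "\<And>t. t \<in> S \<Longrightarrow> norm (f' t) \<le> C" "s \<in> S" "t \<in> S"
  shows "norm (f s - f t) \<le> C * \<bar>s - t\<bar>"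
proof -
  have "norm (f s - f t) \<le> C * norm (s - t)"
  proof (rule differentiable_bound[OF assms(1) _ _ assms(4,5)])
    show "(f has_derivative (\<lambda>h. h *\<^sub>R f' t)) (at t within S)" if "t \<in> S" for t
      using assms(2)[OF that] by (simp add: has_vector_derivative_def)
    show "onorm (\<lambda>h. h *\<^sub>R f' t) \<le> C" if "t \<in> S" for t
      by (rule onorm_bound)
        (use assms(3)[OF that] order_trans[OF norm_ge_zero assms(3)[OF that]] in
          \<open>auto simp: mult.commute[of C] intro: mult_left_mono\<close>)
  qed
  then show ?thesis by simp
qed

text \<open>The field is globally Lipschitz in \<open>x\<close> and \<open>L * \<tau> < 1\<close>,
  so a single contraction on bounded continuous functions gives the solution, without continuation
  or confinement to a ball. Linear fields and fields composed with a nearest-point projection are of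
  this kind.\<close>

lemma picard:
  fixes F :: "real \<Rightarrow> 'a::euclidean_space \<Rightarrow> 'a"
  assumes "\<tau> > 0" and cont: "continuous_on ({-\<tau>..\<tau>} \<times> UNIV) (\<lambda>(t, x). F t x)"
    and lip: "\<And>t x y. \<bar>t\<bar> \<le> \<tau> \<Longrightarrow> norm (F t x - F t y) \<le> L * norm (x - y)"
    and "0 \<le> L" "L * \<tau> < 1"
  obtains u where "u 0 = p" "\<And>t. \<bar>t\<bar> < \<tau> \<Longrightarrow> (u has_vector_derivative F t (u t)) (at t)"
proof -
  \<comment> \<open>Clamping time to the interval from \<open>-\<tau>\<close> to
    \<open>\<tau>\<close> makes the iterates defined and bounded on the whole line, as elements of
    the complete space \<open>real \<Rightarrow>\<^sub>C 'a\<close>.\<close>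
  define c where "c t = max (-\<tau>) (min \<tau> t)" for t
  have c: "c t \<in> {-\<tau>..\<tau>}" "\<bar>c t\<bar> \<le> \<tau>" "continuous_on S c" for t S
    using \<open>\<tau> > 0\<close> by (auto simp: c_def intro!: continuous_intros)
  \<comment> \<open>The oriented integral from 0 to \<open>t\<close>: as \<open>{0..t}\<close> is
    empty for negative \<open>t\<close>, both integrals start at \<open>-\<tau>\<close>.\<close>
  define J where "J h t = integral {-\<tau>..t} h - integral {-\<tau>..0} h" for h :: "real \<Rightarrow> 'a" and t
  have Fc: "continuous_on {-\<tau>..\<tau>} (\<lambda>t. F t (f t))" if "continuous_on {-\<tau>..\<tau>} f" for f
  proof -
    have "continuous_on {-\<tau>..\<tau>} (\<lambda>t. case (t, f t) of (t, x) \<Rightarrow> F t x)"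
      by (rule continuous_on_compose2[OF cont]) (auto intro!: continuous_intros that)
    then show ?thesis by simp
  qed
  have J: "((\<lambda>t. J h t) has_vector_derivative h t) (at t within {-\<tau>..\<tau>})"
    if "continuous_on {-\<tau>..\<tau>} h" "t \<in> {-\<tau>..\<tau>}" for h t
    unfolding J_def
    using has_vector_derivative_diff[OF integral_has_vector_derivative[OF that] has_vector_derivative_const]
    by simp
  have J0: "J h 0 = 0" for h by (simp add: J_def)
  have JB: "norm (J h (c t) - J g (c t)) \<le> B * \<tau>"
    if "continuous_on {-\<tau>..\<tau>} h" "continuous_on {-\<tau>..\<tau>} g" "\<And>s. s \<in> {-\<tau>..\<tau>} \<Longrightarrow> norm (h s - g s) \<le> B"
    for h g t B
  proof -
    have "norm ((J h (c t) - J g (c t)) - (J h 0 - J g 0)) \<le> B * \<bar>c t - 0\<bar>"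
    proof (rule vector_derivative_bound[where S="{-\<tau>..\<tau>}" and f'="\<lambda>t. h t - g t" and f="\<lambda>t. J h t - J g t"])
      show "((\<lambda>t. J h t - J g t) has_vector_derivative h t - g t) (at t within {-\<tau>..\<tau>})"
        if "t \<in> {-\<tau>..\<tau>}" for t
        by (rule has_vector_derivative_diff[OF J J]) fact+
    qed (use that(3) c \<open>\<tau> > 0\<close> in auto)
    also have "\<dots> \<le> B * \<tau>"
      using c(2)[of t] that(3)[of 0] \<open>\<tau> > 0\<close> order_trans[OF norm_ge_zero]
      by (intro mult_left_mono) auto
    finally show ?thesis by (simp add: J0)
  qed
  define T where "T f = Bcontfun (\<lambda>t. p + J (\<lambda>s. F s (apply_bcontfun f s)) (c t))"
    for f :: "real \<Rightarrow>\<^sub>C 'a"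
  have fc: "continuous_on S (apply_bcontfun f)" for S and f :: "real \<Rightarrow>\<^sub>C 'a"
    using continuous_on_subset[OF continuous_on_apply_bcontfun] by blast
  have T: "apply_bcontfun (T f) t = p + J (\<lambda>s. F s (apply_bcontfun f s)) (c t)" for f t
  proof -
    let ?h = "\<lambda>t. p + J (\<lambda>s. F s (apply_bcontfun f s)) t"
    have "continuous_on {-\<tau>..\<tau>} (J (\<lambda>s. F s (apply_bcontfun f s)))"
      using J[OF Fc[OF fc]] by (intro continuous_on_vector_derivative) auto
    then have ch: "continuous_on {-\<tau>..\<tau>} ?h" by (intro continuous_intros)
    then have "bounded (?h ` {-\<tau>..\<tau>})"
      using compact_continuous_image compact_imp_bounded compact_Icc by blast
    then have "bounded (range (\<lambda>t. ?h (c t)))"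
      by (rule bounded_subset) (use c(1) in auto)
    moreover have "continuous_on UNIV (\<lambda>t. ?h (c t))"
      by (rule continuous_on_compose2[OF ch c(3)]) (use c(1) in auto)
    ultimately have "(\<lambda>t. ?h (c t)) \<in> bcontfun" by (simp add: bcontfun_def)
    then show ?thesis unfolding T_def by (simp add: Bcontfun_inverse)
  qed
  have "\<exists>!f. T f = f"
  proof (rule banach_fix_type[of "L * \<tau>"], safe)
    fix f g
    show "dist (T f) (T g) \<le> L * \<tau> * dist f g"
    proof (rule dist_bound)
      fix t
      have "norm (J (\<lambda>s. F s (apply_bcontfun f s)) (c t) - J (\<lambda>s. F s (apply_bcontfun g s)) (c t))
          \<le> (L * dist f g) * \<tau>"
      proof (rule JB[OF Fc[OF fc] Fc[OF fc]])
        fix s assume "s \<in> {-\<tau>..\<tau>}"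
        then have "norm (F s (apply_bcontfun f s) - F s (apply_bcontfun g s))
            \<le> L * norm (apply_bcontfun f s - apply_bcontfun g s)"
          by (intro lip) auto
        also have "\<dots> \<le> L * dist f g"
          using dist_bounded[of f s g] \<open>0 \<le> L\<close> by (intro mult_left_mono) (auto simp: dist_norm)
        finally show "norm (F s (apply_bcontfun f s) - F s (apply_bcontfun g s)) \<le> L * dist f g" .
      qed
      then show "dist (apply_bcontfun (T f) t) (apply_bcontfun (T g) t) \<le> L * \<tau> * dist f g"
        by (simp add: T dist_norm mult_ac)
    qed
  qed (use assms in auto)
  then obtain f where f: "T f = f" by blast
  have eq: "apply_bcontfun f t = p + J (\<lambda>s. F s (apply_bcontfun f s)) t" if "\<bar>t\<bar> \<le> \<tau>" for t
    using T[of f t] that by (auto simp: f c_def)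
  show ?thesis
  proof
    show "apply_bcontfun f 0 = p" using eq[of 0] \<open>\<tau> > 0\<close> by (simp add: J0)
    fix t :: real assume t: "\<bar>t\<bar> < \<tau>"
    let ?J = "\<lambda>t. p + J (\<lambda>s. F s (apply_bcontfun f s)) t"
    have "(?J has_vector_derivative (0 + F t (apply_bcontfun f t))) (at t within {-\<tau>..\<tau>})"
      using t by (intro has_vector_derivative_add has_vector_derivative_const J Fc fc) auto
    then have "(?J has_vector_derivative F t (apply_bcontfun f t)) (at t within {-\<tau><..<\<tau>})"
      by (auto intro: has_vector_derivative_within_subset)
    then have "(?J has_vector_derivative F t (apply_bcontfun f t)) (at t)"
      using t by (simp add: at_within_open[of t "{-\<tau><..<\<tau>}"] abs_less_iff)
    then show "(apply_bcontfun f has_vector_derivative F t (apply_bcontfun f t)) (at t)"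
      by (rule has_vector_derivative_transform_within_open[where S="{-\<tau><..<\<tau>}"])
        (use t eq in \<open>auto simp: abs_le_iff\<close>)
  qed
qed

text \<open>On a time interval short compared with \<open>1 / L\<close>, the supremum of \<open>e\<close> can be absorbed, so
  that no exponential is needed.\<close>

lemma short_time_gronwall:
  fixes e :: "real \<Rightarrow> 'a::real_normed_vector"
  assumes der: "\<And>t. \<bar>t\<bar> \<le> \<tau> \<Longrightarrow> (e has_vector_derivative e' t) (at t)"
    and bd: "\<And>t. \<bar>t\<bar> \<le> \<tau> \<Longrightarrow> norm (e' t) \<le> L * norm (e t) + \<kappa>"
    and "0 \<le> L" "L * \<tau> \<le> 1/2" "0 \<le> \<kappa>" "\<bar>t\<bar> \<le> \<tau>"
  shows "norm (e t) \<le> 2 * (norm (e 0) + \<tau> * \<kappa>)"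
proof -
  have "isCont e t" if "\<bar>t\<bar> \<le> \<tau>" for t
    by (rule has_vector_derivative_continuous[OF der[OF that]])
  then have "continuous_on {-\<tau>..\<tau>} e"
    by (auto intro!: continuous_at_imp_continuous_on simp: abs_le_iff)
  then have "continuous_on {-\<tau>..\<tau>} (\<lambda>t. norm (e t))" by (intro continuous_intros)
  moreover have "{-\<tau>..\<tau>} \<noteq> {}" using assms(6) by auto
  ultimately obtain t0 where t0: "t0 \<in> {-\<tau>..\<tau>}" "\<And>t. t \<in> {-\<tau>..\<tau>} \<Longrightarrow> norm (e t) \<le> norm (e t0)"
    using continuous_attains_sup[of "{-\<tau>..\<tau>}" "\<lambda>t. norm (e t)"] by auto
  let ?M = "norm (e t0)"
  have "norm (e t0 - e 0) \<le> (L * ?M + \<kappa>) * \<bar>t0 - 0\<bar>"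
  proof (rule vector_derivative_bound[where S="{-\<tau>..\<tau>}" and f'=e'])
    show "norm (e' t) \<le> L * ?M + \<kappa>" if "t \<in> {-\<tau>..\<tau>}" for t
      using bd[of t] mult_left_mono[OF t0(2)[OF that] \<open>0 \<le> L\<close>] that
      by (auto simp: abs_le_iff)
  qed (use t0 der in \<open>auto intro: has_vector_derivative_at_within\<close>)
  also have "\<dots> \<le> (L * ?M + \<kappa>) * \<tau>"
    using t0(1) assms by (intro mult_left_mono) auto
  also have "\<dots> = (L * \<tau>) * ?M + \<tau> * \<kappa>" by (simp add: algebra_simps)
  also have "\<dots> \<le> 1/2 * ?M + \<tau> * \<kappa>"
    using assms(4) by (intro add_right_mono mult_right_mono) auto
  finally have "?M \<le> 2 * (norm (e 0) + \<tau> * \<kappa>)"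
    using norm_triangle_ineq2[of "e t0" "e 0"] unfolding distrib_left by linarith
  then show ?thesis using t0(2)[of t] assms(6) by (auto simp: abs_le_iff)
qed

section \<open>Estimates on balls and differentiability of a flow in its initial value\<close>

lemma Cinf_on_Lipschitz_cball:
  fixes Z :: "'a::euclidean_space \<Rightarrow> 'b::euclidean_space"
  assumes "Cinf_on N Z" "open N" "cball x0 R \<subseteq> N"
  obtains L where "L \<ge> 0"
    "\<And>x w. x \<in> cball x0 R \<Longrightarrow> norm (frechet_derivative Z (at x) w) \<le> L * norm w"
    "\<And>x y. x \<in> cball x0 R \<Longrightarrow> y \<in> cball x0 R \<Longrightarrow> norm (Z x - Z y) \<le> L * norm (x - y)"
proof -
  let ?B = "cball x0 R"
  define d where "d x = (\<Sum>b\<in>Basis. norm (frechet_derivative Z (at x) b))" for x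
  have "continuous_on ?B d" unfolding d_def
    by (intro continuous_intros continuous_on_subset[OF Cinf_on_continuous[OF Cinf_on_frechet[OF assms(1)]] assms(3)])
  then have "bounded (d ` ?B)"
    using compact_continuous_image compact_imp_bounded compact_cball by blast
  then obtain L where L: "L > 0" "\<And>x. x \<in> ?B \<Longrightarrow> norm (d x) \<le> L"
    by (auto simp: bounded_pos)
  have 1: "norm (frechet_derivative Z (at x) w) \<le> L * norm w" if "x \<in> ?B" for x w
  proof -
    have lin: "linear (frechet_derivative Z (at x))"
      using that assms by (blast intro: Cinf_on_linear_frechet)
    have "norm (frechet_derivative Z (at x) w) \<le> (\<Sum>b\<in>Basis. norm (inner w b *\<^sub>R frechet_derivative Z (at x) b))"
      by (subst linear_Basis_expansion[OF lin]) (rule norm_sum)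
    also have "\<dots> \<le> (\<Sum>b\<in>Basis. norm w * norm (frechet_derivative Z (at x) b))"
      by (intro sum_mono) (simp add: Basis_le_norm mult_right_mono)
    also have "\<dots> = norm w * d x" by (simp add: d_def sum_distrib_left)
    also have "\<dots> \<le> norm w * L" using L(2)[OF that] by (intro mult_left_mono) auto
    finally show ?thesis by (simp add: mult.commute)
  qed
  have "norm (Z x - Z y) \<le> L * norm (x - y)" if "x \<in> ?B" "y \<in> ?B" for x y
  proof (rule differentiable_bound[OF convex_cball _ _ that])
    show "(Z has_derivative frechet_derivative Z (at z)) (at z within ?B)" if "z \<in> ?B" for z
      using that assms by (blast intro: has_derivative_at_withinI Cinf_on_has_derivative)
    show "onorm (frechet_derivative Z (at z)) \<le> L" if "z \<in> ?B" for z
      by (rule onorm_bound[OF _ 1[OF that]]) (use L in auto)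
  qed
  then show ?thesis using that[of L] L(1) 1 by auto
qed

text \<open>The derivative is Lipschitz on the ball since its values on \<open>Basis\<close> are;
  this bounds the error of linearizing at \<open>y\<close> quadratically, with \<open>K\<close> the
  sum of those Lipschitz constants.\<close>

lemma Cinf_on_Taylor_cball:
  fixes Z :: "'a::euclidean_space \<Rightarrow> 'b::euclidean_space"
  assumes "Cinf_on N Z" "open N" "cball x0 R \<subseteq> N"
  obtains K where "K \<ge> 0"
    "\<And>x y. x \<in> cball x0 R \<Longrightarrow> y \<in> cball x0 R \<Longrightarrow>
      norm (Z x - Z y - frechet_derivative Z (at y) (x - y)) \<le> K * (norm (x - y))\<^sup>2"
proof -
  let ?B = "cball x0 R" and ?D = "\<lambda>x. frechet_derivative Z (at x)"
  have "\<exists>L\<ge>0. \<forall>x\<in>?B. \<forall>y\<in>?B. norm (?D x b - ?D y b) \<le> L * norm (x - y)" for b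
    using Cinf_on_Lipschitz_cball[OF Cinf_on_frechet[OF assms(1)] assms(2,3), of b] by metis
  then obtain l where l: "\<And>b. l b \<ge> 0"
    "\<And>x y b. x \<in> ?B \<Longrightarrow> y \<in> ?B \<Longrightarrow> norm (?D x b - ?D y b) \<le> l b * norm (x - y)" by metis
  define K where "K = (\<Sum>b\<in>Basis. l b)"
  have lin: "linear (?D x)" if "x \<in> ?B" for x
    using that assms by (blast intro: Cinf_on_linear_frechet)
  have D: "norm (?D x w - ?D y w) \<le> K * norm (x - y) * norm w" if "x \<in> ?B" "y \<in> ?B" for x y w
  proof -
    have "?D x w - ?D y w = (\<Sum>b\<in>Basis. inner w b *\<^sub>R (?D x b - ?D y b))"
      by (rule linear_Basis_expansion[OF linear_compose_sub[OF lin[OF that(1)] lin[OF that(2)]]])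
    then have "norm (?D x w - ?D y w) \<le> (\<Sum>b\<in>Basis. norm (inner w b *\<^sub>R (?D x b - ?D y b)))"
      by (simp only: norm_sum)
    also have "\<dots> \<le> (\<Sum>b\<in>Basis. norm w * (l b * norm (x - y)))"
      using that l by (intro sum_mono) (auto intro!: mult_mono simp: Basis_le_norm)
    also have "\<dots> = K * norm (x - y) * norm w"
      by (simp add: K_def sum_distrib_left sum_distrib_right mult_ac)
    finally show ?thesis .
  qed
  have "K \<ge> 0" using l by (auto simp: K_def intro: sum_nonneg)
  moreover have "norm (Z x - Z y - ?D y (x - y)) \<le> K * (norm (x - y))\<^sup>2" if "x \<in> ?B" "y \<in> ?B" for x y
  proof -
    \<comment> \<open>The ball of radius \<open>norm (x - y)\<close> around \<open>y\<close>
      contains the segment to \<open>x\<close>, and on it the derivative deviates from that at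
      \<open>y\<close> by at most \<open>K * norm (x - y)\<close>.\<close>
    let ?S = "?B \<inter> cball y (norm (x - y))"
    have "norm (Z x - Z y - ?D y (x - y)) \<le> norm (x - y) * (K * norm (x - y))"
    proof (rule differentiable_bound_linearization[where S="?S"])
      show "y + t *\<^sub>R (x - y) \<in> ?S" if "t \<in> {0..1}" for t
      proof -
        have "y + t *\<^sub>R (x - y) = (1 - t) *\<^sub>R y + t *\<^sub>R x" by (simp add: algebra_simps)
        then have "y + t *\<^sub>R (x - y) \<in> ?B"
          using convexD_alt[OF convex_cball \<open>y \<in> ?B\<close> \<open>x \<in> ?B\<close>, of t] that by auto
        moreover have "t * norm (x - y) \<le> 1 * norm (x - y)"
          using that by (intro mult_right_mono) auto
        ultimately show ?thesis using that by (auto simp: dist_norm)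
      qed
      show "(Z has_derivative ?D z) (at z within ?S)" if "z \<in> ?S" for z
        using that assms by (blast intro: has_derivative_at_withinI Cinf_on_has_derivative)
      show "onorm (?D z - ?D y) \<le> K * norm (x - y)" if "z \<in> ?S" for z
        unfolding fun_diff_def
      proof (rule onorm_bound)
        fix w
        have "norm (?D z w - ?D y w) \<le> K * norm (z - y) * norm w"
          using that \<open>y \<in> ?B\<close> by (intro D) auto
        also have "\<dots> \<le> K * norm (x - y) * norm w"
          using that \<open>K \<ge> 0\<close> by (intro mult_mono) (auto simp: dist_norm norm_minus_commute)
        finally show "norm (?D z w - ?D y w) \<le> K * norm (x - y) * norm w" .
      qed (use \<open>K \<ge> 0\<close> in auto)
    qed (use that in auto)
    then show ?thesis by (simp add: power2_eq_square mult_ac)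
  qed
  ultimately show ?thesis by (rule that)
qed

text \<open>No regularity of \<open>u\<close> in the initial point is assumed; only its orbits solve
  the equation. \<open>Y t\<close> is the solution operator of the equation linearized along the
  orbit of \<open>x0\<close>, and the short-time Gronwall estimate bounds the deviation from it. The
  derivative is stated along curves \<open>c\<close> because \<open>P\<close> need not be a
  neighborhood of \<open>x0\<close>.\<close>

lemma flow_differentiable:
  fixes Z :: "'a::euclidean_space \<Rightarrow> 'a"
  assumes Z: "Cinf_on N Z" "open N" "cball x0 R \<subseteq> N" and "0 < T" "x0 \<in> P"
    and u0: "\<And>p. p \<in> P \<Longrightarrow> u 0 p = p"
    and uB: "\<And>p t. p \<in> P \<Longrightarrow> \<bar>t\<bar> < T \<Longrightarrow> u t p \<in> cball x0 R"
    and ud: "\<And>p t. p \<in> P \<Longrightarrow> \<bar>t\<bar> < T \<Longrightarrow> ((\<lambda>t. u t p) has_vector_derivative Z (u t p)) (at t)"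
  obtains \<tau> Y where "0 < \<tau>" "\<tau> \<le> T" "\<And>t. \<bar>t\<bar> < \<tau> \<Longrightarrow> linear (Y t)" "\<And>v. Y 0 v = v"
    "\<And>v. ((\<lambda>t. Y t v) has_vector_derivative frechet_derivative Z (at x0) v) (at 0)"
    "\<And>t c v. \<bar>t\<bar> < \<tau> \<Longrightarrow> c 0 = x0 \<Longrightarrow> (c has_vector_derivative v) (at 0) \<Longrightarrow>
       (\<forall>\<^sub>F s in at 0. c s \<in> P) \<Longrightarrow> ((\<lambda>s. u t (c s)) has_vector_derivative Y t v) (at 0)"
proof -
  let ?D = "\<lambda>x. frechet_derivative Z (at x)"
  obtain L where L: "L \<ge> 0"
    "\<And>x w. x \<in> cball x0 R \<Longrightarrow> norm (?D x w) \<le> L * norm w"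
    "\<And>x y. x \<in> cball x0 R \<Longrightarrow> y \<in> cball x0 R \<Longrightarrow> norm (Z x - Z y) \<le> L * norm (x - y)"
    using Cinf_on_Lipschitz_cball[OF Z] by metis
  obtain K where K: "K \<ge> 0" "\<And>x y. x \<in> cball x0 R \<Longrightarrow> y \<in> cball x0 R \<Longrightarrow>
      norm (Z x - Z y - ?D y (x - y)) \<le> K * (norm (x - y))\<^sup>2"
    using Cinf_on_Taylor_cball[OF Z] by metis
  \<comment> \<open>\<open>T/2\<close> keeps the closed interval inside the domain of the orbits.
    The other term makes \<open>L * \<tau> \<le> 1/2\<close>, which serves both the Gronwall
    estimate and the contraction; the summand 1 covers \<open>L = 0\<close>.\<close>
  define \<tau> where "\<tau> = min (T/2) (1 / (2 * L + 1) / 2)"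
  have \<tau>: "0 < \<tau>" "\<tau> < T" using \<open>0 < T\<close> L(1) by (auto simp: \<tau>_def min_def)
  have "L * \<tau> \<le> L * (1 / (2 * L + 1) / 2)" using L(1) by (intro mult_left_mono) (auto simp: \<tau>_def)
  also have "\<dots> \<le> 1/2" using L(1) by (auto simp: divide_simps)
  finally have L\<tau>: "L * \<tau> \<le> 1/2" .
  have uB': "u t p \<in> cball x0 R" "((\<lambda>t. u t p) has_vector_derivative Z (u t p)) (at t)"
    if "p \<in> P" "\<bar>t\<bar> \<le> \<tau>" for p t
    using uB[OF that(1)] ud[OF that(1)] that \<tau> by auto
  have linD: "linear (?D (u t x0))" if "\<bar>t\<bar> \<le> \<tau>" for t
    using uB'(1)[OF \<open>x0 \<in> P\<close> that] Z by (blast intro: Cinf_on_linear_frechet)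
  have Dlip: "norm (?D (u t x0) x - ?D (u t x0) y) \<le> L * norm (x - y)" if "\<bar>t\<bar> \<le> \<tau>" for t x y
    using L(2)[OF uB'(1)[OF \<open>x0 \<in> P\<close> that], of "x - y"] linear_diff[OF linD[OF that]] by simp
  have cont: "continuous_on ({-\<tau>..\<tau>} \<times> UNIV) (\<lambda>(t, w). ?D (u t x0) w)"
  proof -
    have cu: "continuous_on {-\<tau>..\<tau>} (\<lambda>t. u t x0)"
      using has_vector_derivative_continuous[OF uB'(2)[OF \<open>x0 \<in> P\<close>]]
      by (auto intro!: continuous_at_imp_continuous_on simp: abs_le_iff)
    have "continuous_on {-\<tau>..\<tau>} (\<lambda>t. ?D (u t x0) b)" for b
      by (rule continuous_on_compose2[OF Cinf_on_continuous[OF Cinf_on_frechet[OF Z(1)]] cu])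
        (use uB'(1)[OF \<open>x0 \<in> P\<close>] Z(3) in \<open>auto simp: abs_le_iff\<close>)
    then have "continuous_on ({-\<tau>..\<tau>} \<times> UNIV) (\<lambda>z. ?D (u (fst z) x0) b)" for b
      by (rule continuous_on_compose2) (auto intro: continuous_intros)
    then have "continuous_on ({-\<tau>..\<tau>} \<times> UNIV) (\<lambda>z. \<Sum>b\<in>Basis. inner (snd z) b *\<^sub>R ?D (u (fst z) x0) b)"
      by (intro continuous_intros)
    then show ?thesis
      by (rule continuous_on_eq) (auto simp: linear_Basis_expansion[OF linD, symmetric] abs_le_iff)
  qed
  have "\<exists>y. y 0 = v \<and> (\<forall>t. \<bar>t\<bar> < \<tau> \<longrightarrow> (y has_vector_derivative ?D (u t x0) (y t)) (at t))" for v
    by (rule picard[OF \<tau>(1) cont Dlip L(1), of v]) (use L\<tau> in auto)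
  then obtain y where y0: "\<And>v. y v 0 = v"
    and y: "\<And>v t. \<bar>t\<bar> < \<tau> \<Longrightarrow> (y v has_vector_derivative ?D (u t x0) (y v t)) (at t)" by metis
  \<comment> \<open>The solutions \<open>y v\<close> satisfy their equation for
    \<open>\<bar>t\<bar> < \<tau>\<close> only, while the Gronwall estimate needs a closed
    interval.\<close>
  define \<tau>' where "\<tau>' = \<tau> / 2"
  have \<tau>': "0 < \<tau>'" "\<tau>' < \<tau>" "\<And>t. \<bar>t\<bar> \<le> \<tau>' \<Longrightarrow> \<bar>t\<bar> \<le> \<tau>" "\<And>t. \<bar>t\<bar> \<le> \<tau>' \<Longrightarrow> \<bar>t\<bar> < \<tau>"
    using \<tau> by (auto simp: \<tau>'_def)
  have L\<tau>': "L * \<tau>' \<le> 1/2"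
    using L\<tau> mult_left_mono[of \<tau>' \<tau> L] \<tau>' L(1) by linarith
  \<comment> \<open>Uniqueness for the linearized equation; it makes \<open>y\<close> linear in the
    initial vector.\<close>
  have zero: "e t = 0" if "\<And>t. \<bar>t\<bar> < \<tau> \<Longrightarrow> (e has_vector_derivative ?D (u t x0) (e t)) (at t)" "e 0 = 0" "\<bar>t\<bar> \<le> \<tau>'"
    for e t
    using short_time_gronwall[of \<tau>' e "\<lambda>t. ?D (u t x0) (e t)" L 0 t] that \<tau>' L\<tau>' L(1)
      L(2)[OF uB'(1)[OF \<open>x0 \<in> P\<close>]] by auto
  show ?thesis
  proof (rule that[of \<tau>' "\<lambda>t v. y v t"])
    show "0 < \<tau>'" "\<tau>' \<le> T" using \<tau> \<tau>' by auto
    show "linear (\<lambda>v. y v t)" if t: "\<bar>t\<bar> < \<tau>'" for t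
    proof (rule linearI)
      fix a b
      have "y (a + b) t - (y a t + y b t) = 0"
      proof (rule zero)
        show "((\<lambda>t. y (a + b) t - (y a t + y b t)) has_vector_derivative
            ?D (u t x0) (y (a + b) t - (y a t + y b t))) (at t)" if "\<bar>t\<bar> < \<tau>" for t
          using that y by (auto simp: linear_diff linear_add linD intro!: has_vector_derivative_diff has_vector_derivative_add)
      qed (use t y0 in auto)
      then show "y (a + b) t = y a t + y b t" by simp
    next
      fix r a
      have "y (r *\<^sub>R a) t - r *\<^sub>R y a t = 0"
      proof (rule zero)
        show "((\<lambda>t. y (r *\<^sub>R a) t - r *\<^sub>R y a t) has_vector_derivative
            ?D (u t x0) (y (r *\<^sub>R a) t - r *\<^sub>R y a t)) (at t)" if "\<bar>t\<bar> < \<tau>" for t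
        proof -
          have "((\<lambda>t. r *\<^sub>R y a t) has_vector_derivative r *\<^sub>R ?D (u t x0) (y a t)) (at t)"
            by (rule bounded_linear.has_vector_derivative[OF bounded_linear_scaleR_right y[OF that]])
          then show ?thesis
            using that y by (auto simp: linear_diff linear_cmul linD intro!: has_vector_derivative_diff)
        qed
      qed (use t y0 in auto)
      then show "y (r *\<^sub>R a) t = r *\<^sub>R y a t" by simp
    qed
    show "y v 0 = v" for v by (rule y0)
    show "(y v has_vector_derivative ?D x0 v) (at 0)" for v
      using y[of 0 v] y0[of v] u0[OF \<open>x0 \<in> P\<close>] \<tau> by simp
  next
    fix t c v assume t: "\<bar>t\<bar> < \<tau>'" and c0: "c 0 = x0" and c: "(c has_vector_derivative v) (at 0)"
      and cP: "\<forall>\<^sub>F s in at 0. c s \<in> P"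
    \<comment> \<open>The relative error of approximating \<open>c\<close> by its tangent line. The
      final bound \<open>?Q s\<close> consists of a multiple of \<open>r s\<close> and a term with
      the factor \<open>\<bar>s\<bar>\<close>, so it tends to 0.\<close>
    define r where "r s = norm (c s - x0 - s *\<^sub>R v) / norm s" for s
    have r: "(r \<longlongrightarrow> 0) (at 0)"
      using c unfolding has_vector_derivative_def has_derivative_at r_def by (simp add: c0)
    let ?Q = "\<lambda>s. 2 * (r s + \<tau>' * (K * (4 * (\<bar>s\<bar> * (r s + norm v)\<^sup>2))))"
    have est: "norm (u t (c s) - u t x0 - s *\<^sub>R y v t) / norm s \<le> ?Q s" if "c s \<in> P" "s \<noteq> 0" for s
    proof -
      have d1: "norm (u t' (c s) - u t' x0) \<le> 2 * norm (c s - x0)" if t': "\<bar>t'\<bar> \<le> \<tau>'" for t'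
      proof -
        have "norm (u t' (c s) - u t' x0) \<le> 2 * (norm (u 0 (c s) - u 0 x0) + \<tau>' * 0)"
        proof (rule short_time_gronwall[where e'="\<lambda>t. Z (u t (c s)) - Z (u t x0)", OF _ _ L(1) L\<tau>' _ t'])
          fix t assume "\<bar>t\<bar> \<le> \<tau>'"
          then have t: "\<bar>t\<bar> \<le> \<tau>" by (rule \<tau>'(3))
          show "((\<lambda>t. u t (c s) - u t x0) has_vector_derivative Z (u t (c s)) - Z (u t x0)) (at t)"
            by (intro has_vector_derivative_diff uB'(2) \<open>x0 \<in> P\<close> \<open>c s \<in> P\<close> t)
          show "norm (Z (u t (c s)) - Z (u t x0)) \<le> L * norm (u t (c s) - u t x0) + 0"
            using L(3)[OF uB'(1)[OF \<open>c s \<in> P\<close> t] uB'(1)[OF \<open>x0 \<in> P\<close> t]] by simp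
        qed simp
        then show ?thesis using u0[OF \<open>x0 \<in> P\<close>] u0[OF \<open>c s \<in> P\<close>] by simp
      qed
      have "norm (u t (c s) - u t x0 - s *\<^sub>R y v t)
          \<le> 2 * (norm (u 0 (c s) - u 0 x0 - s *\<^sub>R y v 0) + \<tau>' * (K * (2 * norm (c s - x0))\<^sup>2))"
      proof (rule short_time_gronwall[where e'="\<lambda>t. Z (u t (c s)) - Z (u t x0) - s *\<^sub>R ?D (u t x0) (y v t)"])
        fix t' assume t': "\<bar>t'\<bar> \<le> \<tau>'"
        have "((\<lambda>t. s *\<^sub>R y v t) has_vector_derivative s *\<^sub>R ?D (u t' x0) (y v t')) (at t')"
          by (rule bounded_linear.has_vector_derivative[OF bounded_linear_scaleR_right y]) (use t' \<tau>' in auto)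
        then show "((\<lambda>t. u t (c s) - u t x0 - s *\<^sub>R y v t) has_vector_derivative
            Z (u t' (c s)) - Z (u t' x0) - s *\<^sub>R ?D (u t' x0) (y v t')) (at t')"
          by (intro has_vector_derivative_diff uB') (use t' \<tau>' \<open>x0 \<in> P\<close> \<open>c s \<in> P\<close> in auto)
        let ?a = "u t' (c s)" and ?b = "u t' x0"
        \<comment> \<open>Split into the quadratic Taylor remainder, controlled through
          \<open>d1\<close>, and the linearized field applied to the error itself, which the
          Gronwall estimate absorbs.\<close>
        have "Z ?a - Z ?b - s *\<^sub>R ?D ?b (y v t') = (Z ?a - Z ?b - ?D ?b (?a - ?b)) + ?D ?b (?a - ?b - s *\<^sub>R y v t')"
          using t' \<tau>' by (simp add: linear_diff linear_cmul linD)
        then have "norm (Z ?a - Z ?b - s *\<^sub>R ?D ?b (y v t'))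
            \<le> norm (Z ?a - Z ?b - ?D ?b (?a - ?b)) + norm (?D ?b (?a - ?b - s *\<^sub>R y v t'))"
          by (simp only: norm_triangle_ineq)
        also have "\<dots> \<le> K * (norm (?a - ?b))\<^sup>2 + L * norm (?a - ?b - s *\<^sub>R y v t')"
          using t' \<tau>' \<open>x0 \<in> P\<close> \<open>c s \<in> P\<close> by (intro add_mono K(2) L(2) uB') auto
        also have "K * (norm (?a - ?b))\<^sup>2 \<le> K * (2 * norm (c s - x0))\<^sup>2"
          using d1[OF t'] K(1) by (intro mult_left_mono power_mono) auto
        finally show "norm (Z ?a - Z ?b - s *\<^sub>R ?D ?b (y v t'))
            \<le> L * norm (?a - ?b - s *\<^sub>R y v t') + K * (2 * norm (c s - x0))\<^sup>2" by simp
      qed (use L(1) L\<tau>' K(1) t in auto)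
      also have "u 0 (c s) - u 0 x0 - s *\<^sub>R y v 0 = c s - x0 - s *\<^sub>R v"
        using u0 \<open>x0 \<in> P\<close> \<open>c s \<in> P\<close> y0 by simp
      also have "norm (c s - x0 - s *\<^sub>R v) = \<bar>s\<bar> * r s" using \<open>s \<noteq> 0\<close> by (simp add: r_def)
      also have "2 * (\<bar>s\<bar> * r s + \<tau>' * (K * (2 * norm (c s - x0))\<^sup>2))
          \<le> 2 * (\<bar>s\<bar> * r s + \<tau>' * (K * (2 * (\<bar>s\<bar> * (r s + norm v)))\<^sup>2))"
      proof -
        have "norm (c s - x0) \<le> norm (c s - x0 - s *\<^sub>R v) + norm (s *\<^sub>R v)"
          using norm_triangle_ineq[of "c s - x0 - s *\<^sub>R v" "s *\<^sub>R v"] by simp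
        also have "\<dots> = \<bar>s\<bar> * (r s + norm v)" using \<open>s \<noteq> 0\<close> by (simp add: r_def algebra_simps)
        finally have "norm (c s - x0) \<le> \<bar>s\<bar> * (r s + norm v)" .
        then show ?thesis using K(1) \<tau>' by (intro mult_left_mono add_left_mono power_mono) auto
      qed
      also have "\<dots> = \<bar>s\<bar> * ?Q s" by (simp add: algebra_simps power2_eq_square)
      finally show ?thesis using \<open>s \<noteq> 0\<close> by (simp add: divide_le_eq mult.commute)
    qed
    have Q: "(?Q \<longlongrightarrow> 2 * (0 + \<tau>' * (K * (4 * (\<bar>0\<bar> * (0 + norm v)\<^sup>2))))) (at 0)"
      by (intro tendsto_intros r)
    have "((\<lambda>s. norm (u t (c s) - u t x0 - s *\<^sub>R y v t) / norm s) \<longlongrightarrow> 0) (at 0)"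
    proof (rule Lim_null_comparison)
      show "(?Q \<longlongrightarrow> 0) (at 0)" using Q by simp
      show "\<forall>\<^sub>F s in at 0. norm (norm (u t (c s) - u t x0 - s *\<^sub>R y v t) / norm s) \<le> ?Q s"
        using cP eventually_neq_at_within[of 0]
        by eventually_elim (use est in auto)
    qed
    then show "((\<lambda>s. u t (c s)) has_vector_derivative y v t) (at 0)"
      unfolding has_vector_derivative_def has_derivative_at
      by (simp add: c0 bounded_linear_scaleR_left)
  qed
qed

section \<open>Charts and tangent vectors\<close>

text \<open>Charts take values in a subspace, so the change of coordinates is called smooth through
  an extension \<open>F\<close> to an open set of the ambient space. The condition
  \<open>q \<in> V\<close> ensures that points of \<open>U\<close> with coordinates near those of
  \<open>p\<close> also lie in the other chart.\<close>

definition trans_at ::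
  "'a set \<Rightarrow> ('a \<Rightarrow> 'e::euclidean_space) \<Rightarrow> 'a set \<Rightarrow> ('a \<Rightarrow> 'f::euclidean_space) \<Rightarrow> 'a \<Rightarrow> bool" where
  "trans_at U \<phi> V \<psi> p \<longleftrightarrow> (\<exists>N F. open N \<and> \<phi> p \<in> N \<and> Cinf_on N F \<and>
     (\<forall>q\<in>U. \<phi> q \<in> N \<longrightarrow> q \<in> V \<and> F (\<phi> q) = \<psi> q))"

text \<open>The smooth half of compatibility with the atlas, kept apart from the topology and the
  model, so that products of charts are handled without a topological argument.\<close>

definition smooth_chart :: "('a, 'e::euclidean_space) smooth_structure \<Rightarrow> 'a set \<Rightarrow> ('a \<Rightarrow> 'e) \<Rightarrow> bool" where
  "smooth_chart A U \<phi> \<longleftrightarrow>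
     (\<forall>(V, \<psi>)\<in>charts A. \<forall>p\<in>U \<inter> V. trans_at U \<phi> V \<psi> p \<and> trans_at V \<psi> U \<phi> p)"

text \<open>\<open>S\<close> may be a source fiber or the set of composable pairs: \<open>F\<close>
  is a smooth extension of the coordinate expression, and only its values at coordinates of points
  of \<open>S\<close> are prescribed. Its derivative is therefore used along curves in
  \<open>S\<close>.\<close>

definition local_rep ::
  "'a set \<Rightarrow> ('a \<Rightarrow> 'b) \<Rightarrow> 'a set \<Rightarrow> ('a \<Rightarrow> 'e::euclidean_space) \<Rightarrow> 'b set \<Rightarrow> ('b \<Rightarrow> 'f::euclidean_space) \<Rightarrow>
   'e set \<Rightarrow> ('e \<Rightarrow> 'f) \<Rightarrow> bool" where
  "local_rep S f U \<phi> V \<psi> N F \<longleftrightarrow> open N \<and> Cinf_on N F \<and>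
     (\<forall>q\<in>S \<inter> U. \<phi> q \<in> N \<longrightarrow> f q \<in> V \<and> F (\<phi> q) = \<psi> (f q))"

definition covered :: "('a, 'e) smooth_structure \<Rightarrow> bool" where
  "covered A \<longleftrightarrow> (\<forall>p. \<exists>(U, \<phi>)\<in>charts A. p \<in> U)"

lemma trans_at_prod:
  assumes "trans_at U \<phi> V \<psi> p" "trans_at U' \<phi>' V' \<psi>' p'"
  shows "trans_at (U \<times> U') (map_prod \<phi> \<phi>') (V \<times> V') (map_prod \<psi> \<psi>') (p, p')"
proof -
  obtain N F where N: "open N" "\<phi> p \<in> N" "Cinf_on N F" "\<And>q. q \<in> U \<Longrightarrow> \<phi> q \<in> N \<Longrightarrow> q \<in> V \<and> F (\<phi> q) = \<psi> q"
    using assms(1) by (auto simp: trans_at_def)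
  obtain N' F' where N': "open N'" "\<phi>' p' \<in> N'" "Cinf_on N' F'"
    "\<And>q. q \<in> U' \<Longrightarrow> \<phi>' q \<in> N' \<Longrightarrow> q \<in> V' \<and> F' (\<phi>' q) = \<psi>' q"
    using assms(2) by (auto simp: trans_at_def)
  have op: "open (N \<times> N')" using N N' by (simp add: open_Times)
  have "Cinf_on (N \<times> N') (\<lambda>z. (F (fst z), F' (snd z)))"
    by (intro Cinf_on_Pair[OF op] Cinf_on_compose[OF op N(1) _ _ N(3)] Cinf_on_compose[OF op N'(1) _ _ N'(3)]
        Cinf_on_bounded_linear[OF op bounded_linear_fst Cinf_on_id[OF op]]
        Cinf_on_bounded_linear[OF op bounded_linear_snd Cinf_on_id[OF op]]) auto
  then show ?thesis unfolding trans_at_def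
    by (intro exI[of _ "N \<times> N'"] exI[of _ "\<lambda>z. (F (fst z), F' (snd z))"]) (use N N' op in auto)
qed

lemma smooth_chartD:
  assumes "smooth_chart A U \<phi>" "(V, \<psi>) \<in> charts A" "p \<in> U" "p \<in> V"
  shows "trans_at U \<phi> V \<psi> p" "trans_at V \<psi> U \<phi> p"
  using assms by (auto simp: smooth_chart_def)

lemma smooth_chart_prod:
  assumes "smooth_chart A U \<phi>" "smooth_chart B V \<psi>"
  shows "smooth_chart (prod_structure A B) (U \<times> V) (map_prod \<phi> \<psi>)"
proof -
  have "trans_at (U \<times> V) (map_prod \<phi> \<psi>) W \<theta> z \<and> trans_at W \<theta> (U \<times> V) (map_prod \<phi> \<psi>) z"
    if W: "(W, \<theta>) \<in> charts (prod_structure A B)" and z: "z \<in> (U \<times> V) \<inter> W" for W \<theta> z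
  proof -
    obtain U' \<phi>' V' \<psi>' where *: "W = U' \<times> V'" "\<theta> = map_prod \<phi>' \<psi>'" "(U', \<phi>') \<in> charts A" "(V', \<psi>') \<in> charts B"
      using W by (auto simp: prod_structure_def)
    obtain p q where "z = (p, q)" by fastforce
    then show ?thesis
      using smooth_chartD[OF assms(1) *(3), of p] smooth_chartD[OF assms(2) *(4), of q] z *(1,2)
      by (simp add: trans_at_prod)
  qed
  then show ?thesis by (auto simp: smooth_chart_def)
qed

lemma smooth_chart_eucl: "smooth_chart (eucl :: ('e, 'e::euclidean_space) smooth_structure) UNIV id"
proof -
  have "trans_at UNIV (id :: 'e \<Rightarrow> 'e) UNIV id p" for p
    unfolding trans_at_def
    by (rule exI[of _ UNIV], rule exI[of _ "\<lambda>x. x"]) (simp add: Cinf_on_id)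
  then show ?thesis by (simp add: smooth_chart_def eucl_def)
qed

lemma coveredE:
  assumes "covered A" obtains U \<phi> where "(U, \<phi>) \<in> charts A" "p \<in> U"
  using assms unfolding covered_def by fast

lemma covered_prod: 
  assumes "covered A" "covered B" shows "covered (prod_structure A B)"
  unfolding covered_def
proof
  fix z :: "'a \<times> 'c"
  obtain U \<phi> where U: "(U, \<phi>) \<in> charts A" "fst z \<in> U" by (rule coveredE[OF assms(1)])
  obtain V \<psi> where V: "(V, \<psi>) \<in> charts B" "snd z \<in> V" by (rule coveredE[OF assms(2)])
  have "(U \<times> V, map_prod \<phi> \<psi>) \<in> charts (prod_structure A B)" "z \<in> U \<times> V"
    using U V by (auto simp: prod_structure_def mem_Times_iff)
  then show "\<exists>(U, \<phi>)\<in>charts (prod_structure A B). z \<in> U" by (intro bexI[rotated]) auto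
qed

lemma covered_eucl: "covered eucl"
  by (auto simp: covered_def eucl_def)

lemma manifold_covered: "manifold A \<Longrightarrow> covered A"
  unfolding covered_def
proof
  fix p assume "manifold A"
  then have "p \<in> (\<Union>(U, \<phi>)\<in>charts A. U)" by (simp add: manifold_def)
  then show "\<exists>(U, \<phi>)\<in>charts A. p \<in> U" by (auto simp: case_prod_beta)
qed

text \<open>Composition with the two coordinate changes moves a coordinate expression from one pair
  of charts to another; this makes smoothness testable in any compatible charts.\<close>

lemma local_rep_change:
  assumes rep: "local_rep S f U \<phi> V \<psi> N F" "\<phi> p \<in> N" and p: "p \<in> S" "p \<in> U'"
    and t: "trans_at U' \<phi>' U \<phi> p" "trans_at V \<psi> V' \<psi>' (f p)"
  shows "\<exists>N F. \<phi>' p \<in> N \<and> local_rep S f U' \<phi>' V' \<psi>' N F"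
proof -
  obtain N1 T where T: "open N1" "\<phi>' p \<in> N1" "Cinf_on N1 T" "\<And>q. q \<in> U' \<Longrightarrow> \<phi>' q \<in> N1 \<Longrightarrow> q \<in> U \<and> T (\<phi>' q) = \<phi> q"
    using t(1) by (auto simp: trans_at_def)
  obtain N2 R where R: "open N2" "\<psi> (f p) \<in> N2" "Cinf_on N2 R" "\<And>q. q \<in> V \<Longrightarrow> \<psi> q \<in> N2 \<Longrightarrow> q \<in> V' \<and> R (\<psi> q) = \<psi>' q"
    using t(2) by (auto simp: trans_at_def)
  have F: "open N" "Cinf_on N F" "\<And>q. q \<in> S \<Longrightarrow> q \<in> U \<Longrightarrow> \<phi> q \<in> N \<Longrightarrow> f q \<in> V \<and> F (\<phi> q) = \<psi> (f q)"
    using rep by (auto simp: local_rep_def)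
  define M where "M = N \<inter> F -` N2"
  define N' where "N' = N1 \<inter> T -` M"
  have "open M"
    using continuous_on_open_vimage[OF F(1)] Cinf_on_continuous[OF F(2)] R(1) by (metis M_def inf_commute)
  then have "open N'"
    using continuous_on_open_vimage[OF T(1)] Cinf_on_continuous[OF T(3)] by (metis N'_def inf_commute)
  have 1: "Cinf_on N' (\<lambda>x. F (T x))"
    by (rule Cinf_on_compose[OF \<open>open N'\<close> F(1)]) (auto simp: N'_def M_def intro: Cinf_on_subset T F)
  have "Cinf_on N' (\<lambda>x. R (F (T x)))"
    by (rule Cinf_on_compose[OF \<open>open N'\<close> R(1) _ 1 R(3)]) (auto simp: N'_def M_def)
  moreover have "\<phi>' p \<in> N'"
    using T(2) T(4)[OF p(2)] F(3)[OF p(1)] rep(2) R(2) by (auto simp: N'_def M_def)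
  moreover have "f q \<in> V' \<and> R (F (T (\<phi>' q))) = \<psi>' (f q)" if "q \<in> S \<inter> U'" "\<phi>' q \<in> N'" for q
    using that T(4)[of q] F(3)[of q] R(4)[of "f q"] by (auto simp: N'_def M_def)
  ultimately show ?thesis using \<open>open N'\<close> unfolding local_rep_def by blast
qed

lemma smooth_map_local_rep:
  assumes "smooth_map A B S f" "smooth_chart A U \<phi>" "smooth_chart B V \<psi>" "p \<in> S" "p \<in> U" "f p \<in> V"
  shows "\<exists>N F. \<phi> p \<in> N \<and> local_rep S f U \<phi> V \<psi> N F"
proof -
  obtain c d N F where "c \<in> charts A" "d \<in> charts B" "p \<in> fst c" "f p \<in> fst d"
    "local_rep S f (fst c) (snd c) (fst d) (snd d) N F" "snd c p \<in> N"
    using assms(1)[unfolded smooth_map_def, rule_format, OF assms(4)]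
    unfolding local_rep_def case_prod_beta by blast
  then obtain U0 \<phi>0 V0 \<psi>0 where *: "(U0, \<phi>0) \<in> charts A" "(V0, \<psi>0) \<in> charts B" "p \<in> U0" "f p \<in> V0"
    "local_rep S f U0 \<phi>0 V0 \<psi>0 N F" "\<phi>0 p \<in> N" by (metis prod.collapse)
  show ?thesis
    by (rule local_rep_change[OF *(5,6) assms(4,5)])
      (rule smooth_chartD[OF assms(2) *(1) assms(5) *(3)] smooth_chartD[OF assms(3) *(2) assms(6) *(4)])+
qed

lemma smooth_map_if_local_rep:
  assumes "covered A" "covered B"
    and "\<And>p. p \<in> S \<Longrightarrow> \<exists>U \<phi> V \<psi> N F. smooth_chart A U \<phi> \<and> smooth_chart B V \<psi> \<and> p \<in> U \<and> f p \<in> V \<and>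
      \<phi> p \<in> N \<and> local_rep S f U \<phi> V \<psi> N F"
  shows "smooth_map A B S f"
  unfolding smooth_map_def
proof
  fix p assume p: "p \<in> S"
  obtain U \<phi> V \<psi> N F where *: "smooth_chart A U \<phi>" "smooth_chart B V \<psi>" "p \<in> U" "f p \<in> V"
    "\<phi> p \<in> N" "local_rep S f U \<phi> V \<psi> N F" using assms(3)[OF p] by metis
  obtain U0 \<phi>0 V0 \<psi>0 where c: "(U0, \<phi>0) \<in> charts A" "p \<in> U0" "(V0, \<psi>0) \<in> charts B" "f p \<in> V0"
    using coveredE[OF assms(1)] coveredE[OF assms(2)] by metis
  have "\<exists>N F. \<phi>0 p \<in> N \<and> local_rep S f U0 \<phi>0 V0 \<psi>0 N F"
    by (rule local_rep_change[OF *(6,5) p c(2)]) (rule smooth_chartD[OF *(1) c(1) *(3) c(2)] smooth_chartD[OF *(2) c(3) *(4) c(4)])+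
  then show "\<exists>(U, \<phi>)\<in>charts A. \<exists>(V, \<psi>)\<in>charts B. \<exists>N F.
        p \<in> U \<and> f p \<in> V \<and> open N \<and> \<phi> p \<in> N \<and> Cinf_on N F \<and>
        (\<forall>q\<in>S \<inter> U. \<phi> q \<in> N \<longrightarrow> f q \<in> V \<and> F (\<phi> q) = \<psi> (f q))"
    using c unfolding local_rep_def by blast
qed

lemma smooth_map_in_charts:
  assumes "covered A" "covered B" "smooth_chart A U \<phi>" "smooth_chart B V \<psi>" "S \<subseteq> U" "f ` S \<subseteq> V"
    and rep: "\<And>p. p \<in> S \<Longrightarrow> \<exists>N F. \<phi> p \<in> N \<and> local_rep S f U \<phi> V \<psi> N F"
  shows "smooth_map A B S f"
proof (rule smooth_map_if_local_rep[OF assms(1,2)])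
  fix p assume p: "p \<in> S"
  then have "p \<in> U" "f p \<in> V" using assms(5,6) by auto
  then show "\<exists>U \<phi> V \<psi> N F. smooth_chart A U \<phi> \<and> smooth_chart B V \<psi> \<and> p \<in> U \<and> f p \<in> V \<and>
      \<phi> p \<in> N \<and> local_rep S f U \<phi> V \<psi> N F"
    using rep[OF p] assms(3,4) by blast
qed

text \<open>A chart of the maximal atlas. Charts adapted to the source map need not belong to the
  chosen atlas, so the development works with these instead of \<open>charts A\<close>.\<close>

definition compat_chart ::
  "('a::topological_space, 'e::euclidean_space) smooth_structure \<Rightarrow> 'a set \<Rightarrow> ('a \<Rightarrow> 'e) \<Rightarrow> bool" where
  "compat_chart A U \<phi> \<longleftrightarrow> open U \<and> openin (top_of_set (model A)) (\<phi> ` U) \<and>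
     homeomorphism U (\<phi> ` U) \<phi> (inv_into U \<phi>) \<and> smooth_chart A U \<phi>"

lemma compat_chartD:
  assumes "compat_chart A U \<phi>"
  shows "open U" "openin (top_of_set (model A)) (\<phi> ` U)" "smooth_chart A U \<phi>" "inj_on \<phi> U"
    "continuous_on U \<phi>" "continuous_on (\<phi> ` U) (inv_into U \<phi>)"
proof -
  show *: "open U" "openin (top_of_set (model A)) (\<phi> ` U)" "smooth_chart A U \<phi>"
    "continuous_on U \<phi>" "continuous_on (\<phi> ` U) (inv_into U \<phi>)"
    using assms by (auto simp: compat_chart_def homeomorphism_def)
  show "inj_on \<phi> U"
    by (rule inj_on_inverseI[where g="inv_into U \<phi>"]) (use assms in \<open>auto simp: compat_chart_def homeomorphism_def\<close>)
qed

lemma compat_chart_inv: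
  assumes "compat_chart A U \<phi>"
  shows "p \<in> U \<Longrightarrow> \<phi> p \<in> model A" "p \<in> U \<Longrightarrow> inv_into U \<phi> (\<phi> p) = p"
    "x \<in> \<phi> ` U \<Longrightarrow> inv_into U \<phi> x \<in> U" "x \<in> \<phi> ` U \<Longrightarrow> \<phi> (inv_into U \<phi> x) = x"
  using compat_chartD[OF assms] openin_subset[of "top_of_set (model A)" "\<phi> ` U"]
  by (auto simp: f_inv_into_f inv_into_into)

lemma compat_chart_nbhd:
  assumes c: "compat_chart A U \<phi>" and "open Q" "p \<in> Q" "p \<in> U"
  shows "\<exists>N. open N \<and> \<phi> p \<in> N \<and> (\<forall>x\<in>model A \<inter> N. x \<in> \<phi> ` (U \<inter> Q))"
proof -
  note cD = compat_chartD[OF c]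
  have "openin (top_of_set (\<phi> ` U)) (\<phi> ` U \<inter> inv_into U \<phi> -` (U \<inter> Q))"
    using cD(1,6) \<open>open Q\<close> by (intro continuous_openin_preimage_gen) auto
  then have "openin (top_of_set (model A)) (\<phi> ` U \<inter> inv_into U \<phi> -` (U \<inter> Q))"
    using cD(2) openin_trans by blast
  moreover have "\<phi> ` U \<inter> inv_into U \<phi> -` (U \<inter> Q) = \<phi> ` (U \<inter> Q)"
    using compat_chart_inv[OF c] by (auto simp: image_iff) 
  ultimately obtain N where "open N" "\<phi> ` (U \<inter> Q) = model A \<inter> N"
    by (auto simp: openin_open)
  then show ?thesis using assms by blast
qed

lemma compat_chart_continuous:
  assumes c: "compat_chart A U \<phi>" and "open N" "p \<in> U" "\<phi> p \<in> N"
  shows "\<exists>Q. open Q \<and> p \<in> Q \<and> Q \<subseteq> U \<and> \<phi> ` Q \<subseteq> N"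
proof -
  have "open (\<phi> -` N \<inter> U)"
    using compat_chartD(1,5)[OF c] \<open>open N\<close> continuous_on_open_vimage by blast
  then show ?thesis using assms by (intro exI[of _ "\<phi> -` N \<inter> U"]) auto
qed

lemma manifold_compat_chart:
  assumes "manifold A" "(U, \<phi>) \<in> charts A"
  shows "compat_chart A U \<phi>"
proof -
  have pre: "open U \<and> openin (top_of_set (model A)) (\<phi> ` U) \<and> homeomorphism U (\<phi> ` U) \<phi> (inv_into U \<phi>)"
    if c: "(U, \<phi>) \<in> charts A" for U \<phi>
  proof -
    obtain \<theta> where o: "open U" "openin (top_of_set (model A)) (\<phi> ` U)" "homeomorphism U (\<phi> ` U) \<phi> \<theta>"
      using assms(1) c unfolding manifold_def by fastforce
    have "\<theta> x = inv_into U \<phi> x" if "x \<in> \<phi> ` U" for x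
      using o(3) that unfolding homeomorphism_def by (metis imageE inv_into_f_f inj_onI)
    then have "homeomorphism U (\<phi> ` U) \<phi> (inv_into U \<phi>)"
      using o(3) by (auto simp: homeomorphism_def cong: continuous_on_cong)
    then show ?thesis using o by blast
  qed
  have tr: "trans_at U \<phi> V \<psi> p" if c: "(U, \<phi>) \<in> charts A" "(V, \<psi>) \<in> charts A" "p \<in> U" "p \<in> V" for U \<phi> V \<psi> p
  proof -
    \<comment> \<open>With the atlas emptied, \<open>smooth_chart\<close> holds vacuously; this
      makes the topological facts about compatible charts available before smooth compatibility is
      known.\<close>
    have cU: "compat_chart (A\<lparr>charts := {}\<rparr>) U \<phi>"
      using pre[OF c(1)] by (simp add: compat_chart_def smooth_chart_def)
    have "smooth_map eucl eucl (\<phi> ` (U \<inter> V)) (\<psi> \<circ> inv_into U \<phi>)"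
      using assms(1) c unfolding manifold_def by fastforce
    from this[unfolded smooth_map_def, rule_format, of "\<phi> p"]
    obtain N F where N: "open N" "\<phi> p \<in> N" "Cinf_on N F" "\<And>q. q \<in> \<phi> ` (U \<inter> V) \<Longrightarrow> q \<in> N \<Longrightarrow> F q = \<psi> (inv_into U \<phi> q)"
      using c(3,4) by (auto simp: eucl_def)
    \<comment> \<open>The smoothness of the transition speaks only of coordinates of points in the
      overlap; \<open>N'\<close> excludes the points of \<open>U\<close> outside
      \<open>V\<close>.\<close>
    obtain N' where N': "open N'" "\<phi> p \<in> N'" "\<forall>x\<in>model A \<inter> N'. x \<in> \<phi> ` (U \<inter> V)"
      using compat_chart_nbhd[OF cU, of V p] pre[OF c(2)] c by auto
    have inU: "\<phi> q \<in> model A" "inv_into U \<phi> (\<phi> q) = q" if "q \<in> U" for q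
      using compat_chart_inv[OF cU] that by auto
    have "q \<in> V \<and> F (\<phi> q) = \<psi> q" if q: "q \<in> U" "\<phi> q \<in> N \<inter> N'" for q
    proof -
      have m: "\<phi> q \<in> \<phi> ` (U \<inter> V)" using N'(3) inU(1)[OF q(1)] q(2) by blast
      then have "q \<in> V" using q(1) compat_chartD(4)[OF cU] by (auto simp: inj_on_def)
      then show ?thesis using N(4)[OF m] q inU(2)[OF q(1)] by simp
    qed
    moreover have "open (N \<inter> N')" "\<phi> p \<in> N \<inter> N'" "Cinf_on (N \<inter> N') F"
      using N N' by (auto intro: Cinf_on_subset)
    ultimately show ?thesis unfolding trans_at_def by blast
  qed
  show ?thesis using pre[OF assms(2)] tr assms(2)
    unfolding compat_chart_def smooth_chart_def by auto
qed

lemma manifold_subspace: "manifold A \<Longrightarrow> subspace (model A)"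
  by (simp add: manifold_def)

lemma chart_at:
  assumes "manifold A" "chart_at A p = (V, \<psi>)"
  shows "(V, \<psi>) \<in> charts A" "p \<in> V" "compat_chart A V \<psi>"
proof -
  have "\<exists>c. c \<in> charts A \<and> p \<in> fst c"
    using coveredE[OF manifold_covered[OF assms(1)]] by (metis fst_conv)
  then have "chart_at A p \<in> charts A \<and> p \<in> fst (chart_at A p)"
    unfolding chart_at_def by (rule someI_ex)
  then show "(V, \<psi>) \<in> charts A" "p \<in> V" using assms(2) by auto
  then show "compat_chart A V \<psi>" using manifold_compat_chart[OF assms(1)] by blast
qed

lemma ex_compat_chart: "manifold A \<Longrightarrow> \<exists>U \<phi>. compat_chart A U \<phi> \<and> p \<in> U"
  using chart_at by (metis surj_pair)

lemma trans_at_compat: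
  assumes "manifold A" "compat_chart A U \<phi>" "compat_chart A V \<psi>" "p \<in> U" "p \<in> V"
  shows "trans_at U \<phi> V \<psi> p"
proof -
  obtain W \<theta> where W: "chart_at A p = (W, \<theta>)" by fastforce
  note W' = chart_at[OF assms(1) W]
  have t: "trans_at U \<phi> W \<theta> p" "trans_at W \<theta> V \<psi> p"
    using smooth_chartD[OF compat_chartD(3)[OF assms(2)] W'(1) assms(4) W'(2)]
      smooth_chartD[OF compat_chartD(3)[OF assms(3)] W'(1) assms(5) W'(2)] by auto
  have i: "local_rep UNIV id W \<theta> W \<theta> UNIV id"
    unfolding local_rep_def using Cinf_on_id[of UNIV] by (simp add: id_def)
  show ?thesis
    using local_rep_change[OF i, of p U \<phi> V \<psi>] t assms by (auto simp: local_rep_def trans_at_def)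
qed

section \<open>Velocities and tangent vectors in arbitrary charts\<close>

lemma has_vector_derivative_slope:
  fixes f :: "real \<Rightarrow> 'a::real_normed_vector"
  assumes "(f has_vector_derivative v) (at t)"
  shows "((\<lambda>s. (f s - f t) /\<^sub>R (s - t)) \<longlongrightarrow> v) (at t)"
proof -
  have "((\<lambda>s. norm (f s - f t - (s - t) *\<^sub>R v) / norm (s - t)) \<longlongrightarrow> 0) (at t)"
    using assms unfolding has_vector_derivative_def has_derivative_iff_norm by simp
  moreover have "norm (f s - f t - (s - t) *\<^sub>R v) / norm (s - t) = norm ((f s - f t) /\<^sub>R (s - t) - v)"
    if "s \<noteq> t" for s
  proof -
    have "(f s - f t) /\<^sub>R (s - t) - v = (f s - f t - (s - t) *\<^sub>R v) /\<^sub>R (s - t)"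
      using that by (simp add: scaleR_diff_right)
    then show ?thesis by (simp add: divide_inverse mult.commute)
  qed
  ultimately have "((\<lambda>s. norm ((f s - f t) /\<^sub>R (s - t) - v)) \<longlongrightarrow> 0) (at t)"
    by (elim Lim_transform_within[where d=1]) auto
  then show ?thesis using tendsto_norm_zero_iff LIM_zero_cancel by blast
qed

lemma vector_derivative_in_subspace:
  fixes f :: "real \<Rightarrow> 'a::euclidean_space"
  assumes "subspace M" "(f has_vector_derivative v) (at t)" "\<forall>\<^sub>F s in at t. f s \<in> M" "f t \<in> M"
  shows "v \<in> M"
proof (rule Lim_in_closed_set[OF closed_subspace[OF assms(1)]])
  show "\<forall>\<^sub>F s in at t. (f s - f t) /\<^sub>R (s - t) \<in> M"
    using assms(3) by eventually_elim (auto intro: subspace_scale subspace_diff assms)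
  show "((\<lambda>s. (f s - f t) /\<^sub>R (s - t)) \<longlongrightarrow> v) (at t)"
    using assms(2) by (rule has_vector_derivative_slope)
qed auto

lemma has_vector_derivative_eventually:
  assumes "(f has_vector_derivative v) (at t)" "\<forall>\<^sub>F s in at t. f s = g s" "f t = g t"
  shows "(g has_vector_derivative v) (at t)"
  using assms unfolding has_vector_derivative_def
  by (rule has_derivative_transform_eventually) auto

lemma isCont_eventually:
  "isCont f t \<Longrightarrow> open N \<Longrightarrow> f t \<in> N \<Longrightarrow> \<forall>\<^sub>F s in at t. f s \<in> N"
  by (auto simp: isCont_def intro: topological_tendstoD)

lemma compat_chart_eventually:
  assumes "compat_chart A U \<phi>" "isCont \<gamma> t" "\<gamma> t \<in> U" "open N" "\<phi> (\<gamma> t) \<in> N"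
  shows "\<forall>\<^sub>F s in at t. \<gamma> s \<in> U \<and> \<phi> (\<gamma> s) \<in> N"
proof -
  obtain Q where "open Q" "\<gamma> t \<in> Q" "Q \<subseteq> U" "\<phi> ` Q \<subseteq> N"
    using compat_chart_continuous[OF assms(1,4,3,5)] by blast
  then show ?thesis
    using isCont_eventually[OF assms(2), of Q] by (auto elim!: eventually_mono)
qed

lemma isCont_line: "isCont (\<lambda>s. x + s *\<^sub>R v) (t::real)" for x v :: "'a::real_normed_vector"
  by (intro continuous_intros)

lemma has_vector_derivative_line: "((\<lambda>s. x + s *\<^sub>R v) has_vector_derivative v) (at t)"
  by (auto intro!: derivative_eq_intros)

lemma line_in_chart:
  assumes M: "manifold A" and c: "compat_chart A U \<phi>" and "p \<in> U" "open Q" "p \<in> Q" "v \<in> model A"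
    "open N" "\<phi> p \<in> N"
  obtains \<delta> where "0 < \<delta>"
    "\<And>s. \<bar>s\<bar> < \<delta> \<Longrightarrow> \<phi> p + s *\<^sub>R v \<in> N \<and> \<phi> p + s *\<^sub>R v \<in> \<phi> ` (U \<inter> Q)"
proof -
  obtain N' where N': "open N'" "\<phi> p \<in> N'" "\<forall>x\<in>model A \<inter> N'. x \<in> \<phi> ` (U \<inter> Q)"
    using compat_chart_nbhd[OF c assms(4,5,3)] by blast
  have "isCont (\<lambda>s. \<phi> p + s *\<^sub>R v) 0" by (rule isCont_line)
  then obtain T where T: "open T" "0 \<in> T" "\<And>s. s \<in> T \<Longrightarrow> \<phi> p + s *\<^sub>R v \<in> N \<inter> N'"
    using isCont_openD[of 0 "\<lambda>s. \<phi> p + s *\<^sub>R v" "N \<inter> N'"] N' assms by auto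
  obtain \<delta> where "0 < \<delta>" "ball 0 \<delta> \<subseteq> T" using T(1,2) open_contains_ball by blast
  moreover have "\<phi> p + s *\<^sub>R v \<in> model A" for s
    using compat_chart_inv(1)[OF c \<open>p \<in> U\<close>] manifold_subspace[OF M] \<open>v \<in> model A\<close>
    by (simp add: subspace_add subspace_scale)
  ultimately show ?thesis using T(3) N'(3) by (intro that[of \<delta>]) (auto simp: subset_iff dist_real_def)
qed

lemma eventually_at_0_less: "0 < \<delta> \<Longrightarrow> \<forall>\<^sub>F s in at (0::real). \<bar>s\<bar> < \<delta>"
  by (auto simp: eventually_at dist_real_def intro: exI[of _ \<delta>])

text \<open>\<open>chart_comp\<close> is the derivative of the coordinate change \<open>F\<close>
  out of the preferred chart, restricted to the model. \<open>F\<close> and \<open>F'\<close> are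
  extensions that invert each other on chart images only, hence the restriction to
  \<open>v \<in> model A\<close>.\<close>

lemma chart_comp_frechet:
  assumes M: "manifold A" and c: "compat_chart A U \<phi>" and p: "p \<in> U" and V: "chart_at A p = (V, \<psi>)"
  obtains T N F N' F' where "open N" "\<psi> p \<in> N" "Cinf_on N F" "\<And>q. q \<in> V \<Longrightarrow> \<psi> q \<in> N \<Longrightarrow> q \<in> U \<and> F (\<psi> q) = \<phi> q"
    "open N'" "\<phi> p \<in> N'" "Cinf_on N' F'" "\<And>q. q \<in> U \<Longrightarrow> \<phi> q \<in> N' \<Longrightarrow> q \<in> V \<and> F' (\<phi> q) = \<psi> q"
    "\<And>v. v \<in> model A \<Longrightarrow> chart_comp A \<phi> p v = frechet_derivative F (at (\<psi> p)) v"
    "\<And>v. v \<in> model A \<Longrightarrow> frechet_derivative F' (at (\<phi> p)) (chart_comp A \<phi> p v) = v"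
proof -
  note cV = chart_at[OF M V]
  obtain N F where F: "open N" "\<psi> p \<in> N" "Cinf_on N F" "\<And>q. q \<in> V \<Longrightarrow> \<psi> q \<in> N \<Longrightarrow> q \<in> U \<and> F (\<psi> q) = \<phi> q"
    using trans_at_compat[OF M cV(3) c cV(2) p] by (auto simp: trans_at_def)
  obtain N' F' where F': "open N'" "\<phi> p \<in> N'" "Cinf_on N' F'" "\<And>q. q \<in> U \<Longrightarrow> \<phi> q \<in> N' \<Longrightarrow> q \<in> V \<and> F' (\<phi> q) = \<psi> q"
    using trans_at_compat[OF M c cV(3) p cV(2)] by (auto simp: trans_at_def)
  have Fp: "F (\<psi> p) = \<phi> p" using F cV by auto
  have *: "chart_comp A \<phi> p v = frechet_derivative F (at (\<psi> p)) v \<and>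
      frechet_derivative F' (at (\<phi> p)) (chart_comp A \<phi> p v) = v" if v: "v \<in> model A" for v
  proof -
    obtain \<delta> where \<delta>: "0 < \<delta>" "\<And>s. \<bar>s\<bar> < \<delta> \<Longrightarrow> \<psi> p + s *\<^sub>R v \<in> N \<and> \<psi> p + s *\<^sub>R v \<in> \<psi> ` (V \<inter> UNIV)"
      using line_in_chart[OF M cV(3) cV(2) open_UNIV UNIV_I v F(1,2)] by metis
    have e1: "F (\<psi> p + s *\<^sub>R v) = \<phi> (inv_into V \<psi> (\<psi> p + s *\<^sub>R v))" if "\<bar>s\<bar> < \<delta>" for s
    proof -
      obtain q where "q \<in> V" "\<psi> p + s *\<^sub>R v = \<psi> q" using \<delta>(2)[OF \<open>\<bar>s\<bar> < \<delta>\<close>] by auto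
      then show ?thesis using F(4)[of q] \<delta>(2)[OF \<open>\<bar>s\<bar> < \<delta>\<close>] compat_chart_inv(2)[OF cV(3)] by simp
    qed
    have d1: "((\<lambda>s. F (\<psi> p + s *\<^sub>R v)) has_vector_derivative frechet_derivative F (at (\<psi> p)) v) (at 0)"
      using Cinf_on_vector_derivative[OF F(3) has_vector_derivative_line[of "\<psi> p" v 0]] F(2) by simp
    have "((\<lambda>s. \<phi> (inv_into V \<psi> (\<psi> p + s *\<^sub>R v))) has_vector_derivative frechet_derivative F (at (\<psi> p)) v) (at 0)"
      by (rule has_vector_derivative_eventually[OF d1])
        (use \<delta>(1) e1 e1[of 0] in \<open>auto intro: eventually_mono[OF eventually_at_0_less[OF \<delta>(1)]]\<close>)
    then have 1: "chart_comp A \<phi> p v = frechet_derivative F (at (\<psi> p)) v"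
      unfolding chart_comp_def V by (simp add: vector_derivative_at)
    have d2: "((\<lambda>s. F' (F (\<psi> p + s *\<^sub>R v))) has_vector_derivative
        frechet_derivative F' (at (F (\<psi> p))) (frechet_derivative F (at (\<psi> p)) v)) (at 0)"
      using Cinf_on_vector_derivative[OF F'(3) d1] F'(2) Fp by simp
    have "isCont (\<lambda>s. F (\<psi> p + s *\<^sub>R v)) 0" by (rule has_vector_derivative_continuous[OF d1])
    then have "\<forall>\<^sub>F s in at 0. F (\<psi> p + s *\<^sub>R v) \<in> N'"
      by (rule isCont_eventually) (use F' Fp in auto)
    then have "\<forall>\<^sub>F s in at 0. F' (F (\<psi> p + s *\<^sub>R v)) = \<psi> p + s *\<^sub>R v"
      using eventually_at_0_less[OF \<delta>(1)]
    proof eventually_elim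
      case (elim s)
      obtain q where "q \<in> V" "\<psi> p + s *\<^sub>R v = \<psi> q" using \<delta>(2)[OF elim(2)] by auto
      then show ?case using F(4)[of q] F'(4)[of q] elim \<delta>(2)[OF elim(2)] by auto
    qed
    then have "((\<lambda>s. \<psi> p + s *\<^sub>R v) has_vector_derivative
        frechet_derivative F' (at (F (\<psi> p))) (frechet_derivative F (at (\<psi> p)) v)) (at 0)"
      by (rule has_vector_derivative_eventually[OF d2]) (use F' Fp p in auto)
    then have "frechet_derivative F' (at (F (\<psi> p))) (frechet_derivative F (at (\<psi> p)) v) = v"
      using has_vector_derivative_line vector_derivative_unique_at by blast
    then show ?thesis using 1 Fp by simp
  qed
  show ?thesis by (rule that[OF F F']) (use * in blast)+
qed

text \<open>Velocities do not depend on the chart. Continuity of \<open>\<gamma>\<close> belongs to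
  the notion because a chart map is arbitrary outside its domain: its composite with a curve that
  leaves the chart could still be differentiable.\<close>

lemma has_velocity_iff:
  assumes M: "manifold A" and c: "compat_chart A U \<phi>" and p: "\<gamma> t \<in> U" and v: "v \<in> model A"
  shows "has_velocity A \<gamma> t v \<longleftrightarrow> isCont \<gamma> t \<and>
    ((\<lambda>s. \<phi> (\<gamma> s)) has_vector_derivative chart_comp A \<phi> (\<gamma> t) v) (at t)"
proof -
  obtain V \<psi> where V: "chart_at A (\<gamma> t) = (V, \<psi>)" by fastforce
  note cV = chart_at[OF M V]
  obtain N F N' F' where F: "open N" "\<psi> (\<gamma> t) \<in> N" "Cinf_on N F" "\<And>q. q \<in> V \<Longrightarrow> \<psi> q \<in> N \<Longrightarrow> q \<in> U \<and> F (\<psi> q) = \<phi> q"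
    and F': "open N'" "\<phi> (\<gamma> t) \<in> N'" "Cinf_on N' F'" "\<And>q. q \<in> U \<Longrightarrow> \<phi> q \<in> N' \<Longrightarrow> q \<in> V \<and> F' (\<phi> q) = \<psi> q"
    and D: "\<And>v. v \<in> model A \<Longrightarrow> chart_comp A \<phi> (\<gamma> t) v = frechet_derivative F (at (\<psi> (\<gamma> t))) v"
    "\<And>v. v \<in> model A \<Longrightarrow> frechet_derivative F' (at (\<phi> (\<gamma> t))) (chart_comp A \<phi> (\<gamma> t) v) = v"
    by (rule chart_comp_frechet[OF M c p V]) blast
  have "((\<lambda>s. \<phi> (\<gamma> s)) has_vector_derivative chart_comp A \<phi> (\<gamma> t) v) (at t)"
    if "isCont \<gamma> t" "((\<lambda>s. \<psi> (\<gamma> s)) has_vector_derivative v) (at t)"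
    unfolding D(1)[OF v]
    by (rule has_vector_derivative_eventually[OF Cinf_on_vector_derivative[OF F(3) that(2) F(2)]])
      (use F cV in \<open>auto intro: eventually_mono[OF compat_chart_eventually[OF cV(3) that(1) cV(2) F(1,2)]]\<close>)
  moreover have "((\<lambda>s. \<psi> (\<gamma> s)) has_vector_derivative v) (at t)"
    if "isCont \<gamma> t" "((\<lambda>s. \<phi> (\<gamma> s)) has_vector_derivative chart_comp A \<phi> (\<gamma> t) v) (at t)"
    using has_vector_derivative_eventually[OF Cinf_on_vector_derivative[OF F'(3) that(2) F'(2)], of "\<lambda>s. \<psi> (\<gamma> s)"]
      F' p eventually_mono[OF compat_chart_eventually[OF c that(1) p F'(1,2)], of "\<lambda>s. F' (\<phi> (\<gamma> s)) = \<psi> (\<gamma> s)"]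
    by (simp add: D(2)[OF v])
  ultimately show ?thesis by (auto simp: has_velocity_def V)
qed

lemma compat_chart_derivative_in_model:
  assumes M: "manifold A" and c: "compat_chart A U \<phi>" and p: "\<gamma> t \<in> U" "isCont \<gamma> t"
    and d: "((\<lambda>s. \<phi> (\<gamma> s)) has_vector_derivative w) (at t)"
  shows "w \<in> model A"
  by (rule vector_derivative_in_subspace[OF manifold_subspace[OF M] d])
    (use compat_chart_inv(1)[OF c] p in \<open>auto intro: eventually_mono[OF compat_chart_eventually[OF c p(2,1) open_UNIV UNIV_I]]\<close>)

lemma has_velocity_in_model:
  assumes M: "manifold A" and "has_velocity A \<gamma> t v"
  shows "v \<in> model A"
proof -
  obtain V \<psi> where V: "chart_at A (\<gamma> t) = (V, \<psi>)" by fastforce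
  note cV = chart_at[OF M V]
  show ?thesis
    by (rule compat_chart_derivative_in_model[OF M cV(3), of \<gamma> t]) (use assms(2) V cV in \<open>auto simp: has_velocity_def\<close>)
qed

lemma has_velocity_unique: "has_velocity A \<gamma> t v \<Longrightarrow> has_velocity A \<gamma> t w \<Longrightarrow> v = w"
  unfolding has_velocity_def using vector_derivative_unique_at by blast

lemma velocity_eqI: "has_velocity A \<gamma> t v \<Longrightarrow> velocity A \<gamma> t = v"
  unfolding velocity_def by (rule the_equality) (auto intro: has_velocity_unique)

lemma has_velocity_eventually:
  assumes "has_velocity A \<gamma> t v" "\<forall>\<^sub>F s in at t. \<gamma> s = \<gamma>' s" "\<gamma> t = \<gamma>' t"
  shows "has_velocity A \<gamma>' t v"
proof -
  have "isCont \<gamma>' t"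
    using assms by (auto simp: has_velocity_def isCont_def tendsto_cong)
  moreover have "((\<lambda>s. snd (chart_at A (\<gamma>' t)) (\<gamma>' s)) has_vector_derivative v) (at t)"
    by (rule has_vector_derivative_eventually[where f="\<lambda>s. snd (chart_at A (\<gamma> t)) (\<gamma> s)"])
      (use assms in \<open>auto simp: has_velocity_def elim: eventually_mono\<close>)
  ultimately show ?thesis by (simp add: has_velocity_def)
qed

lemma chart_comp_linear:
  assumes M: "manifold A" and c: "compat_chart A U \<phi>" and p: "p \<in> U"
  obtains T where "linear T" "\<And>v. v \<in> model A \<Longrightarrow> chart_comp A \<phi> p v = T v"
proof -
  obtain V \<psi> where V: "chart_at A p = (V, \<psi>)" by fastforce
  show ?thesis
    by (rule chart_comp_frechet[OF M c p V]) (blast intro: that Cinf_on_linear_frechet)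
qed

lemma chart_comp_inj:
  assumes M: "manifold A" and c: "compat_chart A U \<phi>" and p: "p \<in> U"
  shows "inj_on (chart_comp A \<phi> p) (model A)"
proof -
  obtain V \<psi> where V: "chart_at A p = (V, \<psi>)" by fastforce
  obtain G where "\<And>v. v \<in> model A \<Longrightarrow> G (chart_comp A \<phi> p v) = v"
    using chart_comp_frechet[OF M c p V] by metis
  then show ?thesis by (rule inj_on_inverseI)
qed

lemma has_velocity_ex:
  assumes M: "manifold A" and c: "compat_chart A U \<phi>" and p: "\<gamma> t \<in> U" "isCont \<gamma> t"
    and d: "((\<lambda>s. \<phi> (\<gamma> s)) has_vector_derivative w) (at t)"
  obtains v where "v \<in> model A" "has_velocity A \<gamma> t v" "chart_comp A \<phi> (\<gamma> t) v = w"
proof -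
  obtain V \<psi> where V: "chart_at A (\<gamma> t) = (V, \<psi>)" by fastforce
  note cV = chart_at[OF M V]
  obtain N F where F: "open N" "\<phi> (\<gamma> t) \<in> N" "Cinf_on N F" "\<And>q. q \<in> U \<Longrightarrow> \<phi> q \<in> N \<Longrightarrow> q \<in> V \<and> F (\<phi> q) = \<psi> q"
    using trans_at_compat[OF M c cV(3) p(1) cV(2)] by (auto simp: trans_at_def)
  have "((\<lambda>s. \<psi> (\<gamma> s)) has_vector_derivative frechet_derivative F (at (\<phi> (\<gamma> t))) w) (at t)"
    by (rule has_vector_derivative_eventually[OF Cinf_on_vector_derivative[OF F(3) d F(2)]])
      (use F p in \<open>auto intro: eventually_mono[OF compat_chart_eventually[OF c p(2,1) F(1,2)]]\<close>)
  then have v: "has_velocity A \<gamma> t (frechet_derivative F (at (\<phi> (\<gamma> t))) w)"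
    using p(2) V by (simp add: has_velocity_def)
  show ?thesis
  proof (rule that[OF has_velocity_in_model[OF M v] v])
    show "chart_comp A \<phi> (\<gamma> t) (frechet_derivative F (at (\<phi> (\<gamma> t))) w) = w"
      using has_velocity_iff[OF M c, of \<gamma> t, OF p(1) has_velocity_in_model[OF M v]] v d vector_derivative_unique_at
      by blast
  qed
qed

lemma curve_in_chart:
  fixes A :: "('a::{t2_space, second_countable_topology}, 'e::euclidean_space) smooth_structure" and \<delta> :: real
  assumes M: "covered A" and c: "compat_chart A U \<phi>" and "0 < \<delta>"
    and x: "Cinf_on {-\<delta><..<\<delta>} x" "\<And>s. \<bar>s\<bar> < \<delta> \<Longrightarrow> x s \<in> \<phi> ` U"
  shows "smooth_map eucl A {-\<delta><..<\<delta>} (\<lambda>s. inv_into U \<phi> (x s))"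
    "\<And>t. \<bar>t\<bar> < \<delta> \<Longrightarrow> isCont (\<lambda>s. inv_into U \<phi> (x s)) t"
proof -
  let ?I = "{-\<delta><..<\<delta>}"
  have x': "x s \<in> \<phi> ` U" if "s \<in> ?I" for s using that by (intro x(2)) (auto simp: abs_if)
  show "smooth_map eucl A ?I (\<lambda>s. inv_into U \<phi> (x s))"
  proof (rule smooth_map_if_local_rep[OF covered_eucl M])
    fix t assume t: "t \<in> ?I"
    have "local_rep ?I (\<lambda>s. inv_into U \<phi> (x s)) UNIV id U \<phi> ?I x"
      using x x' compat_chart_inv(3,4)[OF c] by (auto simp: local_rep_def open_greaterThanLessThan)
    then show "\<exists>U' \<phi>' V \<psi> N F. smooth_chart eucl U' \<phi>' \<and> smooth_chart A V \<psi> \<and> t \<in> U' \<and>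
        inv_into U \<phi> (x t) \<in> V \<and> \<phi>' t \<in> N \<and> local_rep ?I (\<lambda>s. inv_into U \<phi> (x s)) U' \<phi>' V \<psi> N F"
      using smooth_chart_eucl compat_chartD(3)[OF c] compat_chart_inv(3)[OF c x'[OF t]] t
      by (intro exI[of _ "UNIV::real set"] exI[of _ "id::real \<Rightarrow> real"] exI[of _ U] exI[of _ \<phi>] exI[of _ ?I] exI[of _ x]) auto
  qed
  have "continuous_on ?I (\<lambda>s. inv_into U \<phi> (x s))"
    by (rule continuous_on_compose2[OF compat_chartD(6)[OF c] Cinf_on_continuous[OF x(1)]]) (use x' in auto)
  then show "isCont (\<lambda>s. inv_into U \<phi> (x s)) t" if "\<bar>t\<bar> < \<delta>" for t
    using that by (auto simp: continuous_on_eq_continuous_at abs_less_iff)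
qed

lemma curve_in_ex:
  assumes M: "manifold A" and c: "compat_chart A U \<phi>" and "0 < \<delta>" "p \<in> U" "x 0 = \<phi> p"
    and x: "Cinf_on {-\<delta><..<\<delta>} x" "\<And>s. \<bar>s\<bar> < \<delta> \<Longrightarrow> x s \<in> \<phi> ` U" "\<And>s. \<bar>s\<bar> < \<delta> \<Longrightarrow> inv_into U \<phi> (x s) \<in> S"
    and d: "(x has_vector_derivative chart_comp A \<phi> p v) (at 0)" and v: "v \<in> model A"
  shows "curve_in A S p v (\<lambda>s. inv_into U \<phi> (x s))"
proof -
  let ?\<gamma> = "\<lambda>s. inv_into U \<phi> (x s)"
  note cc = curve_in_chart[OF manifold_covered[OF M] c \<open>0 < \<delta>\<close> x(1,2)]
  have 0: "?\<gamma> 0 = p" using assms compat_chart_inv(2)[OF c] by simp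
  have "((\<lambda>s. \<phi> (?\<gamma> s)) has_vector_derivative chart_comp A \<phi> (?\<gamma> 0) v) (at 0)"
    unfolding 0
    by (rule has_vector_derivative_eventually[OF d])
      (use x(2) compat_chart_inv(4)[OF c] \<open>0 < \<delta>\<close> in \<open>auto intro: eventually_mono[OF eventually_at_0_less]\<close>)
  then have "has_velocity A ?\<gamma> 0 v"
    using has_velocity_iff[OF M c, of ?\<gamma> 0 v] 0 \<open>p \<in> U\<close> v cc(2)[of 0] \<open>0 < \<delta>\<close> by auto
  then show ?thesis
    unfolding curve_in_def using 0 cc(1) \<open>0 < \<delta>\<close> x(3) by (intro conjI exI[of _ \<delta>]) (auto simp: abs_less_iff)
qed

lemma Cinf_on_line: "Cinf_on U (\<lambda>s::real. x + s *\<^sub>R v)" for v :: "'a::euclidean_space"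
proof -
  have "Cinf_on UNIV (\<lambda>s::real. x + s *\<^sub>R v)"
    by (intro Cinf_on_add Cinf_on_scaleR Cinf_on_const Cinf_on_id) auto
  then show ?thesis by (rule Cinf_on_subset) auto
qed

lemma chart_comp_surj:
  assumes M: "manifold A" and c: "compat_chart A U \<phi>" and p: "p \<in> U" and w: "w \<in> model A"
  obtains v where "v \<in> model A" "chart_comp A \<phi> p v = w"
proof -
  obtain \<delta> where \<delta>: "0 < \<delta>" "\<And>s. \<bar>s\<bar> < \<delta> \<Longrightarrow> \<phi> p + s *\<^sub>R w \<in> UNIV \<and> \<phi> p + s *\<^sub>R w \<in> \<phi> ` (U \<inter> UNIV)"
    using line_in_chart[OF M c p open_UNIV UNIV_I w open_UNIV UNIV_I] by metis
  let ?\<gamma> = "\<lambda>s. inv_into U \<phi> (\<phi> p + s *\<^sub>R w)"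
  have "isCont ?\<gamma> 0"
    by (rule curve_in_chart(2)[OF manifold_covered[OF M] c \<delta>(1) Cinf_on_line]) (use \<delta> in auto)
  have 0: "?\<gamma> 0 = p" using compat_chart_inv(2)[OF c p] by simp
  have "((\<lambda>s. \<phi> (?\<gamma> s)) has_vector_derivative w) (at 0)"
    by (rule has_vector_derivative_eventually[OF has_vector_derivative_line[of "\<phi> p" w]])
      (use \<delta> compat_chart_inv(4)[OF c] compat_chart_inv(2)[OF c p] in
        \<open>auto intro: eventually_mono[OF eventually_at_0_less[OF \<delta>(1)]]\<close>)
  then show ?thesis
    using has_velocity_ex[OF M c, of ?\<gamma> 0 w] 0 p \<open>isCont ?\<gamma> 0\<close> that by auto
qed

text \<open>In the preferred chart the components of a vector are the vector itself, which is seen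
  from the velocity of a straight line; in any other chart they are the derivative of a curve in the
  model subspace.\<close>

lemma chart_comp_in_model:
  assumes M: "manifold A" and c: "compat_chart A U \<phi>" and p: "p \<in> U" and v: "v \<in> model A"
  shows "chart_comp A \<phi> p v \<in> model A"
proof -
  obtain V \<psi> where V: "chart_at A p = (V, \<psi>)" by fastforce
  note cV = chart_at[OF M V]
  obtain w where w: "w \<in> model A" "chart_comp A \<psi> p w = v"
    using chart_comp_surj[OF M cV(3,2) v] .
  obtain \<delta> where \<delta>: "0 < \<delta>" "\<And>s. \<bar>s\<bar> < \<delta> \<Longrightarrow> \<psi> p + s *\<^sub>R v \<in> UNIV \<and> \<psi> p + s *\<^sub>R v \<in> \<psi> ` (V \<inter> UNIV)"
    using line_in_chart[OF M cV(3,2) open_UNIV UNIV_I v open_UNIV UNIV_I] by metis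
  have "curve_in A UNIV p w (\<lambda>s. inv_into V \<psi> (\<psi> p + s *\<^sub>R v))"
    by (rule curve_in_ex[OF M cV(3) \<delta>(1) cV(2) _ Cinf_on_line])
      (use \<delta> w has_vector_derivative_line in auto)
  then have g: "has_velocity A (\<lambda>s. inv_into V \<psi> (\<psi> p + s *\<^sub>R v)) 0 w" "inv_into V \<psi> (\<psi> p + 0 *\<^sub>R v) = p"
    by (auto simp: curve_in_def)
  have "w = v"
  proof -
    have "((\<lambda>s. \<psi> (inv_into V \<psi> (\<psi> p + s *\<^sub>R v))) has_vector_derivative w) (at 0)"
      using g V by (simp add: has_velocity_def)
    moreover have "((\<lambda>s. \<psi> (inv_into V \<psi> (\<psi> p + s *\<^sub>R v))) has_vector_derivative chart_comp A \<psi> p w) (at 0)"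
      using has_velocity_iff[OF M cV(3), of "\<lambda>s. inv_into V \<psi> (\<psi> p + s *\<^sub>R v)" 0 w] g cV(2) w(1) by simp
    ultimately show ?thesis using w(2) vector_derivative_unique_at by blast
  qed
  then show ?thesis
    using has_velocity_iff[OF M c, of "\<lambda>s. inv_into V \<psi> (\<psi> p + s *\<^sub>R v)" 0 w] g p v
      compat_chart_derivative_in_model[OF M c, of "\<lambda>s. inv_into V \<psi> (\<psi> p + s *\<^sub>R v)" 0 "chart_comp A \<phi> p v"]
    by simp
qed

text \<open>Supplies the curve from which \<open>SOME\<close> in \<open>tangent_map\<close> chooses
  when the domain is open.\<close>

lemma curve_in_open:
  assumes M: "manifold A" and "open W" "p \<in> W" and v: "v \<in> model A"
  obtains \<gamma> where "curve_in A W p v \<gamma>"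
proof -
  obtain U \<phi> where c: "compat_chart A U \<phi>" "p \<in> U" using ex_compat_chart[OF M] by blast
  let ?w = "chart_comp A \<phi> p v"
  have w: "?w \<in> model A" by (rule chart_comp_in_model[OF M c v])
  obtain \<delta> where \<delta>: "0 < \<delta>" "\<And>s. \<bar>s\<bar> < \<delta> \<Longrightarrow> \<phi> p + s *\<^sub>R ?w \<in> UNIV \<and> \<phi> p + s *\<^sub>R ?w \<in> \<phi> ` (U \<inter> W)"
    using line_in_chart[OF M c \<open>open W\<close> \<open>p \<in> W\<close> w open_UNIV UNIV_I] by metis
  have "curve_in A W p v (\<lambda>s. inv_into U \<phi> (\<phi> p + s *\<^sub>R ?w))"
  proof (rule curve_in_ex[OF M c(1) \<delta>(1) c(2) _ Cinf_on_line _ _ has_vector_derivative_line v])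
    show "inv_into U \<phi> (\<phi> p + s *\<^sub>R ?w) \<in> W" if "\<bar>s\<bar> < \<delta>" for s
      using \<delta>(2)[OF that] compat_chart_inv(2)[OF c(1)] by auto
  qed (use \<delta> in auto)
  then show ?thesis by (rule that)
qed

lemma has_velocity_compose:
  assumes M: "manifold A" "manifold B" and c: "compat_chart A U \<phi>" "compat_chart B V \<psi>"
    and rep: "local_rep S f U \<phi> V \<psi> N F" "\<phi> p \<in> N" and p: "p \<in> S" "p \<in> U" "\<gamma> 0 = p"
    and \<gamma>: "has_velocity A \<gamma> 0 v" "\<forall>\<^sub>F s in at 0. \<gamma> s \<in> S"
  obtains w where "w \<in> model B" "has_velocity B (\<lambda>s. f (\<gamma> s)) 0 w"
    "chart_comp B \<psi> (f p) w = frechet_derivative F (at (\<phi> p)) (chart_comp A \<phi> p v)"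
proof -
  have F: "open N" "Cinf_on N F" "\<And>q. q \<in> S \<Longrightarrow> q \<in> U \<Longrightarrow> \<phi> q \<in> N \<Longrightarrow> f q \<in> V \<and> F (\<phi> q) = \<psi> (f q)"
    using rep by (auto simp: local_rep_def)
  have v: "v \<in> model A" by (rule has_velocity_in_model[OF M(1) \<gamma>(1)])
  have i: "isCont \<gamma> 0" and d: "((\<lambda>s. \<phi> (\<gamma> s)) has_vector_derivative chart_comp A \<phi> p v) (at 0)"
    using has_velocity_iff[OF M(1) c(1), of \<gamma> 0 v] \<gamma>(1) p v by auto
  have d2: "((\<lambda>s. F (\<phi> (\<gamma> s))) has_vector_derivative frechet_derivative F (at (\<phi> p)) (chart_comp A \<phi> p v)) (at 0)"
    using Cinf_on_vector_derivative[OF F(2) d] rep(2) p by simp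
  have ev: "\<forall>\<^sub>F s in at 0. f (\<gamma> s) \<in> V \<and> F (\<phi> (\<gamma> s)) = \<psi> (f (\<gamma> s))"
  proof -
    have "\<forall>\<^sub>F s in at 0. \<gamma> s \<in> U \<and> \<phi> (\<gamma> s) \<in> N"
      using compat_chart_eventually[OF c(1) i, of N] p F(1) rep(2) by auto
    then show ?thesis using \<gamma>(2) by eventually_elim (use F(3) in auto)
  qed
  have fp: "f p \<in> V" "F (\<phi> p) = \<psi> (f p)" using F(3)[OF p(1,2) rep(2)] by auto
  have d3: "((\<lambda>s. \<psi> (f (\<gamma> s))) has_vector_derivative frechet_derivative F (at (\<phi> p)) (chart_comp A \<phi> p v)) (at 0)"
    by (rule has_vector_derivative_eventually[OF d2]) (use ev fp p in \<open>auto elim: eventually_mono\<close>)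
  \<comment> \<open>\<open>f\<close> is not given as a continuous map. Continuity along the curve is
    recovered from the coordinate expression, since a chart is a homeomorphism onto a relatively
    open set.\<close>
  have "isCont (\<lambda>s. f (\<gamma> s)) 0"
    unfolding isCont_def
  proof (rule topological_tendstoI)
    fix Q assume Q: "open Q" "f (\<gamma> 0) \<in> Q"
    obtain N' where N': "open N'" "\<psi> (f p) \<in> N'" "\<forall>x\<in>model B \<inter> N'. x \<in> \<psi> ` (V \<inter> Q)"
      using compat_chart_nbhd[OF c(2) Q(1), of "f p"] Q(2) fp p by auto
    have "\<forall>\<^sub>F s in at 0. \<psi> (f (\<gamma> s)) \<in> N'"
      by (rule isCont_eventually[OF has_vector_derivative_continuous[OF d3]]) (use N' p in auto)
    then show "\<forall>\<^sub>F s in at 0. f (\<gamma> s) \<in> Q"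
      using ev
    proof eventually_elim
      case (elim s)
      then have "\<psi> (f (\<gamma> s)) \<in> \<psi> ` (V \<inter> Q)" using N'(3) compat_chart_inv(1)[OF c(2)] by blast
      then show ?case using compat_chartD(4)[OF c(2)] elim by (auto simp: inj_on_def)
    qed
  qed
  then show ?thesis
    using has_velocity_ex[OF M(2) c(2), of "\<lambda>s. f (\<gamma> s)" 0, OF _ _ d3] fp p that by auto
qed

text \<open>As soon as one admissible curve exists, the choice in \<open>tangent_map\<close> does
  not matter: every image curve has the components given by the derivative of \<open>F\<close>, and
  \<open>chart_comp\<close> is injective on the model.\<close>

lemma tangent_map_local_rep:
  assumes M: "manifold A" "manifold B" and c: "compat_chart A U \<phi>" "compat_chart B V \<psi>"
    and rep: "local_rep S f U \<phi> V \<psi> N F" "\<phi> p \<in> N" and p: "p \<in> S" "p \<in> U"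
    and ex: "curve_in A S p v \<gamma>0"
  shows "tangent_map A B S f p v \<in> model B"
    "chart_comp B \<psi> (f p) (tangent_map A B S f p v) = frechet_derivative F (at (\<phi> p)) (chart_comp A \<phi> p v)"
    "\<And>\<gamma>. \<gamma> 0 = p \<Longrightarrow> has_velocity A \<gamma> 0 v \<Longrightarrow> \<forall>\<^sub>F s in at 0. \<gamma> s \<in> S \<Longrightarrow>
      has_velocity B (\<lambda>s. f (\<gamma> s)) 0 (tangent_map A B S f p v)"
proof -
  have curve: "\<gamma> 0 = p" "has_velocity A \<gamma> 0 v" "\<forall>\<^sub>F s in at 0. \<gamma> s \<in> S" if crv: "curve_in A S p v \<gamma>" for \<gamma>
  proof -
    obtain \<delta> where d: "\<delta> > 0" "\<gamma> ` {-\<delta><..<\<delta>} \<subseteq> S" using crv unfolding curve_in_def by blast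
    have "\<gamma> s \<in> S" if "\<bar>s\<bar> < \<delta>" for s
    proof -
      have "s \<in> {-\<delta><..<\<delta>}" using that by auto
      then show ?thesis using d(2) by blast
    qed
    then show "\<forall>\<^sub>F s in at 0. \<gamma> s \<in> S"
      by (rule eventually_mono[OF eventually_at_0_less[OF d(1)]])
    show "\<gamma> 0 = p" "has_velocity A \<gamma> 0 v" using crv by (auto simp only: curve_in_def)
  qed
  let ?\<gamma> = "SOME \<gamma>. curve_in A S p v \<gamma>"
  have S: "curve_in A S p v ?\<gamma>" by (rule someI[of "\<lambda>\<gamma>. curve_in A S p v \<gamma>", OF ex])
  have fp: "f p \<in> V" using rep p by (auto simp: local_rep_def)
  obtain w where w: "w \<in> model B" "has_velocity B (\<lambda>s. f (?\<gamma> s)) 0 w"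
    "chart_comp B \<psi> (f p) w = frechet_derivative F (at (\<phi> p)) (chart_comp A \<phi> p v)"
    by (rule has_velocity_compose[OF M c rep p curve[OF S]])
  then have tw: "tangent_map A B S f p v = w"
    unfolding tangent_map_def by (auto intro!: velocity_eqI simp: o_def)
  show "tangent_map A B S f p v \<in> model B"
    "chart_comp B \<psi> (f p) (tangent_map A B S f p v) = frechet_derivative F (at (\<phi> p)) (chart_comp A \<phi> p v)"
    using w tw by auto
  show "has_velocity B (\<lambda>s. f (\<gamma> s)) 0 (tangent_map A B S f p v)"
    if \<gamma>: "\<gamma> 0 = p" "has_velocity A \<gamma> 0 v" "\<forall>\<^sub>F s in at 0. \<gamma> s \<in> S" for \<gamma>
  proof -
    obtain w' where w': "w' \<in> model B" "has_velocity B (\<lambda>s. f (\<gamma> s)) 0 w'"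
      "chart_comp B \<psi> (f p) w' = frechet_derivative F (at (\<phi> p)) (chart_comp A \<phi> p v)"
      by (rule has_velocity_compose[OF M c rep p \<gamma>])
    then have "w' = w" using w chart_comp_inj[OF M(2) c(2) fp] by (auto simp: inj_on_def)
    then show ?thesis using w' tw by simp
  qed
qed

section \<open>Submersions and densities\<close>

lemma homeomorphism_inv_into:
  assumes "homeomorphism U (\<phi> ` U) \<phi> \<theta>" shows "homeomorphism U (\<phi> ` U) \<phi> (inv_into U \<phi>)"
proof -
  have "\<theta> x = inv_into U \<phi> x" if "x \<in> \<phi> ` U" for x
    using assms that unfolding homeomorphism_def by (metis imageE inv_into_f_f inj_onI)
  then show ?thesis using assms by (auto simp: homeomorphism_def cong: continuous_on_cong)
qed

lemma trans_at_comp: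
  assumes "trans_at U \<phi> V \<psi> p" "trans_at V \<psi> W \<theta> p" "p \<in> U"
  shows "trans_at U \<phi> W \<theta> p"
proof -
  have i: "local_rep UNIV id V \<psi> V \<psi> UNIV id"
    unfolding local_rep_def using Cinf_on_id[of UNIV] by (simp add: id_def)
  show ?thesis
    using local_rep_change[OF i, of p U \<phi> W \<theta>] assms by (auto simp: local_rep_def trans_at_def)
qed

lemma chart_comp_change:
  assumes M: "manifold A" and c: "compat_chart A U \<xi>" "compat_chart A V \<phi>" and p: "p \<in> U"
    and F: "open N" "\<xi> p \<in> N" "Cinf_on N F" "\<And>q. q \<in> U \<Longrightarrow> \<xi> q \<in> N \<Longrightarrow> q \<in> V \<and> F (\<xi> q) = \<phi> q"
    and v: "v \<in> model A"
  shows "chart_comp A \<phi> p v = frechet_derivative F (at (\<xi> p)) (chart_comp A \<xi> p v)"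
proof -
  obtain \<gamma> where "curve_in A UNIV p v \<gamma>" using curve_in_open[OF M open_UNIV UNIV_I v] .
  then have \<gamma>: "\<gamma> 0 = p" "has_velocity A \<gamma> 0 v" by (simp_all add: curve_in_def)
  have rep: "local_rep UNIV (\<lambda>q. q) U \<xi> V \<phi> N F" using F by (simp add: local_rep_def)
  obtain w where "w \<in> model A" "has_velocity A (\<lambda>s. \<gamma> s) 0 w"
    "chart_comp A \<phi> p w = frechet_derivative F (at (\<xi> p)) (chart_comp A \<xi> p v)"
    by (rule has_velocity_compose[OF M M c rep F(2) UNIV_I p \<gamma>]) auto
  then show ?thesis using has_velocity_unique[OF \<gamma>(2)] by auto
qed

text \<open>The value at \<open>p\<close> of the coordinate vector field with constant components
  \<open>w\<close>.\<close>

definition chart_vec :: "('a, 'e::euclidean_space) smooth_structure \<Rightarrow> ('a \<Rightarrow> 'e) \<Rightarrow> 'a \<Rightarrow> 'e \<Rightarrow> 'e" where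
  "chart_vec A \<phi> p = inv_into (model A) (chart_comp A \<phi> p)"

lemma chart_vec:
  assumes M: "manifold A" and c: "compat_chart A U \<phi>" and p: "p \<in> U"
  shows "w \<in> model A \<Longrightarrow> chart_vec A \<phi> p w \<in> model A"
    "w \<in> model A \<Longrightarrow> chart_comp A \<phi> p (chart_vec A \<phi> p w) = w"
    "v \<in> model A \<Longrightarrow> chart_vec A \<phi> p (chart_comp A \<phi> p v) = v"
proof -
  have "w \<in> chart_comp A \<phi> p ` model A" if "w \<in> model A"
    using chart_comp_surj[OF M c p that] by blast
  then show "w \<in> model A \<Longrightarrow> chart_vec A \<phi> p w \<in> model A"
    "w \<in> model A \<Longrightarrow> chart_comp A \<phi> p (chart_vec A \<phi> p w) = w"
    unfolding chart_vec_def by (auto simp: inv_into_into f_inv_into_f)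
  show "v \<in> model A \<Longrightarrow> chart_vec A \<phi> p (chart_comp A \<phi> p v) = v"
    unfolding chart_vec_def by (rule inv_into_f_f[OF chart_comp_inj[OF M c p]])
qed

text \<open>Produces the coordinate frames of \<open>ker ds\<close> and the projectable extensions.
  In another chart the components are the derivative of the coordinate change applied to
  \<open>W\<close>, hence smooth.\<close>

lemma vector_field_in_chart:
  fixes A :: "('a::{t2_space, second_countable_topology}, 'e::euclidean_space) smooth_structure"
  assumes M: "manifold A" and c: "compat_chart A U \<xi>" and Q: "Q \<subseteq> U"
    and W: "open N" "Cinf_on N W" "\<And>q. q \<in> Q \<Longrightarrow> \<xi> q \<in> N" "\<And>q. q \<in> Q \<Longrightarrow> W (\<xi> q) \<in> model A"
  shows "vector_field A Q (\<lambda>q. chart_vec A \<xi> q (W (\<xi> q)))"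
  unfolding vector_field_def smooth_along_def
proof (intro conjI)
  let ?X = "\<lambda>q. chart_vec A \<xi> q (W (\<xi> q))"
  note sc = compat_chartD(3)[OF c]
  have "local_rep Q id U \<xi> U \<xi> UNIV (\<lambda>x. x)"
    by (auto simp: local_rep_def Cinf_on_id)
  then show "smooth_map A A Q id"
    using Q by (intro smooth_map_in_charts[OF manifold_covered[OF M] manifold_covered[OF M] sc sc]) auto
  show "?X ` Q \<subseteq> model A" using chart_vec(1)[OF M c] W(4) Q by blast
  show "\<forall>(V, \<phi>)\<in>charts A. smooth_map A eucl {x \<in> Q. id x \<in> V} (\<lambda>x. chart_comp A \<phi> (id x) (?X x))"
  proof clarify
    fix V \<phi> assume V: "(V, \<phi>) \<in> charts A"
    note cV = manifold_compat_chart[OF M V]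
    show "smooth_map A eucl {x \<in> Q. id x \<in> V} (\<lambda>x. chart_comp A \<phi> (id x) (?X x))"
    proof (rule smooth_map_in_charts[OF manifold_covered[OF M] covered_eucl sc smooth_chart_eucl])
      fix p assume "p \<in> {x \<in> Q. id x \<in> V}"
      then have p: "p \<in> Q" "p \<in> U" "p \<in> V" using Q by auto
      obtain N' F where F: "open N'" "\<xi> p \<in> N'" "Cinf_on N' F" "\<And>q. q \<in> U \<Longrightarrow> \<xi> q \<in> N' \<Longrightarrow> q \<in> V \<and> F (\<xi> q) = \<phi> q"
        using trans_at_compat[OF M c cV p(2,3)] by (auto simp: trans_at_def)
      let ?N = "N \<inter> N'"
      have "open ?N" using W F by auto
      have "Cinf_on ?N (\<lambda>x. frechet_derivative F (at x) (W x))"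
        by (rule Cinf_on_frechet_at[OF \<open>open ?N\<close> F(1) _ Cinf_on_id[OF \<open>open ?N\<close>] _ F(3)])
          (auto intro: Cinf_on_subset[OF W(2)])
      moreover have "frechet_derivative F (at (\<xi> q)) (W (\<xi> q)) = chart_comp A \<phi> q (?X q)"
        if "q \<in> Q" "\<xi> q \<in> ?N" for q
        using chart_comp_change[OF M c cV _ F(1) _ F(3,4), of q "?X q"] chart_vec(1,2)[OF M c, of q "W (\<xi> q)"]
          that Q W(4)[OF that(1)] by auto
      ultimately have "local_rep {x \<in> Q. id x \<in> V} (\<lambda>x. chart_comp A \<phi> (id x) (?X x)) U \<xi> UNIV id
          ?N (\<lambda>x. frechet_derivative F (at x) (W x))"
        using \<open>open ?N\<close> by (auto simp: local_rep_def)
      moreover have "\<xi> p \<in> ?N" using W(3) p F by auto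
      ultimately show "\<exists>N F. \<xi> p \<in> N \<and>
          local_rep {x \<in> Q. id x \<in> V} (\<lambda>x. chart_comp A \<phi> (id x) (?X x)) U \<xi> UNIV id N F"
        by blast
    qed (use Q in auto)
  qed
qed

text \<open>The local normal form of a submersion: in these coordinates \<open>f\<close> is a linear
  map \<open>D\<close>, split by \<open>J\<close>. A linear map takes the place of a coordinate
  projection because both models are arbitrary subspaces, possibly 0.\<close>

definition adapted_chart ::
  "('a::topological_space, 'e::euclidean_space) smooth_structure \<Rightarrow>
   ('b::topological_space, 'f::euclidean_space) smooth_structure \<Rightarrow> ('a \<Rightarrow> 'b) \<Rightarrow>
   'a set \<Rightarrow> ('a \<Rightarrow> 'e) \<Rightarrow> 'b set \<Rightarrow> ('b \<Rightarrow> 'f) \<Rightarrow> ('e \<Rightarrow> 'f) \<Rightarrow> ('f \<Rightarrow> 'e) \<Rightarrow> bool" where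
  "adapted_chart A B f U \<xi> V \<eta> D J \<longleftrightarrow> compat_chart A U \<xi> \<and> compat_chart B V \<eta> \<and>
     linear D \<and> linear J \<and> D ` model A \<subseteq> model B \<and> range J \<subseteq> model A \<and>
     (\<forall>b\<in>model B. D (J b) = b) \<and> (\<forall>q\<in>U. f q \<in> V \<and> \<eta> (f q) = D (\<xi> q))"

text \<open>With \<open>\<sigma>\<close> a submersion in coordinates, \<open>D\<close> its derivative at the point and \<open>J\<close> a right inverse of \<open>D\<close>,
  the map \<open>x + J (\<sigma> x - D x)\<close> is a local diffeomorphism that turns \<open>\<sigma>\<close> into \<open>D\<close>.\<close>

lemma submersion_adapted_chart:
  fixes A :: "('a::{t2_space, second_countable_topology}, 'e::euclidean_space) smooth_structure"
    and B :: "('b::{t2_space, second_countable_topology}, 'f::euclidean_space) smooth_structure"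
  assumes M: "manifold A" "manifold B" and f: "submersion A B f"
  obtains U \<xi> V \<eta> D J where "adapted_chart A B f U \<xi> V \<eta> D J" "p \<in> U"
proof -
  obtain U0 \<phi> where c: "compat_chart A U0 \<phi>" and p: "p \<in> U0" using ex_compat_chart[OF M(1)] by blast
  obtain V \<eta> where cV: "compat_chart B V \<eta>" and fp: "f p \<in> V" using ex_compat_chart[OF M(2)] by blast
  obtain N \<sigma> where N: "\<phi> p \<in> N" and rep: "local_rep UNIV f U0 \<phi> V \<eta> N \<sigma>"
    using smooth_map_local_rep[of A B UNIV f, OF _ compat_chartD(3)[OF c] compat_chartD(3)[OF cV] UNIV_I p fp] f
    by (auto simp: submersion_def)
  have \<sigma>: "open N" "Cinf_on N \<sigma>" "\<And>q. q \<in> U0 \<Longrightarrow> \<phi> q \<in> N \<Longrightarrow> f q \<in> V \<and> \<sigma> (\<phi> q) = \<eta> (f q)"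
    using rep by (auto simp: local_rep_def)
  define D where "D = frechet_derivative \<sigma> (at (\<phi> p))"
  have linD: "linear D" unfolding D_def by (rule Cinf_on_linear_frechet[OF \<sigma>(2) N])
  have tm: "tangent_map A B UNIV f p v \<in> model B"
    "chart_comp B \<eta> (f p) (tangent_map A B UNIV f p v) = D (chart_comp A \<phi> p v)" if v: "v \<in> model A" for v
  proof -
    obtain \<gamma> where "curve_in A UNIV p v \<gamma>" using curve_in_open[OF M(1) open_UNIV UNIV_I v] .
    from tangent_map_local_rep(1,2)[OF M c cV rep N UNIV_I p this]
    show "tangent_map A B UNIV f p v \<in> model B"
      "chart_comp B \<eta> (f p) (tangent_map A B UNIV f p v) = D (chart_comp A \<phi> p v)" by (auto simp: D_def)
  qed
  have DA: "D w \<in> model B" if w: "w \<in> model A" for w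
    using chart_comp_surj[OF M(1) c p w] tm chart_comp_in_model[OF M(2) cV fp] by metis
  have DB: "b \<in> D ` model A" if b: "b \<in> model B" for b
  proof -
    obtain v' where v': "v' \<in> model B" "chart_comp B \<eta> (f p) v' = b"
      using chart_comp_surj[OF M(2) cV fp b] .
    then obtain v where "v \<in> model A" "v' = tangent_map A B UNIV f p v"
      using f unfolding submersion_def by blast
    then show ?thesis using tm(2)[of v] v'(2) chart_comp_in_model[OF M(1) c p] by (metis image_eqI)
  qed
  obtain J where J: "J ` UNIV \<subseteq> model A" "linear J" "\<And>b. b \<in> D ` model A \<Longrightarrow> D (J b) = b"
    using linear_exists_right_inverse_on[OF linD manifold_subspace[OF M(1)]] by blast
  have blJ: "bounded_linear J" and blD: "bounded_linear D"
    using J(2) linD by (auto simp: linear_conv_bounded_linear)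
  define \<theta> where "\<theta> x = x + J (\<sigma> x - D x)" for x
  have \<theta>: "Cinf_on N \<theta>" unfolding \<theta>_def
    by (intro Cinf_on_add \<sigma> Cinf_on_id Cinf_on_bounded_linear[OF \<sigma>(1) blJ] Cinf_on_diff
        Cinf_on_linear[OF \<sigma>(1) linD])
  have "(\<theta> has_derivative (\<lambda>v. v + J (D v - D v))) (at (\<phi> p))"
    unfolding \<theta>_def
    using Cinf_on_has_derivative[OF \<sigma>(2) N]
    by (intro has_derivative_add has_derivative_ident bounded_linear.has_derivative[OF blJ] has_derivative_diff
        bounded_linear_imp_has_derivative[OF blD]) (simp add: D_def)
  then have "(\<theta> has_derivative (\<lambda>v. v)) (at (\<phi> p))" by (simp add: linear_0[OF J(2)])
  then have "frechet_derivative \<theta> (at (\<phi> p)) v = v" for v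
    using frechet_derivative_at by metis
  then obtain U1 V1 \<kappa> where U1: "open U1" "U1 \<subseteq> N" "\<phi> p \<in> U1" and V1: "open V1"
    and hom: "homeomorphism U1 V1 \<theta> \<kappa>" and \<kappa>: "Cinf_on V1 \<kappa>"
    using smooth_inverse_function[OF \<sigma>(1) \<theta> N] by metis
  have hom': "\<And>x. x \<in> U1 \<Longrightarrow> \<theta> x \<in> V1 \<and> \<kappa> (\<theta> x) = x" "\<And>y. y \<in> V1 \<Longrightarrow> \<kappa> y \<in> U1 \<and> \<theta> (\<kappa> y) = y"
    using hom by (auto simp: homeomorphism_def)
  define U where "U = U0 \<inter> \<phi> -` U1"
  define \<xi> where "\<xi> q = \<theta> (\<phi> q)" for q
  have opU: "open U"
    using continuous_on_open_vimage[OF compat_chartD(1)[OF c], of \<phi>] compat_chartD(5)[OF c] U1(1)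
    unfolding U_def by (simp add: Int_commute)
  have U: "q \<in> U0" "\<phi> q \<in> U1" "\<phi> q \<in> model A" "\<phi> q \<in> N" if "q \<in> U" for q
    using that compat_chart_inv(1)[OF c] U1(2) by (auto simp: U_def)
  \<comment> \<open>\<open>\<theta>\<close> moves points by elements of \<open>range J\<close>,
    which lie in the model; hence the new chart again has values in the model and a relatively open
    image.\<close>
  have M_iff: "\<theta> x \<in> model A \<longleftrightarrow> x \<in> model A" for x
  proof
    note sA = manifold_subspace[OF M(1)]
    have J': "J z \<in> model A" for z using J(1) by auto
    show "x \<in> model A \<Longrightarrow> \<theta> x \<in> model A" unfolding \<theta>_def using J' sA by (simp add: subspace_add)
    assume "\<theta> x \<in> model A"
    then have "\<theta> x - J (\<sigma> x - D x) \<in> model A" using J' sA by (simp add: subspace_diff)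
    then show "x \<in> model A" by (simp add: \<theta>_def)
  qed
  have "\<exists>O3. open O3 \<and> \<phi> ` U = model A \<inter> O3"
  proof -
    have "openin (top_of_set (\<phi> ` U0)) (\<phi> ` U0 \<inter> U1)" using U1(1) by auto
    then have "openin (top_of_set (model A)) (\<phi> ` U0 \<inter> U1)" using compat_chartD(2)[OF c] openin_trans by blast
    moreover have "\<phi> ` U0 \<inter> U1 = \<phi> ` U" by (auto simp: U_def)
    ultimately show ?thesis by (auto simp: openin_open)
  qed
  then obtain O3 where O3: "open O3" "\<phi> ` U = model A \<inter> O3" by blast
  have opim: "open (V1 \<inter> \<kappa> -` O3)"
    using continuous_on_open_vimage[OF V1] Cinf_on_continuous[OF \<kappa>] O3(1) by (metis inf_commute)
  have im: "\<xi> ` U = model A \<inter> (V1 \<inter> \<kappa> -` O3)"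
  proof (intro equalityI subsetI)
    fix y assume "y \<in> \<xi> ` U"
    then obtain q where q: "q \<in> U" "y = \<theta> (\<phi> q)" by (auto simp: \<xi>_def)
    then show "y \<in> model A \<inter> (V1 \<inter> \<kappa> -` O3)"
      using hom'(1)[OF U(2)[OF q(1)]] M_iff U(3)[OF q(1)] O3(2) by auto
  next
    fix y assume y: "y \<in> model A \<inter> (V1 \<inter> \<kappa> -` O3)"
    then have "\<kappa> y \<in> model A" using hom'(2)[of y] M_iff[of "\<kappa> y"] by auto
    then obtain q where "q \<in> U" "\<kappa> y = \<phi> q" using y O3(2) by blast
    then show "y \<in> \<xi> ` U" using hom'(2)[of y] y by (auto simp: \<xi>_def)
  qed
  have c\<xi>: "compat_chart A U \<xi>"
    unfolding compat_chart_def
  proof (intro conjI opU)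
    show "openin (top_of_set (model A)) (\<xi> ` U)" using opim im by (auto simp: openin_open)
    have "homeomorphism U (\<xi> ` U) \<xi> (\<lambda>y. inv_into U0 \<phi> (\<kappa> y))"
      unfolding homeomorphism_def
    proof (intro conjI)
      show inv: "\<forall>q\<in>U. inv_into U0 \<phi> (\<kappa> (\<xi> q)) = q"
        using hom'(1) U(1,2) compat_chart_inv(2)[OF c] by (simp add: \<xi>_def)
      then show "\<forall>y\<in>\<xi> ` U. \<xi> (inv_into U0 \<phi> (\<kappa> y)) = y" "(\<lambda>y. inv_into U0 \<phi> (\<kappa> y)) ` \<xi> ` U = U"
        by force+
      show "continuous_on U \<xi>" unfolding \<xi>_def
        by (rule continuous_on_compose2[OF Cinf_on_continuous[OF \<theta>] continuous_on_subset[OF compat_chartD(5)[OF c]]])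
          (use U in auto)
      have "continuous_on (\<xi> ` U) \<kappa>"
        by (rule continuous_on_subset[OF Cinf_on_continuous[OF \<kappa>]]) (use im in auto)
      then show "continuous_on (\<xi> ` U) (\<lambda>y. inv_into U0 \<phi> (\<kappa> y))"
        by (rule continuous_on_compose2[OF compat_chartD(6)[OF c]]) (use hom'(1) U(1,2) in \<open>auto simp: \<xi>_def\<close>)
    qed auto
    then show "homeomorphism U (\<xi> ` U) \<xi> (inv_into U \<xi>)" by (rule homeomorphism_inv_into)
    have t1: "trans_at U \<xi> U0 \<phi> q" if "q \<in> U" for q
      unfolding trans_at_def
      by (rule exI[of _ V1], rule exI[of _ \<kappa>]) (use that V1 \<kappa> hom'(1) U(1,2) in \<open>auto simp: \<xi>_def\<close>)
    have t2: "trans_at U0 \<phi> U \<xi> q" if "q \<in> U" for q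
      unfolding trans_at_def
      by (rule exI[of _ U1], rule exI[of _ \<theta>])
        (use that U1 \<theta> U(2) Cinf_on_subset in \<open>auto simp: \<xi>_def U_def\<close>)
    show "smooth_chart A U \<xi>"
      unfolding smooth_chart_def
    proof clarify
      fix W \<omega> q assume W: "(W, \<omega>) \<in> charts A" "q \<in> U" "q \<in> W"
      then show "trans_at U \<xi> W \<omega> q \<and> trans_at W \<omega> U \<xi> q"
        using smooth_chartD[OF compat_chartD(3)[OF c] W(1) U(1)[OF W(2)] W(3)] t1 t2
        by (auto intro: trans_at_comp)
    qed
  qed
  have "adapted_chart A B f U \<xi> V \<eta> D J"
    unfolding adapted_chart_def
  proof (intro conjI ballI c\<xi> cV linD J(2))
    show "D ` model A \<subseteq> model B" using DA by auto
    show "range J \<subseteq> model A" using J(1) .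
    show "D (J b) = b" if "b \<in> model B" for b using DB[OF that] J(3) by blast
    fix q assume q: "q \<in> U"
    show fq: "f q \<in> V" using \<sigma>(3) U[OF q] by blast
    have s: "\<sigma> (\<phi> q) = \<eta> (f q)" using \<sigma>(3) U[OF q] by blast
    \<comment> \<open>Since \<open>D (J b) = b\<close> on the model of \<open>B\<close>, applying
      \<open>D\<close> to \<open>\<theta> x = x + J (\<sigma> x - D x)\<close> leaves
      \<open>\<sigma> x\<close>, provided that the correction lies in that model.\<close>
    have "\<sigma> (\<phi> q) - D (\<phi> q) \<in> model B"
      using s compat_chart_inv(1)[OF cV fq] DA[OF U(3)[OF q]] manifold_subspace[OF M(2)] by (simp add: subspace_diff)
    then show "\<eta> (f q) = D (\<xi> q)"
      unfolding \<xi>_def \<theta>_def using DB J(3) s by (simp add: linear_add[OF linD])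
  qed
  then show ?thesis using that p U1(3) by (auto simp: U_def)
qed

lemma adapted_chartD:
  assumes "adapted_chart A B f U \<xi> V \<eta> D J"
  shows "compat_chart A U \<xi>" "compat_chart B V \<eta>" "linear D" "linear J"
    "\<And>x. x \<in> model A \<Longrightarrow> D x \<in> model B" "\<And>b. J b \<in> model A" "\<And>b. b \<in> model B \<Longrightarrow> D (J b) = b"
    "\<And>q. q \<in> U \<Longrightarrow> f q \<in> V" "\<And>q. q \<in> U \<Longrightarrow> \<eta> (f q) = D (\<xi> q)"
  using assms by (auto simp: adapted_chart_def)

lemma frechet_derivative_linear:
  "linear D \<Longrightarrow> frechet_derivative D (at (x::'a::euclidean_space)) = (D :: 'a \<Rightarrow> 'b::euclidean_space)"
  by (metis bounded_linear_imp_has_derivative frechet_derivative_at linear_conv_bounded_linear)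

lemma adapted_chart_tangent_map:
  fixes A :: "('a::{t2_space, second_countable_topology}, 'e::euclidean_space) smooth_structure"
    and B :: "('b::{t2_space, second_countable_topology}, 'f::euclidean_space) smooth_structure"
  assumes M: "manifold A" "manifold B" and ad: "adapted_chart A B f U \<xi> V \<eta> D J" and q: "q \<in> U"
    and v: "v \<in> model A"
  shows "tangent_map A B UNIV f q v \<in> model B"
    "chart_comp B \<eta> (f q) (tangent_map A B UNIV f q v) = D (chart_comp A \<xi> q v)"
    "\<And>\<gamma>. \<gamma> 0 = q \<Longrightarrow> has_velocity A \<gamma> 0 v \<Longrightarrow> has_velocity B (\<lambda>s. f (\<gamma> s)) 0 (tangent_map A B UNIV f q v)"
    "tangent_map A B UNIV f q v = 0 \<longleftrightarrow> D (chart_comp A \<xi> q v) = 0"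
proof -
  note aD = adapted_chartD[OF ad]
  have rep: "local_rep UNIV f U \<xi> V \<eta> UNIV D"
    using aD by (auto simp: local_rep_def intro: Cinf_on_linear)
  obtain \<gamma> where "curve_in A UNIV q v \<gamma>" using curve_in_open[OF M(1) open_UNIV UNIV_I v] .
  note t = tangent_map_local_rep[OF M aD(1,2) rep UNIV_I UNIV_I q this]
  show 1: "tangent_map A B UNIV f q v \<in> model B"
    and 2: "chart_comp B \<eta> (f q) (tangent_map A B UNIV f q v) = D (chart_comp A \<xi> q v)"
    using t(1,2) frechet_derivative_linear[OF aD(3)] by auto
  show "has_velocity B (\<lambda>s. f (\<gamma> s)) 0 (tangent_map A B UNIV f q v)" if "\<gamma> 0 = q" "has_velocity A \<gamma> 0 v" for \<gamma>
    using t(3)[OF that] by simp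
  obtain T where T: "linear T" "\<And>v. v \<in> model B \<Longrightarrow> chart_comp B \<eta> (f q) v = T v"
    using chart_comp_linear[OF M(2) aD(2) aD(8)[OF q]] by metis
  have "0 \<in> model B" using manifold_subspace[OF M(2)] by (rule subspace_0)
  then have "chart_comp B \<eta> (f q) 0 = 0" using T by (simp add: linear_0)
  then show "tangent_map A B UNIV f q v = 0 \<longleftrightarrow> D (chart_comp A \<xi> q v) = 0"
    using 1 2 chart_comp_inj[OF M(2) aD(2) aD(8)[OF q]] \<open>0 \<in> model B\<close> by (metis inj_onD)
qed

section \<open>The kernel of \<open>ds\<close> in adapted charts, frames and densities\<close>

lemma ker_ds_adapted:
  fixes A :: "('a::{t2_space, second_countable_topology}, 'e::euclidean_space) smooth_structure"
    and B :: "('b::{t2_space, second_countable_topology}, 'f::euclidean_space) smooth_structure"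
  assumes M: "manifold A" "manifold B" and ad: "adapted_chart A B (src G) U \<xi> V \<eta> D J" and q: "q \<in> U"
  shows "v \<in> ker_ds A B G q \<longleftrightarrow> v \<in> model A \<and> D (chart_comp A \<xi> q v) = 0"
  using adapted_chart_tangent_map(4)[OF M ad q] by (auto simp: ker_ds_def)

lemma subspace_kernel_adapted:
  assumes M: "manifold A" and ad: "adapted_chart A B f U \<xi> V \<eta> D J"
  shows "subspace {x \<in> model A. D x = 0}"
  using manifold_subspace[OF M] adapted_chartD(3)[OF ad]
  by (auto simp: subspace_def linear_0 linear_add linear_cmul)

lemma dim_kernel_adapted:
  assumes M: "manifold A" "manifold B" and ad: "adapted_chart A B f U \<xi> V \<eta> D J"
  shows "dim {x \<in> model A. D x = 0} = dim (model A) - dim (model B)"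
proof -
  note aD = adapted_chartD[OF ad]
  note sA = manifold_subspace[OF M(1)] and sB = manifold_subspace[OF M(2)]
  let ?C = "{x \<in> model A. D x = 0}"
  have sJ: "subspace (J ` model B)" by (rule linear_subspace_image[OF aD(4) sB])
  \<comment> \<open>The model of \<open>A\<close> is the direct sum of the kernel of
    \<open>D\<close> and the image under \<open>J\<close> of the model of \<open>B\<close>.\<close>
  have "{x + y |x y. x \<in> ?C \<and> y \<in> J ` model B} = model A"
  proof (intro equalityI subsetI)
    fix x assume "x \<in> {x + y |x y. x \<in> ?C \<and> y \<in> J ` model B}"
    then show "x \<in> model A" using aD(6) sA by (auto intro: subspace_add)
  next
    fix x assume x: "x \<in> model A"
    have "x = (x - J (D x)) + J (D x)" by simp
    moreover have "x - J (D x) \<in> ?C"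
      using x aD sA by (auto intro: subspace_diff simp: linear_diff)
    ultimately show "x \<in> {x + y |x y. x \<in> ?C \<and> y \<in> J ` model B}" using aD(5)[OF x] by blast
  qed
  moreover have "?C \<inter> J ` model B = {0}"
  proof -
    have "J b = 0" if "b \<in> model B" "D (J b) = 0" for b using that aD(7) linear_0[OF aD(4)] by simp
    then show ?thesis using subspace_0[OF sB] subspace_0[OF sA] linear_0[OF aD(4)] linear_0[OF aD(3)] by force
  qed
  moreover have "dim (J ` model B) = dim (model B)"
  proof (rule dim_image_eq[OF aD(4)])
    have "span (model B) = model B" using sB by simp
    show "inj_on J (span (model B))" unfolding \<open>span (model B) = model B\<close> using aD(7) by (auto intro!: inj_on_inverseI[where g=D])
  qed
  ultimately show ?thesis
    using dim_sums_Int[OF subspace_kernel_adapted[OF M(1) ad] sJ] by simp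
qed

lemma dim_ker_ds:
  fixes A :: "('a::{t2_space, second_countable_topology}, 'e::euclidean_space) smooth_structure"
    and B :: "('b::{t2_space, second_countable_topology}, 'f::euclidean_space) smooth_structure"
  assumes M: "manifold A" "manifold B" and ad: "adapted_chart A B (src G) U \<xi> V \<eta> D J" and q: "q \<in> U"
  shows "subspace (ker_ds A B G q)" "dim (ker_ds A B G q) = dim (model A) - dim (model B)"
proof -
  note aD = adapted_chartD[OF ad]
  let ?C = "{x \<in> model A. D x = 0}"
  obtain T where T: "linear T" "\<And>v. v \<in> model A \<Longrightarrow> chart_comp A \<xi> q v = T v"
    using chart_comp_linear[OF M(1) aD(1) q] by metis
  have eq: "ker_ds A B G q = {v \<in> model A. D (T v) = 0}"
    using ker_ds_adapted[OF M ad q] T(2) by auto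
  show s: "subspace (ker_ds A B G q)"
    unfolding eq using manifold_subspace[OF M(1)] T(1) aD(3)
    by (auto simp: subspace_def linear_0 linear_add linear_cmul)
  have "T ` ker_ds A B G q = ?C"
  proof (intro equalityI subsetI)
    fix w assume "w \<in> T ` ker_ds A B G q"
    then show "w \<in> ?C" using chart_comp_in_model[OF M(1) aD(1) q] T(2) by (fastforce simp: eq)
  next
    fix w assume w: "w \<in> ?C"
    then obtain v where "v \<in> model A" "chart_comp A \<xi> q v = w" using chart_comp_surj[OF M(1) aD(1) q] by blast
    then show "w \<in> T ` ker_ds A B G q" using T(2) w by (auto simp: eq)
  qed
  moreover have "inj_on T (ker_ds A B G q)"
    using chart_comp_inj[OF M(1) aD(1) q] T(2) by (auto simp: inj_on_def eq)
  ultimately show "dim (ker_ds A B G q) = dim (model A) - dim (model B)"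
    using dim_image_eq[OF T(1), of "ker_ds A B G q"] dim_kernel_adapted[OF M ad] s by (metis span_eq_iff)
qed

text \<open>A list rather than a set, since tuples of tangent vectors are lists; the expansion of
  each \<open>x \<in> C\<close> is included for direct use. For a zero-dimensional \<open>C\<close>
  the list is empty.\<close>

definition onb_list :: "'e::euclidean_space set \<Rightarrow> 'e list \<Rightarrow> bool" where
  "onb_list C es \<longleftrightarrow> set es \<subseteq> C \<and> length es = dim C \<and> distinct es \<and> span (set es) = C \<and>
     (\<forall>i<dim C. \<forall>j<dim C. inner (es ! i) (es ! j) = (if i = j then 1 else 0)) \<and>
     (\<forall>x\<in>C. x = (\<Sum>i<dim C. inner x (es ! i) *\<^sub>R es ! i))"

lemma onb_list_span:
  fixes es :: "'e::euclidean_space list"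
  assumes "distinct es" "pairwise (\<lambda>x y. inner x y = 0) (set es)" "\<And>x. x \<in> set es \<Longrightarrow> norm x = 1"
  shows "onb_list (span (set es)) es"
proof -
  let ?E = "set es"
  have "pairwise Linear_Algebra.orthogonal ?E"
    using assms(2) by (simp add: pairwise_def Linear_Algebra.orthogonal_def)
  moreover have "0 \<notin> ?E" using assms(3) by fastforce
  ultimately have "independent ?E" by (rule pairwise_orthogonal_independent)
  then have l: "length es = dim (span ?E)" using assms(1) by (simp add: distinct_card dim_eq_card_independent)
  have ip: "inner x y = (if x = y then 1 else 0)" if "x \<in> ?E" "y \<in> ?E" for x y
    using assms(2,3) that by (auto simp: pairwise_def norm_eq_1)
  have "x = (\<Sum>i<dim (span ?E). inner x (es ! i) *\<^sub>R es ! i)" if "x \<in> span ?E" for x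
  proof -
    obtain u where u: "x = (\<Sum>v\<in>?E. u v *\<^sub>R v)" using \<open>x \<in> span ?E\<close> span_finite[of ?E] by auto
    have "inner x w = u w" if "w \<in> ?E" for w
    proof -
      have "inner x w = (\<Sum>v\<in>?E. u v * inner v w)" by (simp add: u inner_sum_left)
      also have "\<dots> = (\<Sum>v\<in>?E. if v = w then u w else 0)"
        using ip that by (intro sum.cong) auto
      finally show ?thesis using that by simp
    qed
    then have "x = (\<Sum>v\<in>?E. inner x v *\<^sub>R v)" using u by simp
    also have "\<dots> = (\<Sum>i<dim (span ?E). inner x (es ! i) *\<^sub>R es ! i)"
      using sum.reindex_bij_betw[OF bij_betw_nth[OF assms(1)], of "{..<dim (span ?E)}" ?E "\<lambda>v. inner x v *\<^sub>R v"] l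
      by simp
    finally show ?thesis .
  qed
  moreover have "inner (es ! i) (es ! j) = (if i = j then 1 else 0)" if "i < dim (span ?E)" "j < dim (span ?E)" for i j
    using ip[of "es ! i" "es ! j"] that l nth_eq_iff_index_eq[OF assms(1)] by simp
  ultimately show ?thesis
    unfolding onb_list_def using assms(1) l by (auto intro: span_base)
qed

lemma ex_onb_list:
  fixes C :: "'e::euclidean_space set"
  assumes "subspace C"
  obtains es where "onb_list C es"
proof -
  obtain E where E: "pairwise Linear_Algebra.orthogonal E" "\<And>x. x \<in> E \<Longrightarrow> norm x = 1" "independent E" "span E = C"
    using orthonormal_basis_subspace[OF assms] by metis
  have "finite E" using E(3) independent_imp_finite by blast
  then obtain es where es: "set es = E" "distinct es" using finite_distinct_list by blast
  have "onb_list (span (set es)) es"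
    by (rule onb_list_span) (use E es in \<open>auto simp: pairwise_def Linear_Algebra.orthogonal_def\<close>)
  then show ?thesis using that E(4) es(1) by simp
qed

text \<open>The determinant of the components of \<open>w 0\<close>, \<open>w 1\<close> and so on
  along an orthonormal list. Inner products make it a polynomial in arbitrary vectors, hence smooth;
  it depends only on their orthogonal projections to the span of \<open>es\<close>.\<close>

definition coord_det :: "'e::euclidean_space list \<Rightarrow> (nat \<Rightarrow> 'e) \<Rightarrow> real" where
  "coord_det es w = Determinant.det (mat (length es) (length es) (\<lambda>(i, j). inner (w j) (es ! i)))"

lemma convolution_algebra_density:
  "a \<in> convolution_algebra A B G \<Longrightarrow> density (ker_ds A B G g) (a g)"
  by (simp add: convolution_algebra_def)

lemma chart_comp_sum:
  assumes M: "manifold A" and c: "compat_chart A U \<xi>" and p: "p \<in> U" and "\<And>i. i \<in> S \<Longrightarrow> x i \<in> model A"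
  shows "chart_comp A \<xi> p (\<Sum>i\<in>S. r i *\<^sub>R x i) = (\<Sum>i\<in>S. r i *\<^sub>R chart_comp A \<xi> p (x i))"
proof -
  obtain T where T: "linear T" "\<And>v. v \<in> model A \<Longrightarrow> chart_comp A \<xi> p v = T v"
    using chart_comp_linear[OF M c p] by metis
  have "(\<Sum>i\<in>S. r i *\<^sub>R x i) \<in> model A"
    using assms(4) manifold_subspace[OF M] by (intro subspace_sum subspace_scale) auto
  then show ?thesis using T assms(4) by (simp add: linear_sum linear_cmul)
qed

text \<open>Constant vectors of the chart give a frame of \<open>ker ds\<close> at every point of
  \<open>U\<close>, a common reference for the values of a density.\<close>

lemma adapted_frame:
  fixes A :: "('a::{t2_space, second_countable_topology}, 'e::euclidean_space) smooth_structure"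
    and B :: "('b::{t2_space, second_countable_topology}, 'f::euclidean_space) smooth_structure"
  assumes M: "manifold A" "manifold B" and ad: "adapted_chart A B (src G) U \<xi> V \<eta> D J" and q: "q \<in> U"
    and onb: "onb_list {x \<in> model A. D x = 0} es"
  defines "bs \<equiv> map (chart_vec A \<xi> q) es"
  shows "set bs \<subseteq> ker_ds A B G q" "length bs = dim (ker_ds A B G q)" "distinct bs" "independent (set bs)"
    "span (set bs) = ker_ds A B G q" "\<And>i. i < length es \<Longrightarrow> chart_comp A \<xi> q (bs ! i) = es ! i"
proof -
  note aD = adapted_chartD[OF ad]
  note cv = chart_vec[OF M(1) aD(1) q]
  have es: "set es \<subseteq> {x \<in> model A. D x = 0}" "length es = dim {x \<in> model A. D x = 0}" "distinct es"
      "span (set es) = {x \<in> model A. D x = 0}" using onb by (auto simp: onb_list_def)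
  have esA: "set es \<subseteq> model A" using es by auto
  show 1: "set bs \<subseteq> ker_ds A B G q"
    using es(1) cv by (auto simp: bs_def ker_ds_adapted[OF M ad q])
  show l: "length bs = dim (ker_ds A B G q)"
    using es(2) dim_ker_ds(2)[OF M ad q] dim_kernel_adapted[OF M ad] by (simp add: bs_def)
  have "inj_on (chart_vec A \<xi> q) (set es)"
    using cv(2) esA by (intro inj_on_inverseI[where g="chart_comp A \<xi> q"]) auto
  then show d: "distinct bs" using es(3) by (simp add: bs_def distinct_map)
  obtain T where T: "linear T" "\<And>v. v \<in> model A \<Longrightarrow> chart_comp A \<xi> q v = T v"
    using chart_comp_linear[OF M(1) aD(1) q] by metis
  have bsA: "set bs \<subseteq> model A" using esA cv(1) by (auto simp: bs_def)
  have Tb: "T ` set bs = set es"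
    using esA cv T(2) bsA by (force simp: bs_def image_image)
  have injT: "inj_on T (model A)"
    using chart_comp_inj[OF M(1) aD(1) q] T(2) by (auto simp: inj_on_def)
  have sub: "span (set bs) \<subseteq> ker_ds A B G q"
    using 1 dim_ker_ds(1)[OF M ad q] by (rule span_minimal)
  have "v \<in> span (set bs)" if v: "v \<in> ker_ds A B G q" for v
  proof -
    have vA: "v \<in> model A" "D (T v) = 0" using v T(2) by (auto simp: ker_ds_adapted[OF M ad q])
    then have "T v \<in> span (set es)"
      using es(4) chart_comp_in_model[OF M(1) aD(1) q vA(1)] T(2) by auto
    then obtain u where u: "u \<in> span (set bs)" "T v = T u"
      using linear_span_image[OF T(1), of "set bs"] Tb by auto
    then have "v = u" using injT vA(1) sub by (auto simp: inj_on_def ker_ds_def)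
    then show ?thesis using u by simp
  qed
  then show sp: "span (set bs) = ker_ds A B G q" using sub by auto
  show "independent (set bs)"
    by (rule card_le_dim_spanning[where V="ker_ds A B G q"]) (use 1 sp l d distinct_card in \<open>auto simp: distinct_card\<close>)
  show "chart_comp A \<xi> q (bs ! i) = es ! i" if "i < length es" for i
    using that cv(2) esA by (simp add: bs_def subset_iff)
qed

lemma densityD:
  assumes "density V a" "vs \<in> tuples V" "distinct bs" "independent (set bs)" "span (set bs) = V" "linear L"
    "Q \<in> carrier_mat (dim V) (dim V)" "\<And>j. j < dim V \<Longrightarrow> L (bs ! j) = (\<Sum>i<dim V. Q $$ (i, j) *\<^sub>R bs ! i)"
  shows "a (map L vs) = \<bar>Determinant.det Q\<bar> *\<^sub>R a vs"
  using assms(1)[unfolded density_def, THEN bspec, OF assms(2), THEN spec, THEN spec, THEN spec, of bs L Q, THEN mp]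
    assms(3-8) by blast

text \<open>The frame is a basis, so some linear map carries it to \<open>ws\<close>; its matrix
  consists of the coordinates of \<open>ws\<close>, and the transformation law of densities produces
  the determinant. Linearly dependent \<open>ws\<close> are covered as well.\<close>

lemma density_in_chart:
  fixes A :: "('a::{t2_space, second_countable_topology}, 'e::euclidean_space) smooth_structure"
    and B :: "('b::{t2_space, second_countable_topology}, 'f::euclidean_space) smooth_structure"
  assumes M: "manifold A" "manifold B" and ad: "adapted_chart A B (src G) U \<xi> V \<eta> D J" and q: "q \<in> U"
    and onb: "onb_list {x \<in> model A. D x = 0} es"
    and a: "density (ker_ds A B G q) a" and ws: "set ws \<subseteq> ker_ds A B G q" "length ws = length es"
  shows "a ws = \<bar>coord_det es (\<lambda>j. chart_comp A \<xi> q (ws ! j))\<bar> *\<^sub>R a (map (chart_vec A \<xi> q) es)"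
proof -
  note aD = adapted_chartD[OF ad]
  let ?bs = "map (chart_vec A \<xi> q) es" and ?K = "ker_ds A B G q" and ?C = "{x \<in> model A. D x = 0}"
  note fr = adapted_frame[OF M ad q onb]
  have l: "length es = dim ?K" using fr(2) by simp
  have lC: "dim ?C = dim ?K" using onb l by (simp add: onb_list_def)
  \<comment> \<open>A linear extension is prescribed on a set of vectors, so the position of
    \<open>b\<close> in the list, unique by distinctness, has to be recovered from
    \<open>b\<close>.\<close>
  obtain L where L: "linear L" "\<And>b. b \<in> set ?bs \<Longrightarrow> L b = ws ! (THE j. j < length ?bs \<and> ?bs ! j = b)"
    using linear_independent_extend[OF fr(4), of "\<lambda>b. ws ! (THE j. j < length ?bs \<and> ?bs ! j = b)"] by auto
  have Lb: "L (?bs ! j) = ws ! j" if "j < length es" for j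
  proof -
    have "(THE i. i < length ?bs \<and> ?bs ! i = ?bs ! j) = j"
      using that fr(3) nth_eq_iff_index_eq[OF fr(3)] by (intro the_equality) (auto simp del: nth_map)
    then show ?thesis using L(2)[of "?bs ! j"] nth_mem[of j ?bs] that by simp
  qed
  define Q where "Q = mat (length es) (length es) (\<lambda>(i, j). inner (chart_comp A \<xi> q (ws ! j)) (es ! i))"
  have LM: "L (?bs ! j) = (\<Sum>i<dim ?K. Q $$ (i, j) *\<^sub>R ?bs ! i)" if j: "j < dim ?K" for j
  proof -
    have "ws ! j \<in> ?K" using ws nth_mem[of j ws] j l by auto
    then have wjA: "ws ! j \<in> model A" and wjC: "chart_comp A \<xi> q (ws ! j) \<in> ?C"
      using chart_comp_in_model[OF M(1) aD(1) q] by (auto simp: ker_ds_adapted[OF M ad q])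
    have bA: "?bs ! i \<in> model A" if "i < dim ?K" for i
    proof -
      have "?bs ! i \<in> set ?bs" using that l by (intro nth_mem) simp
      then have "?bs ! i \<in> ?K" using fr(1) by blast
      then show ?thesis by (simp add: ker_ds_def)
    qed
    have "chart_comp A \<xi> q (\<Sum>i<dim ?K. Q $$ (i, j) *\<^sub>R ?bs ! i) = (\<Sum>i<dim ?K. Q $$ (i, j) *\<^sub>R es ! i)"
      using chart_comp_sum[OF M(1) aD(1) q, of "{..<dim ?K}" "\<lambda>i. ?bs ! i" "\<lambda>i. Q $$ (i, j)"] bA fr(6) l
      by (simp del: nth_map)
    also have "\<dots> = (\<Sum>i<dim ?C. inner (chart_comp A \<xi> q (ws ! j)) (es ! i) *\<^sub>R es ! i)"
      using lC l j by (simp add: Q_def)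
    also have "\<dots> = chart_comp A \<xi> q (ws ! j)"
      using onb wjC unfolding onb_list_def by metis
    finally have "(\<Sum>i<dim ?K. Q $$ (i, j) *\<^sub>R ?bs ! i) = ws ! j"
      using chart_comp_inj[OF M(1) aD(1) q] wjA bA manifold_subspace[OF M(1)]
      by (elim inj_onD) (auto intro!: subspace_sum subspace_scale simp del: nth_map)
    then show ?thesis using Lb j l by simp
  qed
  have mL: "map L ?bs = ws"
    by (rule nth_equalityI) (use ws l Lb in \<open>auto\<close>)
  have bt: "?bs \<in> tuples ?K" using fr(1,2) by (auto simp: tuples_def)
  have Qc: "Q \<in> carrier_mat (dim ?K) (dim ?K)" using l by (simp add: Q_def)
  have "a (map L ?bs) = \<bar>Determinant.det Q\<bar> *\<^sub>R a ?bs"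
    by (rule densityD[OF a bt fr(3,4,5) L(1) Qc LM])
  then have "a ws = \<bar>Determinant.det Q\<bar> *\<^sub>R a ?bs" unfolding mL .
  then show ?thesis by (simp add: coord_det_def Q_def)
qed

lemma density_frame_smooth:
  fixes A :: "('a::{t2_space, second_countable_topology}, 'e::euclidean_space) smooth_structure"
    and B :: "('b::{t2_space, second_countable_topology}, 'f::euclidean_space) smooth_structure"
  assumes M: "manifold A" "manifold B" and ad: "adapted_chart A B (src G) U \<xi> V \<eta> D J"
    and onb: "onb_list {x \<in> model A. D x = 0} es" and a: "a \<in> convolution_algebra A B G"
  shows "smooth_map A eucl U (\<lambda>q. a q (map (chart_vec A \<xi> q) es))"
proof -
  note aD = adapted_chartD[OF ad]
  define Xs where "Xs = map (\<lambda>w q. chart_vec A \<xi> q w) es"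
  have Xs: "map (\<lambda>X. X q) Xs = map (chart_vec A \<xi> q) es" for q by (simp add: Xs_def)
  have "vector_field A U X" if "X \<in> set Xs" for X
  proof -
    obtain w where w: "w \<in> set es" "X = (\<lambda>q. chart_vec A \<xi> q w)" using \<open>X \<in> set Xs\<close> by (auto simp: Xs_def)
    show ?thesis unfolding w(2)
      by (rule vector_field_in_chart[OF M(1) aD(1) subset_refl open_UNIV Cinf_on_const])
        (use w onb in \<open>auto simp: onb_list_def\<close>)
  qed
  moreover have "map (\<lambda>X. X q) Xs \<in> tuples (ker_ds A B G q) \<and> span (set (map (\<lambda>X. X q) Xs)) = ker_ds A B G q"
    if "q \<in> U" for q
    unfolding Xs using adapted_frame[OF M ad that onb] by (simp add: tuples_def)
  ultimately have "smooth_map A eucl U (\<lambda>q. a q (map (\<lambda>X. X q) Xs))"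
    using a compat_chartD(1)[OF aD(1)] unfolding convolution_algebra_def by blast
  then show ?thesis by (simp add: Xs)
qed

lemma coord_det_eq:
  "coord_det es w = (\<Sum>p\<in>{p. p permutes {0..<length es}}. signof p * (\<Prod>i=0..<length es. inner (w (p i)) (es ! i)))"
proof -
  let ?n = "length es"
  have "coord_det es w = (\<Sum>p\<in>{p. p permutes {0..<?n}}. signof p *
      (\<Prod>i=0..<?n. mat ?n ?n (\<lambda>(i, j). inner (w j) (es ! i)) $$ (i, p i)))"
    unfolding coord_det_def by (rule det_def') simp
  also have "\<dots> = (\<Sum>p\<in>{p. p permutes {0..<?n}}. signof p * (\<Prod>i=0..<?n. inner (w (p i)) (es ! i)))"
  proof (intro sum.cong prod.cong refl arg_cong2[where f="(*)"])
    fix p i assume "p \<in> {p. p permutes {0..<?n}}" "i \<in> {0..<?n}"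
    then have "i < ?n" "p i < ?n" using permutes_in_image by fastforce+
    then show "mat ?n ?n (\<lambda>(i, j). inner (w j) (es ! i)) $$ (i, p i) = inner (w (p i)) (es ! i)" by simp
  qed
  finally show ?thesis .
qed

lemma Cinf_on_coord_det:
  assumes "open N" "\<And>j. j < length es \<Longrightarrow> Cinf_on N (w j)"
  shows "Cinf_on N (\<lambda>z. coord_det es (\<lambda>j. w j z))"
  unfolding coord_det_eq
proof (intro Cinf_on_sum[OF assms(1)] Cinf_on_mult[OF assms(1)] Cinf_on_const Cinf_on_prod[OF assms(1)]
    Cinf_on_inner[OF assms(1)])
  fix p i assume "p \<in> {p. p permutes {0..<length es}}" "i \<in> {0..<length es}"
  then have "p i < length es" using permutes_in_image by fastforce
  then show "Cinf_on N (w (p i))" by (rule assms(2))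
qed

text \<open>The directional derivative of \<open>coord_det\<close> at \<open>w\<close> along
  \<open>w'\<close>, by the product rule in each summand of the Leibniz formula.\<close>

definition coord_det_deriv :: "'e::euclidean_space list \<Rightarrow> (nat \<Rightarrow> 'e) \<Rightarrow> (nat \<Rightarrow> 'e) \<Rightarrow> real" where
  "coord_det_deriv es w w' = (\<Sum>p\<in>{p. p permutes {0..<length es}}. signof p *
     (\<Sum>i=0..<length es. inner (w' (p i)) (es ! i) * (\<Prod>k\<in>{0..<length es} - {i}. inner (w (p k)) (es ! k))))"

lemma coord_det_has_derivative:
  assumes "\<And>j. j < length es \<Longrightarrow> (w j has_vector_derivative w' j) (at t)"
  shows "((\<lambda>t. coord_det es (\<lambda>j. w j t)) has_vector_derivative coord_det_deriv es (\<lambda>j. w j t) w') (at t)"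
  unfolding coord_det_eq coord_det_deriv_def has_real_derivative_iff_has_vector_derivative[symmetric]
proof (intro DERIV_sum DERIV_cmult has_field_derivative_prod)
  fix p i assume "p \<in> {p. p permutes {0..<length es}}" "i \<in> {0..<length es}"
  then have "p i < length es" using permutes_in_image by fastforce
  then show "((\<lambda>t. inner (w (p i) t) (es ! i)) has_real_derivative inner (w' (p i)) (es ! i)) (at t)"
    unfolding has_real_derivative_iff_has_vector_derivative
    by (intro bounded_linear.has_vector_derivative[OF bounded_linear_inner_left] assms)
qed

text \<open>A kernel vector of the matrix gives a linear combination of the \<open>w j\<close> that
  is orthogonal to the basis of \<open>C\<close> and lies in \<open>C\<close>. With the converse
  below, a determinant that vanishes remains 0 after applying a linear map to the vectors.\<close>

lemma coord_det_eq_0_iff: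
  assumes onb: "onb_list C es" and "\<And>j. j < length es \<Longrightarrow> w j \<in> C"
  shows "coord_det es w = 0 \<Longrightarrow> \<exists>c. (\<exists>j<length es. c j \<noteq> 0) \<and> (\<Sum>j<length es. c j *\<^sub>R w j) = 0"
proof -
  let ?n = "length es"
  let ?Q = "mat ?n ?n (\<lambda>(i, j). inner (w j) (es ! i))"
  assume "coord_det es w = 0"
  then obtain v where v: "v \<in> carrier_vec ?n" "v \<noteq> 0\<^sub>v ?n" "?Q *\<^sub>v v = 0\<^sub>v ?n"
    using det_0_iff_vec_prod_zero[of ?Q ?n] by (auto simp: coord_det_def)
  let ?s = "\<Sum>j<?n. vec_index v j *\<^sub>R w j"
  have s0: "inner ?s (es ! i) = 0" if "i < ?n" for i
  proof -
    have "vec_index (?Q *\<^sub>v v) i = 0" using v(3) that by simp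
    then have "(\<Sum>j\<in>{0..<?n}. inner (w j) (es ! i) * vec_index v j) = 0"
      using that v(1) by (auto simp: scalar_prod_def)
    then show ?thesis by (simp add: inner_sum_left atLeast0LessThan mult.commute)
  qed
  have "subspace C" using onb subspace_span by (metis onb_list_def)
  then have "?s \<in> C" using assms(2) by (intro subspace_sum subspace_scale) auto
  then have "?s = (\<Sum>i<dim C. inner ?s (es ! i) *\<^sub>R es ! i)"
    using onb unfolding onb_list_def by blast
  also have "\<dots> = 0" using s0 onb by (simp add: onb_list_def)
  finally have "?s = 0" .
  moreover have "\<exists>j<?n. vec_index v j \<noteq> 0"
    using v(1,2) by (metis carrier_vecD eq_vecI index_zero_vec)
  ultimately show ?thesis by blast
qed

lemma coord_det_eq_0:
  assumes "j < length es" "c j \<noteq> 0" "(\<Sum>j<length es. c j *\<^sub>R w j) = 0"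
  shows "coord_det es w = 0"
proof -
  let ?n = "length es"
  let ?Q = "mat ?n ?n (\<lambda>(i, j). inner (w j) (es ! i))"
  let ?v = "Matrix.vec ?n c"
  have "?Q *\<^sub>v ?v = 0\<^sub>v ?n"
  proof (rule eq_vecI)
    fix i assume "i < dim_vec (0\<^sub>v ?n)"
    then have i: "i < ?n" by simp
    have "(\<Sum>j\<in>{0..<?n}. inner (w j) (es ! i) * c j) = inner (\<Sum>j<?n. c j *\<^sub>R w j) (es ! i)"
      by (simp add: inner_sum_left atLeast0LessThan mult.commute)
    then show "vec_index (?Q *\<^sub>v ?v) i = vec_index (0\<^sub>v ?n) i"
      using i assms(3) by (simp add: scalar_prod_def)
  qed simp
  moreover have "?v \<noteq> 0\<^sub>v ?n" using assms(1,2) by (metis index_vec index_zero_vec(1))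
  ultimately show ?thesis
    using det_0_iff_vec_prod_zero[of ?Q ?n] unfolding coord_det_def by (metis mat_carrier vec_carrier)
qed

section \<open>Deformations in charts\<close>

lemma frechet_derivative_chain:
  assumes "Cinf_on N F" "a x \<in> N" "(a has_derivative a') (at x)"
  shows "frechet_derivative (\<lambda>x. F (a x)) (at x) w = frechet_derivative F (at (a x)) (a' w)"
proof -
  have "((\<lambda>x. F (a x)) has_derivative (\<lambda>w. frechet_derivative F (at (a x)) (a' w))) (at x)"
    using has_derivative_compose[OF assms(3) Cinf_on_has_derivative[OF assms(1,2)]] .
  from frechet_derivative_at[OF this] show ?thesis by metis
qed

lemma Cinf_on_middle_slice:
  fixes F :: "real \<times> 'a::euclidean_space \<times> 'b::euclidean_space \<Rightarrow> 'c::euclidean_space"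
  assumes "open N" "Cinf_on N F"
  shows "open {x. (\<epsilon>, x, z) \<in> N}" "Cinf_on {x. (\<epsilon>, x, z) \<in> N} (\<lambda>x. F (\<epsilon>, x, z))"
    "(\<epsilon>, x, z) \<in> N \<Longrightarrow> frechet_derivative (\<lambda>x. F (\<epsilon>, x, z)) (at x) w = frechet_derivative F (at (\<epsilon>, x, z)) (0, w, 0)"
proof -
  have c: "continuous_on UNIV (\<lambda>x. (\<epsilon>, x, z))" by (intro continuous_intros)
  show op: "open {x. (\<epsilon>, x, z) \<in> N}"
    using continuous_on_open_vimage[OF open_UNIV, of "\<lambda>x. (\<epsilon>, x, z)"] c assms(1) by (auto simp: vimage_def)
  show "Cinf_on {x. (\<epsilon>, x, z) \<in> N} (\<lambda>x. F (\<epsilon>, x, z))"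
    by (rule Cinf_on_compose[OF op assms(1) _ _ assms(2)])
      (auto intro!: Cinf_on_Pair Cinf_on_const Cinf_on_id op)
  show "frechet_derivative (\<lambda>x. F (\<epsilon>, x, z)) (at x) w = frechet_derivative F (at (\<epsilon>, x, z)) (0, w, 0)"
    if "(\<epsilon>, x, z) \<in> N"
    by (rule frechet_derivative_chain[where a="\<lambda>x. (\<epsilon>, x, z)", OF assms(2) that])
      (auto intro!: derivative_eq_intros)
qed

lemma local_repD:
  assumes "local_rep S f U \<phi> V \<psi> N F"
  shows "open N" "Cinf_on N F" "q \<in> S \<Longrightarrow> q \<in> U \<Longrightarrow> \<phi> q \<in> N \<Longrightarrow> f q \<in> V"
    "q \<in> S \<Longrightarrow> q \<in> U \<Longrightarrow> \<phi> q \<in> N \<Longrightarrow> F (\<phi> q) = \<psi> (f q)"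
  using assms by (auto simp: local_rep_def)

locale deformation =
  fixes A :: "('g::{t2_space, second_countable_topology}, 'e::euclidean_space) smooth_structure"
    and B :: "('m::{t2_space, second_countable_topology}, 'f::euclidean_space) smooth_structure"
    and G :: "('g, 'm) groupoid" and I :: "real set" and m :: "real \<Rightarrow> 'g \<Rightarrow> 'g \<Rightarrow> 'g"
  assumes lie: "lie_groupoid A B G" and dfm: "s_constant_deformation A B G I m"
begin

lemma MA: "manifold A" and MB: "manifold B" and grp: "is_groupoid G" and sub: "submersion A B (src G)"
  and smooth_mul: "smooth_map (prod_structure A A) A (composable G) (\<lambda>(g, h). mul G g h)"
  using lie by (auto simp: lie_groupoid_def)

lemma src_mul: "src G g = tgt G h \<Longrightarrow> src G (mul G g h) = src G h"
  using grp by (auto simp: is_groupoid_def)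

lemma src_division: "src G g = src G h \<Longrightarrow> src G (division G g h) = tgt G h"
  using grp by (simp add: is_groupoid_def division_def)

lemma mul_division: "src G g = src G h \<Longrightarrow> mul G (division G g h) h = g"
  using grp unfolding is_groupoid_def division_def by metis

lemma division_mul: "src G g = tgt G h \<Longrightarrow> division G (mul G g h) h = g"
  using grp unfolding is_groupoid_def division_def by metis

lemma I: "open I" "0 \<in> I" and m_0: "src G g = src G h \<Longrightarrow> m 0 g h = division G g h"
  and smooth_m: "smooth_map (prod_structure eucl (prod_structure A A)) A
       {(\<epsilon>, g, h). \<epsilon> \<in> I \<and> src G g = src G h} (\<lambda>(\<epsilon>, g, h). m \<epsilon> g h)"
  using dfm by (auto simp: s_constant_deformation_def)

text \<open>Both sides are \<open>tgt H h\<close> for the groupoid \<open>H\<close> at the parameter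
  \<open>\<epsilon>\<close>, since \<open>H\<close> has the source map of \<open>G\<close>. Hence
  \<open>g' \<mapsto> m \<epsilon> g' h\<close> sends a source fiber into a source fiber.\<close>

lemma src_m: 
  assumes "\<epsilon> \<in> I" "src G g = src G h" shows "src G (m \<epsilon> g h) = src G (m \<epsilon> h h)"
proof -
  obtain H where H: "lie_groupoid A B H" "src H = src G"
    "\<And>g h. src G g = src G h \<Longrightarrow> m \<epsilon> g h = division H g h"
    using dfm assms(1) unfolding s_constant_deformation_def by blast
  have "is_groupoid H" using H(1) by (simp add: lie_groupoid_def)
  then have "src H (division H g' h) = tgt H h" if "src H g' = src H h" for g'
    using that by (simp add: is_groupoid_def division_def)
  then show ?thesis using H(2,3) assms(2) by metis
qed

lemma ex_adapted: 
  obtains U \<xi> V \<eta> D J where "adapted_chart A B (src G) U \<xi> V \<eta> D J" "p \<in> U"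
  using submersion_adapted_chart[OF MA MB sub] .

lemma src_eq_adapted:
  assumes "adapted_chart A B (src G) U \<xi> V \<eta> D J" "q \<in> U" "q' \<in> U"
  shows "src G q = src G q' \<longleftrightarrow> D (\<xi> q) = D (\<xi> q')"
  using adapted_chartD(8,9)[OF assms(1)] assms(2,3) compat_chartD(4)[OF adapted_chartD(2)[OF assms(1)]]
  by (metis inj_onD)

text \<open>In an adapted chart a straight line in a direction of the kernel of \<open>D\<close>
  stays in the source fiber. Such curves make differentials along the fiber well defined.\<close>

lemma fiber_curve:
  assumes v: "v \<in> ker_ds A B G g"
  obtains \<gamma> where "curve_in A (src_fiber G (src G g)) g v \<gamma>"
proof -
  obtain U \<xi> V \<eta> D J where ad: "adapted_chart A B (src G) U \<xi> V \<eta> D J" and g: "g \<in> U" using ex_adapted .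
  note aD = adapted_chartD[OF ad]
  let ?w = "chart_comp A \<xi> g v"
  have vA: "v \<in> model A" and Dw: "D ?w = 0" using v ker_ds_adapted[OF MA MB ad g] by auto
  have w: "?w \<in> model A" by (rule chart_comp_in_model[OF MA aD(1) g vA])
  obtain \<delta> where \<delta>: "0 < \<delta>" "\<And>s. \<bar>s\<bar> < \<delta> \<Longrightarrow> \<xi> g + s *\<^sub>R ?w \<in> UNIV \<and> \<xi> g + s *\<^sub>R ?w \<in> \<xi> ` (U \<inter> UNIV)"
    using line_in_chart[OF MA aD(1) g open_UNIV UNIV_I w open_UNIV UNIV_I] by metis
  have "curve_in A (src_fiber G (src G g)) g v (\<lambda>s. inv_into U \<xi> (\<xi> g + s *\<^sub>R ?w))"
  proof (rule curve_in_ex[OF MA aD(1) \<delta>(1) g _ Cinf_on_line _ _ has_vector_derivative_line vA])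
    fix s :: real assume s: "\<bar>s\<bar> < \<delta>"
    then have x: "\<xi> g + s *\<^sub>R ?w \<in> \<xi> ` U" using \<delta>(2) by auto
    show "inv_into U \<xi> (\<xi> g + s *\<^sub>R ?w) \<in> src_fiber G (src G g)"
      using src_eq_adapted[OF ad compat_chart_inv(3)[OF aD(1) x] g] compat_chart_inv(4)[OF aD(1) x] Dw
      by (simp add: src_fiber_def linear_add[OF aD(3)] linear_cmul[OF aD(3)])
  qed (use \<delta> in auto)
  then show ?thesis by (rule that)
qed

text \<open>The coordinate expression of
  \<open>(\<epsilon>, g, h) \<mapsto> m \<epsilon> g h\<close>, prescribed only for pairs with a
  common source. The parameter is a coordinate like the others, so that one smooth function carries
  all mixed derivatives.\<close>

definition m_rep :: "'g set \<Rightarrow> ('g \<Rightarrow> 'e) \<Rightarrow> 'g set \<Rightarrow> ('g \<Rightarrow> 'e) \<Rightarrow> 'g set \<Rightarrow> ('g \<Rightarrow> 'e) \<Rightarrow>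
    (real \<times> 'e \<times> 'e) set \<Rightarrow> (real \<times> 'e \<times> 'e \<Rightarrow> 'e) \<Rightarrow> bool" where
  "m_rep U \<phi> W \<zeta> V \<psi> N F \<longleftrightarrow> compat_chart A U \<phi> \<and> compat_chart A W \<zeta> \<and> compat_chart A V \<psi> \<and>
     open N \<and> Cinf_on N F \<and> (\<forall>z\<in>N. fst z \<in> I) \<and>
     (\<forall>\<epsilon> g h. g \<in> U \<longrightarrow> h \<in> W \<longrightarrow> src G g = src G h \<longrightarrow> (\<epsilon>, \<phi> g, \<zeta> h) \<in> N \<longrightarrow>
        m \<epsilon> g h \<in> V \<and> F (\<epsilon>, \<phi> g, \<zeta> h) = \<psi> (m \<epsilon> g h))"

lemma m_repD:
  assumes "m_rep U \<phi> W \<zeta> V \<psi> N F"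
  shows "compat_chart A U \<phi>" "compat_chart A W \<zeta>" "compat_chart A V \<psi>" "open N" "Cinf_on N F"
    "\<And>\<epsilon> x z. (\<epsilon>, x, z) \<in> N \<Longrightarrow> \<epsilon> \<in> I"
    "\<And>\<epsilon> g h. g \<in> U \<Longrightarrow> h \<in> W \<Longrightarrow> src G g = src G h \<Longrightarrow> (\<epsilon>, \<phi> g, \<zeta> h) \<in> N \<Longrightarrow> m \<epsilon> g h \<in> V"
    "\<And>\<epsilon> g h. g \<in> U \<Longrightarrow> h \<in> W \<Longrightarrow> src G g = src G h \<Longrightarrow> (\<epsilon>, \<phi> g, \<zeta> h) \<in> N \<Longrightarrow>
       F (\<epsilon>, \<phi> g, \<zeta> h) = \<psi> (m \<epsilon> g h)"
  using assms by (fastforce simp: m_rep_def)+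

lemma ex_m_rep:
  assumes c: "compat_chart A U \<phi>" "compat_chart A W \<zeta>" "compat_chart A V \<psi>"
    and p: "g \<in> U" "h \<in> W" "\<epsilon> \<in> I" "src G g = src G h" "m \<epsilon> g h \<in> V"
  obtains N F where "m_rep U \<phi> W \<zeta> V \<psi> N F" "(\<epsilon>, \<phi> g, \<zeta> h) \<in> N"
proof -
  let ?S = "{(\<epsilon>, g, h). \<epsilon> \<in> I \<and> src G g = src G h}" and ?f = "\<lambda>(\<epsilon>, g, h). m \<epsilon> g h"
  have sc: "smooth_chart (prod_structure eucl (prod_structure A A)) (UNIV \<times> (U \<times> W)) (map_prod id (map_prod \<phi> \<zeta>))"
    by (intro smooth_chart_prod smooth_chart_eucl compat_chartD(3) c)
  obtain N F where N: "map_prod id (map_prod \<phi> \<zeta>) (\<epsilon>, g, h) \<in> N"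
    and rep: "local_rep ?S ?f (UNIV \<times> (U \<times> W)) (map_prod id (map_prod \<phi> \<zeta>)) V \<psi> N F"
    using smooth_map_local_rep[OF smooth_m sc compat_chartD(3)[OF c(3)], of "(\<epsilon>, g, h)"] p by auto
  have r: "open N" "Cinf_on N F" "\<And>\<epsilon> g h. \<epsilon> \<in> I \<Longrightarrow> g \<in> U \<Longrightarrow> h \<in> W \<Longrightarrow> src G g = src G h \<Longrightarrow> (\<epsilon>, \<phi> g, \<zeta> h) \<in> N \<Longrightarrow>
      m \<epsilon> g h \<in> V \<and> F (\<epsilon>, \<phi> g, \<zeta> h) = \<psi> (m \<epsilon> g h)"
    using local_repD(1,2)[OF rep] local_repD(3,4)[OF rep, of "(_, _, _)"] by auto
  let ?N = "N \<inter> (I \<times> UNIV)"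
  have "open ?N" using r(1) I(1) by (intro open_Int open_Times) auto
  then have "m_rep U \<phi> W \<zeta> V \<psi> ?N F"
    unfolding m_rep_def using c r by (auto intro: Cinf_on_subset)
  then show ?thesis using that N p by auto
qed

text \<open>The differential along the fiber is the partial derivative of \<open>F\<close> in the
  second argument. Its values are in \<open>ker ds\<close> because
  \<open>src G (m \<epsilon> g' h)\<close> is constant for \<open>g'\<close> in the fiber.\<close>

lemma m_tangent:
  assumes mr: "m_rep U \<phi> W \<zeta> V \<psi> N F" and p: "g \<in> U" "h \<in> W" "src G g = src G h" "(\<epsilon>, \<phi> g, \<zeta> h) \<in> N"
    and v: "v \<in> ker_ds A B G g"
  defines "T \<equiv> tangent_map A A (src_fiber G (src G h)) (\<lambda>g'. m \<epsilon> g' h) g v"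
  shows "T \<in> model A" "T \<in> ker_ds A B G (m \<epsilon> g h)"
    "chart_comp A \<psi> (m \<epsilon> g h) T = frechet_derivative F (at (\<epsilon>, \<phi> g, \<zeta> h)) (0, chart_comp A \<phi> g v, 0)"
    "\<And>\<gamma>. \<gamma> 0 = g \<Longrightarrow> has_velocity A \<gamma> 0 v \<Longrightarrow> \<forall>\<^sub>F s in at 0. \<gamma> s \<in> src_fiber G (src G h) \<Longrightarrow>
      has_velocity A (\<lambda>s. m \<epsilon> (\<gamma> s) h) 0 T"
proof -
  note r = m_repD[OF mr] and sl = Cinf_on_middle_slice[OF m_repD(4,5)[OF mr], where \<epsilon>=\<epsilon> and z="\<zeta> h"]
  have rep: "local_rep (src_fiber G (src G h)) (\<lambda>g'. m \<epsilon> g' h) U \<phi> V \<psi> {x. (\<epsilon>, x, \<zeta> h) \<in> N} (\<lambda>x. F (\<epsilon>, x, \<zeta> h))"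
    unfolding local_rep_def using sl(1,2) r(7,8) p(2) by (auto simp: src_fiber_def)
  obtain \<gamma> where \<gamma>: "curve_in A (src_fiber G (src G h)) g v \<gamma>" using fiber_curve[OF v] p(3) by metis
  have gS: "g \<in> src_fiber G (src G h)" using p(3) by (simp add: src_fiber_def)
  note t = tangent_map_local_rep[OF MA MA r(1,3) rep _ gS p(1) \<gamma>]
  show TA: "T \<in> model A"
    and "chart_comp A \<psi> (m \<epsilon> g h) T = frechet_derivative F (at (\<epsilon>, \<phi> g, \<zeta> h)) (0, chart_comp A \<phi> g v, 0)"
    using t(1,2) p(4) sl(3)[OF p(4)] by (auto simp: T_def)
  show vel: "has_velocity A (\<lambda>s. m \<epsilon> (\<gamma> s) h) 0 T"
    if "\<gamma> 0 = g" "has_velocity A \<gamma> 0 v" "\<forall>\<^sub>F s in at 0. \<gamma> s \<in> src_fiber G (src G h)" for \<gamma>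
    using t(3)[OF _ that] p(4) by (simp add: T_def)
  obtain \<delta> where \<delta>: "\<delta> > 0" "\<gamma> ` {-\<delta><..<\<delta>} \<subseteq> src_fiber G (src G h)" using \<gamma> unfolding curve_in_def by blast
  have "\<gamma> s \<in> src_fiber G (src G h)" if "\<bar>s\<bar> < \<delta>" for s
  proof -
    have "s \<in> {-\<delta><..<\<delta>}" using that by auto
    then show ?thesis using \<delta>(2) by blast
  qed
  then have ev: "\<forall>\<^sub>F s in at 0. \<gamma> s \<in> src_fiber G (src G h)"
    by (rule eventually_mono[OF eventually_at_0_less[OF \<delta>(1)]])
  have \<gamma>0: "\<gamma> 0 = g" "has_velocity A \<gamma> 0 v" using \<gamma> by (auto simp only: curve_in_def)
  obtain U' \<xi> V' \<eta> D J where ad: "adapted_chart A B (src G) U' \<xi> V' \<eta> D J" and q: "m \<epsilon> g h \<in> U'" using ex_adapted .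
  have "has_velocity B (\<lambda>s. src G (m \<epsilon> (\<gamma> s) h)) 0 (tangent_map A B UNIV (src G) (m \<epsilon> g h) T)"
    by (rule adapted_chart_tangent_map(3)[OF MA MB ad q TA]) (use vel[OF \<gamma>0 ev] \<gamma>0 in auto)
  moreover have "has_velocity B (\<lambda>s. src G (m \<epsilon> (\<gamma> s) h)) 0 0"
  proof (rule has_velocity_eventually)
    show "has_velocity B (\<lambda>s. src G (m \<epsilon> h h)) 0 0" by (simp add: has_velocity_def)
    have "\<epsilon> \<in> I" using r(6)[OF p(4)] .
    show "\<forall>\<^sub>F s in at 0. src G (m \<epsilon> h h) = src G (m \<epsilon> (\<gamma> s) h)"
      using ev by eventually_elim (rule src_m[OF \<open>\<epsilon> \<in> I\<close>, symmetric], simp add: src_fiber_def)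
    show "src G (m \<epsilon> h h) = src G (m \<epsilon> (\<gamma> 0) h)" unfolding \<gamma>0(1) by (rule src_m[OF \<open>\<epsilon> \<in> I\<close> p(3), symmetric])
  qed
  ultimately have "tangent_map A B UNIV (src G) (m \<epsilon> g h) T = 0" by (rule has_velocity_unique)
  then show "T \<in> ker_ds A B G (m \<epsilon> g h)" using TA by (simp add: ker_ds_def)
qed

lemma ex_mul_rep:
  assumes c: "compat_chart A U \<phi>" "compat_chart A W \<zeta>" "compat_chart A V \<psi>"
    and p: "k \<in> U" "h \<in> W" "src G k = tgt G h" "mul G k h \<in> V"
  obtains N F where "open N" "Cinf_on N F" "(\<phi> k, \<zeta> h) \<in> N"
    "\<And>k h. k \<in> U \<Longrightarrow> h \<in> W \<Longrightarrow> src G k = tgt G h \<Longrightarrow> (\<phi> k, \<zeta> h) \<in> N \<Longrightarrow>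
      mul G k h \<in> V \<and> F (\<phi> k, \<zeta> h) = \<psi> (mul G k h)"
proof -
  have sc: "smooth_chart (prod_structure A A) (U \<times> W) (map_prod \<phi> \<zeta>)"
    by (intro smooth_chart_prod compat_chartD(3) c)
  obtain N F where N: "map_prod \<phi> \<zeta> (k, h) \<in> N"
    and rep: "local_rep (composable G) (\<lambda>(g, h). mul G g h) (U \<times> W) (map_prod \<phi> \<zeta>) V \<psi> N F"
    using smooth_map_local_rep[OF smooth_mul sc compat_chartD(3)[OF c(3)], of "(k, h)"] p by (auto simp: composable_def)
  have "mul G k h \<in> V \<and> F (\<phi> k, \<zeta> h) = \<psi> (mul G k h)"
    if "k \<in> U" "h \<in> W" "src G k = tgt G h" "(\<phi> k, \<zeta> h) \<in> N" for k h
    using local_repD(3,4)[OF rep, of "(k, h)"] that by (simp add: composable_def)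
  then show ?thesis using that[of N F] N local_repD(1,2)[OF rep] by simp
qed

text \<open>The reason is that right translation by \<open>h\<close> is invertible on the fibers of the source map.\<close>

lemma m_tangent_0_inj:
  assumes mr: "m_rep U \<phi> W \<zeta> V \<psi> N F" and p: "g \<in> U" "h \<in> W" "src G g = src G h" "(0, \<phi> g, \<zeta> h) \<in> N"
    and v: "v \<in> ker_ds A B G g" and 0: "frechet_derivative F (at (0, \<phi> g, \<zeta> h)) (0, chart_comp A \<phi> g v, 0) = 0"
  shows "v = 0"
proof -
  note r = m_repD[OF mr]
  let ?k = "m 0 g h"
  obtain \<gamma> where \<gamma>: "curve_in A (src_fiber G (src G h)) g v \<gamma>" using fiber_curve[OF v] p(3) by metis
  obtain \<delta> where \<delta>: "\<delta> > 0" "\<gamma> ` {-\<delta><..<\<delta>} \<subseteq> src_fiber G (src G h)" using \<gamma> unfolding curve_in_def by blast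
  have "\<gamma> s \<in> src_fiber G (src G h)" if "\<bar>s\<bar> < \<delta>" for s
  proof -
    have "s \<in> {-\<delta><..<\<delta>}" using that by auto
    then show ?thesis using \<delta>(2) by blast
  qed
  then have ev: "\<forall>\<^sub>F s in at 0. \<gamma> s \<in> src_fiber G (src G h)"
    by (rule eventually_mono[OF eventually_at_0_less[OF \<delta>(1)]])
  have \<gamma>0: "\<gamma> 0 = g" "has_velocity A \<gamma> 0 v" using \<gamma> by (auto simp only: curve_in_def)
  let ?T = "tangent_map A A (src_fiber G (src G h)) (\<lambda>g'. m 0 g' h) g v"
  note t = m_tangent[OF mr p v]
  have vel: "has_velocity A (\<lambda>s. m 0 (\<gamma> s) h) 0 ?T" by (rule t(4)[OF \<gamma>0 ev])
  have kV: "?k \<in> V" by (rule r(7)[OF p])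
  have cT: "chart_comp A \<psi> ?k ?T = 0" using t(3) 0 by simp
  have kh: "mul G ?k h = g" "src G ?k = tgt G h" using m_0[OF p(3)] mul_division src_division p(3) by auto
  obtain N' F' where F': "open N'" "Cinf_on N' F'" "(\<psi> ?k, \<zeta> h) \<in> N'"
    "\<And>k h. k \<in> V \<Longrightarrow> h \<in> W \<Longrightarrow> src G k = tgt G h \<Longrightarrow> (\<psi> k, \<zeta> h) \<in> N' \<Longrightarrow>
      mul G k h \<in> U \<and> F' (\<psi> k, \<zeta> h) = \<phi> (mul G k h)"
    using ex_mul_rep[OF r(3,2,1) kV p(2) kh(2)] p(1) kh(1) by metis
  let ?N = "{x. (x, \<zeta> h) \<in> N'}"
  have "open ?N"
    using continuous_on_open_vimage[OF open_UNIV, of "\<lambda>x. (x, \<zeta> h)"] F'(1)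
    by (auto simp: vimage_def intro!: continuous_intros)
  moreover have "Cinf_on ?N (\<lambda>x. F' (x, \<zeta> h))"
    by (rule Cinf_on_compose[OF \<open>open ?N\<close> F'(1) _ _ F'(2)])
      (auto intro!: Cinf_on_Pair Cinf_on_const Cinf_on_id \<open>open ?N\<close>)
  ultimately have rep: "local_rep (src_fiber G (tgt G h)) (\<lambda>k. mul G k h) V \<psi> U \<phi> ?N (\<lambda>x. F' (x, \<zeta> h))"
    unfolding local_rep_def using F'(4) p(2) by (auto simp: src_fiber_def)
  have lin: "linear (frechet_derivative (\<lambda>x. F' (x, \<zeta> h)) (at (\<psi> ?k)))"
    using \<open>Cinf_on ?N (\<lambda>x. F' (x, \<zeta> h))\<close> F'(3) by (blast intro: Cinf_on_linear_frechet)
  have ev2: "\<forall>\<^sub>F s in at 0. m 0 (\<gamma> s) h \<in> src_fiber G (tgt G h)"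
    using ev by eventually_elim (auto simp: src_fiber_def m_0 src_division)
  obtain w where w: "w \<in> model A" "has_velocity A (\<lambda>s. mul G (m 0 (\<gamma> s) h) h) 0 w"
    "chart_comp A \<phi> (mul G ?k h) w = frechet_derivative (\<lambda>x. F' (x, \<zeta> h)) (at (\<psi> ?k)) (chart_comp A \<psi> ?k ?T)"
    by (rule has_velocity_compose[OF MA MA r(3,1) rep _ _ kV _ vel ev2])
      (use F'(3) kh \<gamma>0 in \<open>auto simp: src_fiber_def\<close>)
  have "has_velocity A (\<lambda>s. mul G (m 0 (\<gamma> s) h) h) 0 v"
  proof (rule has_velocity_eventually[OF \<gamma>0(2)])
    show "\<forall>\<^sub>F s in at 0. \<gamma> s = mul G (m 0 (\<gamma> s) h) h"
      using ev by eventually_elim (auto simp: src_fiber_def m_0 mul_division)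
  qed (use kh \<gamma>0 in auto)
  then have "w = v" using w(2) has_velocity_unique by blast
  have "chart_comp A \<phi> g v = 0" using w(3) cT kh \<open>w = v\<close> lin by (simp add: linear_0)
  moreover have "chart_comp A \<phi> g 0 = 0"
    using chart_comp_linear[OF MA r(1) p(1)] subspace_0[OF manifold_subspace[OF MA]] linear_0 by metis
  ultimately show "v = 0"
    using chart_comp_inj[OF MA r(1) p(1)] w(1) \<open>w = v\<close> subspace_0[OF manifold_subspace[OF MA]] by (metis inj_onD)
qed

text \<open>In coordinates the cocycle is the partial derivative of \<open>F\<close> in the
  parameter at 0, over the base point \<open>k = m 0 (mul G k h) h\<close>.\<close>

lemma cocycle_rep:
  assumes mr: "m_rep U \<phi> W \<zeta> V \<psi> N F" and p: "src G k = tgt G h" "mul G k h \<in> U" "h \<in> W" "(0, \<phi> (mul G k h), \<zeta> h) \<in> N"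
  shows "has_velocity A (\<lambda>\<epsilon>. m \<epsilon> (mul G k h) h) 0 (deformation_cocycle A G m k h)" "k \<in> V"
    "chart_comp A \<psi> k (deformation_cocycle A G m k h) = frechet_derivative F (at (0, \<phi> (mul G k h), \<zeta> h)) (1, 0, 0)"
    "deformation_cocycle A G m k h \<in> model A"
proof -
  note r = m_repD[OF mr]
  let ?g = "mul G k h" and ?a = "\<lambda>\<epsilon>::real. (\<epsilon>, \<phi> (mul G k h), \<zeta> h)"
  have s: "src G ?g = src G h" by (rule src_mul[OF p(1)])
  have k: "m 0 ?g h = k" using m_0[OF s] division_mul[OF p(1)] by simp
  have "isCont ?a 0" by (intro continuous_intros)
  then obtain T where T: "open T" "0 \<in> T" "\<And>\<epsilon>. \<epsilon> \<in> T \<Longrightarrow> ?a \<epsilon> \<in> N"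
    using isCont_openD[of 0 ?a N] r(4) p(4) by auto
  then obtain \<delta> where "0 < \<delta>" "ball 0 \<delta> \<subseteq> T" using open_contains_ball by blast
  then have \<delta>: "0 < \<delta>" "?a \<epsilon> \<in> N" if "\<bar>\<epsilon>\<bar> < \<delta>" for \<epsilon> using that T(3) by (auto simp: subset_iff dist_real_def)
  then have \<delta>0: "0 < \<delta>" using \<open>0 < \<delta>\<close> by simp
  have mV: "m \<epsilon> ?g h \<in> V" "F (?a \<epsilon>) = \<psi> (m \<epsilon> ?g h)" if "\<bar>\<epsilon>\<bar> < \<delta>" for \<epsilon>
    using r(7,8)[OF p(2,3) s \<delta>(2)[OF that]] by auto
  have Cx: "Cinf_on {-\<delta><..<\<delta>} (\<lambda>\<epsilon>. F (?a \<epsilon>))"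
    by (rule Cinf_on_compose[OF _ r(4) _ _ r(5)])
      (use \<delta>(2) in \<open>auto intro!: Cinf_on_Pair Cinf_on_const Cinf_on_id simp: open_greaterThanLessThan abs_if\<close>)
  have "isCont (\<lambda>\<epsilon>. inv_into V \<psi> (F (?a \<epsilon>))) 0"
    by (rule curve_in_chart(2)[OF manifold_covered[OF MA] r(3) \<delta>0 Cx]) (use mV \<delta>0 in auto)
  moreover have "\<forall>\<^sub>F \<epsilon> in at 0. inv_into V \<psi> (F (?a \<epsilon>)) = m \<epsilon> ?g h"
    by (rule eventually_mono[OF eventually_at_0_less[OF \<delta>0]]) (use mV compat_chart_inv(2)[OF r(3)] in auto)
  moreover have "inv_into V \<psi> (F (?a 0)) = m 0 ?g h"
    using mV[of 0] \<delta>0 compat_chart_inv(2)[OF r(3)] by auto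
  ultimately have cont: "isCont (\<lambda>\<epsilon>. m \<epsilon> ?g h) 0" by (simp add: isCont_def tendsto_cong)
  have "(?a has_vector_derivative (1, 0, 0)) (at 0)"
    by (auto simp: has_vector_derivative_def zero_prod_def intro!: derivative_eq_intros)
  then have d: "((\<lambda>\<epsilon>. F (?a \<epsilon>)) has_vector_derivative frechet_derivative F (at (?a 0)) (1, 0, 0)) (at 0)"
    using Cinf_on_vector_derivative[OF r(5), of ?a "(1, 0, 0)" 0] p(4) by simp
  have "((\<lambda>\<epsilon>. \<psi> (m \<epsilon> ?g h)) has_vector_derivative frechet_derivative F (at (?a 0)) (1, 0, 0)) (at 0)"
    by (rule has_vector_derivative_eventually[OF d])
      (use mV mV[of 0] \<delta>0 in \<open>auto intro: eventually_mono[OF eventually_at_0_less[OF \<delta>0]]\<close>)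
  then obtain v where v: "v \<in> model A" "has_velocity A (\<lambda>\<epsilon>. m \<epsilon> ?g h) 0 v"
    "chart_comp A \<psi> (m 0 ?g h) v = frechet_derivative F (at (?a 0)) (1, 0, 0)"
    using has_velocity_ex[OF MA r(3), of "\<lambda>\<epsilon>. m \<epsilon> ?g h" 0, OF _ cont] mV(1)[of 0] \<delta>0 by auto
  then have "deformation_cocycle A G m k h = v" unfolding deformation_cocycle_def by (intro velocity_eqI)
  then show "has_velocity A (\<lambda>\<epsilon>. m \<epsilon> ?g h) 0 (deformation_cocycle A G m k h)"
    "chart_comp A \<psi> k (deformation_cocycle A G m k h) = frechet_derivative F (at (?a 0)) (1, 0, 0)"
    "deformation_cocycle A G m k h \<in> model A" "k \<in> V"
    using v k mV(1)[of 0] \<delta>0 by auto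
qed

text \<open>Both \<open>k\<close> and \<open>h\<close> vary; the composite with the multiplication is evaluated through
  a local expression of the latter.\<close>

lemma cocycle_local_rep:
  assumes kh: "src G k0 = tgt G h0" and cV: "compat_chart A V \<psi>" "k0 \<in> V" and cW: "compat_chart A W \<zeta>" "h0 \<in> W"
  obtains N X where "open N" "Cinf_on N X" "(\<psi> k0, \<zeta> h0) \<in> N"
    "\<And>k h. src G k = tgt G h \<Longrightarrow> k \<in> V \<Longrightarrow> h \<in> W \<Longrightarrow> (\<psi> k, \<zeta> h) \<in> N \<Longrightarrow>
      X (\<psi> k, \<zeta> h) = chart_comp A \<psi> k (deformation_cocycle A G m k h)"
proof -
  let ?g = "mul G k0 h0"
  obtain U \<phi> where cU: "compat_chart A U \<phi>" "?g \<in> U" using ex_compat_chart[OF MA] by blast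
  have s: "src G ?g = src G h0" by (rule src_mul[OF kh])
  have k0: "m 0 ?g h0 = k0" using m_0[OF s] division_mul[OF kh] by simp
  obtain N F where mr: "m_rep U \<phi> W \<zeta> V \<psi> N F" and N: "(0, \<phi> ?g, \<zeta> h0) \<in> N"
    using ex_m_rep[OF cU(1) cW(1) cV(1) cU(2) cW(2) I(2) s] k0 cV(2) by metis
  note r = m_repD[OF mr]
  obtain N' P where P: "open N'" "Cinf_on N' P" "(\<psi> k0, \<zeta> h0) \<in> N'"
    "\<And>k h. k \<in> V \<Longrightarrow> h \<in> W \<Longrightarrow> src G k = tgt G h \<Longrightarrow> (\<psi> k, \<zeta> h) \<in> N' \<Longrightarrow>
      mul G k h \<in> U \<and> P (\<psi> k, \<zeta> h) = \<phi> (mul G k h)"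
    using ex_mul_rep[OF cV(1) cW(1) cU(1) cV(2) cW(2) kh cU(2)] by metis
  let ?a = "\<lambda>z. (0::real, P z, snd z)"
  have Ca: "Cinf_on N' ?a"
    by (intro Cinf_on_Pair P Cinf_on_const Cinf_on_bounded_linear[OF P(1) bounded_linear_snd Cinf_on_id[OF P(1)]])
  define N'' where "N'' = N' \<inter> ?a -` N"
  have op: "open N''"
    using continuous_on_open_vimage[OF P(1)] Cinf_on_continuous[OF Ca] r(4) by (metis N''_def inf_commute)
  have "Cinf_on N'' (\<lambda>z. frechet_derivative F (at (?a z)) (1, 0, 0))"
    by (rule Cinf_on_frechet_at[OF op r(4) _ _ Cinf_on_const r(5)])
      (auto simp: N''_def intro: Cinf_on_subset[OF Ca])
  moreover have "(\<psi> k0, \<zeta> h0) \<in> N''"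
    using P(3) P(4)[OF cV(2) cW(2) kh P(3)] N by (simp add: N''_def)
  moreover have "frechet_derivative F (at (?a (\<psi> k, \<zeta> h))) (1, 0, 0) = chart_comp A \<psi> k (deformation_cocycle A G m k h)"
    if "src G k = tgt G h" "k \<in> V" "h \<in> W" "(\<psi> k, \<zeta> h) \<in> N''" for k h
    using cocycle_rep(3)[OF mr that(1) _ that(3)] P(4)[OF that(2,3,1)] that(4) by (simp add: N''_def)
  ultimately show ?thesis using that[of N'' "\<lambda>z. frechet_derivative F (at (?a z)) (1, 0, 0)"] op by blast
qed

lemma cocycle_in_model: 
  assumes "src G k = tgt G h" shows "deformation_cocycle A G m k h \<in> model A"
    "has_velocity A (\<lambda>\<epsilon>. m \<epsilon> (mul G k h) h) 0 (deformation_cocycle A G m k h)" "m 0 (mul G k h) h = k"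
proof -
  have s: "src G (mul G k h) = src G h" by (rule src_mul[OF assms])
  obtain U \<phi> W \<zeta> V \<psi> where c: "compat_chart A U \<phi>" "mul G k h \<in> U" "compat_chart A W \<zeta>" "h \<in> W"
    "compat_chart A V \<psi>" "m 0 (mul G k h) h \<in> V" using ex_compat_chart[OF MA] by metis
  obtain N F where mr: "m_rep U \<phi> W \<zeta> V \<psi> N F" "(0, \<phi> (mul G k h), \<zeta> h) \<in> N"
    using ex_m_rep[OF c(1,3,5,2,4) I(2) s c(6)] .
  show "deformation_cocycle A G m k h \<in> model A"
    "has_velocity A (\<lambda>\<epsilon>. m \<epsilon> (mul G k h) h) 0 (deformation_cocycle A G m k h)"
    using cocycle_rep(1,4)[OF mr(1) assms c(2,4) mr(2)] by auto
  show "m 0 (mul G k h) h = k" using m_0[OF s] division_mul[OF assms] by simp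
qed

text \<open>By \<open>src_m\<close> the source of \<open>m \<epsilon> (mul G k h) h\<close> depends
  on \<open>h\<close> alone, and so does its velocity; this supplies the function
  \<open>s\<^sub>c\<close> in the definition of \<open>Cdef2\<close>.\<close>

lemma cocycle_projection:
  assumes "src G k = tgt G h"
  shows "tangent_map A B UNIV (src G) k (deformation_cocycle A G m k h) = velocity B (\<lambda>\<epsilon>. src G (m \<epsilon> h h)) 0"
proof -
  note c = cocycle_in_model[OF assms]
  obtain U \<xi> V \<eta> D J where ad: "adapted_chart A B (src G) U \<xi> V \<eta> D J" and k: "k \<in> U" using ex_adapted .
  have s: "src G (mul G k h) = src G h" by (rule src_mul[OF assms])
  have "has_velocity B (\<lambda>\<epsilon>. src G (m \<epsilon> (mul G k h) h)) 0 (tangent_map A B UNIV (src G) k (deformation_cocycle A G m k h))"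
    by (rule adapted_chart_tangent_map(3)[OF MA MB ad k c(1)]) (use c(2,3) in auto)
  then have "has_velocity B (\<lambda>\<epsilon>. src G (m \<epsilon> h h)) 0 (tangent_map A B UNIV (src G) k (deformation_cocycle A G m k h))"
  proof (rule has_velocity_eventually)
    show "\<forall>\<^sub>F \<epsilon> in at 0. src G (m \<epsilon> (mul G k h) h) = src G (m \<epsilon> h h)"
      using eventually_at_in_open'[OF I] by eventually_elim (use src_m s in blast)
  qed (use src_m[OF I(2) s] in auto)
  then show ?thesis by (simp add: velocity_eqI)
qed

lemma cocycle_in_Cdef2: "deformation_cocycle A G m \<in> Cdef2 A B G"
proof -
  let ?c = "deformation_cocycle A G m"
  have cov: "covered (prod_structure A A)" by (intro covered_prod manifold_covered MA)
  have "smooth_along (prod_structure A A) A (composable G) fst (\<lambda>(g, h). ?c g h)"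
    unfolding smooth_along_def
  proof (intro conjI)
    show "smooth_map (prod_structure A A) A (composable G) fst"
    proof (rule smooth_map_if_local_rep[OF cov manifold_covered[OF MA]])
      fix z :: "'g \<times> 'g" assume "z \<in> composable G"
      obtain U \<phi> W \<zeta> where c: "compat_chart A U \<phi>" "fst z \<in> U" "compat_chart A W \<zeta>" "snd z \<in> W"
        using ex_compat_chart[OF MA] by metis
      have "local_rep (composable G) fst (U \<times> W) (map_prod \<phi> \<zeta>) U \<phi> UNIV fst"
        by (auto simp: local_rep_def intro!: Cinf_on_bounded_linear[OF open_UNIV bounded_linear_fst Cinf_on_id[OF open_UNIV]])
      then show "\<exists>U \<phi> V \<psi> N F. smooth_chart (prod_structure A A) U \<phi> \<and> smooth_chart A V \<psi> \<and> z \<in> U \<and> fst z \<in> V \<and>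
          \<phi> z \<in> N \<and> local_rep (composable G) fst U \<phi> V \<psi> N F"
        using smooth_chart_prod[OF compat_chartD(3)[OF c(1)] compat_chartD(3)[OF c(3)]] compat_chartD(3)[OF c(1)] c
        by (intro exI[of _ "U \<times> W"] exI[of _ "map_prod \<phi> \<zeta>"] exI[of _ U] exI[of _ \<phi>] exI[of _ UNIV] exI[of _ fst])
          (simp add: mem_Times_iff)
    qed
    show "(\<lambda>(g, h). ?c g h) ` composable G \<subseteq> model A"
      using cocycle_in_model(1) by (auto simp: composable_def)
    show "\<forall>(V, \<psi>)\<in>charts A. smooth_map (prod_structure A A) eucl {x \<in> composable G. fst x \<in> V}
        (\<lambda>x. chart_comp A \<psi> (fst x) ((\<lambda>(g, h). ?c g h) x))"
    proof clarify
      fix V \<psi> assume V: "(V, \<psi>) \<in> charts A"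
      note cV = manifold_compat_chart[OF MA V]
      let ?S = "{x \<in> composable G. fst x \<in> V}" and ?f = "\<lambda>x. chart_comp A \<psi> (fst x) ((\<lambda>(g, h). ?c g h) x)"
      show "smooth_map (prod_structure A A) eucl ?S ?f"
      proof (rule smooth_map_if_local_rep[OF cov covered_eucl])
        fix z assume z: "z \<in> ?S"
        then have kh: "src G (fst z) = tgt G (snd z)" "fst z \<in> V" by (auto simp: composable_def)
        obtain W \<zeta> where c: "compat_chart A W \<zeta>" "snd z \<in> W" using ex_compat_chart[OF MA] by metis
        obtain N X where X: "open N" "Cinf_on N X" "(\<psi> (fst z), \<zeta> (snd z)) \<in> N"
          "\<And>k h. src G k = tgt G h \<Longrightarrow> k \<in> V \<Longrightarrow> h \<in> W \<Longrightarrow> (\<psi> k, \<zeta> h) \<in> N \<Longrightarrow>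
            X (\<psi> k, \<zeta> h) = chart_comp A \<psi> k (?c k h)"
          using cocycle_local_rep[OF kh(1) cV kh(2) c] by metis
        have "local_rep ?S ?f (V \<times> W) (map_prod \<psi> \<zeta>) UNIV id N X"
          using X by (auto simp: local_rep_def composable_def)
        moreover have "map_prod \<psi> \<zeta> z \<in> N" using X(3) by (cases z) auto
        moreover have "z \<in> V \<times> W" using kh c by (simp add: mem_Times_iff)
        ultimately show "\<exists>U \<phi> V \<psi> N F. smooth_chart (prod_structure A A) U \<phi> \<and> smooth_chart eucl V \<psi> \<and> z \<in> U \<and>
            ?f z \<in> V \<and> \<phi> z \<in> N \<and> local_rep ?S ?f U \<phi> V \<psi> N F"
          using smooth_chart_prod[OF compat_chartD(3)[OF cV] compat_chartD(3)[OF c(1)]] smooth_chart_eucl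
          by (intro exI[of _ "V \<times> W"] exI[of _ "map_prod \<psi> \<zeta>"] exI[of _ UNIV] exI[of _ id] exI[of _ N] exI[of _ X])
            simp
      qed
    qed
  qed
  moreover have "\<forall>(g, h)\<in>composable G. tangent_map A B UNIV (src G) g (?c g h) = velocity B (\<lambda>\<epsilon>. src G (m \<epsilon> h h)) 0"
    using cocycle_projection by (auto simp: composable_def)
  ultimately show ?thesis unfolding Cdef2_def mem_Collect_eq
    by (intro conjI exI[of _ "\<lambda>h. velocity B (\<lambda>\<epsilon>. src G (m \<epsilon> h h)) 0"])
qed

end

section \<open>The action of vector fields on densities\<close>

text \<open>With \<open>Q\<close> a projection along the kernel of \<open>D\<close>, the difference \<open>Q (u t p - u t p')\<close> satisfies a
  linear differential inequality because \<open>D (Z x)\<close> depends only on \<open>D x\<close>.\<close>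

lemma flow_kernel:
  fixes Z :: "'a::euclidean_space \<Rightarrow> 'a" and D :: "'a \<Rightarrow> 'b::euclidean_space"
  assumes Z: "Cinf_on N Z" "open N" "cball x0 R \<subseteq> N" and M: "subspace M" and lin: "linear D" "linear Q"
    and Q: "\<And>x. Q x \<in> M" "\<And>x. x \<in> M \<Longrightarrow> D (Q x) = D x" "\<And>x y. D x = D y \<Longrightarrow> Q x = Q y"
    and c: "\<And>x. norm (Q x) \<le> c * norm x" "0 \<le> c" "\<rho> * (1 + 2 * c) \<le> R" and "0 < T"
    and u0: "\<And>p. p \<in> P \<Longrightarrow> u 0 p = p"
    and uB: "\<And>p t. p \<in> P \<Longrightarrow> \<bar>t\<bar> < T \<Longrightarrow> u t p \<in> cball x0 \<rho> \<inter> M"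
    and ud: "\<And>p t. p \<in> P \<Longrightarrow> \<bar>t\<bar> < T \<Longrightarrow> ((\<lambda>t. u t p) has_vector_derivative Z (u t p)) (at t)"
    and proj: "\<And>x y. x \<in> cball x0 R \<inter> M \<Longrightarrow> y \<in> cball x0 R \<inter> M \<Longrightarrow> D x = D y \<Longrightarrow> D (Z x) = D (Z y)"
  obtains \<tau> where "0 < \<tau>" "\<And>t p p'. \<bar>t\<bar> < \<tau> \<Longrightarrow> p \<in> P \<Longrightarrow> p' \<in> P \<Longrightarrow> D p = D p' \<Longrightarrow> D (u t p) = D (u t p')"
proof -
  obtain L where L: "L \<ge> 0"
    "\<And>x y. x \<in> cball x0 R \<Longrightarrow> y \<in> cball x0 R \<Longrightarrow> norm (Z x - Z y) \<le> L * norm (x - y)"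
    using Cinf_on_Lipschitz_cball[OF Z] by metis
  define \<tau> where "\<tau> = min (T/2) (1 / (2 * (c * L) + 1) / 2)"
  have cL: "0 \<le> c * L" using L(1) c(2) by simp
  have \<tau>: "0 < \<tau>" "\<tau> < T" using \<open>0 < T\<close> cL by (auto simp: \<tau>_def min_def)
  have "c * L * \<tau> \<le> c * L * (1 / (2 * (c * L) + 1) / 2)" using cL by (intro mult_left_mono) (auto simp: \<tau>_def)
  also have "\<dots> \<le> 1/2"
  proof -
    have "a * (1 / (2 * a + 1) / 2) \<le> 1/2" if "0 \<le> a" for a :: real using that by (simp add: divide_simps)
    then show ?thesis using cL .
  qed
  finally have L\<tau>: "c * L * \<tau> \<le> 1/2" .
  have "D (u t p) = D (u t p')" if p: "p \<in> P" "p' \<in> P" "D p = D p'" and t: "\<bar>t\<bar> < \<tau>" for t p p'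
  proof -
    define e where "e t = Q (u t p - u t p')" for t
    have "norm (e t) \<le> 2 * (norm (e 0) + \<tau> * 0)"
    proof (rule short_time_gronwall[where e'="\<lambda>t. Q (Z (u t p) - Z (u t p'))", OF _ _ cL L\<tau>])
      fix t assume "\<bar>t\<bar> \<le> \<tau>"
      then have t: "\<bar>t\<bar> < T" using \<tau> by simp
      show "(e has_vector_derivative Q (Z (u t p) - Z (u t p'))) (at t)"
        unfolding e_def using lin(2) ud p t
        by (intro bounded_linear.has_vector_derivative[of Q] has_vector_derivative_diff)
          (auto simp: linear_conv_bounded_linear)
      let ?x = "u t p" and ?y = "u t p'"
      have xy: "?x \<in> cball x0 \<rho> \<inter> M" "?y \<in> cball x0 \<rho> \<inter> M" using uB p t by auto
      then have "0 \<le> \<rho>" by (auto intro: order_trans[OF zero_le_dist])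
      then have "\<rho> * 1 \<le> \<rho> * (1 + 2 * c)" using c(2) by (intro mult_left_mono) auto
      then have "\<rho> \<le> R" using c(3) by simp
      \<comment> \<open>\<open>?x'\<close> has the same \<open>D\<close>-value as \<open>?x\<close>
        but differs from \<open>?y\<close> only by \<open>e t\<close>. Replacing \<open>?x\<close>
        by it under \<open>Q\<close> turns the Lipschitz bound of \<open>Z\<close> into one in terms
        of \<open>e t\<close>; the condition \<open>\<rho> * (1 + 2 * c) \<le> R\<close> keeps
        \<open>?x'\<close> in the ball.\<close>
      let ?x' = "?y + e t"
      have D: "D ?x' = D ?x"
        using Q(2)[OF subspace_diff[OF M, of ?x ?y]] xy by (simp add: e_def linear_add[OF lin(1)] linear_diff[OF lin(1)])
      have "norm (?x - ?y) \<le> 2 * \<rho>"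
        using xy norm_triangle_ineq4[of "?x - x0" "?y - x0"] by (auto simp: dist_norm norm_minus_commute)
      then have "norm (e t) \<le> c * (2 * \<rho>)"
        using c(1)[of "?x - ?y"] mult_left_mono[OF _ c(2)] order_trans by (fastforce simp: e_def)
      then have "dist x0 ?x' \<le> \<rho> + c * (2 * \<rho>)"
        using xy norm_triangle_ineq4[of "x0 - ?y" "e t"] by (auto simp: dist_norm diff_diff_eq)
      also have "\<dots> \<le> R" using c(3) by (simp add: algebra_simps)
      finally have x': "?x' \<in> cball x0 R \<inter> M"
        using xy Q(1) subspace_add[OF M] by (auto simp: e_def)
      have "D (Z ?x) = D (Z ?x')"
        by (rule proj) (use xy x' D \<open>\<rho> \<le> R\<close> in auto)
      then have "Q (Z ?x - Z ?y) = Q (Z ?x' - Z ?y)"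
        by (intro Q(3)) (simp add: linear_diff[OF lin(1)])
      then have "norm (Q (Z ?x - Z ?y)) \<le> c * norm (Z ?x' - Z ?y)" using c(1) by simp
      also have "\<dots> \<le> c * (L * norm (?x' - ?y))"
        using x' xy \<open>\<rho> \<le> R\<close> c(2) by (intro mult_left_mono L(2)) auto
      finally show "norm (Q (Z ?x - Z ?y)) \<le> c * L * norm (e t) + 0" by simp
    qed (use t in auto)
    moreover have "e 0 = 0"
      using Q(3)[of "p - p'" 0] p u0 linear_0[OF lin(2)] by (simp add: e_def linear_diff[OF lin(1)] linear_0[OF lin(1)])
    ultimately have "D (e t) = 0" by (simp add: linear_0[OF lin(1)])
    moreover have "u t p \<in> M" "u t p' \<in> M" using uB[OF p(1), of t] uB[OF p(2), of t] t \<tau> by auto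
    ultimately show ?thesis
      using Q(2)[OF subspace_diff[OF M]] by (simp add: e_def linear_diff[OF lin(1)])
  qed
  then show ?thesis using that \<tau>(1) by blast
qed

text \<open>The chart expression of a curve on the manifold is meaningful only while the curve stays
  in \<open>U\<close>, so the speed bound cannot be integrated directly. \<open>K\<close> is a
  compact chart preimage of a ball, hence closed in the manifold, and lies in the open set
  \<open>V\<close>: at a first exit time from \<open>V\<close> the curve would be in
  \<open>K\<close>, hence in \<open>V\<close> for a little longer. The bound
  \<open>C * T \<le> R / 4\<close> leads from radius \<open>R / 4\<close> to
  \<open>R / 2\<close>.\<close>

lemma confined_in_chart_pos:
  fixes A :: "('a::{t2_space, second_countable_topology}, 'e::euclidean_space) smooth_structure"
  assumes M: "manifold A" and c: "compat_chart A U \<xi>" and "0 < R"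
    and ball: "\<And>x. x \<in> model A \<Longrightarrow> dist x0 x \<le> R \<Longrightarrow> x \<in> \<xi> ` U"
    and cont: "\<And>t. 0 \<le> t \<Longrightarrow> t < T \<Longrightarrow> isCont \<gamma> t"
    and init: "\<gamma> 0 \<in> U" "dist x0 (\<xi> (\<gamma> 0)) \<le> R / 4"
    and vel: "\<And>t. 0 \<le> t \<Longrightarrow> t < T \<Longrightarrow> \<gamma> t \<in> U \<Longrightarrow> dist x0 (\<xi> (\<gamma> t)) \<le> R \<Longrightarrow>
       \<exists>w. ((\<lambda>t. \<xi> (\<gamma> t)) has_vector_derivative w) (at t) \<and> norm w \<le> C"
    and CT: "C * T \<le> R / 4" "0 \<le> C" and t: "0 \<le> t" "t < T"
  shows "\<gamma> t \<in> U \<and> dist x0 (\<xi> (\<gamma> t)) \<le> R / 2"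
proof -
  define V where "V = {q \<in> U. dist x0 (\<xi> q) < R}"
  define K where "K = {q \<in> U. dist x0 (\<xi> q) \<le> R / 2}"
  have "open V"
  proof -
    have "V = \<xi> -` ball x0 R \<inter> U" by (auto simp: V_def)
    then show ?thesis using continuous_on_open_vimage[OF compat_chartD(1)[OF c], of \<xi>] compat_chartD(5)[OF c] by simp
  qed
  have "closed K"
  proof -
    have sub: "cball x0 (R/2) \<inter> model A \<subseteq> \<xi> ` U"
      using ball \<open>0 < R\<close> by auto
    have "compact (cball x0 (R/2) \<inter> model A)"
      using closed_subspace[OF manifold_subspace[OF M]] by (intro compact_Int_closed) auto
    then have "compact (inv_into U \<xi> ` (cball x0 (R/2) \<inter> model A))"
      by (intro compact_continuous_image continuous_on_subset[OF compat_chartD(6)[OF c] sub])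
    moreover have "K = inv_into U \<xi> ` (cball x0 (R/2) \<inter> model A)"
    proof (intro equalityI subsetI)
      fix q assume "q \<in> K"
      then have "q = inv_into U \<xi> (\<xi> q)" "\<xi> q \<in> cball x0 (R/2) \<inter> model A"
        using compat_chart_inv(1,2)[OF c] by (auto simp: K_def)
      then show "q \<in> inv_into U \<xi> ` (cball x0 (R/2) \<inter> model A)" by blast
    next
      fix q assume "q \<in> inv_into U \<xi> ` (cball x0 (R/2) \<inter> model A)"
      then obtain x where x: "x \<in> cball x0 (R/2) \<inter> model A" "q = inv_into U \<xi> x" by auto
      then show "q \<in> K" using sub compat_chart_inv(3,4)[OF c, of x] by (auto simp: K_def)
    qed
    ultimately show ?thesis by (simp add: compact_imp_closed)
  qed
  have KV: "K \<subseteq> V" using \<open>0 < R\<close> by (auto simp: K_def V_def)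
  have inK: "\<gamma> s \<in> K" if s: "0 \<le> s" "s < T" and V: "\<And>r. 0 \<le> r \<Longrightarrow> r \<le> s \<Longrightarrow> \<gamma> r \<in> V" for s
  proof -
    obtain f' where f': "\<And>r. r \<in> {0..s} \<Longrightarrow> ((\<lambda>t. \<xi> (\<gamma> t)) has_vector_derivative f' r) (at r) \<and> norm (f' r) \<le> C"
    proof -
      have "\<forall>r\<in>{0..s}. \<exists>w. ((\<lambda>t. \<xi> (\<gamma> t)) has_vector_derivative w) (at r) \<and> norm w \<le> C"
      proof
        fix r assume "r \<in> {0..s}"
        then show "\<exists>w. ((\<lambda>t. \<xi> (\<gamma> t)) has_vector_derivative w) (at r) \<and> norm w \<le> C"
          using vel[of r] V[of r] s by (simp add: V_def)
      qed
      from bchoice[OF this] show ?thesis using that by blast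
    qed
    have "norm (\<xi> (\<gamma> s) - \<xi> (\<gamma> 0)) \<le> C * \<bar>s - 0\<bar>"
      by (rule vector_derivative_bound[where S="{0..s}" and f'=f' and f="\<lambda>t. \<xi> (\<gamma> t)"])
        (use f' s in \<open>auto intro: has_vector_derivative_at_within\<close>)
    also have "\<dots> \<le> C * T" using s CT(2) by (intro mult_left_mono) auto
    finally have "dist (\<xi> (\<gamma> 0)) (\<xi> (\<gamma> s)) \<le> R / 4" using CT(1) by (simp add: dist_norm norm_minus_commute)
    then have "dist x0 (\<xi> (\<gamma> s)) \<le> R / 2"
      using init(2) dist_triangle[of x0 "\<xi> (\<gamma> s)" "\<xi> (\<gamma> 0)"] by simp
    then show ?thesis using V[of s] s by (auto simp: K_def V_def)
  qed
  define bad where "bad = {t \<in> {0..<T}. \<gamma> t \<notin> V}"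
  have "bad = {}"
  proof (rule ccontr)
    assume "bad \<noteq> {}"
    define t1 where "t1 = Inf bad"
    have bb: "bdd_below bad" by (auto simp: bad_def intro: bdd_belowI[of _ 0])
    obtain b where b: "b \<in> bad" using \<open>bad \<noteq> {}\<close> by blast
    have t1: "0 \<le> t1" "t1 < T"
      using \<open>bad \<noteq> {}\<close> cInf_lower[OF b bb] b by (auto simp: t1_def bad_def intro!: cInf_greatest)
    have below: "\<gamma> r \<in> V" if "0 \<le> r" "r < t1" for r
      using cInf_lower[OF _ bb, of r] that t1 by (auto simp: t1_def bad_def)
    have "\<gamma> t1 \<in> K"
    proof (cases "t1 = 0")
      \<comment> \<open>At time 0 there is no earlier time from which to take a limit; the initial
        condition is used.\<close>
      case True
      then show ?thesis using init \<open>0 < R\<close> by (auto simp: K_def)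
    next
      case False
      have "(\<gamma> \<longlongrightarrow> \<gamma> t1) (at_left t1)"
        using cont[OF t1] filterlim_at_split unfolding isCont_def by blast
      moreover have "\<forall>\<^sub>F r in at_left t1. \<gamma> r \<in> K"
        using eventually_at_left_real[of 0 t1] False t1
        by (auto elim!: eventually_mono intro!: inK below)
      ultimately show ?thesis
        using \<open>closed K\<close> by (intro Lim_in_closed_set[of K _ "at_left t1"]) auto
    qed
    then have "\<gamma> t1 \<in> V" using KV by blast
    then obtain Q where Q: "open Q" "t1 \<in> Q" "\<And>r. r \<in> Q \<Longrightarrow> \<gamma> r \<in> V"
      using isCont_openD[OF cont[OF t1] \<open>open V\<close>] by metis
    then obtain e where e: "0 < e" "ball t1 e \<subseteq> Q" using open_contains_ball by blast
    have "t1 + e \<le> r" if "r \<in> bad" for r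
    proof (rule ccontr)
      assume "\<not> t1 + e \<le> r"
      moreover have "t1 \<le> r" using cInf_lower[OF that bb] by (simp add: t1_def)
      ultimately have "r \<in> ball t1 e" by (auto simp: dist_real_def)
      then show False using Q(3) e(2) that by (auto simp: bad_def)
    qed
    then have "t1 + e \<le> Inf bad" using \<open>bad \<noteq> {}\<close> by (intro cInf_greatest) auto
    then show False using e(1) by (simp add: t1_def)
  qed
  then have "\<gamma> t \<in> K" using t by (intro inK) (auto simp: bad_def)
  then show ?thesis by (auto simp: K_def)
qed

lemma confined_in_chart:
  fixes A :: "('a::{t2_space, second_countable_topology}, 'e::euclidean_space) smooth_structure"
  assumes M: "manifold A" and c: "compat_chart A U \<xi>" and "0 < R"
    and ball: "\<And>x. x \<in> model A \<Longrightarrow> dist x0 x \<le> R \<Longrightarrow> x \<in> \<xi> ` U"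
    and cont: "\<And>t. \<bar>t\<bar> < T \<Longrightarrow> isCont \<gamma> t"
    and init: "\<gamma> 0 \<in> U" "dist x0 (\<xi> (\<gamma> 0)) \<le> R / 4"
    and vel: "\<And>t. \<bar>t\<bar> < T \<Longrightarrow> \<gamma> t \<in> U \<Longrightarrow> dist x0 (\<xi> (\<gamma> t)) \<le> R \<Longrightarrow>
       \<exists>w. ((\<lambda>t. \<xi> (\<gamma> t)) has_vector_derivative w) (at t) \<and> norm w \<le> C"
    and CT: "C * T \<le> R / 4" "0 \<le> C" and t: "\<bar>t\<bar> < T"
  shows "\<gamma> t \<in> U \<and> dist x0 (\<xi> (\<gamma> t)) \<le> R / 2"
proof (cases "0 \<le> t")
  case True
  show ?thesis
    by (rule confined_in_chart_pos[OF M c \<open>0 < R\<close> ball, where T=T and \<gamma>=\<gamma> and C=C and t=t]) (use assms True in auto)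
next
  case False
  let ?\<gamma> = "\<lambda>t. \<gamma> (- t)"
  have "?\<gamma> (- t) \<in> U \<and> dist x0 (\<xi> (?\<gamma> (- t))) \<le> R / 2"
  proof (rule confined_in_chart_pos[OF M c \<open>0 < R\<close> ball, where T=T and \<gamma>="?\<gamma>" and C=C and t="- t"])
    show "isCont ?\<gamma> s" if "0 \<le> s" "s < T" for s
      using isCont_o2[of s uminus \<gamma>] cont[of "- s"] that by simp
    show "\<exists>w. ((\<lambda>t. \<xi> (?\<gamma> t)) has_vector_derivative w) (at s) \<and> norm w \<le> C"
      if s: "0 \<le> s" "s < T" "?\<gamma> s \<in> U" "dist x0 (\<xi> (?\<gamma> s)) \<le> R" for s
    proof -
      obtain w where w: "((\<lambda>t. \<xi> (\<gamma> t)) has_vector_derivative w) (at (- s))" "norm w \<le> C"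
        using vel[of "- s"] s by auto
      have "(uminus has_vector_derivative (-1::real)) (at s)"
        by (auto intro!: derivative_eq_intros)
      from vector_diff_chain_at[OF this] w(1)
      have "((\<lambda>t. \<xi> (\<gamma> (- t))) has_vector_derivative (- w)) (at s)" by (simp add: o_def)
      then show ?thesis using w(2) by (intro exI[of _ "- w"]) simp
    qed
  qed (use assms False in auto)
  then show ?thesis by simp
qed

text \<open>Smoothness of a vector field is defined by charts of the atlas. This transfers it to an
  adapted chart and shrinks \<open>N\<close> so that the chart points over \<open>N\<close> lie in
  the domain \<open>Q\<close>.\<close>

lemma vector_field_local_rep:
  fixes A :: "('a::{t2_space, second_countable_topology}, 'e::euclidean_space) smooth_structure"
  assumes M: "manifold A" and c: "compat_chart A U \<xi>" and Q: "open Q" "vector_field A Q Z" and p: "p \<in> U" "p \<in> Q"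
  obtains N W where "open N" "\<xi> p \<in> N" "Cinf_on N W"
    "\<And>q. q \<in> U \<Longrightarrow> \<xi> q \<in> N \<Longrightarrow> q \<in> Q" "\<And>q. q \<in> U \<Longrightarrow> \<xi> q \<in> N \<Longrightarrow> W (\<xi> q) = chart_comp A \<xi> q (Z q)"
proof -
  obtain V \<phi> where V: "chart_at A p = (V, \<phi>)" by fastforce
  note cV = chart_at[OF M V]
  have sm: "smooth_map A eucl {x \<in> Q. id x \<in> V} (\<lambda>x. chart_comp A \<phi> (id x) (Z x))" and Zm: "Z ` Q \<subseteq> model A"
    using Q(2) cV(1) unfolding vector_field_def smooth_along_def by blast+
  obtain N1 W1 where N1: "\<xi> p \<in> N1" and rep: "local_rep {x \<in> Q. id x \<in> V} (\<lambda>x. chart_comp A \<phi> (id x) (Z x)) U \<xi> UNIV id N1 W1"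
    using smooth_map_local_rep[OF sm compat_chartD(3)[OF c] smooth_chart_eucl, of p] p cV(2) by auto
  obtain N2 F2 where F2: "open N2" "\<phi> p \<in> N2" "Cinf_on N2 F2" "\<And>q. q \<in> V \<Longrightarrow> \<phi> q \<in> N2 \<Longrightarrow> q \<in> U \<and> F2 (\<phi> q) = \<xi> q"
    using trans_at_compat[OF M cV(3) c cV(2) p(1)] by (auto simp: trans_at_def)
  obtain N3 F3 where F3: "open N3" "\<xi> p \<in> N3" "Cinf_on N3 F3" "\<And>q. q \<in> U \<Longrightarrow> \<xi> q \<in> N3 \<Longrightarrow> q \<in> V \<and> F3 (\<xi> q) = \<phi> q"
    using trans_at_compat[OF M c cV(3) p(1) cV(2)] by (auto simp: trans_at_def)
  obtain N4 where N4: "open N4" "\<xi> p \<in> N4" "\<forall>x\<in>model A \<inter> N4. x \<in> \<xi> ` (U \<inter> Q)"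
    using compat_chart_nbhd[OF c Q(1) p(2,1)] by blast
  have inQ: "q \<in> Q" if "q \<in> U" "\<xi> q \<in> N4" for q
  proof -
    have "\<xi> q \<in> \<xi> ` (U \<inter> Q)" using N4(3) compat_chart_inv(1)[OF c that(1)] that(2) by blast
    then show ?thesis using compat_chartD(4)[OF c] that(1) by (auto simp: inj_on_def)
  qed
  define N where "N = N1 \<inter> (N3 \<inter> F3 -` N2) \<inter> N4"
  have "open (F3 -` N2 \<inter> N3)"
    using continuous_on_open_vimage[OF F3(1)] Cinf_on_continuous[OF F3(3)] F2(1) by blast
  then have op: "open N" unfolding N_def using local_repD(1)[OF rep] N4(1) by (metis inf_commute open_Int)
  have "Cinf_on N (\<lambda>x. frechet_derivative F2 (at (F3 x)) (W1 x))"
    by (rule Cinf_on_frechet_at[OF op F2(1) _ _ _ F2(3)])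
      (auto simp: N_def intro: Cinf_on_subset[OF F3(3)] Cinf_on_subset[OF local_repD(2)[OF rep]])
  moreover have "\<xi> p \<in> N" using N1 F3(2) F3(4)[OF p(1) F3(2)] F2(2) N4(2) by (simp add: N_def)
  moreover have "q \<in> Q \<and> frechet_derivative F2 (at (F3 (\<xi> q))) (W1 (\<xi> q)) = chart_comp A \<xi> q (Z q)"
    if q: "q \<in> U" "\<xi> q \<in> N" for q
  proof -
    have qs: "q \<in> Q" "q \<in> V" "F3 (\<xi> q) = \<phi> q" "\<phi> q \<in> N2" using inQ F3(4)[OF q(1)] q by (auto simp: N_def)
    have "chart_comp A \<xi> q (Z q) = frechet_derivative F2 (at (\<phi> q)) (chart_comp A \<phi> q (Z q))"
      by (rule chart_comp_change[OF M cV(3) c qs(2) F2(1) qs(4) F2(3,4)]) (use Zm qs(1) in auto)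
    moreover have "W1 (\<xi> q) = chart_comp A \<phi> q (Z q)"
      using local_repD(4)[OF rep, of q] qs q by (simp add: N_def)
    ultimately show ?thesis using qs by simp
  qed
  ultimately show ?thesis using that[of N] op by blast
qed

lemma isCont_from_chart:
  assumes c: "compat_chart A U \<xi>" and p: "\<gamma> t \<in> U" "\<forall>\<^sub>F s in at t. \<gamma> s \<in> U" and cont: "isCont (\<lambda>s. \<xi> (\<gamma> s)) t"
  shows "isCont \<gamma> t"
  unfolding isCont_def
proof (rule topological_tendstoI)
  fix Q assume Q: "open Q" "\<gamma> t \<in> Q"
  obtain N' where N': "open N'" "\<xi> (\<gamma> t) \<in> N'" "\<forall>x\<in>model A \<inter> N'. x \<in> \<xi> ` (U \<inter> Q)"
    using compat_chart_nbhd[OF c Q p(1)] by auto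
  have "\<forall>\<^sub>F s in at t. \<xi> (\<gamma> s) \<in> N'"
    by (rule isCont_eventually[OF cont]) (use N' in auto)
  then show "\<forall>\<^sub>F s in at t. \<gamma> s \<in> Q"
    using p(2)
  proof eventually_elim
    case (elim s)
    then have "\<xi> (\<gamma> s) \<in> \<xi> ` (U \<inter> Q)" using N'(3) compat_chart_inv(1)[OF c] by blast
    then show ?case using compat_chartD(4)[OF c] elim by (auto simp: inj_on_def)
  qed
qed

lemma compat_chart_cball:
  fixes A :: "('a::{t2_space, second_countable_topology}, 'e::euclidean_space) smooth_structure"
  assumes "compat_chart A U \<xi>" "p \<in> U" "open Q" "p \<in> Q" "open N" "\<xi> p \<in> N"
  obtains R where "0 < R" "cball (\<xi> p) R \<subseteq> N" "\<And>x. x \<in> model A \<Longrightarrow> dist (\<xi> p) x \<le> R \<Longrightarrow> x \<in> \<xi> ` (U \<inter> Q)"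
proof -
  obtain N' where N': "open N'" "\<xi> p \<in> N'" "\<forall>x\<in>model A \<inter> N'. x \<in> \<xi> ` (U \<inter> Q)"
    using compat_chart_nbhd[OF assms(1,3,4,2)] by blast
  moreover have "open (N \<inter> N')" "\<xi> p \<in> N \<inter> N'" using assms(5,6) N' by auto
  then obtain R where "0 < R" "cball (\<xi> p) R \<subseteq> N \<inter> N'"
    using open_contains_cball by metis
  ultimately show ?thesis using that[of R] N'(3) by (auto simp: subset_iff)
qed

lemma Cinf_on_bounded_cball:
  fixes F :: "'a::euclidean_space \<Rightarrow> 'b::euclidean_space"
  assumes "Cinf_on N F" "cball x0 R \<subseteq> N"
  obtains C where "0 \<le> C" "\<And>x. x \<in> cball x0 R \<Longrightarrow> norm (F x) \<le> C"
proof -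
  have "bounded (F ` cball x0 R)"
    by (intro compact_imp_bounded compact_continuous_image continuous_on_subset[OF Cinf_on_continuous[OF assms(1)] assms(2)]) auto
  then obtain C where "C > 0" "\<forall>y\<in>F ` cball x0 R. norm y \<le> C" by (auto simp: bounded_pos)
  then show ?thesis using that[of C] by auto
qed

section \<open>Flows of projectable vector fields and their differentials\<close>

context deformation
begin

text \<open>A \<open>local_flow\<close> comes without smoothness in the starting point. Near
  \<open>k\<close> its orbits are confined to the chart, where they solve the equation for
  \<open>Z'\<close>; \<open>flow_differentiable\<close> then yields the differential, and
  \<open>flow_kernel\<close> its compatibility with \<open>ker ds\<close>.\<close>

lemma flow_tangent:
  assumes ad: "adapted_chart A B (src G) U \<xi> V \<eta> D J" and k: "k \<in> U"
    and sp: "s_projectable A B G U' Z" and fl: "local_flow A U' Z W \<delta> \<Phi>" and kW: "k \<in> W"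
    and N: "open N" "\<xi> k \<in> N" "Cinf_on N Z'" "\<And>q. q \<in> U \<Longrightarrow> \<xi> q \<in> N \<Longrightarrow> q \<in> U'"
      "\<And>q. q \<in> U \<Longrightarrow> \<xi> q \<in> N \<Longrightarrow> Z' (\<xi> q) = chart_comp A \<xi> q (Z q)"
  obtains \<tau> Y where "0 < \<tau>" "\<And>t. \<bar>t\<bar> < \<tau> \<Longrightarrow> \<Phi> t k \<in> U" "\<Phi> 0 k = k"
    "((\<lambda>t. \<xi> (\<Phi> t k)) has_vector_derivative Z' (\<xi> k)) (at 0)"
    "\<And>t. \<bar>t\<bar> < \<tau> \<Longrightarrow> linear (Y t)" "\<And>v. Y 0 v = v"
    "\<And>v. ((\<lambda>t. Y t v) has_vector_derivative frechet_derivative Z' (at (\<xi> k)) v) (at 0)"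
    "\<And>t v. \<bar>t\<bar> < \<tau> \<Longrightarrow> v \<in> ker_ds A B G k \<Longrightarrow> tangent_map A A W (\<Phi> t) k v \<in> ker_ds A B G (\<Phi> t k)"
    "\<And>t v. \<bar>t\<bar> < \<tau> \<Longrightarrow> v \<in> ker_ds A B G k \<Longrightarrow>
       chart_comp A \<xi> (\<Phi> t k) (tangent_map A A W (\<Phi> t) k v) = Y t (chart_comp A \<xi> k v)"
proof -
  note aD = adapted_chartD[OF ad] and sA = manifold_subspace[OF MA]
  let ?x0 = "\<xi> k"
  have opW: "open W" and "0 < \<delta>" and fl0: "\<And>p. p \<in> W \<Longrightarrow> \<Phi> 0 p = p"
    and flU: "\<And>p t. p \<in> W \<Longrightarrow> \<bar>t\<bar> < \<delta> \<Longrightarrow> \<Phi> t p \<in> U'"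
    and flv: "\<And>p t. p \<in> W \<Longrightarrow> \<bar>t\<bar> < \<delta> \<Longrightarrow> has_velocity A (\<lambda>\<tau>. \<Phi> \<tau> p) t (Z (\<Phi> t p))"
    using fl by (auto simp: local_flow_def abs_if split: if_splits)
  have ZA: "Z q \<in> model A" if "q \<in> U'" for q
    using sp that by (auto simp: s_projectable_def vector_field_def smooth_along_def)
  obtain Y' where Y': "\<And>q. q \<in> U' \<Longrightarrow> tangent_map A B UNIV (src G) q (Z q) = Y' (src G q)"
    using sp unfolding s_projectable_def by blast
  obtain R where R: "0 < R" "cball ?x0 R \<subseteq> N" "\<And>x. x \<in> model A \<Longrightarrow> dist ?x0 x \<le> R \<Longrightarrow> x \<in> \<xi> ` (U \<inter> W)"
    using compat_chart_cball[OF aD(1) k opW kW N(1,2)] by metis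
  obtain C where C: "0 \<le> C" "\<And>x. x \<in> cball ?x0 R \<Longrightarrow> norm (Z' x) \<le> C"
    using Cinf_on_bounded_cball[OF N(3) R(2)] by metis
  define Q where "Q x = J (D x)" for x
  have linQ: "linear Q" using linear_compose[OF aD(3,4)] by (simp add: Q_def[abs_def] o_def)
  obtain c where c: "0 < c" "\<And>x. norm (Q x) \<le> c * norm x" using linear_bounded_pos[OF linQ] by blast
  \<comment> \<open>Chosen so that the auxiliary points in \<open>flow_kernel\<close>, displaced by
    at most \<open>2 * c * \<rho>\<close>, remain in the ball of radius \<open>R\<close>.\<close>
  define \<rho> where "\<rho> = R / (1 + 2 * c)"
  have \<rho>: "0 < \<rho>" "\<rho> * (1 + 2 * c) \<le> R" using R(1) c(1) by (auto simp: \<rho>_def)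
  have "\<rho> * 1 \<le> \<rho> * (1 + 2 * c)" using c(1) \<rho>(1) by (intro mult_left_mono) auto
  then have \<rho>R: "\<rho> \<le> R" using \<rho>(2) by simp
  \<comment> \<open>During this time orbits of speed at most \<open>C\<close> that start within
    \<open>\<rho> / 4\<close> stay within \<open>\<rho> / 2\<close>; \<open>C + 1\<close> avoids a
    division by 0.\<close>
  define T where "T = min \<delta> (\<rho> / (4 * (C + 1)))"
  have T: "0 < T" "T \<le> \<delta>" using \<open>0 < \<delta>\<close> \<rho>(1) C(1) by (auto simp: T_def)
  have "C * T \<le> C * (\<rho> / (4 * (C + 1)))" using C(1) by (intro mult_left_mono) (auto simp: T_def)
  also have "\<dots> \<le> \<rho> / 4" using C(1) \<rho>(1) by (simp add: divide_simps)
  finally have CT: "C * T \<le> \<rho> / 4" .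
  \<comment> \<open>Starting points in coordinates. Only points of the model correspond to points of
    the manifold, so \<open>P\<close> is in general not a neighborhood of \<open>?x0\<close> in the
    ambient space.\<close>
  define P where "P = {x \<in> model A. dist ?x0 x \<le> \<rho> / 4}"
  define u where "u t x = \<xi> (\<Phi> t (inv_into U \<xi> x))" for t x
  have PU: "inv_into U \<xi> x \<in> U" "inv_into U \<xi> x \<in> W" "\<xi> (inv_into U \<xi> x) = x" if "x \<in> P" for x
  proof -
    have "x \<in> \<xi> ` (U \<inter> W)" using that R(3)[of x] \<rho>(1) \<rho>R by (auto simp: P_def)
    then show "inv_into U \<xi> x \<in> U" "inv_into U \<xi> x \<in> W" "\<xi> (inv_into U \<xi> x) = x"
      using compat_chart_inv(2)[OF aD(1)] by auto
  qed
  have der: "((\<lambda>t. \<xi> (\<Phi> t q)) has_vector_derivative Z' (\<xi> (\<Phi> t q))) (at t)"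
    if "q \<in> W" "\<bar>t\<bar> < T" "\<Phi> t q \<in> U" "dist ?x0 (\<xi> (\<Phi> t q)) \<le> \<rho>" for q t
  proof -
    have "\<bar>t\<bar> < \<delta>" using that T by simp
    then have "((\<lambda>t. \<xi> (\<Phi> t q)) has_vector_derivative chart_comp A \<xi> (\<Phi> t q) (Z (\<Phi> t q))) (at t)"
      using has_velocity_iff[OF MA aD(1), of "\<lambda>t. \<Phi> t q" t "Z (\<Phi> t q)"] that flv[OF that(1)] ZA[OF flU[OF that(1)]] by auto
    moreover have "\<xi> (\<Phi> t q) \<in> N" using that(4) \<rho>R R(2) by auto
    ultimately show ?thesis using N(5)[OF that(3)] by simp
  qed
  have conf: "\<Phi> t q \<in> U \<and> dist ?x0 (\<xi> (\<Phi> t q)) \<le> \<rho> / 2" if q: "q \<in> U" "q \<in> W" "dist ?x0 (\<xi> q) \<le> \<rho> / 4" and t: "\<bar>t\<bar> < T" for q t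
  proof (rule confined_in_chart[OF MA aD(1) \<rho>(1) _ _ _ _ _ CT C(1) t, where \<gamma>="\<lambda>t. \<Phi> t q"])
    show "x \<in> \<xi> ` U" if "x \<in> model A" "dist ?x0 x \<le> \<rho>" for x using R(3)[of x] that \<rho>R by auto
    show "isCont (\<lambda>t. \<Phi> t q) t" if "\<bar>t\<bar> < T" for t
      using flv[OF q(2), of t] that T by (simp add: has_velocity_def)
    show "\<exists>w. ((\<lambda>t. \<xi> (\<Phi> t q)) has_vector_derivative w) (at t) \<and> norm w \<le> C"
      if "\<bar>t\<bar> < T" "\<Phi> t q \<in> U" "dist ?x0 (\<xi> (\<Phi> t q)) \<le> \<rho>" for t
      using der[OF q(2) that] C(2)[of "\<xi> (\<Phi> t q)"] that(3) \<rho>R by auto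
  qed (use q fl0[OF q(2)] in auto)
  have u0: "u 0 x = x" if "x \<in> P" for x using PU[OF that] fl0 by (simp add: u_def)
  have uU: "\<Phi> t (inv_into U \<xi> x) \<in> U" "dist ?x0 (u t x) \<le> \<rho> / 2" if "x \<in> P" "\<bar>t\<bar> < T" for x t
    using conf[OF PU(1,2)[OF that(1)] _ that(2)] PU(3)[OF that(1)] that(1) by (auto simp: u_def P_def)
  have uB: "u t x \<in> cball ?x0 \<rho> \<inter> model A" if "x \<in> P" "\<bar>t\<bar> < T" for x t
    using uU[OF that] compat_chart_inv(1)[OF aD(1)] \<rho>(1) by (auto simp: u_def)
  have ud: "((\<lambda>t. u t x) has_vector_derivative Z' (u t x)) (at t)" if "x \<in> P" "\<bar>t\<bar> < T" for x t
    using der[OF PU(2)[OF that(1)] that(2) uU(1)[OF that]] uU(2)[OF that] \<rho>(1) by (simp add: u_def)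
  have x0P: "?x0 \<in> P" using compat_chart_inv(1)[OF aD(1) k] \<rho>(1) by (simp add: P_def)
  have cN: "cball ?x0 \<rho> \<subseteq> N" using R(2) \<rho>R by auto
  have uB': "u t p \<in> cball ?x0 \<rho>" if "p \<in> P" "\<bar>t\<bar> < T" for p t
    using uB that by auto
  obtain \<tau>1 Y where Y: "0 < \<tau>1" "\<tau>1 \<le> T" "\<And>t. \<bar>t\<bar> < \<tau>1 \<Longrightarrow> linear (Y t)" "\<And>v. Y 0 v = v"
    "\<And>v. ((\<lambda>t. Y t v) has_vector_derivative frechet_derivative Z' (at ?x0) v) (at 0)"
    "\<And>t c v. \<bar>t\<bar> < \<tau>1 \<Longrightarrow> c 0 = ?x0 \<Longrightarrow> (c has_vector_derivative v) (at 0) \<Longrightarrow>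
       (\<forall>\<^sub>F s in at 0. c s \<in> P) \<Longrightarrow> ((\<lambda>s. u t (c s)) has_vector_derivative Y t v) (at 0)"
    by (rule flow_differentiable[OF N(3,1) cN T(1) x0P, of u, OF u0 uB' ud])
      (assumption | (rule that; assumption))+
  obtain \<tau>2 where \<tau>2: "0 < \<tau>2"
    "\<And>t p p'. \<bar>t\<bar> < \<tau>2 \<Longrightarrow> p \<in> P \<Longrightarrow> p' \<in> P \<Longrightarrow> D p = D p' \<Longrightarrow> D (u t p) = D (u t p')"
  proof (rule flow_kernel[OF N(3,1) R(2) sA aD(3) linQ _ _ _ c(2) less_imp_le[OF c(1)] \<rho>(2) T(1), of P u])
    show "Q x \<in> model A" for x using aD(6) by (simp add: Q_def)
    show "D (Q x) = D x" if "x \<in> model A" for x using aD(7)[OF aD(5)[OF that]] by (simp add: Q_def)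
    show "Q x = Q y" if "D x = D y" for x y using that by (simp add: Q_def)
    show "D (Z' x) = D (Z' y)" if xy: "x \<in> cball ?x0 R \<inter> model A" "y \<in> cball ?x0 R \<inter> model A" "D x = D y" for x y
    proof -
      obtain q q' where q: "q \<in> U" "x = \<xi> q" "q' \<in> U" "y = \<xi> q'"
        using R(3)[of x] R(3)[of y] xy by auto
      have qN: "\<xi> q \<in> N" "\<xi> q' \<in> N" using q xy R(2) by auto
      note qU = N(4)[OF q(1) qN(1)] N(4)[OF q(3) qN(2)]
      have s: "src G q = src G q'" using src_eq_adapted[OF ad q(1,3)] q xy(3) by simp
      have "D (Z' x) = chart_comp B \<eta> (src G q) (Y' (src G q))"
        using adapted_chart_tangent_map(2)[OF MA MB ad q(1) ZA[OF qU(1)]] Y'[OF qU(1)] N(5)[OF q(1) qN(1)] q(2) by simp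
      moreover have "D (Z' y) = chart_comp B \<eta> (src G q') (Y' (src G q'))"
        using adapted_chart_tangent_map(2)[OF MA MB ad q(3) ZA[OF qU(2)]] Y'[OF qU(2)] N(5)[OF q(3) qN(2)] q(4) by simp
      ultimately show ?thesis using s by simp
    qed
  qed ((rule u0; assumption) | (rule uB; assumption) | (rule ud; assumption) | (rule that; assumption))+
  define \<tau> where "\<tau> = min \<tau>1 \<tau>2"
  have \<tau>: "0 < \<tau>" "\<And>t. \<bar>t\<bar> < \<tau> \<Longrightarrow> \<bar>t\<bar> < \<tau>1" "\<And>t. \<bar>t\<bar> < \<tau> \<Longrightarrow> \<bar>t\<bar> < \<tau>2" "\<And>t. \<bar>t\<bar> < \<tau> \<Longrightarrow> \<bar>t\<bar> < T"
    using Y(1,2) \<tau>2(1) by (auto simp: \<tau>_def)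
  have uk: "u t ?x0 = \<xi> (\<Phi> t k)" for t using compat_chart_inv(2)[OF aD(1) k] by (simp add: u_def)
  have \<Phi>U: "\<Phi> t k \<in> U" if "\<bar>t\<bar> < T" for t using conf[OF k kW] that \<rho>(1) by auto
  have tm: "tangent_map A A W (\<Phi> t) k v \<in> model A \<and>
      chart_comp A \<xi> (\<Phi> t k) (tangent_map A A W (\<Phi> t) k v) = Y t (chart_comp A \<xi> k v)"
    if t: "\<bar>t\<bar> < \<tau>" and v: "v \<in> model A" for t v
  proof -
    \<comment> \<open>The very curve chosen in the definition of \<open>tangent_map\<close>; the
      velocity of its image is the value to be computed.\<close>
    define \<gamma> where "\<gamma> = (SOME \<gamma>. curve_in A W k v \<gamma>)"
    obtain \<gamma>0 where "curve_in A W k v \<gamma>0" using curve_in_open[OF MA opW kW v] .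
    then have "curve_in A W k v \<gamma>" unfolding \<gamma>_def by (rule someI[of "\<lambda>\<gamma>. curve_in A W k v \<gamma>"])
    then have \<gamma>: "\<gamma> 0 = k" "has_velocity A \<gamma> 0 v" by (auto simp only: curve_in_def)
    have i: "isCont \<gamma> 0" and d: "((\<lambda>s. \<xi> (\<gamma> s)) has_vector_derivative chart_comp A \<xi> k v) (at 0)"
      using has_velocity_iff[OF MA aD(1), of \<gamma> 0 v] \<gamma> k v by auto
    have ev: "\<forall>\<^sub>F s in at 0. \<gamma> s \<in> U \<and> \<xi> (\<gamma> s) \<in> ball ?x0 (\<rho> / 4)"
      by (rule compat_chart_eventually[OF aD(1) i]) (use \<gamma> k \<rho>(1) in auto)
    then have ev2: "\<forall>\<^sub>F s in at 0. \<xi> (\<gamma> s) \<in> P"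
      by eventually_elim (use compat_chart_inv(1)[OF aD(1)] in \<open>auto simp: P_def\<close>)
    have d1: "((\<lambda>s. u t (\<xi> (\<gamma> s))) has_vector_derivative Y t (chart_comp A \<xi> k v)) (at 0)"
      by (rule Y(6)[OF \<tau>(2)[OF t] _ d ev2]) (simp add: \<gamma>)
    have ev3: "\<forall>\<^sub>F s in at 0. u t (\<xi> (\<gamma> s)) = \<xi> (\<Phi> t (\<gamma> s))"
      using ev by eventually_elim (use compat_chart_inv(2)[OF aD(1)] in \<open>auto simp: u_def\<close>)
    have d2: "((\<lambda>s. \<xi> (\<Phi> t (\<gamma> s))) has_vector_derivative Y t (chart_comp A \<xi> k v)) (at 0)"
      by (rule has_vector_derivative_eventually[OF d1 ev3]) (simp add: uk \<gamma>)
    have ev4: "\<forall>\<^sub>F s in at 0. \<Phi> t (\<gamma> s) \<in> U"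
      using ev ev2 by eventually_elim (use uU(1)[OF _ \<tau>(4)[OF t]] compat_chart_inv(2)[OF aD(1)] in fastforce)
    have cont: "isCont (\<lambda>s. \<Phi> t (\<gamma> s)) 0"
      by (rule isCont_from_chart[OF aD(1) _ ev4 has_vector_derivative_continuous[OF d2]]) (use \<gamma> \<Phi>U \<tau>(4)[OF t] in auto)
    obtain w where w: "w \<in> model A" "has_velocity A (\<lambda>s. \<Phi> t (\<gamma> s)) 0 w"
      "chart_comp A \<xi> (\<Phi> t (\<gamma> 0)) w = Y t (chart_comp A \<xi> k v)"
      by (rule has_velocity_ex[OF MA aD(1) _ cont d2]) (use \<gamma> \<Phi>U \<tau>(4)[OF t] in auto)
    have "tangent_map A A W (\<Phi> t) k v = w"
      unfolding tangent_map_def \<gamma>_def[symmetric] using velocity_eqI[OF w(2)] by (simp add: o_def)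
    then show ?thesis using w \<gamma> by simp
  qed
  show ?thesis
  proof (rule that[of \<tau> Y, OF \<tau>(1)])
    show "\<Phi> t k \<in> U" if "\<bar>t\<bar> < \<tau>" for t using \<Phi>U \<tau>(4)[OF that] .
    show "\<Phi> 0 k = k" by (rule fl0[OF kW])
    show "((\<lambda>t. \<xi> (\<Phi> t k)) has_vector_derivative Z' ?x0) (at 0)"
      using ud[OF x0P, of 0] T(1) u0[OF x0P] by (simp add: uk)
    fix t v assume t: "\<bar>t\<bar> < \<tau>" and v: "v \<in> ker_ds A B G k"
    let ?v = "chart_comp A \<xi> k v"
    have vA: "v \<in> model A" and Dv: "D ?v = 0" using v ker_ds_adapted[OF MA MB ad k] by auto
    have v'A: "?v \<in> model A" by (rule chart_comp_in_model[OF MA aD(1) k vA])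
    show "chart_comp A \<xi> (\<Phi> t k) (tangent_map A A W (\<Phi> t) k v) = Y t ?v" using tm[OF t vA] by simp
    have "isCont (\<lambda>s. ?x0 + s *\<^sub>R ?v) 0" by (rule isCont_line)
    then have "\<forall>\<^sub>F s in at 0. ?x0 + s *\<^sub>R ?v \<in> ball ?x0 (\<rho> / 4)"
      by (rule isCont_eventually) (use \<rho>(1) in auto)
    then have evP: "\<forall>\<^sub>F s in at 0. ?x0 + s *\<^sub>R ?v \<in> P"
      by eventually_elim (use compat_chart_inv(1)[OF aD(1) k] v'A sA in \<open>auto simp: P_def subspace_add subspace_scale\<close>)
    have "((\<lambda>s. u t (?x0 + s *\<^sub>R ?v)) has_vector_derivative Y t ?v) (at 0)"
      by (rule Y(6)[OF \<tau>(2)[OF t] _ has_vector_derivative_line evP]) simp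
    then have "((\<lambda>s. D (u t (?x0 + s *\<^sub>R ?v))) has_vector_derivative D (Y t ?v)) (at 0)"
      by (rule bounded_linear.has_vector_derivative[OF linear_conv_bounded_linear[THEN iffD1, OF aD(3)]])
    \<comment> \<open>The line in the direction \<open>?v\<close> has constant
      \<open>D\<close>-value, and by \<open>\<tau>2\<close> so does its image under the flow; hence
      \<open>Y t ?v\<close> lies in the kernel of \<open>D\<close>.\<close>
    moreover have "((\<lambda>s. D (u t (?x0 + s *\<^sub>R ?v))) has_vector_derivative 0) (at 0)"
    proof (rule has_vector_derivative_eventually[OF has_vector_derivative_const])
      show "\<forall>\<^sub>F s in at 0. D (u t ?x0) = D (u t (?x0 + s *\<^sub>R ?v))"
      proof (rule eventually_mono[OF evP])
        fix s :: real assume s: "?x0 + s *\<^sub>R ?v \<in> P"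
        have "D (?x0 + s *\<^sub>R ?v) = D ?x0" by (simp only: linear_add[OF aD(3)] linear_cmul[OF aD(3)] Dv scaleR_zero_right add_0_right)
        then show "D (u t ?x0) = D (u t (?x0 + s *\<^sub>R ?v))"
          by (intro \<tau>2(2)[OF \<tau>(3)[OF t] x0P s]) simp
      qed
    qed simp
    ultimately have "D (Y t ?v) = 0" using vector_derivative_unique_at by blast
    then show "tangent_map A A W (\<Phi> t) k v \<in> ker_ds A B G (\<Phi> t k)"
      using tm[OF t vA] ker_ds_adapted[OF MA MB ad \<Phi>U[OF \<tau>(4)[OF t]]] by simp
  qed (use Y \<tau> in auto)
qed

end

lemma open_vimage_Int:
  "open U \<Longrightarrow> continuous_on U f \<Longrightarrow> open V \<Longrightarrow> open (f -` V \<inter> U)"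
  using continuous_on_open_vimage by blast

context deformation
begin

text \<open>Ensures that the description in \<open>vf_action\<close> is not vacuous. The components
  of \<open>X\<close> along the fiber are extended to be constant in the directions of
  \<open>J\<close>; the projected field then has constant components in the chart of
  \<open>B\<close>, and the flow is built in coordinates by \<open>picard\<close>.\<close>

lemma ex_projectable_flow:
  assumes ad: "adapted_chart A B (src G) U \<xi> V \<eta> D J" and k: "k \<in> U"
    and N: "open N" "\<xi> k \<in> N" "Cinf_on N X'"
      "\<And>q. q \<in> U \<Longrightarrow> src G q = src G k \<Longrightarrow> \<xi> q \<in> N \<Longrightarrow> X' (\<xi> q) = chart_comp A \<xi> q (X q)"
    and X: "\<And>q. src G q = src G k \<Longrightarrow> X q \<in> model A"
      "\<And>q. src G q = src G k \<Longrightarrow> tangent_map A B UNIV (src G) q (X q) = b"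
  obtains U' Z W \<delta> \<Phi> where "s_projectable A B G U' Z" "\<forall>g'\<in>U' \<inter> src_fiber G (src G k). Z g' = X g'"
    "local_flow A U' Z W \<delta> \<Phi>" "k \<in> W"
proof -
  note aD = adapted_chartD[OF ad] and sA = manifold_subspace[OF MA] and sB = manifold_subspace[OF MB]
  let ?x0 = "\<xi> k"
  have x0A: "?x0 \<in> model A" by (rule compat_chart_inv(1)[OF aD(1) k])
  \<comment> \<open>On the model, a retraction onto the slice \<open>D x = D ?x0\<close>, which is
    the source fiber of \<open>k\<close> in this chart.\<close>
  define a where "a x = x - J (D x - D ?x0)" for x
  have Ca: "Cinf_on UNIV a"
    unfolding a_def using aD(3,4)
    by (intro Cinf_on_diff Cinf_on_id Cinf_on_bounded_linear[where L=J] Cinf_on_linear Cinf_on_const)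
      (auto simp: linear_conv_bounded_linear)
  obtain N' where N': "open N'" "?x0 \<in> N'" "\<forall>x\<in>model A \<inter> N'. x \<in> \<xi> ` (U \<inter> UNIV)"
    using compat_chart_nbhd[OF aD(1) open_UNIV UNIV_I k] by blast
  define N1 where "N1 = a -` (N \<inter> N')"
  have a0: "a ?x0 = ?x0" by (simp add: a_def linear_0[OF aD(4)])
  have opN1: "open N1" and x0N1: "?x0 \<in> N1"
    using N N' a0 continuous_on_open_vimage[OF open_UNIV, of a] Cinf_on_continuous[OF Ca] by (auto simp: N1_def)
  define Z' where "Z' x = X' (a x)" for x
  have CZ: "Cinf_on N1 Z'"
    unfolding Z'_def by (rule Cinf_on_compose[OF opN1 N(1) _ Cinf_on_subset[OF Ca] N(3)]) (auto simp: N1_def)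
  define b0 where "b0 = chart_comp B \<eta> (src G k) b"
  have bB: "b \<in> model B" using adapted_chart_tangent_map(1)[OF MA MB ad k X(1)] X(2) by auto
  have b0B: "b0 \<in> model B" unfolding b0_def by (rule chart_comp_in_model[OF MB aD(2) aD(8)[OF k] bB])
  have Z'x: "Z' x \<in> model A \<and> D (Z' x) = b0" if x: "x \<in> model A" "x \<in> N1" for x
  proof -
    have "D x - D ?x0 \<in> model B" using aD(5) x(1) x0A sB by (simp add: subspace_diff)
    then have Da: "D (a x) = D ?x0" by (simp add: a_def linear_diff[OF aD(3)] aD(7))
    have "a x \<in> model A" using x(1) aD(6) sA by (simp add: a_def subspace_diff)
    then obtain q where q: "q \<in> U" "a x = \<xi> q" using N'(3) x(2) by (auto simp: N1_def)
    have s: "src G q = src G k" using src_eq_adapted[OF ad q(1) k] Da q(2) by simp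
    have Z: "Z' x = chart_comp A \<xi> q (X q)" using N(4)[OF q(1) s] x(2) q(2) by (simp add: Z'_def N1_def)
    then show ?thesis
      using chart_comp_in_model[OF MA aD(1) q(1) X(1)[OF s]] adapted_chart_tangent_map(2)[OF MA MB ad q(1) X(1)[OF s]]
        X(2)[OF s] s by (simp add: b0_def)
  qed
  define Q where "Q = \<xi> -` N1 \<inter> U"
  have opQ: "open Q"
    unfolding Q_def using continuous_on_open_vimage[OF compat_chartD(1)[OF aD(1)]] compat_chartD(5)[OF aD(1)] opN1 by blast
  have QU: "q \<in> U" "\<xi> q \<in> N1" "\<xi> q \<in> model A" if "q \<in> Q" for q
    using that compat_chart_inv(1)[OF aD(1)] by (auto simp: Q_def)
  define Z where "Z q = chart_vec A \<xi> q (Z' (\<xi> q))" for q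
  have Zc: "Z q \<in> model A" "chart_comp A \<xi> q (Z q) = Z' (\<xi> q)" if "q \<in> Q" for q
    using chart_vec(1,2)[OF MA aD(1) QU(1)[OF that]] Z'x[OF QU(3,2)] that by (auto simp: Z_def)
  have sp: "s_projectable A B G Q Z"
    unfolding s_projectable_def
  proof (intro conjI exI[of _ "\<lambda>y. chart_vec B \<eta> y b0"] opQ ballI)
    show "vector_field A Q Z"
      unfolding Z_def by (rule vector_field_in_chart[OF MA aD(1) _ opN1 CZ]) (use QU Z'x in auto)
    show "vector_field B (src G ` Q) (\<lambda>y. chart_vec B \<eta> y b0)"
      by (rule vector_field_in_chart[OF MB aD(2) _ open_UNIV Cinf_on_const]) (use QU(1) aD(8) b0B in auto)
    fix q assume q: "q \<in> Q"
    show "tangent_map A B UNIV (src G) q (Z q) = chart_vec B \<eta> (src G q) b0"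
      using adapted_chart_tangent_map(1,2)[OF MA MB ad QU(1)[OF q] Zc(1)[OF q]] Zc(2)[OF q] Z'x[OF QU(3,2)[OF q]]
        chart_vec(3)[OF MB aD(2) aD(8)[OF QU(1)[OF q]]] by metis
  qed
  have agree: "\<forall>g'\<in>Q \<inter> src_fiber G (src G k). Z g' = X g'"
  proof
    fix q assume "q \<in> Q \<inter> src_fiber G (src G k)"
    then have q: "q \<in> Q" and s: "src G q = src G k" by (auto simp: src_fiber_def)
    have "D (\<xi> q) = D ?x0" using src_eq_adapted[OF ad QU(1)[OF q] k] s by simp
    then have "a (\<xi> q) = \<xi> q" by (simp add: a_def linear_0[OF aD(4)])
    then have "Z' (\<xi> q) = chart_comp A \<xi> q (X q)"
      using N(4)[OF QU(1)[OF q] s] QU(2)[OF q] by (simp add: Z'_def N1_def)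
    then show "Z q = X q" unfolding Z_def using chart_vec(3)[OF MA aD(1) QU(1)[OF q] X(1)[OF s]] by simp
  qed
  obtain R where R: "0 < R" "cball ?x0 R \<subseteq> N1" "\<And>x. x \<in> model A \<Longrightarrow> dist ?x0 x \<le> R \<Longrightarrow> x \<in> \<xi> ` (U \<inter> UNIV)"
    using compat_chart_cball[OF aD(1) k open_UNIV UNIV_I opN1 x0N1] by metis
  obtain C where C: "0 \<le> C" "\<And>x. x \<in> cball ?x0 R \<Longrightarrow> norm (Z' x) \<le> C"
    using Cinf_on_bounded_cball[OF CZ R(2)] by metis
  obtain L where L: "0 \<le> L" "\<And>x y. x \<in> cball ?x0 R \<Longrightarrow> y \<in> cball ?x0 R \<Longrightarrow> norm (Z' x - Z' y) \<le> L * norm (x - y)"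
    using Cinf_on_Lipschitz_cball[OF CZ opN1 R(2)] by metis
  \<comment> \<open>On this compact convex set the field is Lipschitz; composing it with the
    nearest-point projection makes it globally so without changing it on \<open>K\<close>.\<close>
  define K where "K = cball ?x0 R \<inter> model A"
  have "?x0 \<in> K" using x0A R(1) by (simp add: K_def)
  then have "K \<noteq> {}" by blast
  moreover have "convex K" "closed K"
    using subspace_imp_convex[OF sA] closed_subspace[OF sA] by (auto simp: K_def convex_Int)
  ultimately have K: "convex K" "closed K" "K \<noteq> {}" by auto
  let ?pr = "closest_point K"
  have pr: "?pr x \<in> K" for x using closest_point_in_set[OF K(2,3)] .
  have prL: "norm (?pr x - ?pr y) \<le> norm (x - y)" for x y
    using closest_point_lipschitz[OF K(1,2,3), of x y] by (simp add: dist_norm)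
  have prc: "continuous_on UNIV ?pr"
    using continuous_at_closest_point[OF K(1,2,3)] by (simp add: continuous_on_eq_continuous_at)
  have Kc: "x \<in> cball ?x0 R" "x \<in> model A" "x \<in> N1" if "x \<in> K" for x using that R(2) by (auto simp: K_def)
  \<comment> \<open>The first bound keeps solutions started within \<open>R / 2\<close> inside
    \<open>K\<close>, the second makes the contraction constant less than 1.\<close>
  define \<delta> where "\<delta> = min (R / (4 * (C + 1))) (1 / (2 * (L + 1)))"
  have \<delta>: "0 < \<delta>" using R(1) C(1) L(1) by (auto simp: \<delta>_def)
  have "C * \<delta> \<le> C * (R / (4 * (C + 1)))" using C(1) by (intro mult_left_mono) (auto simp: \<delta>_def)
  also have "\<dots> \<le> R / 4" using C(1) R(1) by (simp add: divide_simps)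
  finally have C\<delta>: "C * \<delta> \<le> R / 4" .
  have "L * \<delta> \<le> L * (1 / (2 * (L + 1)))" using L(1) by (intro mult_left_mono) (auto simp: \<delta>_def)
  also have "\<dots> < 1" using L(1) by (simp add: divide_simps)
  finally have L\<delta>: "L * \<delta> < 1" .
  have contF: "continuous_on ({-\<delta>..\<delta>} \<times> UNIV) (\<lambda>(t, x). Z' (?pr x))"
  proof -
    have "continuous_on UNIV (\<lambda>x. Z' (?pr x))"
      by (rule continuous_on_compose2[OF Cinf_on_continuous[OF CZ] prc]) (use pr Kc in auto)
    then have "continuous_on ({-\<delta>..\<delta>} \<times> UNIV) (\<lambda>z. Z' (?pr (snd z)))"
      by (rule continuous_on_compose2) (auto intro: continuous_intros)
    then show ?thesis by (simp add: case_prod_beta')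
  qed
  have lipF: "norm (Z' (?pr x) - Z' (?pr y)) \<le> L * norm (x - y)" for x y
  proof -
    have "norm (Z' (?pr x) - Z' (?pr y)) \<le> L * norm (?pr x - ?pr y)" by (intro L(2) Kc(1) pr)
    also have "\<dots> \<le> L * norm (x - y)" by (intro mult_left_mono prL L(1))
    finally show ?thesis .
  qed
  have "\<exists>u. u 0 = p \<and> (\<forall>t. \<bar>t\<bar> < \<delta> \<longrightarrow> (u has_vector_derivative Z' (?pr (u t))) (at t))" for p
    using picard[OF \<delta> contF lipF L(1) L\<delta>, of p] by metis
  then obtain u where u0: "\<And>p. u p 0 = p"
    and ud: "\<And>p t. \<bar>t\<bar> < \<delta> \<Longrightarrow> (u p has_vector_derivative Z' (?pr (u p t))) (at t)" by metis
  obtain es where es: "onb_list (model A) es" using ex_onb_list[OF sA] .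
  \<comment> \<open>The orthogonal projection to the model. The field has values in the model, so
    the orthogonal part of a solution is constant, hence 0 when it starts in the model.\<close>
  define \<pi> where "\<pi> x = (\<Sum>i<dim (model A). inner x (es ! i) *\<^sub>R es ! i)" for x
  have linp: "bounded_linear \<pi>"
    unfolding \<pi>_def linear_conv_bounded_linear[symmetric]
    by (rule linearI) (auto simp: inner_add_left scaleR_add_left sum.distrib scaleR_sum_right)
  have pid: "\<pi> x = x" if "x \<in> model A" for x using es that unfolding onb_list_def \<pi>_def by metis
  have pin: "\<pi> x \<in> model A" for x
    unfolding \<pi>_def using es sA by (intro subspace_sum subspace_scale) (auto simp: onb_list_def)
  have uK: "u p t \<in> K" if p: "p \<in> model A" "dist ?x0 p < R / 2" and t: "\<bar>t\<bar> < \<delta>" for p t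
  proof -
    let ?I = "{-\<delta><..<\<delta>}"
    have cI: "convex ?I" by auto
    have tI: "t \<in> ?I" "0 \<in> ?I" using t \<delta> by (auto simp: abs_if split: if_splits)
    have d: "(u p has_vector_derivative Z' (?pr (u p s))) (at s within ?I)" if "s \<in> ?I" for s
      using ud[of s p] that by (auto intro: has_vector_derivative_at_within simp: abs_if)
    have "norm (u p t - u p 0) \<le> C * \<bar>t - 0\<bar>"
      by (rule vector_derivative_bound[OF cI d]) (use C(2) pr Kc(1) tI in auto)
    also have "\<dots> \<le> C * \<delta>" using C(1) t by (intro mult_left_mono) auto
    finally have "dist p (u p t) \<le> R / 4" using C\<delta> u0 by (simp add: dist_norm norm_minus_commute)
    then have 1: "dist ?x0 (u p t) \<le> R" using p(2) dist_triangle[of ?x0 "u p t" p] R(1) by simp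
    have "norm ((u p t - \<pi> (u p t)) - (u p 0 - \<pi> (u p 0))) \<le> 0 * \<bar>t - 0\<bar>"
    proof (rule vector_derivative_bound[OF cI])
      show "((\<lambda>t. u p t - \<pi> (u p t)) has_vector_derivative (Z' (?pr (u p s)) - \<pi> (Z' (?pr (u p s))))) (at s within ?I)"
        if "s \<in> ?I" for s
        by (intro has_vector_derivative_diff d[OF that] bounded_linear.has_vector_derivative[OF linp])
      show "norm (Z' (?pr (u p s)) - \<pi> (Z' (?pr (u p s)))) \<le> 0" for s
        using pid[of "Z' (?pr (u p s))"] Z'x[OF Kc(2,3)[OF pr]] by simp
    qed (use tI in auto)
    then have "u p t = \<pi> (u p t)" using u0 pid[OF p(1)] by simp
    then have "u p t \<in> model A" using pin by metis
    then show ?thesis using 1 by (simp add: K_def)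
  qed
  define W where "W = \<xi> -` ball ?x0 (R / 2) \<inter> U"
  define \<Phi> where "\<Phi> t q = inv_into U \<xi> (u (\<xi> q) t)" for t q
  have opW: "open W"
    unfolding W_def using continuous_on_open_vimage[OF compat_chartD(1)[OF aD(1)]] compat_chartD(5)[OF aD(1)] by blast
  have fl: "local_flow A Q Z W \<delta> \<Phi>"
    unfolding local_flow_def
  proof (intro conjI opW \<delta> ballI)
    fix q assume "q \<in> W"
    then have q: "q \<in> U" "\<xi> q \<in> model A" "dist ?x0 (\<xi> q) < R / 2"
      using compat_chart_inv(1)[OF aD(1)] by (auto simp: W_def)
    show "\<Phi> 0 q = q" using compat_chart_inv(2)[OF aD(1) q(1)] by (simp add: \<Phi>_def u0)
    have uq: "u (\<xi> q) t \<in> K" "\<Phi> t q \<in> U" "\<xi> (\<Phi> t q) = u (\<xi> q) t" if "\<bar>t\<bar> < \<delta>" for t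
    proof -
      show 1: "u (\<xi> q) t \<in> K" by (rule uK[OF q(2,3) that])
      then have "u (\<xi> q) t \<in> \<xi> ` U" using R(3)[of "u (\<xi> q) t"] by (auto simp: K_def)
      then show "\<Phi> t q \<in> U" "\<xi> (\<Phi> t q) = u (\<xi> q) t"
        using compat_chart_inv(3,4)[OF aD(1)] by (auto simp: \<Phi>_def)
    qed
    fix t assume "t \<in> {-\<delta><..<\<delta>}"
    then have t: "\<bar>t\<bar> < \<delta>" by (auto simp: abs_if)
    show tQ: "\<Phi> t q \<in> Q" using uq[OF t] Kc(3) by (auto simp: Q_def)
    have ev: "\<forall>\<^sub>F s in at t. \<bar>s\<bar> < \<delta>"
      using isCont_eventually[where f="\<lambda>s. \<bar>s\<bar>" and t=t and N="{..<\<delta>}"] t by (auto intro!: continuous_intros)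
    have d: "(u (\<xi> q) has_vector_derivative Z' (u (\<xi> q) t)) (at t)"
      using ud[OF t, of "\<xi> q"] closest_point_self[OF uq(1)[OF t]] by simp
    have d': "((\<lambda>s. \<xi> (\<Phi> s q)) has_vector_derivative Z' (u (\<xi> q) t)) (at t)"
      by (rule has_vector_derivative_eventually[OF d]) (use uq t in \<open>auto intro: eventually_mono[OF ev]\<close>)
    have "isCont (\<lambda>s. \<Phi> s q) t"
      by (rule isCont_from_chart[OF aD(1) _ _ has_vector_derivative_continuous[OF d']])
        (use uq t in \<open>auto intro: eventually_mono[OF ev]\<close>)
    then show "has_velocity A (\<lambda>\<tau>. \<Phi> \<tau> q) t (Z (\<Phi> t q))"
      using has_velocity_iff[OF MA aD(1), of "\<lambda>\<tau>. \<Phi> \<tau> q" t "Z (\<Phi> t q)"] uq[OF t] Zc[OF tQ] d' by simp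
  qed
  show ?thesis by (rule that[OF sp agree fl]) (use k R(1) in \<open>auto simp: W_def\<close>)
qed

text \<open>The hypothesis \<open>H\<close> speaks of every local expression \<open>Z'\<close> that
  agrees with \<open>X\<close> on the fiber of \<open>k\<close>: its value at the point and its
  derivatives along the vectors \<open>ws\<close> are fixed by \<open>X\<close>. These are the only
  data of an extension that enter the derivative of the pulled back density.\<close>

lemma vf_action_eq:
  assumes ad: "adapted_chart A B (src G) U \<xi> V \<eta> D J" and k: "k \<in> U"
    and onb: "onb_list {x \<in> model A. D x = 0} es" and a: "a \<in> convolution_algebra A B G"
    and ws: "set ws \<subseteq> ker_ds A B G k" "length ws = length es"
    and N: "open N" "\<xi> k \<in> N" "Cinf_on N X'"
      "\<And>q. q \<in> U \<Longrightarrow> src G q = src G k \<Longrightarrow> \<xi> q \<in> N \<Longrightarrow> X' (\<xi> q) = chart_comp A \<xi> q (X q)"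
    and X: "\<And>q. src G q = src G k \<Longrightarrow> X q \<in> model A"
      "\<And>q. src G q = src G k \<Longrightarrow> tangent_map A B UNIV (src G) q (X q) = b"
    and \<alpha>: "open N2" "\<xi> k \<in> N2" "Cinf_on N2 \<alpha>"
      "\<And>q. q \<in> U \<Longrightarrow> \<xi> q \<in> N2 \<Longrightarrow> \<alpha> (\<xi> q) = a q (map (chart_vec A \<xi> q) es)"
    and H: "\<And>U' Z N' Z'. open N' \<Longrightarrow> \<xi> k \<in> N' \<Longrightarrow> Cinf_on N' Z' \<Longrightarrow>
      (\<And>q. q \<in> U \<Longrightarrow> \<xi> q \<in> N' \<Longrightarrow> src G q = src G k \<Longrightarrow> Z' (\<xi> q) = chart_comp A \<xi> q (X q)) \<Longrightarrow>
      Z' (\<xi> k) = y \<and> (\<forall>j<length es. frechet_derivative Z' (at (\<xi> k)) (chart_comp A \<xi> k (ws ! j)) = w' j)"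
  defines "w \<equiv> \<lambda>j. chart_comp A \<xi> k (ws ! j)"
  defines "d0 \<equiv> coord_det es w"
  shows "vf_action A B G X a k ws = (sgn d0 * d0) *\<^sub>R frechet_derivative \<alpha> (at (\<xi> k)) y
    + (sgn d0 * coord_det_deriv es w w') *\<^sub>R \<alpha> (\<xi> k)"
proof -
  note aD = adapted_chartD[OF ad]
  let ?C = "{x \<in> model A. D x = 0}"
  let ?r = "(sgn d0 * d0) *\<^sub>R frechet_derivative \<alpha> (at (\<xi> k)) y + (sgn d0 * coord_det_deriv es w w') *\<^sub>R \<alpha> (\<xi> k)"
  have wker: "ws ! j \<in> ker_ds A B G k" if "j < length es" for j
    using ws nth_mem[of j ws] that by auto
  have wC: "w j \<in> ?C" if "j < length es" for j
    using wker[OF that] chart_comp_in_model[OF MA aD(1) k] unfolding w_def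
    by (auto simp: ker_ds_adapted[OF MA MB ad k])
  have all: "((\<lambda>t. a (\<Phi> t k) (map (tangent_map A A W (\<Phi> t) k) ws)) has_vector_derivative ?r) (at 0)"
    if sp: "s_projectable A B G U' Z" and ag: "\<forall>g'\<in>U' \<inter> src_fiber G (src G k). Z g' = X g'"
      and fl: "local_flow A U' Z W \<delta> \<Phi>" and kW: "k \<in> W" for U' Z W \<delta> \<Phi>
  proof -
    have "0 \<in> {-\<delta><..<\<delta>}" using fl by (simp add: local_flow_def)
    then have "\<Phi> 0 k = k" "\<Phi> 0 k \<in> U'" using fl kW unfolding local_flow_def by blast+
    then have kU': "k \<in> U'" by simp
    have op: "open U'" and vf: "vector_field A U' Z" using sp by (auto simp: s_projectable_def)
    obtain N' Z' where Z': "open N'" "\<xi> k \<in> N'" "Cinf_on N' Z'"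
      "\<And>q. q \<in> U \<Longrightarrow> \<xi> q \<in> N' \<Longrightarrow> q \<in> U'" "\<And>q. q \<in> U \<Longrightarrow> \<xi> q \<in> N' \<Longrightarrow> Z' (\<xi> q) = chart_comp A \<xi> q (Z q)"
      using vector_field_local_rep[OF MA aD(1) op vf k kU'] by blast
    have "Z' (\<xi> q) = chart_comp A \<xi> q (X q)" if "q \<in> U" "\<xi> q \<in> N'" "src G q = src G k" for q
      using Z'(4,5)[OF that(1,2)] ag that(3) by (simp add: src_fiber_def)
    then have y: "Z' (\<xi> k) = y" and w': "\<And>j. j < length es \<Longrightarrow> frechet_derivative Z' (at (\<xi> k)) (w j) = w' j"
      using H[OF Z'(1-3)] by (auto simp: w_def)
    obtain \<tau> Y where \<tau>: "0 < \<tau>" and \<Phi>: "\<And>t. \<bar>t\<bar> < \<tau> \<Longrightarrow> \<Phi> t k \<in> U" "\<Phi> 0 k = k"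
      and dx: "((\<lambda>t. \<xi> (\<Phi> t k)) has_vector_derivative Z' (\<xi> k)) (at 0)"
      and Y: "\<And>t. \<bar>t\<bar> < \<tau> \<Longrightarrow> linear (Y t)" "\<And>v. Y 0 v = v"
      "\<And>v. ((\<lambda>t. Y t v) has_vector_derivative frechet_derivative Z' (at (\<xi> k)) v) (at 0)"
      and T: "\<And>t v. \<bar>t\<bar> < \<tau> \<Longrightarrow> v \<in> ker_ds A B G k \<Longrightarrow> tangent_map A A W (\<Phi> t) k v \<in> ker_ds A B G (\<Phi> t k)"
      "\<And>t v. \<bar>t\<bar> < \<tau> \<Longrightarrow> v \<in> ker_ds A B G k \<Longrightarrow>
         chart_comp A \<xi> (\<Phi> t k) (tangent_map A A W (\<Phi> t) k v) = Y t (chart_comp A \<xi> k v)"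
      by (rule flow_tangent[OF ad k sp fl kW Z']) (assumption | (rule that; assumption))+
    define d where "d t = coord_det es (\<lambda>j. Y t (w j))" for t
    have d0: "d 0 = d0" by (simp add: d_def d0_def Y(2))
    have dd: "(d has_vector_derivative coord_det_deriv es w w') (at 0)"
    proof -
      have "((\<lambda>t. Y t (w j)) has_vector_derivative w' j) (at 0)" if "j < length es" for j
        using Y(3)[of "w j"] w'[OF that] by simp
      from coord_det_has_derivative[of es "\<lambda>j t. Y t (w j)" w' 0, OF this]
      show ?thesis unfolding d_def by (simp add: Y(2))
    qed
    have da: "((\<lambda>t. \<alpha> (\<xi> (\<Phi> t k))) has_vector_derivative frechet_derivative \<alpha> (at (\<xi> k)) y) (at 0)"
      using Cinf_on_vector_derivative[OF \<alpha>(3) dx] \<alpha>(2) \<Phi>(2) y by simp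
    have "((\<lambda>t. sgn d0 * d t) has_real_derivative (sgn d0 * coord_det_deriv es w w')) (at 0)"
      using dd DERIV_cmult unfolding has_real_derivative_iff_has_vector_derivative[symmetric] by blast
    from has_vector_derivative_scaleR[OF this da]
    have main: "((\<lambda>t. (sgn d0 * d t) *\<^sub>R \<alpha> (\<xi> (\<Phi> t k))) has_vector_derivative ?r) (at 0)"
      by (simp add: d0 \<Phi>(2))
    \<comment> \<open>A linear dependence among the \<open>w j\<close> persists under the linear
      maps \<open>Y t\<close>, so \<open>d\<close> vanishes near 0 when \<open>d0 = 0\<close>;
      otherwise its sign is locally constant. Either way a differentiable function replaces the
      absolute value.\<close>
    have sg: "\<forall>\<^sub>F t in at 0. \<bar>d t\<bar> = sgn d0 * d t"
    proof (cases "d0 = 0")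
      case True
      then obtain c where c: "\<exists>j<length es. c j \<noteq> 0" "(\<Sum>j<length es. c j *\<^sub>R w j) = 0"
        using coord_det_eq_0_iff[OF onb, of w, OF wC] by (auto simp: d0_def)
      have "d t = 0" if t: "\<bar>t\<bar> < \<tau>" for t
      proof -
        have "(\<Sum>j<length es. c j *\<^sub>R Y t (w j)) = Y t (\<Sum>j<length es. c j *\<^sub>R w j)"
          by (simp add: linear_sum[OF Y(1)[OF t]] linear_cmul[OF Y(1)[OF t]])
        then have "(\<Sum>j<length es. c j *\<^sub>R Y t (w j)) = 0" using c(2) linear_0[OF Y(1)[OF t]] by simp
        moreover obtain j where "j < length es" "c j \<noteq> 0" using c(1) by blast
        ultimately show ?thesis unfolding d_def by (intro coord_det_eq_0[of j es c])
      qed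
      then show ?thesis by (intro eventually_mono[OF eventually_at_0_less[OF \<tau>]]) (simp add: True)
    next
      case False
      have "isCont (\<lambda>t. d t * d0) 0"
        by (intro continuous_intros has_vector_derivative_continuous[OF dd])
      then have "\<forall>\<^sub>F t in at 0. d t * d0 \<in> {0<..}"
        by (rule isCont_eventually) (use False d0 in \<open>auto simp: zero_less_mult_iff linorder_neq_iff\<close>)
      then show ?thesis
        by eventually_elim (auto simp: zero_less_mult_iff sgn_if)
    qed
    have sg0: "\<bar>d 0\<bar> = sgn d0 * d 0" by (simp add: d0 sgn_mult_self_eq abs_sgn mult.commute)
    have inN2: "\<forall>\<^sub>F t in at 0. \<xi> (\<Phi> t k) \<in> N2"
      by (rule isCont_eventually[OF has_vector_derivative_continuous[OF dx] \<alpha>(1)]) (use \<alpha>(2) \<Phi>(2) in auto)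
    have eq: "(sgn d0 * d t) *\<^sub>R \<alpha> (\<xi> (\<Phi> t k)) = a (\<Phi> t k) (map (tangent_map A A W (\<Phi> t) k) ws)"
      if t: "\<bar>t\<bar> < \<tau>" "\<bar>d t\<bar> = sgn d0 * d t" "\<xi> (\<Phi> t k) \<in> N2" for t
    proof -
      let ?ws = "map (tangent_map A A W (\<Phi> t) k) ws"
      have "coord_det es (\<lambda>j. chart_comp A \<xi> (\<Phi> t k) (?ws ! j)) = d t"
        unfolding d_def coord_det_def using T(2)[OF t(1) wker] ws(2)
        by (intro arg_cong[where f=Determinant.det] cong_mat) (auto simp: w_def)
      moreover have "set ?ws \<subseteq> ker_ds A B G (\<Phi> t k)" using T(1)[OF t(1)] ws(1) by auto
      ultimately have "a (\<Phi> t k) ?ws = \<bar>d t\<bar> *\<^sub>R a (\<Phi> t k) (map (chart_vec A \<xi> (\<Phi> t k)) es)"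
        using density_in_chart[OF MA MB ad \<Phi>(1)[OF t(1)] onb convolution_algebra_density[OF a], of ?ws] ws(2) by simp
      then show ?thesis using \<alpha>(4)[OF \<Phi>(1)[OF t(1)] t(3)] t(2) by simp
    qed
    show ?thesis
    proof (rule has_vector_derivative_eventually[OF main])
      show "\<forall>\<^sub>F t in at 0. (sgn d0 * d t) *\<^sub>R \<alpha> (\<xi> (\<Phi> t k)) = a (\<Phi> t k) (map (tangent_map A A W (\<Phi> t) k) ws)"
        using eventually_at_0_less[OF \<tau>] sg inN2 by eventually_elim (rule eq)
      show "(sgn d0 * d 0) *\<^sub>R \<alpha> (\<xi> (\<Phi> 0 k)) = a (\<Phi> 0 k) (map (tangent_map A A W (\<Phi> 0) k) ws)"
        by (rule eq) (use \<tau> sg0 \<alpha>(2) \<Phi>(2) in auto)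
    qed
  qed
  \<comment> \<open>One admissible extension with a flow excludes every other value of
    \<open>r\<close>, as the uniqueness in \<open>THE\<close> requires.\<close>
  obtain U' Z W \<delta> \<Phi> where ex: "s_projectable A B G U' Z" "\<forall>g'\<in>U' \<inter> src_fiber G (src G k). Z g' = X g'"
    "local_flow A U' Z W \<delta> \<Phi>" "k \<in> W"
    using ex_projectable_flow[OF ad k N X] by blast
  show ?thesis
    unfolding vf_action_def
  proof (rule the_equality)
    show "\<forall>U' Z W \<delta> \<Phi>. s_projectable A B G U' Z \<and> (\<forall>g'\<in>U' \<inter> src_fiber G (src G k). Z g' = X g') \<and>
        local_flow A U' Z W \<delta> \<Phi> \<and> k \<in> W \<longrightarrow>
        ((\<lambda>t. a (\<Phi> t k) (map (tangent_map A A W (\<Phi> t) k) ws)) has_vector_derivative ?r) (at 0)"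
      using all by blast
    fix r assume "\<forall>U' Z W \<delta> \<Phi>. s_projectable A B G U' Z \<and> (\<forall>g'\<in>U' \<inter> src_fiber G (src G k). Z g' = X g') \<and>
        local_flow A U' Z W \<delta> \<Phi> \<and> k \<in> W \<longrightarrow>
        ((\<lambda>t. a (\<Phi> t k) (map (tangent_map A A W (\<Phi> t) k) ws)) has_vector_derivative r) (at 0)"
    then have "((\<lambda>t. a (\<Phi> t k) (map (tangent_map A A W (\<Phi> t) k) ws)) has_vector_derivative r) (at 0)"
      using ex by blast
    then show "r = ?r" using all[OF ex] vector_derivative_unique_at by blast
  qed
qed

section \<open>The integrand of the deformed convolution and its derivative in the parameter\<close>

definition integrand :: "('g \<Rightarrow> 'e list \<Rightarrow> 'k::{real_normed_field, euclidean_space}) \<Rightarrow> 'g \<Rightarrow> 'e list \<Rightarrow> real \<Rightarrow> 'g \<Rightarrow> 'k" where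
  "integrand a g vs \<epsilon> h = a (m \<epsilon> g h) (map (tangent_map A A (src_fiber G (src G h)) (\<lambda>g'. m \<epsilon> g' h) g) vs)"

text \<open>One smooth function of the parameter and of the coordinates of \<open>h\<close>
  represents the integrand near \<open>h0\<close>; its smoothness will give the uniform bounds under
  the integral. Its parameter derivative at \<open>h0\<close> is matched with
  \<open>vf_action_eq\<close> term by term.\<close>

lemma integrand_local_form:
  fixes a :: "'g \<Rightarrow> 'e list \<Rightarrow> 'k::{real_normed_field, euclidean_space}"
  assumes a: "a \<in> convolution_algebra A B G" and vs: "vs \<in> tuples (ker_ds A B G g)" and s0: "src G g = src G h0"
  obtains W \<zeta> N \<Psi> where "compat_chart A W \<zeta>" "h0 \<in> W" "open N" "(0, \<zeta> h0) \<in> N" "Cinf_on N \<Psi>"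
    "\<And>\<epsilon> h. h \<in> W \<Longrightarrow> src G g = src G h \<Longrightarrow> (\<epsilon>, \<zeta> h) \<in> N \<Longrightarrow> integrand a g vs \<epsilon> h = \<Psi> (\<epsilon>, \<zeta> h)"
    "vf_action A B G (\<lambda>k. deformation_cocycle A G m k h0) a (m 0 g h0)
       (map (tangent_map A A (src_fiber G (src G h0)) (\<lambda>g'. m 0 g' h0) g) vs)
     = frechet_derivative \<Psi> (at (0, \<zeta> h0)) (1, 0)"
proof -
  let ?k = "m 0 g h0"
  have sk: "src G ?k = tgt G h0"
    using m_0[OF s0] src_division[OF s0] by auto
  obtain U \<xi> V \<eta> D J where ad: "adapted_chart A B (src G) U \<xi> V \<eta> D J" and k: "?k \<in> U" using ex_adapted .
  note aD = adapted_chartD[OF ad]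
  obtain U1 \<phi> where cU: "compat_chart A U1 \<phi>" "g \<in> U1" using ex_compat_chart[OF MA] by blast
  obtain W \<zeta> where cW: "compat_chart A W \<zeta>" "h0 \<in> W" using ex_compat_chart[OF MA] by blast
  obtain N F where mr: "m_rep U1 \<phi> W \<zeta> U \<xi> N F" and p0: "(0, \<phi> g, \<zeta> h0) \<in> N"
    using ex_m_rep[OF cU(1) cW(1) aD(1) cU(2) cW(2) I(2) s0 k] .
  note r = m_repD[OF mr]
  obtain es where onb: "onb_list {x \<in> model A. D x = 0} es"
    using ex_onb_list[OF subspace_kernel_adapted[OF MA ad]] .
  obtain Ug \<xi>g Vg \<eta>g Dg Jg where adg: "adapted_chart A B (src G) Ug \<xi>g Vg \<eta>g Dg Jg" and gUg: "g \<in> Ug" using ex_adapted .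
  have lvs: "length vs = length es" and vsk: "set vs \<subseteq> ker_ds A B G g"
    using vs onb dim_ker_ds(2)[OF MA MB adg gUg] dim_kernel_adapted[OF MA MB ad]
    by (auto simp: tuples_def onb_list_def)
  have vj: "vs ! j \<in> ker_ds A B G g" if "j < length es" for j using vsk lvs nth_mem[of j vs] that by auto
  \<comment> \<open>\<open>v j\<close> are the coordinates of the given vectors, and
    \<open>w j\<close> below those of their images under the differential of
    \<open>g' \<mapsto> m \<epsilon> g' h\<close>, a partial derivative of \<open>F\<close>.\<close>
  define v where "v j = chart_comp A \<phi> g (vs ! j)" for j
  define E where "E v p = frechet_derivative F (at p) v" for v p
  define w where "w j z = E (0, v j, 0) (fst z, \<phi> g, snd z)" for j and z :: "real \<times> 'e"
  define d where "d z = coord_det es (\<lambda>j. w j z)" for z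
  define d0 where "d0 = d (0, \<zeta> h0)"
  let ?pz = "(\<lambda>z. (fst z, \<phi> g, snd z)) :: real \<times> 'e \<Rightarrow> real \<times> 'e \<times> 'e" and ?p0 = "(0, \<phi> g, \<zeta> h0)"
  have Cp: "Cinf_on UNIV ?pz"
    by (intro Cinf_on_Pair Cinf_on_const open_UNIV Cinf_on_bounded_linear[OF open_UNIV bounded_linear_fst Cinf_on_id[OF open_UNIV]]
        Cinf_on_bounded_linear[OF open_UNIV bounded_linear_snd Cinf_on_id[OF open_UNIV]])
  define N0 where "N0 = ?pz -` N"
  have opN0: "open N0"
    unfolding N0_def by (rule open_vimage[OF r(4) Cinf_on_continuous[OF Cp]])
  have CF: "Cinf_on N0 (\<lambda>z. F (?pz z))"
    by (rule Cinf_on_compose[OF opN0 r(4) _ Cinf_on_subset[OF Cp] r(5)]) (auto simp: N0_def)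
  have CE: "Cinf_on N (E v)" for v unfolding E_def[abs_def] by (rule Cinf_on_frechet[OF r(5)])
  have Cw: "Cinf_on N0 (w j)" for j
    unfolding w_def[abs_def] by (rule Cinf_on_compose[OF opN0 r(4) _ Cinf_on_subset[OF Cp] CE]) (auto simp: N0_def)
  have Cd: "Cinf_on N0 d" unfolding d_def[abs_def] by (rule Cinf_on_coord_det[OF opN0 Cw])
  obtain N2 \<alpha> where \<alpha>N: "\<xi> ?k \<in> N2" and \<alpha>r: "local_rep U (\<lambda>q. a q (map (chart_vec A \<xi> q) es)) U \<xi> UNIV id N2 \<alpha>"
    using smooth_map_local_rep[OF density_frame_smooth[OF MA MB ad onb a] compat_chartD(3)[OF aD(1)] smooth_chart_eucl k k] by auto
  have \<alpha>: "open N2" "Cinf_on N2 \<alpha>" "\<And>q. q \<in> U \<Longrightarrow> \<xi> q \<in> N2 \<Longrightarrow> \<alpha> (\<xi> q) = a q (map (chart_vec A \<xi> q) es)"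
    using local_repD[OF \<alpha>r] by auto
  \<comment> \<open>The region where the frame coefficient \<open>\<alpha>\<close> is available and,
    if \<open>d0 \<noteq> 0\<close>, the determinant keeps the sign it has at the base
    point.\<close>
  define N1 where "N1 = {z \<in> N0. F (?pz z) \<in> N2 \<and> (d0 \<noteq> 0 \<longrightarrow> 0 < d z * d0)}"
  have opN1: "open N1"
  proof -
    have "N1 = (\<lambda>z. F (?pz z)) -` N2 \<inter> N0 \<inter> (if d0 = 0 then UNIV else (\<lambda>z. d z * d0) -` {0<..} \<inter> N0)"
      by (auto simp: N1_def)
    moreover have "open ((\<lambda>z. F (?pz z)) -` N2 \<inter> N0)"
      by (rule open_vimage_Int[OF opN0 Cinf_on_continuous[OF CF] \<alpha>(1)])
    moreover have "open ((\<lambda>z. d z * d0) -` {0<..} \<inter> N0)"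
    proof -
      have "continuous_on N0 (\<lambda>z. d z * d0)" using Cinf_on_continuous[OF Cd] by (intro continuous_intros)
      then show ?thesis by (intro open_vimage_Int[OF opN0]) auto
    qed
    ultimately show ?thesis by auto
  qed
  define \<Psi> where "\<Psi> z = (sgn d0 * d z) *\<^sub>R \<alpha> (F (?pz z))" for z
  have C\<Psi>: "Cinf_on N1 \<Psi>"
    unfolding \<Psi>_def[abs_def]
    by (intro Cinf_on_scaleR[OF opN1] Cinf_on_mult[OF opN1] Cinf_on_const Cinf_on_subset[OF Cd]
        Cinf_on_compose[OF opN1 \<alpha>(1) _ Cinf_on_subset[OF CF] \<alpha>(2)]) (auto simp: N1_def)
  have Fk: "F ?p0 = \<xi> ?k" using r(8)[OF cU(2) cW(2) s0 p0] .
  have z0: "(0, \<zeta> h0) \<in> N1"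
    using p0 Fk \<alpha>N by (auto simp: N1_def N0_def d0_def zero_less_mult_iff linorder_neq_iff)
  have inN: "(\<epsilon>, \<phi> g, \<zeta> h) \<in> N" if "(\<epsilon>, \<zeta> h) \<in> N1" for \<epsilon> h using that by (simp add: N1_def N0_def)
  have wT: "chart_comp A \<xi> (m \<epsilon> g h) (tangent_map A A (src_fiber G (src G h)) (\<lambda>g'. m \<epsilon> g' h) g (vs ! j)) = w j (\<epsilon>, \<zeta> h)"
    "tangent_map A A (src_fiber G (src G h)) (\<lambda>g'. m \<epsilon> g' h) g (vs ! j) \<in> ker_ds A B G (m \<epsilon> g h)"
    if "j < length es" "h \<in> W" "src G g = src G h" "(\<epsilon>, \<phi> g, \<zeta> h) \<in> N" for j \<epsilon> h
    using m_tangent(2,3)[OF mr cU(2) that(2,3,4) vj[OF that(1)]] by (auto simp: w_def E_def v_def)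
  have wC: "w j (0, \<zeta> h0) \<in> {x \<in> model A. D x = 0}" if "j < length es" for j
    using wT[OF that cW(2) s0 p0]
      chart_comp_in_model[OF MA aD(1) k, of "tangent_map A A (src_fiber G (src G h0)) (\<lambda>g'. m 0 g' h0) g (vs ! j)"]
    by (auto simp: ker_ds_adapted[OF MA MB ad k])
  have vsum: "chart_comp A \<phi> g (\<Sum>j<length es. c j *\<^sub>R vs ! j) = (\<Sum>j<length es. c j *\<^sub>R v j)"
    "(\<Sum>j<length es. c j *\<^sub>R vs ! j) \<in> ker_ds A B G g" for c
  proof -
    have "vs ! j \<in> model A" if "j \<in> {..<length es}" for j using vj that by (simp add: ker_ds_def)
    from chart_comp_sum[OF MA cU(1,2), of "{..<length es}" "\<lambda>j. vs ! j" c, OF this]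
    show "chart_comp A \<phi> g (\<Sum>j<length es. c j *\<^sub>R vs ! j) = (\<Sum>j<length es. c j *\<^sub>R v j)" by (simp add: v_def)
    show "(\<Sum>j<length es. c j *\<^sub>R vs ! j) \<in> ker_ds A B G g"
      using vj dim_ker_ds(1)[OF MA MB adg gUg] by (intro subspace_sum subspace_scale) auto
  qed
  have Esum: "(\<Sum>j<length es. c j *\<^sub>R w j (\<epsilon>, z)) = E (0, \<Sum>j<length es. c j *\<^sub>R v j, 0) (\<epsilon>, \<phi> g, z)"
    if "(\<epsilon>, \<phi> g, z) \<in> N" for c \<epsilon> z
  proof -
    have lin: "linear (\<lambda>x. E (0, x, 0) (\<epsilon>, \<phi> g, z))"
    proof -
      have "linear (\<lambda>x::'e. (0::real, x, 0::'e))" by (rule linearI) (auto simp: zero_prod_def)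
      from linear_compose[OF this Cinf_on_linear_frechet[OF r(5) that]] show ?thesis by (simp add: E_def o_def)
    qed
    show ?thesis by (simp add: w_def linear_sum[OF lin] linear_cmul[OF lin])
  qed
  \<comment> \<open>For \<open>d0 = 0\<close> the injectivity of right translation shows that the
    vectors \<open>vs\<close> themselves are dependent; then \<open>d\<close> vanishes at every
    point considered, not only at the base point.\<close>
  have abs_d: "\<bar>d (\<epsilon>, \<zeta> h)\<bar> = sgn d0 * d (\<epsilon>, \<zeta> h)" if "(\<epsilon>, \<zeta> h) \<in> N1" for \<epsilon> h
  proof (cases "d0 = 0")
    case True
    then obtain c where c: "\<exists>j<length es. c j \<noteq> 0" "(\<Sum>j<length es. c j *\<^sub>R w j (0, \<zeta> h0)) = 0"
      using coord_det_eq_0_iff[OF onb, of "\<lambda>j. w j (0, \<zeta> h0)", OF wC] by (auto simp: d0_def d_def)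
    have "frechet_derivative F (at ?p0) (0, chart_comp A \<phi> g (\<Sum>j<length es. c j *\<^sub>R vs ! j), 0) = 0"
      using Esum[OF p0] c(2) vsum(1) by (simp add: E_def)
    then have "(\<Sum>j<length es. c j *\<^sub>R vs ! j) = 0"
      by (rule m_tangent_0_inj[OF mr cU(2) cW(2) s0 p0 vsum(2)])
    then have "E (0, \<Sum>j<length es. c j *\<^sub>R v j, 0) (\<epsilon>, \<phi> g, \<zeta> h) = E (0, chart_comp A \<phi> g 0, 0) (\<epsilon>, \<phi> g, \<zeta> h)"
      using vsum(1) by metis
    also have "chart_comp A \<phi> g 0 = 0"
      using chart_comp_sum[OF MA cU(1,2), of "{}::nat set" "\<lambda>_. 0" "\<lambda>_. 0"] by simp
    also have "E (0, 0, 0) (\<epsilon>, \<phi> g, \<zeta> h) = 0"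
      unfolding E_def using linear_0[OF Cinf_on_linear_frechet[OF r(5) inN[OF that]]] by (simp add: zero_prod_def)
    finally have "(\<Sum>j<length es. c j *\<^sub>R w j (\<epsilon>, \<zeta> h)) = 0" using Esum[OF inN[OF that]] by simp
    moreover obtain j where "j < length es" "c j \<noteq> 0" using c(1) by blast
    ultimately have "d (\<epsilon>, \<zeta> h) = 0" unfolding d_def by (intro coord_det_eq_0[of j es c])
    then show ?thesis by simp
  next
    case False
    then have "0 < d (\<epsilon>, \<zeta> h) * d0" using that by (simp add: N1_def)
    then show ?thesis by (auto simp: zero_less_mult_iff sgn_if)
  qed
  have form: "integrand a g vs \<epsilon> h = \<Psi> (\<epsilon>, \<zeta> h)" if h: "h \<in> W" "src G g = src G h" "(\<epsilon>, \<zeta> h) \<in> N1" for \<epsilon> h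
  proof -
    note n = inN[OF h(3)]
    let ?ws = "map (tangent_map A A (src_fiber G (src G h)) (\<lambda>g'. m \<epsilon> g' h) g) vs"
    have q: "m \<epsilon> g h \<in> U" "F (\<epsilon>, \<phi> g, \<zeta> h) = \<xi> (m \<epsilon> g h)" using r(7,8)[OF cU(2) h(1,2) n] by auto
    have "coord_det es (\<lambda>j. chart_comp A \<xi> (m \<epsilon> g h) (?ws ! j)) = d (\<epsilon>, \<zeta> h)"
      unfolding d_def coord_det_def using wT(1)[OF _ h(1,2) n] lvs
      by (intro arg_cong[where f=Determinant.det] cong_mat) auto
    moreover have "set ?ws \<subseteq> ker_ds A B G (m \<epsilon> g h)"
      using wT(2)[OF _ h(1,2) n] lvs by (auto simp: in_set_conv_nth)
    ultimately have "a (m \<epsilon> g h) ?ws = \<bar>d (\<epsilon>, \<zeta> h)\<bar> *\<^sub>R a (m \<epsilon> g h) (map (chart_vec A \<xi> (m \<epsilon> g h)) es)"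
      using density_in_chart[OF MA MB ad q(1) onb convolution_algebra_density[OF a], of ?ws] lvs by simp
    also have "a (m \<epsilon> g h) (map (chart_vec A \<xi> (m \<epsilon> g h)) es) = \<alpha> (F (\<epsilon>, \<phi> g, \<zeta> h))"
      using \<alpha>(3)[OF q(1)] q(2) h(3) by (simp add: N1_def)
    finally show ?thesis using abs_d[OF h(3)] by (simp add: integrand_def \<Psi>_def)
  qed
  let ?ws = "map (tangent_map A A (src_fiber G (src G h0)) (\<lambda>g'. m 0 g' h0) g) vs"
  \<comment> \<open>\<open>?y\<close> is the cocycle in coordinates; \<open>?w' j\<close> is the
    parameter derivative of \<open>w j\<close>, a mixed second derivative of
    \<open>F\<close>.\<close>
  let ?y = "E (1, 0, 0) ?p0" and ?w' = "\<lambda>j. frechet_derivative (E (0, v j, 0)) (at ?p0) (1, 0, 0)"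
  have ws0: "chart_comp A \<xi> ?k (?ws ! j) = w j (0, \<zeta> h0)" if "j < length es" for j
    using wT(1)[OF that cW(2) s0 p0] that lvs by simp
  obtain NX X2 where X2: "open NX" "Cinf_on NX X2" "(\<xi> ?k, \<zeta> h0) \<in> NX"
    "\<And>k h. src G k = tgt G h \<Longrightarrow> k \<in> U \<Longrightarrow> h \<in> W \<Longrightarrow> (\<xi> k, \<zeta> h) \<in> NX \<Longrightarrow>
      X2 (\<xi> k, \<zeta> h) = chart_comp A \<xi> k (deformation_cocycle A G m k h)"
    using cocycle_local_rep[OF sk aD(1) k cW] by metis
  let ?NX = "{x. (x, \<zeta> h0) \<in> NX}"
  have opNX: "open ?NX"
    using continuous_on_open_vimage[OF open_UNIV, of "\<lambda>x. (x, \<zeta> h0)"] X2(1)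
    by (auto simp: vimage_def intro!: continuous_intros)
  have CX: "Cinf_on ?NX (\<lambda>x. X2 (x, \<zeta> h0))"
    by (rule Cinf_on_compose[OF opNX X2(1) _ _ X2(2)]) (auto intro!: Cinf_on_Pair Cinf_on_const Cinf_on_id opNX)
  have vf: "vf_action A B G (\<lambda>k. deformation_cocycle A G m k h0) a ?k ?ws =
     (sgn (coord_det es (\<lambda>j. chart_comp A \<xi> ?k (?ws ! j))) * coord_det es (\<lambda>j. chart_comp A \<xi> ?k (?ws ! j)))
       *\<^sub>R frechet_derivative \<alpha> (at (\<xi> ?k)) ?y
    + (sgn (coord_det es (\<lambda>j. chart_comp A \<xi> ?k (?ws ! j))) * coord_det_deriv es (\<lambda>j. chart_comp A \<xi> ?k (?ws ! j)) ?w')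
       *\<^sub>R \<alpha> (\<xi> ?k)"
  proof (rule vf_action_eq[OF ad k onb a _ _ opNX _ CX _ _ _ \<alpha>(1) \<alpha>N \<alpha>(2,3)])
    show "set ?ws \<subseteq> ker_ds A B G ?k" using wT(2)[OF _ cW(2) s0 p0] lvs by (auto simp: in_set_conv_nth)
    show "length ?ws = length es" using lvs by simp
    show "\<xi> ?k \<in> ?NX" using X2(3) by simp
    show "X2 (\<xi> q, \<zeta> h0) = chart_comp A \<xi> q (deformation_cocycle A G m q h0)"
      if "q \<in> U" "src G q = src G ?k" "\<xi> q \<in> ?NX" for q using X2(4)[OF _ that(1) cW(2)] that sk by simp
    show "deformation_cocycle A G m q h0 \<in> model A" if "src G q = src G ?k" for q
      using cocycle_in_model(1) that sk by simp
    show "tangent_map A B UNIV (src G) q (deformation_cocycle A G m q h0) = velocity B (\<lambda>\<epsilon>. src G (m \<epsilon> h0 h0)) 0"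
      if "src G q = src G ?k" for q using cocycle_projection that sk by simp
    fix N' Z'
    assume Z': "open N'" "\<xi> ?k \<in> N'" "Cinf_on N' Z'"
      and ag: "\<And>q. q \<in> U \<Longrightarrow> \<xi> q \<in> N' \<Longrightarrow> src G q = src G ?k \<Longrightarrow>
        Z' (\<xi> q) = chart_comp A \<xi> q (deformation_cocycle A G m q h0)"
    \<comment> \<open>Any extension of the cocycle satisfies this identity between functions of
      \<open>g'\<close> on the fiber. Differentiating it along a fiber curve determines the vertical
      derivatives of \<open>Z'\<close> by the chain rule.\<close>
    have Z'E: "Z' (F (0, \<phi> g', \<zeta> h0)) = E (1, 0, 0) (0, \<phi> g', \<zeta> h0)"
      if g': "g' \<in> U1" "src G g' = src G h0" "(0, \<phi> g', \<zeta> h0) \<in> N" "F (0, \<phi> g', \<zeta> h0) \<in> N'" for g'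
    proof -
      let ?k' = "m 0 g' h0"
      have k': "src G ?k' = tgt G h0" "mul G ?k' h0 = g'"
        using m_0[OF g'(2)] src_division[OF g'(2)] mul_division[OF g'(2)] by auto
      have kU: "?k' \<in> U" "F (0, \<phi> g', \<zeta> h0) = \<xi> ?k'" using r(7,8)[OF g'(1) cW(2) g'(2,3)] by auto
      have "Z' (\<xi> ?k') = chart_comp A \<xi> ?k' (deformation_cocycle A G m ?k' h0)"
        by (rule ag[OF kU(1)]) (use g'(4) kU k' sk in auto)
      also have "\<dots> = E (1, 0, 0) (0, \<phi> g', \<zeta> h0)"
        using cocycle_rep(3)[OF mr k'(1) _ cW(2)] k'(2) g' by (simp add: E_def)
      finally show ?thesis using kU(2) by simp
    qed
    have 1: "Z' (\<xi> ?k) = ?y" using Z'E[OF cU(2) s0 p0] Fk Z'(2) by simp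
    have 2: "frechet_derivative Z' (at (\<xi> ?k)) (chart_comp A \<xi> ?k (?ws ! j)) = ?w' j" if j: "j < length es" for j
    proof -
      obtain \<gamma> where \<gamma>: "curve_in A (src_fiber G (src G h0)) g (vs ! j) \<gamma>" using fiber_curve[OF vj[OF j]] s0 by metis
      obtain \<delta> where \<delta>: "\<delta> > 0" "\<gamma> ` {-\<delta><..<\<delta>} \<subseteq> src_fiber G (src G h0)" using \<gamma> unfolding curve_in_def by blast
      have \<gamma>0: "\<gamma> 0 = g" "has_velocity A \<gamma> 0 (vs ! j)" using \<gamma> by (auto simp only: curve_in_def)
      have i: "isCont \<gamma> 0" and d\<gamma>: "((\<lambda>s. \<phi> (\<gamma> s)) has_vector_derivative v j) (at 0)"
        using has_velocity_iff[OF MA cU(1), of \<gamma> 0 "vs ! j"] \<gamma>0 cU(2) vj[OF j] by (auto simp: v_def ker_ds_def)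
      let ?q = "\<lambda>s. (0::real, \<phi> (\<gamma> s), \<zeta> h0)"
      have dq: "(?q has_vector_derivative (0, v j, 0)) (at 0)"
        by (intro has_vector_derivative_Pair has_vector_derivative_const d\<gamma>)
      have dFq: "((\<lambda>s. F (?q s)) has_vector_derivative w j (0, \<zeta> h0)) (at 0)"
        using Cinf_on_vector_derivative[OF r(5) dq] p0 \<gamma>0 by (simp add: w_def E_def)
      have dL: "((\<lambda>s. Z' (F (?q s))) has_vector_derivative frechet_derivative Z' (at (\<xi> ?k)) (w j (0, \<zeta> h0))) (at 0)"
        using Cinf_on_vector_derivative[OF Z'(3) dFq] Z'(2) Fk \<gamma>0 by simp
      have dR: "((\<lambda>s. E (1, 0, 0) (?q s)) has_vector_derivative frechet_derivative (E (1, 0, 0)) (at ?p0) (0, v j, 0)) (at 0)"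
        using Cinf_on_vector_derivative[OF CE dq] p0 \<gamma>0 by simp
      have evN: "\<forall>\<^sub>F s in at 0. ?q s \<in> N"
        by (rule isCont_eventually[OF has_vector_derivative_continuous[OF dq] r(4)]) (use p0 \<gamma>0 in auto)
      have evN': "\<forall>\<^sub>F s in at 0. F (?q s) \<in> N'"
        by (rule isCont_eventually[OF has_vector_derivative_continuous[OF dFq] Z'(1)]) (use Z'(2) Fk \<gamma>0 in auto)
      have evU: "\<forall>\<^sub>F s in at 0. \<gamma> s \<in> U1 \<and> \<phi> (\<gamma> s) \<in> UNIV"
        by (rule compat_chart_eventually[OF cU(1) i]) (use \<gamma>0 cU(2) in auto)
      have evS: "\<forall>\<^sub>F s in at 0. src G (\<gamma> s) = src G h0"
      proof (rule eventually_mono[OF eventually_at_0_less[OF \<delta>(1)]])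
        fix s assume "\<bar>s\<bar> < \<delta>"
        then have "s \<in> {-\<delta><..<\<delta>}" by auto
        then have "\<gamma> s \<in> src_fiber G (src G h0)" using \<delta>(2) by blast
        then show "src G (\<gamma> s) = src G h0" by (simp add: src_fiber_def)
      qed
      have "\<forall>\<^sub>F s in at 0. Z' (F (?q s)) = E (1, 0, 0) (?q s)"
        using evN evN' evU evS by eventually_elim (rule Z'E, auto)
      then have "((\<lambda>s. E (1, 0, 0) (?q s)) has_vector_derivative frechet_derivative Z' (at (\<xi> ?k)) (w j (0, \<zeta> h0))) (at 0)"
        by (rule has_vector_derivative_eventually[OF dL]) (use Z'E[OF cU(2) s0 p0] Fk Z'(2) \<gamma>0 in simp)
      then have "frechet_derivative Z' (at (\<xi> ?k)) (w j (0, \<zeta> h0)) = frechet_derivative (E (1, 0, 0)) (at ?p0) (0, v j, 0)"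
        using dR vector_derivative_unique_at by blast
      \<comment> \<open>So far \<open>F\<close> is differentiated first in the parameter and then
        along the fiber; \<open>?w' j\<close> has the opposite order.\<close>
      also have "\<dots> = ?w' j"
        unfolding E_def[abs_def] by (rule frechet_derivative_commute[OF r(4,5) p0])
      finally show ?thesis using ws0[OF j] by simp
    qed
    show "Z' (\<xi> ?k) = ?y \<and> (\<forall>j<length es. frechet_derivative Z' (at (\<xi> ?k)) (chart_comp A \<xi> ?k (?ws ! j)) = ?w' j)"
      using 1 2 by blast
  qed
  have "frechet_derivative \<Psi> (at (0, \<zeta> h0)) (1, 0) =
    (sgn d0 * d0) *\<^sub>R frechet_derivative \<alpha> (at (\<xi> ?k)) ?y
    + (sgn d0 * coord_det_deriv es (\<lambda>j. w j (0, \<zeta> h0)) ?w') *\<^sub>R \<alpha> (\<xi> ?k)"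
  proof -
    let ?l = "\<lambda>\<epsilon>::real. (\<epsilon>, \<zeta> h0)" and ?q = "\<lambda>\<epsilon>::real. (\<epsilon>, \<phi> g, \<zeta> h0)"
    have dl: "(?l has_vector_derivative (1, 0)) (at 0)" and dq: "(?q has_vector_derivative (1, 0, 0)) (at 0)"
      by (auto intro!: has_vector_derivative_Pair has_vector_derivative_id[unfolded id_def] has_vector_derivative_const)
    have 1: "((\<lambda>\<epsilon>. \<Psi> (?l \<epsilon>)) has_vector_derivative frechet_derivative \<Psi> (at (0, \<zeta> h0)) (1, 0)) (at 0)"
      using Cinf_on_vector_derivative[OF C\<Psi> dl z0] .
    have dF: "((\<lambda>\<epsilon>. F (?q \<epsilon>)) has_vector_derivative ?y) (at 0)"
      using Cinf_on_vector_derivative[OF r(5) dq p0] by (simp add: E_def)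
    have d\<alpha>: "((\<lambda>\<epsilon>. \<alpha> (F (?q \<epsilon>))) has_vector_derivative frechet_derivative \<alpha> (at (\<xi> ?k)) ?y) (at 0)"
      using Cinf_on_vector_derivative[OF \<alpha>(2) dF] \<alpha>N Fk by simp
    have "((\<lambda>\<epsilon>. coord_det es (\<lambda>j. w j (?l \<epsilon>))) has_vector_derivative
        coord_det_deriv es (\<lambda>j. w j (?l 0)) ?w') (at 0)"
      unfolding w_def fst_conv snd_conv
      by (rule coord_det_has_derivative[where w="\<lambda>j \<epsilon>. E (0, v j, 0) (?q \<epsilon>)"])
        (rule Cinf_on_vector_derivative[OF CE dq p0])
    then have "((\<lambda>\<epsilon>. sgn d0 * d (?l \<epsilon>)) has_real_derivative
        (sgn d0 * coord_det_deriv es (\<lambda>j. w j (?l 0)) ?w')) (at 0)"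
      unfolding d_def has_real_derivative_iff_has_vector_derivative[symmetric] by (rule DERIV_cmult)
    from has_vector_derivative_scaleR[OF this d\<alpha>]
    have "((\<lambda>\<epsilon>. \<Psi> (?l \<epsilon>)) has_vector_derivative (sgn d0 * d0) *\<^sub>R frechet_derivative \<alpha> (at (\<xi> ?k)) ?y
        + (sgn d0 * coord_det_deriv es (\<lambda>j. w j (?l 0)) ?w') *\<^sub>R \<alpha> (\<xi> ?k)) (at 0)"
      unfolding \<Psi>_def fst_conv snd_conv by (simp add: Fk d0_def)
    then show ?thesis using 1 vector_derivative_unique_at by blast
  qed
  moreover have "coord_det es (\<lambda>j. chart_comp A \<xi> ?k (?ws ! j)) = d0"
    unfolding d0_def d_def coord_det_def using ws0
    by (intro arg_cong[where f=Determinant.det] cong_mat) auto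
  moreover have "coord_det_deriv es (\<lambda>j. chart_comp A \<xi> ?k (?ws ! j)) ?w' = coord_det_deriv es (\<lambda>j. w j (0, \<zeta> h0)) ?w'"
  proof -
    have "p i < length es" if "p permutes {0..<length es}" "i \<in> {0..<length es}" for p i
      using permutes_in_image[OF that(1), of i] that(2) by simp
    then show ?thesis unfolding coord_det_deriv_def using ws0
      by (intro sum.cong refl arg_cong2[where f="(*)"] prod.cong) auto
  qed
  ultimately have "vf_action A B G (\<lambda>k. deformation_cocycle A G m k h0) a ?k ?ws = frechet_derivative \<Psi> (at (0, \<zeta> h0)) (1, 0)"
    using vf by simp
  then show ?thesis
    by (intro that[OF cW opN1 z0 C\<Psi> form])
qed

end

section \<open>Integration over the fibers\<close>

text \<open>Subtracting \<open>i\<close> times the previous bump functions makes the family locally finite: near a point where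
  \<open>b j\<close> exceeds \<open>\<eta>\<close>, all terms with \<open>i > max j (1 / \<eta>)\<close> vanish.\<close>

lemma partition_of_unity_from_bumps:
  fixes b :: "nat \<Rightarrow> 'a::t2_space \<Rightarrow> real"
  assumes cont: "\<And>i. continuous_on UNIV (b i)" and b01: "\<And>i q. 0 \<le> b i q" "\<And>i q. b i q \<le> 1"
    and cov: "\<And>p. p \<in> S \<Longrightarrow> \<exists>i. 0 < b i p"
  obtains \<rho> :: "nat \<Rightarrow> 'a::t2_space \<Rightarrow> real" where "\<And>i. continuous_on S (\<rho> i)" "\<And>i p. p \<in> S \<Longrightarrow> 0 \<le> \<rho> i p" "\<And>i p. \<rho> i p \<noteq> 0 \<Longrightarrow> b i p \<noteq> 0"
    "\<And>p. p \<in> S \<Longrightarrow> (\<lambda>i. \<rho> i p) sums 1"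
    "\<And>p. p \<in> S \<Longrightarrow> \<exists>N. open N \<and> p \<in> N \<and> finite {i. \<exists>q\<in>N \<inter> S. \<rho> i q \<noteq> 0}"
proof -
  define c where "c i q = max 0 (b i q - real i * (\<Sum>j<i. b j q))" for i q
  define s where "s q = (\<Sum>i. c i q)" for q
  have c0: "0 \<le> c i q" for i q by (simp add: c_def)
  have cc: "continuous_on UNIV (c i)" for i
    unfolding c_def by (intro continuous_intros cont)
  have cb: "b i q \<noteq> 0" if "c i q \<noteq> 0" for i q
  proof
    assume "b i q = 0"
    moreover have "0 \<le> real i * (\<Sum>j<i. b j q)" using b01(1) by (simp add: sum_nonneg)
    ultimately show False using that by (simp add: c_def)
  qed
  have loc: "\<exists>N n. open N \<and> p \<in> N \<and> (\<forall>q\<in>N. \<forall>i\<ge>n. c i q = 0)" if p: "p \<in> S" for p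
  proof -
    obtain j where j: "0 < b j p" using cov[OF p] by blast
    define \<eta> where "\<eta> = b j p / 2"
    obtain n where n: "1 / \<eta> < real n" using reals_Archimedean2 by blast
    have \<eta>: "0 < \<eta>" "\<eta> < b j p" using j by (auto simp: \<eta>_def)
    have "open {q. \<eta> < b j q}"
      using open_vimage[OF open_greaterThan[of \<eta>] cont[of j]] by (simp add: vimage_def)
    moreover have "c i q = 0" if "\<eta> < b j q" "i \<ge> Suc (max n j)" for i q
    proof -
      have "real n * \<eta> \<le> real i * (\<Sum>j<i. b j q)"
      proof (rule mult_mono)
        have "b j q \<le> (\<Sum>j<i. b j q)" using that(2) b01(1) by (intro member_le_sum) auto
        then show "\<eta> \<le> (\<Sum>j<i. b j q)" using that(1) by simp
      qed (use that(2) \<eta> in auto)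
      moreover have "1 \<le> real n * \<eta>" using n \<eta>(1) by (simp add: divide_simps)
      ultimately show ?thesis using b01(2)[of i q] by (simp add: c_def)
    qed
    ultimately show ?thesis
      by (intro exI[of _ "{q. \<eta> < b j q}"] exI[of _ "Suc (max n j)"]) (use \<eta> in auto)
  qed
  have sums: "(\<lambda>i. c i p) sums s p" if p: "p \<in> S" for p
  proof -
    obtain N n where "p \<in> N" "\<forall>q\<in>N. \<forall>i\<ge>n. c i q = 0" using loc[OF p] by blast
    then have "\<And>i. i \<notin> {..<n} \<Longrightarrow> c i p = 0" by auto
    then have "summable (\<lambda>i. c i p)" by (rule summable_finite[of "{..<n}", rotated]) auto
    then show ?thesis unfolding s_def by (rule summable_sums)
  qed
  have sc: "isCont s p" if p: "p \<in> S" for p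
  proof -
    obtain N n where N: "open N" "p \<in> N" "\<forall>q\<in>N. \<forall>i\<ge>n. c i q = 0" using loc[OF p] by blast
    have eq: "s q = (\<Sum>i<n. c i q)" if "q \<in> N" for q
      unfolding s_def by (rule suminf_finite) (use N(3) that in auto)
    have "continuous_on N (\<lambda>q. \<Sum>i<n. c i q)"
      by (intro continuous_intros continuous_on_subset[OF cc]) auto
    then have "continuous_on N s" by (rule continuous_on_eq) (simp add: eq)
    then show ?thesis using N continuous_on_eq_continuous_at by blast
  qed
  have spos: "0 < s p" if "p \<in> S" for p
  proof -
    \<comment> \<open>The first bump function that is positive at \<open>p\<close> is not diminished
      by its predecessors, which makes the sum positive at \<open>p\<close>.\<close>
    define i where "i = (LEAST i. 0 < b i p)"
    have i: "0 < b i p" unfolding i_def using cov[OF that] by (rule LeastI_ex)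
    have "b j p = 0" if "j < i" for j
      using not_less_Least[of j "\<lambda>i. 0 < b i p"] that b01(1)[of j p] by (auto simp: i_def)
    then have "c i p = b i p" using i by (simp add: c_def)
    then have "0 < c i p" using i by simp
    moreover have "c i p \<le> s p"
      using sum_le_suminf[OF sums_summable[OF sums[OF that]], of "{i}"] c0 by (simp add: s_def)
    ultimately show ?thesis by simp
  qed
  show ?thesis
  proof (rule that[of "\<lambda>i p. c i p / s p"])
    have scS: "continuous_on S s" using sc by (simp add: continuous_at_imp_continuous_on)
    show "continuous_on S (\<lambda>p. c i p / s p)" for i
      by (rule continuous_on_divide[OF continuous_on_subset[OF cc] scS]) (use spos in force)+
    show "0 \<le> c i p / s p" if "p \<in> S" for i p using c0 spos[OF that] by simp
    show "b i p \<noteq> 0" if "c i p / s p \<noteq> 0" for i p using cb that by auto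
    show "(\<lambda>i. c i p / s p) sums 1" if "p \<in> S" for p
      using sums_divide[OF sums[OF that], of "s p"] spos[OF that] by simp
    show "\<exists>N. open N \<and> p \<in> N \<and> finite {i. \<exists>q\<in>N \<inter> S. c i q / s q \<noteq> 0}" if p: "p \<in> S" for p
    proof -
      obtain N n where N: "open N" "p \<in> N" "\<forall>q\<in>N. \<forall>i\<ge>n. c i q = 0" using loc[OF p] by blast
      have "{i. \<exists>q\<in>N \<inter> S. c i q / s q \<noteq> 0} \<subseteq> {..<n}"
      proof
        fix i assume "i \<in> {i. \<exists>q\<in>N \<inter> S. c i q / s q \<noteq> 0}"
        then obtain q where "q \<in> N" "c i q \<noteq> 0" by auto
        then show "i \<in> {..<n}" using N(3) by (metis lessThan_iff not_le)
      qed
      then have "finite {i. \<exists>q\<in>N \<inter> S. c i q / s q \<noteq> 0}" by (rule finite_subset) simp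
      then show ?thesis using N(1,2) by blast
    qed
  qed
qed

lemma ex_Basis_list:
  assumes "r \<le> DIM('e::euclidean_space)"
  obtains cs :: "'e::euclidean_space list" where "distinct cs" "set cs \<subseteq> Basis" "length cs = r" "onb_list (span (set cs)) cs"
proof -
  obtain bs :: "'e list" where bs: "set bs = Basis" "distinct bs"
    using finite_distinct_list[OF finite_Basis] by blast
  have l: "length bs = DIM('e)" using bs distinct_card by metis
  let ?cs = "take r bs"
  have sub: "set ?cs \<subseteq> Basis" using bs(1) set_take_subset by metis
  have "onb_list (span (set ?cs)) ?cs"
    using sub bs(2) by (intro onb_list_span) (auto simp: pairwise_def inner_not_same_Basis subset_iff)
  then show ?thesis using that[of ?cs] bs l assms sub by simp
qed

text \<open>For an orthonormal list \<open>cs\<close>, the linear map that sends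
  \<open>cs ! i\<close> to \<open>es ! i\<close> and kills the orthogonal complement. It identifies
  a coordinate subspace with the kernel of \<open>D\<close>.\<close>

definition onb_map :: "'e::euclidean_space list \<Rightarrow> 'e list \<Rightarrow> 'e \<Rightarrow> 'e" where
  "onb_map cs es w = (\<Sum>i<length cs. inner w (cs ! i) *\<^sub>R es ! i)"

lemma onb_map:
  assumes cs: "onb_list C cs" and es: "onb_list E es" and l: "length cs = length es"
  shows "linear (onb_map cs es)" "onb_map cs es w \<in> E" "w \<in> C \<Longrightarrow> onb_map es cs (onb_map cs es w) = w"
proof -
  show "linear (onb_map cs es)"
    unfolding onb_map_def
    by (rule linearI) (auto simp: inner_add_left scaleR_add_left sum.distrib scaleR_sum_right)
  have "subspace E" using es subspace_span by (metis onb_list_def)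
  then show "onb_map cs es w \<in> E"
    unfolding onb_map_def using es l by (intro subspace_sum subspace_scale) (auto simp: onb_list_def)
  assume w: "w \<in> C"
  have "inner (onb_map cs es w) (es ! j) = inner w (cs ! j)" if "j < length cs" for j
  proof -
    have "inner (onb_map cs es w) (es ! j) = (\<Sum>i<length cs. inner w (cs ! i) * inner (es ! i) (es ! j))"
      by (simp add: onb_map_def inner_sum_left)
    also have "\<dots> = (\<Sum>i<length cs. if i = j then inner w (cs ! j) else 0)"
      using es l that by (intro sum.cong) (auto simp: onb_list_def)
    finally show ?thesis using that by simp
  qed
  then have "onb_map es cs (onb_map cs es w) = (\<Sum>i<length cs. inner w (cs ! i) *\<^sub>R cs ! i)"
    using l by (simp add: onb_map_def[of es])
  also have "\<dots> = w" using cs w unfolding onb_list_def by metis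
  finally show "onb_map es cs (onb_map cs es w) = w" .
qed

section \<open>Parametrizations of the source fibers and their partitions of unity\<close>

context deformation
begin

lemma isCont_src: "isCont (src G) q"
proof -
  obtain U \<xi> V \<eta> D J where ad: "adapted_chart A B (src G) U \<xi> V \<eta> D J" and q: "q \<in> U" using ex_adapted .
  note aD = adapted_chartD[OF ad]
  have "continuous_on U (\<lambda>q. D (\<xi> q))"
    using linear_continuous_on[OF linear_conv_bounded_linear[THEN iffD1, OF aD(3)]]
    by (rule continuous_on_compose2[OF _ compat_chartD(5)[OF aD(1)]]) auto
  then have "continuous_on U (\<lambda>q. inv_into V \<eta> (D (\<xi> q)))"
    by (rule continuous_on_compose2[OF compat_chartD(6)[OF aD(2)]]) (use aD(8,9) in force)
  then have "continuous_on U (src G)"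
    by (rule continuous_on_eq) (use aD(8,9) compat_chart_inv(2)[OF aD(2)] in metis)
  then show ?thesis using q compat_chartD(1)[OF aD(1)] continuous_on_eq_continuous_at by blast
qed

lemma closed_src_fiber: "closed (src_fiber G y)"
  using continuous_closed_vimage[OF closed_singleton, of "src G" y] isCont_src by (simp add: src_fiber_def vimage_def)

text \<open>In an adapted chart the fiber is the slice through \<open>?x0\<close> parallel to the
  kernel of \<open>D\<close>, which \<open>\<iota>\<close> and \<open>\<kappa>\<close> identify with
  the coordinate subspace. The bump function is a tent in chart coordinates, extended by 0: it is
  continuous on the whole groupoid, and on the fiber it vanishes outside the image of a compact set
  of parameters.\<close>

lemma fiber_parametrization:
  fixes cs :: "'e list"
  assumes cs: "onb_list (span (set cs)) cs" "length cs = dim (model A) - dim (model B)"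
    and p: "p \<in> src_fiber G y"
  obtains W \<psi> b where "openin (top_of_set (span (set cs))) W" "openin (top_of_set (src_fiber G y)) (\<psi> ` W)"
    "inj_on \<psi> W" "smooth_map eucl A W \<psi>" "smooth_map A eucl (\<psi> ` W) (inv_into W \<psi>)"
    "continuous_on UNIV b" "\<forall>q. 0 \<le> b q" "\<forall>q. b q \<le> (1::real)" "0 < b p"
    "\<exists>K\<subseteq>W. compact K \<and> (\<forall>q\<in>src_fiber G y. b q \<noteq> 0 \<longrightarrow> q \<in> \<psi> ` K)"
proof -
  obtain U \<xi> V \<eta> D J where ad: "adapted_chart A B (src G) U \<xi> V \<eta> D J" and pU: "p \<in> U" using ex_adapted .
  note aD = adapted_chartD[OF ad] and sA = manifold_subspace[OF MA]
  let ?S = "src_fiber G y" and ?C = "{x \<in> model A. D x = 0}" and ?Sp = "span (set cs)" and ?x0 = "\<xi> p"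
  have y: "src G p = y" using p by (simp add: src_fiber_def)
  obtain es where es: "onb_list ?C es" using ex_onb_list[OF subspace_kernel_adapted[OF MA ad]] .
  have l: "length cs = length es" using es cs(2) dim_kernel_adapted[OF MA MB ad] by (simp add: onb_list_def)
  define \<iota> where "\<iota> = onb_map cs es"
  define \<kappa> where "\<kappa> = onb_map es cs"
  note i = onb_map[OF cs(1) es l, folded \<iota>_def \<kappa>_def] and k = onb_map[OF es cs(1) l[symmetric], folded \<iota>_def \<kappa>_def]
  have bli: "bounded_linear \<iota>" and blk: "bounded_linear \<kappa>" using i(1) k(1) by (auto simp: linear_conv_bounded_linear)
  have x0A: "?x0 \<in> model A" by (rule compat_chart_inv(1)[OF aD(1) pU])
  have iA: "?x0 + \<iota> w \<in> model A" "D (?x0 + \<iota> w) = D ?x0" for w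
    using i(2)[of w] x0A sA by (auto simp: subspace_add linear_add[OF aD(3)])
  have fib: "\<xi> q - ?x0 \<in> ?C" if "q \<in> U" "q \<in> ?S" for q
    using that compat_chart_inv(1)[OF aD(1) that(1)] x0A sA src_eq_adapted[OF ad that(1) pU] y
    by (auto simp: subspace_diff linear_diff[OF aD(3)] src_fiber_def)
  define \<psi> where "\<psi> w = inv_into U \<xi> (?x0 + \<iota> w)" for w
  define W where "W = {w \<in> ?Sp. ?x0 + \<iota> w \<in> \<xi> ` U}"
  have \<psi>: "\<psi> w \<in> U" "\<xi> (\<psi> w) = ?x0 + \<iota> w" "\<psi> w \<in> ?S" if "w \<in> W" for w
  proof -
    show 1: "\<psi> w \<in> U" and 2: "\<xi> (\<psi> w) = ?x0 + \<iota> w"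
      using that compat_chart_inv(3,4)[OF aD(1)] by (auto simp: W_def \<psi>_def)
    show "\<psi> w \<in> ?S" using src_eq_adapted[OF ad 1 pU] 2 iA(2) y by (simp add: src_fiber_def)
  qed
  have \<kappa>\<psi>: "\<kappa> (\<xi> (\<psi> w) - ?x0) = w" if "w \<in> W" for w
    using \<psi>(2)[OF that] i(3)[of w] that by (simp add: W_def)
  have \<psi>\<kappa>: "\<kappa> (\<xi> q - ?x0) \<in> W" "\<psi> (\<kappa> (\<xi> q - ?x0)) = q" if "q \<in> U" "q \<in> ?S" for q
    using k(3)[OF fib[OF that]] k(2)[of "\<xi> q - ?x0"] that compat_chart_inv(2)[OF aD(1) that(1)] by (auto simp: W_def \<psi>_def)
  have im: "\<psi> ` W = ?S \<inter> U"
  proof (intro equalityI subsetI)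
    fix q assume "q \<in> ?S \<inter> U"
    then show "q \<in> \<psi> ` W" using \<psi>\<kappa>[of q] by (metis IntD1 IntD2 image_eqI)
  qed (use \<psi> in auto)
  have inj: "inj_on \<psi> W" by (rule inj_on_inverseI[where g="\<lambda>q. \<kappa> (\<xi> q - ?x0)"]) (rule \<kappa>\<psi>)
  obtain Q where Q: "open Q" "\<xi> ` U = model A \<inter> Q" using compat_chartD(2)[OF aD(1)] by (auto simp: openin_open)
  have "continuous_on UNIV (\<lambda>w. ?x0 + \<iota> w)"
    by (intro continuous_intros linear_continuous_on bli)
  then have "open ((\<lambda>w. ?x0 + \<iota> w) -` Q)" by (rule open_vimage[OF Q(1)])
  moreover have "W = ?Sp \<inter> (\<lambda>w. ?x0 + \<iota> w) -` Q" using Q(2) iA(1) by (auto simp: W_def)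
  ultimately have 1: "openin (top_of_set ?Sp) W" by (auto simp: openin_open)
  have 2: "openin (top_of_set ?S) (\<psi> ` W)"
    unfolding im using compat_chartD(1)[OF aD(1)] by (auto simp: openin_open)
  have 3: "smooth_map eucl A W \<psi>"
  proof (rule smooth_map_in_charts[OF covered_eucl manifold_covered[OF MA] smooth_chart_eucl compat_chartD(3)[OF aD(1)]])
    have "Cinf_on UNIV (\<lambda>w. ?x0 + \<iota> w)"
      by (intro Cinf_on_add Cinf_on_const Cinf_on_linear i(1)) auto
    then have "local_rep W \<psi> UNIV id U \<xi> UNIV (\<lambda>w. ?x0 + \<iota> w)" using \<psi> by (auto simp: local_rep_def)
    then show "\<exists>N F. id p \<in> N \<and> local_rep W \<psi> UNIV id U \<xi> N F" for p by blast
  qed (use \<psi> in auto)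
  have 4: "smooth_map A eucl (\<psi> ` W) (inv_into W \<psi>)"
  proof (rule smooth_map_in_charts[OF manifold_covered[OF MA] covered_eucl compat_chartD(3)[OF aD(1)] smooth_chart_eucl])
    have "Cinf_on UNIV (\<lambda>x. \<kappa> (x - ?x0))"
      by (intro Cinf_on_bounded_linear[OF open_UNIV blk] Cinf_on_diff Cinf_on_id Cinf_on_const) auto
    then have "local_rep (\<psi> ` W) (inv_into W \<psi>) U \<xi> UNIV id UNIV (\<lambda>x. \<kappa> (x - ?x0))"
      using \<kappa>\<psi> inv_into_f_f[OF inj] by (auto simp: local_rep_def)
    then show "\<exists>N F. \<xi> p \<in> N \<and> local_rep (\<psi> ` W) (inv_into W \<psi>) U \<xi> UNIV id N F" for p by blast
  qed (use im in auto)
  obtain R where R: "0 < R" "\<And>x. x \<in> model A \<Longrightarrow> dist ?x0 x \<le> R \<Longrightarrow> x \<in> \<xi> ` (U \<inter> UNIV)"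
    using compat_chart_cball[OF aD(1) pU open_UNIV UNIV_I open_UNIV UNIV_I] by metis
  define b where "b q = (if q \<in> U then max 0 (1 - dist ?x0 (\<xi> q) / R) else 0)" for q
  \<comment> \<open>A compact chart preimage of the ball, hence closed in the manifold. Continuity
    of \<open>b\<close> is checked on \<open>U\<close> and on the complement of \<open>L\<close>,
    which together cover everything.\<close>
  define L where "L = inv_into U \<xi> ` (cball ?x0 R \<inter> model A)"
  have sub: "cball ?x0 R \<inter> model A \<subseteq> \<xi> ` U" using R(2) by auto
  have "compact (cball ?x0 R \<inter> model A)"
    using closed_subspace[OF sA] by (intro compact_Int_closed) auto
  then have "compact L" unfolding L_def
    by (intro compact_continuous_image continuous_on_subset[OF compat_chartD(6)[OF aD(1)] sub])
  then have "closed L" by (rule compact_imp_closed)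
  have bL: "b q = 0" if "q \<notin> L" for q
  proof (rule ccontr)
    assume b: "b q \<noteq> 0"
    then have q: "q \<in> U" by (simp add: b_def split: if_splits)
    then have "max 0 (1 - dist ?x0 (\<xi> q) / R) \<noteq> 0" using b by (simp only: b_def q if_True not_False_eq_True)
    then have "\<not> 1 - dist ?x0 (\<xi> q) / R \<le> 0" using max.absorb1 by metis
    then have "dist ?x0 (\<xi> q) / R \<le> 1" by linarith
    then have "dist ?x0 (\<xi> q) \<le> R" using R(1) by (simp only: divide_le_eq_1_pos)
    then have "q \<in> L" unfolding L_def
      using compat_chart_inv(1,2)[OF aD(1) q] by (intro image_eqI[of _ _ "\<xi> q"]) auto
    then show False using that by simp
  qed
  have "isCont b q" for q
  proof (cases "q \<in> U")
    case True
    have "continuous_on U (\<lambda>q. max 0 (1 - dist ?x0 (\<xi> q) / R))"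
      using R(1) by (intro continuous_intros compat_chartD(5)[OF aD(1)]) auto
    then have "continuous_on U b" by (rule continuous_on_eq) (simp add: b_def)
    then show ?thesis using True compat_chartD(1)[OF aD(1)] continuous_on_eq_continuous_at by blast
  next
    case False
    have "q \<notin> L" using False sub compat_chart_inv(3)[OF aD(1)] by (auto simp: L_def)
    have "continuous_on (- L) b" by (rule continuous_on_eq[OF continuous_on_const[of _ 0]]) (simp add: bL)
    then show ?thesis using \<open>q \<notin> L\<close> \<open>closed L\<close> continuous_on_eq_continuous_at[of "- L" b] by (simp add: open_Compl)
  qed
  then have 5: "continuous_on UNIV b" by (simp add: continuous_at_imp_continuous_on)
  define K where "K = \<kappa> ` (cball 0 R \<inter> ?C)"
  have "closed ?C" using closed_subspace[OF subspace_kernel_adapted[OF MA ad]] .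
  then have "compact (cball 0 R \<inter> ?C)" by (intro compact_Int_closed) auto
  then have "compact K" unfolding K_def by (intro compact_continuous_image linear_continuous_on blk)
  moreover have "K \<subseteq> W"
  proof
    fix w assume "w \<in> K"
    then obtain v where v: "v \<in> ?C" "norm v \<le> R" "w = \<kappa> v" by (auto simp: K_def)
    have "\<iota> w = v" using k(3)[OF v(1)] v(3) by simp
    moreover have "?x0 + v \<in> \<xi> ` U"
      using R(2)[of "?x0 + v"] v x0A sA by (auto simp: subspace_add dist_norm)
    ultimately show "w \<in> W" using v(3) k(2) by (simp add: W_def)
  qed
  moreover have "q \<in> \<psi> ` K" if "q \<in> ?S" "b q \<noteq> 0" for q
  proof -
    have "q \<in> L" using bL that(2) by blast
    then obtain x where x: "x \<in> cball ?x0 R" "x \<in> model A" "q = inv_into U \<xi> x" by (auto simp: L_def)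
    then have "q \<in> U" "\<xi> q = x" using sub compat_chart_inv(3,4)[OF aD(1), of x] by auto
    then have "\<kappa> (\<xi> q - ?x0) \<in> K"
      unfolding K_def using fib[OF \<open>q \<in> U\<close> that(1)] x(1)
      by (intro imageI) (simp add: dist_norm norm_minus_commute)
    then show ?thesis
      using \<psi>\<kappa>(2)[OF \<open>q \<in> U\<close> that(1)] by (metis image_eqI)
  qed
  ultimately have 6: "\<exists>K\<subseteq>W. compact K \<and> (\<forall>q\<in>?S. b q \<noteq> 0 \<longrightarrow> q \<in> \<psi> ` K)" by blast
  show ?thesis
    by (rule that[OF 1 2 inj 3 4 5 _ _ _ 6]) (use R(1) pU in \<open>auto simp: b_def\<close>)
qed

text \<open>The Lindelof property selects countably many bump functions whose positivity sets cover
  the fiber, since \<open>parametrized_partition\<close> is indexed by natural numbers.\<close>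

lemma ex_parametrized_partition:
  "\<exists>cs W \<psi> \<rho>. parametrized_partition A (dim (model A) - dim (model B)) (src_fiber G y) cs W \<psi> \<rho>"
proof -
  let ?S = "src_fiber G y" and ?r = "dim (model A) - dim (model B)"
  have "?r \<le> DIM('e)" using dim_subset_UNIV[of "model A"] by simp
  then obtain cs :: "'e list" where cs: "distinct cs" "set cs \<subseteq> Basis" "length cs = ?r" "onb_list (span (set cs)) cs"
    using ex_Basis_list by blast
  define ok where "ok p W \<psi> b \<longleftrightarrow> openin (top_of_set (span (set cs))) W \<and> openin (top_of_set ?S) (\<psi> ` W) \<and>
    inj_on \<psi> W \<and> smooth_map eucl A W \<psi> \<and> smooth_map A eucl (\<psi> ` W) (inv_into W \<psi>) \<and>
    continuous_on UNIV b \<and> (\<forall>q. 0 \<le> b q) \<and> (\<forall>q. b q \<le> (1::real)) \<and> 0 < b p \<and>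
    (\<exists>K\<subseteq>W. compact K \<and> (\<forall>q\<in>?S. b q \<noteq> 0 \<longrightarrow> q \<in> \<psi> ` K))" for p W and \<psi> :: "'e \<Rightarrow> 'g" and b
  have "\<exists>W \<psi> b. ok p W \<psi> b" if "p \<in> ?S" for p
    unfolding ok_def
    by (rule fiber_parametrization[OF cs(4,3) that]) (rule exI, rule exI, rule exI, intro conjI; assumption)
  then obtain W0 \<psi>0 b0 where ok: "\<And>p. p \<in> ?S \<Longrightarrow> ok p (W0 p) (\<psi>0 p) (b0 p)" by metis
  let ?O = "\<lambda>p. {q. 0 < b0 p q}"
  have opO: "open (?O p)" if "p \<in> ?S" for p
    using open_vimage[OF open_greaterThan[of 0], of "b0 p"] ok[OF that] by (simp add: ok_def vimage_def)
  then have op: "open X" if "X \<in> ?O ` ?S" for X using that by auto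
  obtain F' where F': "F' \<subseteq> ?O ` ?S" "countable F'" "\<Union>F' = \<Union>(?O ` ?S)"
    using Lindelof[of "?O ` ?S", OF op] by metis
  obtain C where C: "countable C" "C \<subseteq> ?S" "F' = ?O ` C"
    using F'(1,2) by (metis countable_subset_image)
  have covS: "\<exists>p\<in>C. 0 < b0 p q" if "q \<in> ?S" for q
  proof -
    have "q \<in> \<Union>(?O ` ?S)" using that ok[OF that] by (auto simp: ok_def)
    then show ?thesis using F'(3) C(3) by auto
  qed
  \<comment> \<open>A unit makes the fiber nonempty, so that the countable set can be enumerated by
    all natural numbers; the construction of the partition tolerates repetitions.\<close>
  have "unit_at G y \<in> ?S" using grp by (simp add: is_groupoid_def src_fiber_def)
  then have "C \<noteq> {}" using covS by blast
  define e where "e = from_nat_into C"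
  have e: "e i \<in> ?S" for i using from_nat_into[OF \<open>C \<noteq> {}\<close>] C(2) by (auto simp: e_def)
  have eC: "range e = C" unfolding e_def by (rule range_from_nat_into[OF \<open>C \<noteq> {}\<close> C(1)])
  have oke: "ok (e i) (W0 (e i)) (\<psi>0 (e i)) (b0 (e i))" for i by (rule ok[OF e])
  obtain \<rho> :: "nat \<Rightarrow> 'g \<Rightarrow> real" where \<rho>: "\<And>i. continuous_on ?S (\<rho> i)" "\<And>i p. p \<in> ?S \<Longrightarrow> 0 \<le> \<rho> i p" "\<And>i p. \<rho> i p \<noteq> 0 \<Longrightarrow> b0 (e i) p \<noteq> 0"
    "\<And>p. p \<in> ?S \<Longrightarrow> (\<lambda>i. \<rho> i p) sums 1"
    "\<And>p. p \<in> ?S \<Longrightarrow> \<exists>N. open N \<and> p \<in> N \<and> finite {i. \<exists>q\<in>N \<inter> ?S. \<rho> i q \<noteq> 0}"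
  proof (rule partition_of_unity_from_bumps[of "\<lambda>i. b0 (e i)" ?S])
    show "\<exists>i. 0 < b0 (e i) p" if "p \<in> ?S" for p
      using covS[OF that] eC by (metis imageE)
  qed (use oke in \<open>auto simp: ok_def\<close>)
  have "parametrized_partition A ?r ?S cs (\<lambda>i. W0 (e i)) (\<lambda>i. \<psi>0 (e i)) \<rho>"
    unfolding parametrized_partition_def
  proof (intro conjI allI ballI)
    show "\<exists>K\<subseteq>W0 (e i). compact K \<and> (\<forall>p\<in>?S. \<rho> i p \<noteq> 0 \<longrightarrow> p \<in> \<psi>0 (e i) ` K)" for i
      using oke[of i] \<rho>(3)[of i] unfolding ok_def by meson
  qed (use oke cs \<rho> in \<open>auto simp: ok_def\<close>)
  then show ?thesis by blast
qed

end

lemma sets_coord_measure [measurable_cong]: "sets (coord_measure cs) = sets borel"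
  by (simp add: coord_measure_def)

text \<open>The coordinates of the points of \<open>K\<close> are bounded by \<open>r\<close>, so
  the preimage of \<open>K\<close> lies in a box of finite product measure; for the empty list the
  product is 1.\<close>

lemma emeasure_coord_measure_finite:
  fixes K :: "'e::euclidean_space set"
  assumes cs: "distinct cs" "set cs \<subseteq> Basis" and K: "bounded K" "K \<in> sets borel"
  shows "emeasure (coord_measure cs) K < \<infinity>"
proof -
  interpret product_sigma_finite "\<lambda>_::'e. lborel :: real measure" by standard
  let ?P = "Pi\<^sub>M (set cs) (\<lambda>_. lborel :: real measure)" and ?f = "\<lambda>x::'e \<Rightarrow> real. \<Sum>b\<in>set cs. x b *\<^sub>R b"
  obtain r where r: "\<And>x. x \<in> K \<Longrightarrow> norm x \<le> r" using K(1) by (auto simp: bounded_iff)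
  have f: "?f \<in> measurable ?P borel" by measurable
  have "emeasure (coord_measure cs) K = emeasure ?P (?f -` K \<inter> space ?P)"
    unfolding coord_measure_def by (rule emeasure_distr[OF f K(2)])
  also have "\<dots> \<le> emeasure ?P (Pi\<^sub>E (set cs) (\<lambda>_. {-r..r}))"
  proof (rule emeasure_mono)
    show "?f -` K \<inter> space ?P \<subseteq> Pi\<^sub>E (set cs) (\<lambda>_. {-r..r})"
    proof
      fix x assume x: "x \<in> ?f -` K \<inter> space ?P"
      have "x b \<in> {-r..r}" if b: "b \<in> set cs" for b
      proof -
        have "inner (?f x) b = (\<Sum>c\<in>set cs. if c = b then x b else 0)"
          unfolding inner_sum_left using cs(2) b
          by (intro sum.cong) (auto simp: inner_Basis subset_iff)
        then have "inner (?f x) b = x b" using b by simp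
        then have "\<bar>x b\<bar> \<le> norm (?f x)" using Basis_le_norm[of b "?f x"] b cs(2) by auto
        also have "\<dots> \<le> r" using x r by auto
        finally show ?thesis by auto
      qed
      then show "x \<in> Pi\<^sub>E (set cs) (\<lambda>_. {-r..r})" using x by (auto simp: space_PiM PiE_iff)
    qed
    show "Pi\<^sub>E (set cs) (\<lambda>_. {-r..r}) \<in> sets ?P" by (intro sets_PiM_I_finite) auto
  qed
  also have "\<dots> = (\<Prod>b\<in>set cs. emeasure lborel {-r..r})"
    by (rule emeasure_PiM) auto
  also have "\<dots> < \<infinity>" by (cases "-r \<le> r") (auto simp: prod_constant power_less_top_ennreal)
  finally show ?thesis .
qed

lemma has_vector_derivative_if_slope:
  fixes f :: "real \<Rightarrow> 'a::real_normed_vector"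
  assumes "((\<lambda>s. (f s - f t) /\<^sub>R (s - t)) \<longlongrightarrow> v) (at t within S)"
  shows "(f has_vector_derivative v) (at t within S)"
proof -
  have "((\<lambda>s. norm ((f s - f t) /\<^sub>R (s - t) - v)) \<longlongrightarrow> 0) (at t within S)"
    using assms by (simp add: LIM_zero tendsto_norm_zero Lim_null[symmetric])
  moreover have "norm (f s - f t - (s - t) *\<^sub>R v) / norm (s - t) = norm ((f s - f t) /\<^sub>R (s - t) - v)"
    if "s \<noteq> t" for s
  proof -
    have "(f s - f t) /\<^sub>R (s - t) - v = (f s - f t - (s - t) *\<^sub>R v) /\<^sub>R (s - t)"
      using that by (simp add: scaleR_diff_right)
    then show ?thesis by (simp add: divide_inverse mult.commute)
  qed
  ultimately have "((\<lambda>s. norm (f s - f t - (s - t) *\<^sub>R v) / norm (s - t)) \<longlongrightarrow> 0) (at t within S)"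
    by (elim Lim_transform_within[where d=1]) auto
  then show ?thesis
    unfolding has_vector_derivative_def has_derivative_iff_norm by (simp add: bounded_linear_scaleR_left)
qed

text \<open>Compactness makes the local bounds and parameter intervals uniform, the mean value
  inequality turns them into a bound for the slopes, and dominated convergence applies along
  sequences of parameters, with a constant on \<open>K\<close> as majorant.\<close>

lemma has_vector_derivative_integral_compact:
  fixes f :: "real \<Rightarrow> 'e::euclidean_space \<Rightarrow> 'k::euclidean_space" and \<mu> :: "'e measure"
  assumes \<mu>: "sets \<mu> = sets borel" "emeasure \<mu> K < \<infinity>" and K: "compact K"
    and loc: "\<And>x0. x0 \<in> K \<Longrightarrow> \<exists>\<delta> V C. 0 < \<delta> \<and> open V \<and> x0 \<in> V \<and>
      (\<forall>\<epsilon>. \<bar>\<epsilon>\<bar> < \<delta> \<longrightarrow> continuous_on (K \<inter> V) (f \<epsilon>)) \<and>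
      (\<forall>\<epsilon> x. \<bar>\<epsilon>\<bar> < \<delta> \<longrightarrow> x \<in> K \<inter> V \<longrightarrow>
        (\<exists>w. ((\<lambda>\<epsilon>. f \<epsilon> x) has_vector_derivative w) (at \<epsilon>) \<and> norm w \<le> C))"
    and g: "\<And>x. x \<in> K \<Longrightarrow> ((\<lambda>\<epsilon>. f \<epsilon> x) has_vector_derivative g x) (at 0)"
  shows "((\<lambda>\<epsilon>. \<integral>x. indicator K x *\<^sub>R f \<epsilon> x \<partial>\<mu>) has_vector_derivative (\<integral>x. indicator K x *\<^sub>R g x \<partial>\<mu>)) (at 0)"
proof -
  obtain \<delta>0 V C0 where l: "\<And>x0. x0 \<in> K \<Longrightarrow> 0 < \<delta>0 x0 \<and> open (V x0) \<and> x0 \<in> V x0 \<and>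
      (\<forall>\<epsilon>. \<bar>\<epsilon>\<bar> < \<delta>0 x0 \<longrightarrow> continuous_on (K \<inter> V x0) (f \<epsilon>)) \<and>
      (\<forall>\<epsilon> x. \<bar>\<epsilon>\<bar> < \<delta>0 x0 \<longrightarrow> x \<in> K \<inter> V x0 \<longrightarrow>
        (\<exists>w. ((\<lambda>\<epsilon>. f \<epsilon> x) has_vector_derivative w) (at \<epsilon>) \<and> norm w \<le> (C0 x0 :: real)))"
    using loc by metis
  obtain T where T: "T \<subseteq> K" "finite T" "K \<subseteq> (\<Union>x\<in>T. V x)"
    using compactE_image[OF K, of K V] l by blast
  \<comment> \<open>The inserted elements 1 and 0 keep \<open>Min\<close> and \<open>Max\<close>
    meaningful when \<open>T\<close> is empty.\<close>
  define \<delta> where "\<delta> = Min (insert 1 (\<delta>0 ` T))"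
  define C where "C = Max (insert 0 (C0 ` T))"
  have \<delta>: "0 < \<delta>" "\<And>x. x \<in> T \<Longrightarrow> \<delta> \<le> \<delta>0 x"
    using T l by (auto simp: \<delta>_def subset_iff)
  have C: "\<And>x. x \<in> T \<Longrightarrow> C0 x \<le> C" using T(2) by (auto simp: C_def)
  have der: "\<exists>w. ((\<lambda>\<epsilon>. f \<epsilon> x) has_vector_derivative w) (at \<epsilon>) \<and> norm w \<le> C" if x: "x \<in> K" and e: "\<bar>\<epsilon>\<bar> < \<delta>" for x \<epsilon>
  proof -
    obtain x0 where x0: "x0 \<in> T" "x \<in> V x0" using T(3) x by blast
    then have "\<bar>\<epsilon>\<bar> < \<delta>0 x0" using \<delta>(2)[OF x0(1)] e by simp
    then obtain w where "((\<lambda>\<epsilon>. f \<epsilon> x) has_vector_derivative w) (at \<epsilon>)" "norm w \<le> C0 x0"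
      using l[of x0] x0 T(1) x by blast
    then show ?thesis using C[OF x0(1)] order_trans by blast
  qed
  have cont: "continuous_on K (f \<epsilon>)" if e: "\<bar>\<epsilon>\<bar> < \<delta>" for \<epsilon>
    unfolding continuous_on_eq_continuous_within
  proof
    fix x assume x: "x \<in> K"
    then obtain x0 where x0: "x0 \<in> T" "x \<in> V x0" using T(3) by blast
    then have "continuous_on (K \<inter> V x0) (f \<epsilon>)" and op: "open (V x0)"
      using l[of x0] T(1) \<delta>(2)[OF x0(1)] e by auto
    then have "continuous (at x within K \<inter> V x0) (f \<epsilon>)"
      using x x0 by (auto simp: continuous_on_eq_continuous_within)
    moreover have "at x within K \<inter> V x0 = at x within K"
      by (rule at_within_nhd[OF x0(2) op]) auto
    ultimately show "continuous (at x within K) (f \<epsilon>)" by (simp add: continuous_within)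
  qed
  have Kb: "K \<in> sets \<mu>" using K \<mu>(1) by (simp add: compact_imp_closed)
  have int1: "integrable \<mu> (\<lambda>x. indicator K x *\<^sub>R (C :: real))"
    using \<mu>(2) Kb by (simp add: integrable_indicator_iff less_top[symmetric])
  have meas: "(\<lambda>x. indicator K x *\<^sub>R f \<epsilon> x) \<in> borel_measurable \<mu>" if "\<bar>\<epsilon>\<bar> < \<delta>" for \<epsilon>
  proof -
    have "(\<lambda>x. indicator K x *\<^sub>R f \<epsilon> x) \<in> borel_measurable borel"
      by (rule borel_measurable_continuous_on_indicator[OF _ cont[OF that]]) (use K in \<open>simp add: compact_imp_closed\<close>)
    then show ?thesis using measurable_cong_sets[OF \<mu>(1) refl] by blast
  qed
  have intf: "integrable \<mu> (\<lambda>x. indicator K x *\<^sub>R f \<epsilon> x)" if "\<bar>\<epsilon>\<bar> < \<delta>" for \<epsilon>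
  proof -
    have "bounded (f \<epsilon> ` K)"
      by (intro compact_imp_bounded compact_continuous_image cont that K)
    then obtain b where b: "\<And>x. x \<in> K \<Longrightarrow> norm (f \<epsilon> x) \<le> b" by (auto simp: bounded_iff)
    have "integrable \<mu> (\<lambda>x. indicator K x *\<^sub>R (b :: real))"
      using \<mu>(2) Kb by (simp add: integrable_indicator_iff less_top[symmetric])
    then show ?thesis
    proof (rule Bochner_Integration.integrable_bound[OF _ meas[OF that]], intro AE_I2)
      fix x
      show "norm (indicator K x *\<^sub>R f \<epsilon> x) \<le> norm (indicator K x *\<^sub>R b)"
        using b[of x] by (auto simp: indicator_def)
    qed
  qed
  let ?I = "{-\<delta><..<\<delta>}"
  have I: "\<bar>\<epsilon>\<bar> < \<delta>" if "\<epsilon> \<in> ?I" for \<epsilon> using that by (auto simp: abs_if)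
  have lip: "norm (f \<epsilon> x - f 0 x) \<le> C * \<bar>\<epsilon> - 0\<bar>" if x: "x \<in> K" and e: "\<epsilon> \<in> ?I" for x \<epsilon>
  proof -
    have "\<forall>\<epsilon>\<in>?I. \<exists>w. ((\<lambda>\<epsilon>. f \<epsilon> x) has_vector_derivative w) (at \<epsilon>) \<and> norm w \<le> C"
      using der[OF x] I by blast
    from bchoice[OF this] obtain w where
      w: "\<And>\<epsilon>. \<epsilon> \<in> ?I \<Longrightarrow> ((\<lambda>\<epsilon>. f \<epsilon> x) has_vector_derivative w \<epsilon>) (at \<epsilon>) \<and> norm (w \<epsilon>) \<le> C" by blast
    show ?thesis
      by (rule vector_derivative_bound[where S="?I" and f'=w and f="\<lambda>\<epsilon>. f \<epsilon> x"])
        (use w e \<delta>(1) in \<open>auto intro: has_vector_derivative_at_within\<close>)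
  qed
  have "((\<lambda>\<epsilon>. \<integral>x. indicator K x *\<^sub>R f \<epsilon> x \<partial>\<mu>) has_vector_derivative (\<integral>x. indicator K x *\<^sub>R g x \<partial>\<mu>)) (at 0 within ?I)"
  proof (rule has_vector_derivative_if_slope, unfold tendsto_at_iff_sequentially comp_def, intro allI impI)
    fix X :: "nat \<Rightarrow> real" assume X: "\<forall>i. X i \<in> ?I - {0}" "X \<longlonglongrightarrow> 0"
    then have Xd: "\<bar>X i\<bar> < \<delta>" "X i \<noteq> 0" "X i \<in> ?I" for i using I by auto
    let ?s = "\<lambda>i x. indicator K x *\<^sub>R ((f (X i) x - f 0 x) /\<^sub>R (X i - 0))"
    have eq: "((\<integral>x. indicator K x *\<^sub>R f (X i) x \<partial>\<mu>) - (\<integral>x. indicator K x *\<^sub>R f 0 x \<partial>\<mu>)) /\<^sub>R (X i - 0) = (\<integral>x. ?s i x \<partial>\<mu>)" for i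
    proof -
      have "(\<integral>x. ?s i x \<partial>\<mu>) = (\<integral>x. (indicator K x *\<^sub>R f (X i) x - indicator K x *\<^sub>R f 0 x) /\<^sub>R (X i - 0) \<partial>\<mu>)"
        by (intro Bochner_Integration.integral_cong) (auto simp: indicator_def)
      also have "\<dots> = (\<integral>x. indicator K x *\<^sub>R f (X i) x - indicator K x *\<^sub>R f 0 x \<partial>\<mu>) /\<^sub>R (X i - 0)"
        by (rule integral_scaleR_right)
      finally show ?thesis using intf[OF Xd(1)] intf[of 0] \<delta>(1) by simp
    qed
    have sm: "?s i \<in> borel_measurable \<mu>" for i
    proof -
      have "(\<lambda>x. (indicator K x *\<^sub>R f (X i) x - indicator K x *\<^sub>R f 0 x) /\<^sub>R (X i - 0)) \<in> borel_measurable \<mu>"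
        by (rule borel_measurable_scaleR[OF borel_measurable_const borel_measurable_diff[OF meas[OF Xd(1)] meas]])
          (use \<delta>(1) in simp)
      then show ?thesis by (simp add: scaleR_diff_right mult.commute)
    qed
    have lim: "(\<lambda>i. ?s i x) \<longlonglongrightarrow> indicator K x *\<^sub>R g x" for x
    proof (cases "x \<in> K")
      case True
      have "(\<lambda>i. (f (X i) x - f 0 x) /\<^sub>R (X i - 0)) \<longlonglongrightarrow> g x"
        using has_vector_derivative_slope[OF g[OF True]] X Xd unfolding tendsto_at_iff_sequentially comp_def by auto
      then show ?thesis by (intro tendsto_scaleR tendsto_const)
    qed simp
    have "(\<lambda>i. \<integral>x. ?s i x \<partial>\<mu>) \<longlonglongrightarrow> (\<integral>x. indicator K x *\<^sub>R g x \<partial>\<mu>)"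
    proof (rule integral_dominated_convergence[where w="\<lambda>x. indicator K x *\<^sub>R C"])
      \<comment> \<open>\<open>g\<close> is given pointwise only; it is measurable as the limit of
        the measurable slopes.\<close>
      show "(\<lambda>x. indicator K x *\<^sub>R g x) \<in> borel_measurable \<mu>"
        by (rule borel_measurable_LIMSEQ_metric[OF sm lim])
      show "AE x in \<mu>. norm (?s i x) \<le> indicator K x *\<^sub>R C" for i
      proof (rule AE_I2)
        fix x
        show "norm (?s i x) \<le> indicator K x *\<^sub>R C"
        proof (cases "x \<in> K")
          case True
          have "norm (f (X i) x - f 0 x) \<le> C * \<bar>X i\<bar>" using lip[OF True Xd(3)] by simp
          then show ?thesis using True Xd(2)[of i] by (simp add: divide_simps)
        qed simp
      qed
    qed (use sm int1 lim in auto)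
    then show "(\<lambda>i. ((\<integral>x. indicator K x *\<^sub>R f (X i) x \<partial>\<mu>) - (\<integral>x. indicator K x *\<^sub>R f 0 x \<partial>\<mu>)) /\<^sub>R (X i - 0))
        \<longlonglongrightarrow> (\<integral>x. indicator K x *\<^sub>R g x \<partial>\<mu>)"
      unfolding eq .
  qed
  moreover have "at (0::real) within ?I = at 0" using \<delta>(1) by (intro at_within_open) auto
  ultimately show ?thesis by simp
qed

lemma continuous_on_locally:
  fixes f :: "'a::t2_space \<Rightarrow> 'b::topological_space"
  assumes "\<And>x. x \<in> S \<Longrightarrow> \<exists>V. open V \<and> x \<in> V \<and> continuous_on (S \<inter> V) f"
  shows "continuous_on S f"
  unfolding continuous_on_eq_continuous_within
proof
  fix x assume x: "x \<in> S"
  then obtain V where V: "open V" "x \<in> V" "continuous_on (S \<inter> V) f" using assms by blast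
  then have "continuous (at x within S \<inter> V) f"
    using x by (auto simp: continuous_on_eq_continuous_within)
  moreover have "at x within S \<inter> V = at x within S"
    by (rule at_within_nhd[OF V(2,1)]) auto
  ultimately show "continuous (at x within S) f" by (simp add: continuous_within)
qed

lemma velocity_cong:
  assumes "\<forall>\<^sub>F s in at t. \<gamma> s = \<gamma>' s" "\<gamma> t = \<gamma>' t"
  shows "velocity A \<gamma> t = velocity A \<gamma>' t"
proof -
  have "has_velocity A \<gamma> t v \<longleftrightarrow> has_velocity A \<gamma>' t v" for v
    using has_velocity_eventually[of A \<gamma> t v \<gamma>'] has_velocity_eventually[of A \<gamma>' t v \<gamma>] assms
    by (auto simp: eq_commute)
  then show ?thesis by (simp add: velocity_def)
qed

text \<open>Meant for \<open>m 0\<close> and \<open>division G\<close>, which are known to agree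
  only on pairs with a common source. The curve chosen in \<open>tangent_map\<close> stays in
  \<open>S\<close> near 0, so agreement on the fiber is enough for the differentials.\<close>

lemma tangent_map_cong:
  assumes "curve_in A S p v \<gamma>" and f: "\<And>q. q \<in> S \<Longrightarrow> f q = f' q"
  shows "tangent_map A B S f p v = tangent_map A B S f' p v"
  unfolding tangent_map_def
proof (rule velocity_cong)
  let ?\<gamma> = "SOME \<gamma>. curve_in A S p v \<gamma>"
  have "curve_in A S p v ?\<gamma>" by (rule someI[of "\<lambda>\<gamma>. curve_in A S p v \<gamma>", OF assms(1)])
  then obtain \<delta> where \<delta>: "\<delta> > 0" "?\<gamma> ` {-\<delta><..<\<delta>} \<subseteq> S" unfolding curve_in_def by blast
  have S: "?\<gamma> s \<in> S" if "\<bar>s\<bar> < \<delta>" for s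
  proof -
    have "s \<in> {-\<delta><..<\<delta>}" using that by auto
    then show ?thesis using \<delta>(2) by blast
  qed
  show "\<forall>\<^sub>F s in at 0. (f \<circ> ?\<gamma>) s = (f' \<circ> ?\<gamma>) s"
    by (rule eventually_mono[OF eventually_at_0_less[OF \<delta>(1)]]) (simp add: f S)
  show "(f \<circ> ?\<gamma>) 0 = (f' \<circ> ?\<gamma>) 0" using f S[of 0] \<delta>(1) by simp
qed

lemma finite_indices_meeting_compact:
  assumes K: "compact K" "K \<subseteq> S"
    and loc: "\<And>p. p \<in> S \<Longrightarrow> \<exists>N. open N \<and> p \<in> N \<and> finite {i. \<exists>q\<in>N \<inter> S. P i q}"
  shows "finite {i. \<exists>q\<in>K. P i q}"
proof -
  have "\<forall>p\<in>S. \<exists>N. open N \<and> p \<in> N \<and> finite {i. \<exists>q\<in>N \<inter> S. P i q}" using loc by blast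
  from bchoice[OF this] obtain N where
    N: "\<forall>p\<in>S. open (N p) \<and> p \<in> N p \<and> finite {i. \<exists>q\<in>N p \<inter> S. P i q}" by blast
  obtain F where F: "F \<subseteq> K" "finite F" "K \<subseteq> (\<Union>p\<in>F. N p)"
    by (rule compactE_image[OF K(1), of K N]) (use N K(2) in auto)
  have "{i. \<exists>q\<in>K. P i q} \<subseteq> (\<Union>p\<in>F. {i. \<exists>q\<in>N p \<inter> S. P i q})"
  proof
    fix i assume "i \<in> {i. \<exists>q\<in>K. P i q}"
    then obtain q where q: "q \<in> K" "P i q" by blast
    then obtain p where "p \<in> F" "q \<in> N p" using F(3) by blast
    then show "i \<in> (\<Union>p\<in>F. {i. \<exists>q\<in>N p \<inter> S. P i q})" using q K(2) by blast
  qed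
  moreover have "finite (\<Union>p\<in>F. {i. \<exists>q\<in>N p \<inter> S. P i q})"
    using F(1,2) N K(2) by (intro finite_UN_I) auto
  ultimately show ?thesis by (rule finite_subset)
qed

section \<open>Integrals over patches and the derivative of the deformed convolution\<close>

context deformation
begin

lemma param_rep:
  assumes sm: "smooth_map eucl A W \<psi>" and x: "x \<in> W"
  obtains U \<xi> V \<eta> D J N F where "adapted_chart A B (src G) U \<xi> V \<eta> D J" "x \<in> N"
    "local_rep W \<psi> UNIV id U \<xi> N F"
proof -
  obtain U \<xi> V \<eta> D J where ad: "adapted_chart A B (src G) U \<xi> V \<eta> D J" "\<psi> x \<in> U" by (rule ex_adapted)
  have "\<exists>N F. id x \<in> N \<and> local_rep W \<psi> UNIV id U \<xi> N F"
    by (rule smooth_map_local_rep[OF sm smooth_chart_eucl compat_chartD(3)[OF adapted_chartD(1)[OF ad(1)]] x UNIV_I ad(2)])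
  then show ?thesis using that[OF ad(1)] by auto
qed

lemma param_continuous:
  fixes \<psi> :: "'d::euclidean_space \<Rightarrow> 'g"
  assumes sm: "smooth_map eucl A W \<psi>"
  shows "continuous_on W \<psi>"
proof (rule continuous_on_locally)
  fix x assume x: "x \<in> W"
  obtain U \<xi> V \<eta> D J N F where ad: "adapted_chart A B (src G) U \<xi> V \<eta> D J" and xN: "x \<in> N"
    and r: "local_rep W \<psi> UNIV id U \<xi> N F" by (rule param_rep[OF sm x])
  note c = adapted_chartD(1)[OF ad]
  have in_U: "\<psi> x' \<in> U" "F x' = \<xi> (\<psi> x')" if "x' \<in> W \<inter> N" for x'
    using local_repD(3,4)[OF r, of x'] that by auto
  have "continuous_on (W \<inter> N) (\<lambda>x'. inv_into U \<xi> (F x'))"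
    by (rule continuous_on_compose2[OF compat_chartD(6)[OF c]
          continuous_on_subset[OF Cinf_on_continuous[OF local_repD(2)[OF r]]]])
      (use in_U in auto)
  then have "continuous_on (W \<inter> N) \<psi>"
    by (rule continuous_on_eq) (use in_U compat_chart_inv(2)[OF c] in simp)
  then show "\<exists>V. open V \<and> x \<in> V \<and> continuous_on (W \<inter> V) \<psi>" using local_repD(1)[OF r] xN by blast
qed

text \<open>The partial derivatives of a parametrization are vertical because the parametrized
  curves stay in one source fiber. Openness of \<open>W\<close> in the coordinate subspace keeps the
  line \<open>x + t *\<^sub>R b\<close> in \<open>W\<close> for small \<open>t\<close>.\<close>

lemma param_velocity:
  assumes W: "openin (top_of_set (span T)) W" "\<psi> ` W \<subseteq> src_fiber G y"
    and ad: "adapted_chart A B (src G) U \<xi> V \<eta> D J" and r: "local_rep W \<psi> UNIV id U \<xi> N F"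
    and x: "x \<in> W" "x \<in> N" and b: "b \<in> T"
  shows "velocity A (\<lambda>t. \<psi> (x + t *\<^sub>R b)) 0 \<in> ker_ds A B G (\<psi> x)"
    "chart_comp A \<xi> (\<psi> x) (velocity A (\<lambda>t. \<psi> (x + t *\<^sub>R b)) 0) = frechet_derivative F (at x) b"
proof -
  note aD = adapted_chartD[OF ad]
  note rD = local_repD[OF r]
  let ?\<gamma> = "\<lambda>t. \<psi> (x + t *\<^sub>R b)"
  obtain Q where Q: "open Q" "W = span T \<inter> Q" using W(1) by (auto simp: openin_open)
  have xU: "\<psi> x \<in> U" using rD(3)[of x] x by simp
  have "isCont (\<lambda>t. x + t *\<^sub>R b) 0" by (intro continuous_intros)
  then have ev: "\<forall>\<^sub>F t in at 0. x + t *\<^sub>R b \<in> Q \<inter> N"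
    by (rule isCont_eventually) (use Q rD(1) x in auto)
  have sp: "x + t *\<^sub>R b \<in> span T" for t
    using x(1) Q(2) b by (auto intro: span_add span_scale span_base)
  have inWN: "x + t *\<^sub>R b \<in> W" "x + t *\<^sub>R b \<in> N" if "x + t *\<^sub>R b \<in> Q \<inter> N" for t
    using that sp Q(2) by auto
  have evU: "\<forall>\<^sub>F t in at 0. ?\<gamma> t \<in> U" and evF: "\<forall>\<^sub>F t in at 0. F (x + t *\<^sub>R b) = \<xi> (?\<gamma> t)"
    and evs: "\<forall>\<^sub>F t in at 0. src G (?\<gamma> t) = src G (\<psi> x)"
    using eventually_mono[OF ev, of "\<lambda>t. ?\<gamma> t \<in> U"] eventually_mono[OF ev, of "\<lambda>t. F (x + t *\<^sub>R b) = \<xi> (?\<gamma> t)"]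
      eventually_mono[OF ev, of "\<lambda>t. src G (?\<gamma> t) = src G (\<psi> x)"] inWN rD(3,4) W(2) x
    by (auto simp: src_fiber_def image_subset_iff)
  have "(F has_derivative frechet_derivative F (at x)) (at (x + 0 *\<^sub>R b))"
    using Cinf_on_has_derivative[OF rD(2) x(2)] by simp
  moreover have "((\<lambda>t. x + t *\<^sub>R b) has_derivative (\<lambda>t. t *\<^sub>R b)) (at 0)"
    by (auto intro!: derivative_eq_intros)
  ultimately have "((\<lambda>t. F (x + t *\<^sub>R b)) has_derivative (\<lambda>t. frechet_derivative F (at x) (t *\<^sub>R b))) (at 0)"
    by (rule has_derivative_compose[rotated])
  then have "((\<lambda>t. F (x + t *\<^sub>R b)) has_vector_derivative frechet_derivative F (at x) b) (at 0)"
    using Cinf_on_linear_frechet[OF rD(2) x(2)] by (simp add: has_vector_derivative_def linear_scale)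
  then have d: "((\<lambda>t. \<xi> (?\<gamma> t)) has_vector_derivative frechet_derivative F (at x) b) (at 0)"
    by (rule has_vector_derivative_eventually[OF _ evF]) (use rD(4)[of x] x in simp)
  have U0: "?\<gamma> 0 \<in> U" using xU by simp
  have "isCont ?\<gamma> 0"
    by (rule isCont_from_chart[OF aD(1) U0 evU has_vector_derivative_continuous[OF d]])
  from has_velocity_ex[where \<gamma>="?\<gamma>" and t=0, OF MA aD(1) U0 this d] obtain v where
    v: "v \<in> model A" "has_velocity A ?\<gamma> 0 v" "chart_comp A \<xi> (?\<gamma> 0) v = frechet_derivative F (at x) b" by metis
  have "((\<lambda>t. D (\<xi> (?\<gamma> t))) has_vector_derivative D (frechet_derivative F (at x) b)) (at 0)"
    by (rule bounded_linear.has_vector_derivative[OF linear_conv_bounded_linear[THEN iffD1, OF aD(3)] d])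
  moreover have "\<forall>\<^sub>F t in at 0. D (\<xi> (?\<gamma> t)) = D (\<xi> (\<psi> x))"
    using evU evs by eventually_elim (use src_eq_adapted[OF ad _ xU] in blast)
  ultimately have "((\<lambda>t. D (\<xi> (\<psi> x))) has_vector_derivative D (frechet_derivative F (at x) b)) (at (0::real))"
    by (rule has_vector_derivative_eventually) simp
  then have "D (frechet_derivative F (at x) b) = 0"
    using vector_derivative_unique_at has_vector_derivative_const by metis
  then have "v \<in> ker_ds A B G (\<psi> x)" using v ker_ds_adapted[OF MA MB ad xU] by simp
  then show "velocity A ?\<gamma> 0 \<in> ker_ds A B G (\<psi> x)"
    "chart_comp A \<xi> (\<psi> x) (velocity A ?\<gamma> 0) = frechet_derivative F (at x) b"
    using velocity_eqI[OF v(2)] v(3) by simp_all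
qed

lemma param_velocity_tuples:
  assumes W: "openin (top_of_set (span (set cs))) W" "\<psi> ` W \<subseteq> src_fiber G y" "smooth_map eucl A W \<psi>"
    and cs: "length cs = dim (model A) - dim (model B)" and x: "x \<in> W"
  shows "map (\<lambda>b. velocity A (\<lambda>t. \<psi> (x + t *\<^sub>R b)) 0) cs \<in> tuples (ker_ds A B G (\<psi> x))"
proof -
  obtain U \<xi> V \<eta> D J N F where ad: "adapted_chart A B (src G) U \<xi> V \<eta> D J" and xN: "x \<in> N"
    and r: "local_rep W \<psi> UNIV id U \<xi> N F" by (rule param_rep[OF W(3) x])
  have "\<psi> x \<in> U" using local_repD(3)[OF r, of x] x xN by simp
  then show ?thesis
    using dim_ker_ds(2)[OF MA MB ad] cs param_velocity(1)[OF W(1,2) ad r x xN] by (auto simp: tuples_def)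
qed

text \<open>In the parametrization a density is an absolute determinant times a smooth coefficient.
  The absolute value leaves continuity, which is enough for the second factor of the convolution, as
  that factor does not vary with \<open>\<epsilon>\<close>.\<close>

lemma param_density_continuous:
  fixes a :: "'g \<Rightarrow> 'e list \<Rightarrow> 'k::{real_normed_field, euclidean_space}"
  assumes W: "openin (top_of_set (span (set cs))) W" "\<psi> ` W \<subseteq> src_fiber G y" "smooth_map eucl A W \<psi>"
    and cs: "length cs = dim (model A) - dim (model B)" and a: "a \<in> convolution_algebra A B G"
  shows "continuous_on W (\<lambda>x. a (\<psi> x) (map (\<lambda>b. velocity A (\<lambda>t. \<psi> (x + t *\<^sub>R b)) 0) cs))"
proof (rule continuous_on_locally)
  fix x assume x: "x \<in> W"
  obtain U \<xi> V \<eta> D J N F where ad: "adapted_chart A B (src G) U \<xi> V \<eta> D J" and xN: "x \<in> N"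
    and r: "local_rep W \<psi> UNIV id U \<xi> N F" by (rule param_rep[OF W(3) x])
  note aD = adapted_chartD[OF ad]
  note rD = local_repD[OF r]
  have in_U: "\<psi> x' \<in> U" "F x' = \<xi> (\<psi> x')" if "x' \<in> W \<inter> N" for x'
    using rD(3,4)[of x'] that by auto
  obtain es where es: "onb_list {x \<in> model A. D x = 0} es"
    by (rule ex_onb_list[OF subspace_kernel_adapted[OF MA ad]])
  then have len: "length cs = length es"
    using dim_kernel_adapted[OF MA MB ad] cs by (simp add: onb_list_def)
  let ?\<alpha> = "\<lambda>q. a q (map (chart_vec A \<xi> q) es)"
  have "\<exists>N2 \<alpha>. \<xi> (\<psi> x) \<in> N2 \<and> local_rep U ?\<alpha> U \<xi> UNIV id N2 \<alpha>"
    using in_U(1)[of x] x xN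
    by (intro smooth_map_local_rep[OF density_frame_smooth[OF MA MB ad es a] compat_chartD(3)[OF aD(1)] smooth_chart_eucl]) auto
  then obtain N2 \<alpha> where N2: "\<xi> (\<psi> x) \<in> N2" and r2: "local_rep U ?\<alpha> U \<xi> UNIV id N2 \<alpha>" by blast
  let ?V = "F -` N2 \<inter> N"
  let ?v = "\<lambda>x. map (\<lambda>b. velocity A (\<lambda>t. \<psi> (x + t *\<^sub>R b)) 0) cs"
  let ?d = "\<lambda>x. coord_det es (\<lambda>j. frechet_derivative F (at x) (cs ! j))"
  have V: "open ?V" by (rule open_vimage_Int[OF rD(1) Cinf_on_continuous[OF rD(2)] local_repD(1)[OF r2]])
  have val: "\<bar>?d x'\<bar> *\<^sub>R \<alpha> (F x') = a (\<psi> x') (?v x')" if x': "x' \<in> W \<inter> ?V" for x'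
  proof -
    have x'N: "x' \<in> W" "x' \<in> N" "x' \<in> W \<inter> N" using x' by auto
    have "a (\<psi> x') (?v x') = \<bar>coord_det es (\<lambda>j. chart_comp A \<xi> (\<psi> x') (?v x' ! j))\<bar> *\<^sub>R ?\<alpha> (\<psi> x')"
      by (rule density_in_chart[OF MA MB ad in_U(1)[OF x'N(3)] es convolution_algebra_density[OF a]])
        (use param_velocity(1)[OF W(1,2) ad r x'N(1,2)] len in auto)
    also have "coord_det es (\<lambda>j. chart_comp A \<xi> (\<psi> x') (?v x' ! j)) = ?d x'"
      unfolding coord_det_eq using param_velocity(2)[OF W(1,2) ad r x'N(1,2)] len
      by (intro sum.cong prod.cong refl arg_cong2[where f="(*)"]) (auto simp: permutes_in_image)
    also have "?\<alpha> (\<psi> x') = \<alpha> (F x')"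
      using local_repD(4)[OF r2, of "\<psi> x'"] in_U[OF x'N(3)] x' by simp
    finally show ?thesis by simp
  qed
  have "continuous_on N ?d"
    by (rule Cinf_on_continuous, rule Cinf_on_coord_det[OF rD(1)], rule Cinf_on_frechet[OF rD(2)])
  then have 1: "continuous_on (W \<inter> ?V) ?d" by (rule continuous_on_subset) auto
  have "continuous_on (W \<inter> ?V) F" by (rule continuous_on_subset[OF Cinf_on_continuous[OF rD(2)]]) auto
  then have 2: "continuous_on (W \<inter> ?V) (\<lambda>x. \<alpha> (F x))"
    by (rule continuous_on_compose2[OF Cinf_on_continuous[OF local_repD(2)[OF r2]]]) auto
  have "continuous_on (W \<inter> ?V) (\<lambda>x. a (\<psi> x) (?v x))"
    by (rule continuous_on_eq[OF continuous_on_scaleR[OF continuous_on_rabs[OF 1] 2] val])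
  moreover have "x \<in> ?V" using in_U(2)[of x] x xN N2 by auto
  ultimately show "\<exists>V. open V \<and> x \<in> V \<and> continuous_on (W \<inter> V) (\<lambda>x. a (\<psi> x) (?v x))"
    using V by blast
qed

text \<open>The integrand of \<open>Phi2\<close> at the cocycle, without the factor from the second
  density.\<close>

definition integrand_deriv ::
  "('g \<Rightarrow> 'e list \<Rightarrow> 'k::{real_normed_field, euclidean_space}) \<Rightarrow> 'g \<Rightarrow> 'e list \<Rightarrow> 'g \<Rightarrow> 'k" where
  "integrand_deriv a g vs h = vf_action A B G (\<lambda>k. deformation_cocycle A G m k h) a (division G g h)
     (map (tangent_map A A (src_fiber G (src G h)) (\<lambda>g'. division G g' h) g) vs)"

lemma integrand_deriv_eq:
  assumes vs: "vs \<in> tuples (ker_ds A B G g)" and s: "src G g = src G h"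
  shows "integrand_deriv a g vs h = vf_action A B G (\<lambda>k. deformation_cocycle A G m k h) a (m 0 g h)
     (map (tangent_map A A (src_fiber G (src G h)) (\<lambda>g'. m 0 g' h) g) vs)"
proof -
  have "tangent_map A A (src_fiber G (src G h)) (\<lambda>g'. division G g' h) g v
      = tangent_map A A (src_fiber G (src G h)) (\<lambda>g'. m 0 g' h) g v" if "v \<in> set vs" for v
  proof -
    have "v \<in> ker_ds A B G g" using that vs by (auto simp: tuples_def)
    then obtain \<gamma> where "curve_in A (src_fiber G (src G g)) g v \<gamma>" by (rule fiber_curve)
    then show ?thesis unfolding s by (rule tangent_map_cong) (simp add: m_0 src_fiber_def)
  qed
  then show ?thesis unfolding integrand_deriv_def m_0[OF s] by (simp cong: map_cong)
qed

text \<open>Collects what dominated convergence needs near \<open>h0\<close>. The derivative at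
  parameter 0 is identified with the cocycle term at \<open>h0\<close> itself; at the other points
  of \<open>Q\<close> a uniform bound is provided, since the local form was matched with
  \<open>vf_action\<close> at \<open>h0\<close>.\<close>

lemma integrand_near:
  fixes a :: "'g \<Rightarrow> 'e list \<Rightarrow> 'k::{real_normed_field, euclidean_space}"
  assumes a: "a \<in> convolution_algebra A B G" and vs: "vs \<in> tuples (ker_ds A B G g)" and s0: "src G g = src G h0"
  obtains Q \<delta> C where "open Q" "h0 \<in> Q" "(0::real) < \<delta>" "(0::real) \<le> C"
    "\<And>\<epsilon>. \<bar>\<epsilon>\<bar> < \<delta> \<Longrightarrow> continuous_on (Q \<inter> src_fiber G (src G g)) (integrand a g vs \<epsilon>)"
    "\<And>\<epsilon> h. \<bar>\<epsilon>\<bar> < \<delta> \<Longrightarrow> h \<in> Q \<Longrightarrow> src G g = src G h \<Longrightarrow>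
      \<exists>w. ((\<lambda>\<epsilon>. integrand a g vs \<epsilon> h) has_vector_derivative w) (at \<epsilon>) \<and> norm w \<le> C"
    "((\<lambda>\<epsilon>. integrand a g vs \<epsilon> h0) has_vector_derivative integrand_deriv a g vs h0) (at 0)"
proof -
  obtain W \<zeta> N \<Psi> where c: "compat_chart A W \<zeta>" and h0: "h0 \<in> W" and N: "open N" "(0, \<zeta> h0) \<in> N" "Cinf_on N \<Psi>"
    and eq: "\<And>\<epsilon> h. h \<in> W \<Longrightarrow> src G g = src G h \<Longrightarrow> (\<epsilon>, \<zeta> h) \<in> N \<Longrightarrow> integrand a g vs \<epsilon> h = \<Psi> (\<epsilon>, \<zeta> h)"
    and d0: "vf_action A B G (\<lambda>k. deformation_cocycle A G m k h0) a (m 0 g h0)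
       (map (tangent_map A A (src_fiber G (src G h0)) (\<lambda>g'. m 0 g' h0) g) vs)
     = frechet_derivative \<Psi> (at (0, \<zeta> h0)) (1, 0)"
    by (rule integrand_local_form[OF a vs s0]) (rule that; assumption)+
  obtain R where R: "0 < R" "cball (0, \<zeta> h0) R \<subseteq> N" using open_contains_cball N(1,2) by metis
  have CD: "Cinf_on N (\<lambda>z. frechet_derivative \<Psi> (at z) (1, 0))" by (rule Cinf_on_frechet[OF N(3)])
  obtain C where C: "0 \<le> C" "\<And>z. z \<in> cball (0, \<zeta> h0) R \<Longrightarrow> norm (frechet_derivative \<Psi> (at z) (1, 0)) \<le> C"
    using Cinf_on_bounded_cball[OF CD R(2)] by metis
  define \<delta> where "\<delta> = R / 2"
  define Q where "Q = \<zeta> -` ball (\<zeta> h0) \<delta> \<inter> W"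
  have Q: "open Q" unfolding Q_def
    by (rule open_vimage_Int[OF compat_chartD(1,5)[OF c] open_ball])
  have box: "(\<epsilon>, \<zeta> h) \<in> cball (0, \<zeta> h0) R" if "\<bar>\<epsilon>\<bar> < \<delta>" "h \<in> Q" for \<epsilon> h
  proof -
    have "dist (0, \<zeta> h0) (\<epsilon>, \<zeta> h) \<le> dist 0 \<epsilon> + dist (\<zeta> h0) (\<zeta> h)"
      unfolding dist_Pair_Pair by (rule sqrt_sum_squares_le_sum_abs[THEN order_trans]) simp
    then show ?thesis using that by (simp add: Q_def \<delta>_def)
  qed
  have inN: "(\<epsilon>, \<zeta> h) \<in> N" if "\<bar>\<epsilon>\<bar> < \<delta>" "h \<in> Q" for \<epsilon> h using box[OF that] R(2) by blast
  have val: "\<Psi> (\<epsilon>, \<zeta> h) = integrand a g vs \<epsilon> h" if "\<bar>\<epsilon>\<bar> < \<delta>" "h \<in> Q" "src G g = src G h" for \<epsilon> h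
    using eq[of h \<epsilon>] that inN[OF that(1,2)] by (simp add: Q_def)
  have der: "((\<lambda>\<epsilon>. integrand a g vs \<epsilon> h) has_vector_derivative frechet_derivative \<Psi> (at (\<epsilon>, \<zeta> h)) (1, 0)) (at \<epsilon>)"
    if "\<bar>\<epsilon>\<bar> < \<delta>" "h \<in> Q" "src G g = src G h" for \<epsilon> h
  proof -
    have "((\<lambda>\<epsilon>. (\<epsilon>, \<zeta> h)) has_derivative (\<lambda>t. (t, 0))) (at \<epsilon>)" by (auto intro!: derivative_eq_intros)
    from has_derivative_compose[OF this Cinf_on_has_derivative[OF N(3) inN[OF that(1,2)]]]
    have "((\<lambda>\<epsilon>. \<Psi> (\<epsilon>, \<zeta> h)) has_derivative (\<lambda>t. frechet_derivative \<Psi> (at (\<epsilon>, \<zeta> h)) (t, 0))) (at \<epsilon>)" .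
    moreover have "(\<lambda>t. frechet_derivative \<Psi> (at (\<epsilon>, \<zeta> h)) (t, 0)) = (\<lambda>t. t *\<^sub>R frechet_derivative \<Psi> (at (\<epsilon>, \<zeta> h)) (1, 0))"
    proof
      show "frechet_derivative \<Psi> (at (\<epsilon>, \<zeta> h)) (t, 0) = t *\<^sub>R frechet_derivative \<Psi> (at (\<epsilon>, \<zeta> h)) (1, 0)" for t
        using linear_scale[OF Cinf_on_linear_frechet[OF N(3) inN[OF that(1,2)]], of t "(1, 0)"] by simp
    qed
    ultimately have "((\<lambda>\<epsilon>. \<Psi> (\<epsilon>, \<zeta> h)) has_vector_derivative frechet_derivative \<Psi> (at (\<epsilon>, \<zeta> h)) (1, 0)) (at \<epsilon>)"
      by (simp only: has_vector_derivative_def)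
    then show ?thesis
    proof (rule has_vector_derivative_transform_within_open)
      show "open {-\<delta><..<\<delta>}" "\<epsilon> \<in> {-\<delta><..<\<delta>}" using that(1) by auto
      show "\<Psi> (e, \<zeta> h) = integrand a g vs e h" if "e \<in> {-\<delta><..<\<delta>}" for e
        by (rule val) (use that \<open>h \<in> Q\<close> \<open>src G g = src G h\<close> in auto)
    qed
  qed
  have h0Q: "h0 \<in> Q" and \<delta>0: "0 < \<delta>" using h0 R(1) by (auto simp: Q_def \<delta>_def)
  show ?thesis
  proof (rule that[OF Q h0Q \<delta>0 C(1)])
    fix \<epsilon> :: real assume e: "\<bar>\<epsilon>\<bar> < \<delta>"
    let ?S = "Q \<inter> src_fiber G (src G g)"
    have "continuous_on ?S \<zeta>"
      by (rule continuous_on_subset[OF compat_chartD(5)[OF c]]) (auto simp: Q_def)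
    then have "continuous_on ?S (\<lambda>h. (\<epsilon>, \<zeta> h))" by (intro continuous_intros)
    then have "continuous_on ?S (\<lambda>h. \<Psi> (\<epsilon>, \<zeta> h))"
      by (rule continuous_on_compose2[OF Cinf_on_continuous[OF N(3)]]) (use inN[OF e] in auto)
    then show "continuous_on ?S (integrand a g vs \<epsilon>)"
      by (rule continuous_on_eq) (use val[OF e] in \<open>auto simp: src_fiber_def\<close>)
    show "\<exists>w. ((\<lambda>\<epsilon>. integrand a g vs \<epsilon> h) has_vector_derivative w) (at \<epsilon>) \<and> norm w \<le> C"
      if h: "h \<in> Q" "src G g = src G h" for h
      using der[OF e h] C(2)[OF box[OF e h(1)]] by blast
  next
    show "((\<lambda>\<epsilon>. integrand a g vs \<epsilon> h0) has_vector_derivative integrand_deriv a g vs h0) (at 0)"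
      using der[OF _ h0Q s0, of 0] \<delta>0 unfolding integrand_deriv_eq[OF vs s0] d0 by simp
  qed
qed

lemma patch_has_derivative:
  fixes a :: "'g \<Rightarrow> 'e list \<Rightarrow> 'k::{real_normed_field, euclidean_space}" and \<psi> :: "'e \<Rightarrow> 'g"
  assumes a: "a \<in> convolution_algebra A B G" and vs: "vs \<in> tuples (ker_ds A B G g)"
    and cs: "distinct cs" "set cs \<subseteq> Basis"
    and \<psi>: "\<psi> ` W \<subseteq> src_fiber G (src G g)" "continuous_on W \<psi>" and \<beta>: "continuous_on W \<beta>"
    and \<rho>: "continuous_on (src_fiber G (src G g)) \<rho>"
    and K: "compact K" "K \<subseteq> W" "\<And>x. x \<in> W \<Longrightarrow> x \<notin> K \<Longrightarrow> \<rho> (\<psi> x) = (0::real)"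
  shows "((\<lambda>\<epsilon>. LINT x:W|coord_measure cs. \<rho> (\<psi> x) *\<^sub>R (integrand a g vs \<epsilon> (\<psi> x) * \<beta> x)) has_vector_derivative
    (LINT x:W|coord_measure cs. \<rho> (\<psi> x) *\<^sub>R (integrand_deriv a g vs (\<psi> x) * \<beta> x))) (at 0)"
proof -
  let ?\<mu> = "coord_measure cs"
  \<comment> \<open>All factors independent of the parameter: the partition function and the second
    density.\<close>
  define k where "k x = \<rho> (\<psi> x) *\<^sub>R \<beta> x" for x
  \<comment> \<open>The partition function vanishes on the part of the patch outside
    \<open>K\<close>, so the integral reduces to a compact set.\<close>
  have onK: "(LINT x:W|?\<mu>. \<rho> (\<psi> x) *\<^sub>R (f x * \<beta> x)) = (\<integral>x. indicator K x *\<^sub>R (f x * k x) \<partial>?\<mu>)" for f :: "'e \<Rightarrow> 'k"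
    unfolding set_lebesgue_integral_def
    using K(2,3) by (intro Bochner_Integration.integral_cong) (auto simp: indicator_def k_def)
  have K\<psi>: "continuous_on K \<psi>" "\<psi> ` K \<subseteq> src_fiber G (src G g)"
    using continuous_on_subset[OF \<psi>(2) K(2)] \<psi>(1) K(2) by auto
  then have srcK: "src G g = src G (\<psi> x)" if "x \<in> K" for x using that by (auto simp: src_fiber_def)
  have kc: "continuous_on K k" unfolding k_def
    by (intro continuous_on_scaleR continuous_on_subset[OF \<beta> K(2)] continuous_on_compose2[OF \<rho> K\<psi>])
  then have "bounded (k ` K)" by (intro compact_imp_bounded compact_continuous_image K(1))
  then obtain b where b: "\<And>x. x \<in> K \<Longrightarrow> norm (k x) \<le> b" by (auto simp: bounded_iff)
  have "((\<lambda>\<epsilon>. \<integral>x. indicator K x *\<^sub>R (integrand a g vs \<epsilon> (\<psi> x) * k x) \<partial>?\<mu>) has_vector_derivative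
     (\<integral>x. indicator K x *\<^sub>R (integrand_deriv a g vs (\<psi> x) * k x) \<partial>?\<mu>)) (at 0)"
  proof (rule has_vector_derivative_integral_compact[OF sets_coord_measure _ K(1)])
    show "emeasure ?\<mu> K < \<infinity>"
      using K(1) by (intro emeasure_coord_measure_finite cs) (auto intro: compact_imp_bounded borel_compact)
    fix x0 assume x0: "x0 \<in> K"
    obtain Q \<delta> C where Q: "open Q" "\<psi> x0 \<in> Q" and \<delta>: "(0::real) < \<delta>" and C: "(0::real) \<le> C"
      and cont: "\<And>\<epsilon>. \<bar>\<epsilon>\<bar> < \<delta> \<Longrightarrow> continuous_on (Q \<inter> src_fiber G (src G g)) (integrand a g vs \<epsilon>)"
      and der: "\<And>\<epsilon> h. \<bar>\<epsilon>\<bar> < \<delta> \<Longrightarrow> h \<in> Q \<Longrightarrow> src G g = src G h \<Longrightarrow>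
      \<exists>w. ((\<lambda>\<epsilon>. integrand a g vs \<epsilon> h) has_vector_derivative w) (at \<epsilon>) \<and> norm w \<le> C"
      and d0: "((\<lambda>\<epsilon>. integrand a g vs \<epsilon> (\<psi> x0)) has_vector_derivative integrand_deriv a g vs (\<psi> x0)) (at 0)"
      by (rule integrand_near[OF a vs srcK[OF x0]]) (rule that; assumption)+
    show "((\<lambda>\<epsilon>. integrand a g vs \<epsilon> (\<psi> x0) * k x0) has_vector_derivative integrand_deriv a g vs (\<psi> x0) * k x0) (at 0)"
      by (rule has_vector_derivative_mult_left[OF d0])
    obtain V where V: "open V" "V \<inter> K = \<psi> -` Q \<inter> K"
      using K\<psi>(1) Q(1) unfolding continuous_on_open_invariant by blast
    have VQ: "\<psi> x \<in> Q" if "x \<in> K \<inter> V" for x using V(2) that by blast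
    have VS: "\<psi> ` (K \<inter> V) \<subseteq> Q \<inter> src_fiber G (src G g)" using VQ K\<psi>(2) by auto
    have 1: "continuous_on (K \<inter> V) (\<lambda>x. integrand a g vs \<epsilon> (\<psi> x) * k x)" if "\<bar>\<epsilon>\<bar> < \<delta>" for \<epsilon>
    proof (rule continuous_on_mult)
      show "continuous_on (K \<inter> V) (\<lambda>x. integrand a g vs \<epsilon> (\<psi> x))"
        by (rule continuous_on_compose2[OF cont[OF that] _ VS])
          (rule continuous_on_subset[OF K\<psi>(1)], auto)
      show "continuous_on (K \<inter> V) k" by (rule continuous_on_subset[OF kc]) auto
    qed
    have 2: "\<exists>w. ((\<lambda>\<epsilon>. integrand a g vs \<epsilon> (\<psi> x) * k x) has_vector_derivative w) (at \<epsilon>) \<and> norm w \<le> C * b"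
      if e: "\<bar>\<epsilon>\<bar> < \<delta>" and x: "x \<in> K \<inter> V" for \<epsilon> x
    proof -
      have xK: "x \<in> K" using x by simp
      obtain w where w: "((\<lambda>\<epsilon>. integrand a g vs \<epsilon> (\<psi> x)) has_vector_derivative w) (at \<epsilon>)" "norm w \<le> C"
        using der[OF e VQ[OF x] srcK[OF xK]] by blast
      have "norm (w * k x) \<le> C * b"
        unfolding norm_mult by (rule mult_mono[OF w(2) b[OF xK] C]) simp
      then show ?thesis using has_vector_derivative_mult_left[OF w(1)] by blast
    qed
    have "x0 \<in> V" using V(2) Q(2) x0 by blast
    then show "\<exists>\<delta> V C. 0 < \<delta> \<and> open V \<and> x0 \<in> V \<and>
      (\<forall>\<epsilon>. \<bar>\<epsilon>\<bar> < \<delta> \<longrightarrow> continuous_on (K \<inter> V) (\<lambda>x. integrand a g vs \<epsilon> (\<psi> x) * k x)) \<and>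
      (\<forall>\<epsilon> x. \<bar>\<epsilon>\<bar> < \<delta> \<longrightarrow> x \<in> K \<inter> V \<longrightarrow>
        (\<exists>w. ((\<lambda>\<epsilon>. integrand a g vs \<epsilon> (\<psi> x) * k x) has_vector_derivative w) (at \<epsilon>) \<and> norm w \<le> C))"
      using \<delta> V(1) 1 2 by blast
  qed
  then show ?thesis unfolding onK .
qed

lemma convolution_has_derivative:
  fixes a\<^sub>1 a\<^sub>2 :: "'g \<Rightarrow> 'e list \<Rightarrow> 'k::{real_normed_field, euclidean_space}"
  assumes a1: "a\<^sub>1 \<in> convolution_algebra A B G" and a2: "a\<^sub>2 \<in> convolution_algebra A B G"
    and vs: "vs \<in> tuples (ker_ds A B G g)"
  shows "((\<lambda>\<epsilon>. convolution A B G (m \<epsilon>) a\<^sub>1 a\<^sub>2 g vs) has_vector_derivative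
    Phi2 A B G (deformation_cocycle A G m) a\<^sub>1 a\<^sub>2 g vs) (at 0)"
proof -
  let ?S = "src_fiber G (src G g)" and ?r = "dim (model A) - dim (model B)"
  let ?P = "\<lambda>(cs, W, \<psi>, \<rho>). parametrized_partition A ?r ?S cs W \<psi> \<rho>"
  \<comment> \<open>The partition selected in \<open>density_integral\<close> depends on the fiber
    only, so it is the same one for every \<open>\<epsilon>\<close> and for
    \<open>Phi2\<close>.\<close>
  obtain cs W \<psi> \<rho> where sel: "(SOME p. ?P p) = (cs, W, \<psi>, \<rho>)" by (rule prod_cases4)
  have "\<exists>p. ?P p" using ex_parametrized_partition[of "src G g"] by auto
  then have "?P (SOME p. ?P p)" by (rule someI_ex)
  then have pp: "parametrized_partition A ?r ?S cs W \<psi> \<rho>" unfolding sel by simp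
  then have cs: "distinct cs" "set cs \<subseteq> Basis" "length cs = ?r"
    and W: "\<And>i. openin (top_of_set (span (set cs))) (W i)" "\<And>i. openin (top_of_set ?S) (\<psi> i ` W i)"
      "\<And>i. inj_on (\<psi> i) (W i)" "\<And>i. smooth_map eucl A (W i) (\<psi> i)"
    and \<rho>: "\<And>i. continuous_on ?S (\<rho> i)"
      "\<And>i. \<exists>K\<subseteq>W i. compact K \<and> (\<forall>p\<in>?S. \<rho> i p \<noteq> 0 \<longrightarrow> p \<in> \<psi> i ` K)"
      "\<And>p. p \<in> ?S \<Longrightarrow> \<exists>N. open N \<and> p \<in> N \<and> finite {i. \<exists>q\<in>N \<inter> ?S. \<rho> i q \<noteq> 0}"
    unfolding parametrized_partition_def by auto
  have WS: "\<psi> i ` W i \<subseteq> ?S" for i using openin_imp_subset[OF W(2)] .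
  let ?v = "\<lambda>i x. map (\<lambda>b. velocity A (\<lambda>t. \<psi> i (x + t *\<^sub>R b)) 0) cs"
  define T where "T f i = (LINT x:W i|coord_measure cs. \<rho> i (\<psi> i x) *\<^sub>R (f (\<psi> i x) * a\<^sub>2 (\<psi> i x) (?v i x)))"
    for f :: "'g \<Rightarrow> 'k" and i
  have int: "fiber_integral A B G (src G g) (\<lambda>h ws. f h * a\<^sub>2 h ws) = (\<Sum>i. T f i)" for f
    unfolding fiber_integral_def density_integral_def sel by (simp add: T_def)
  let ?Z = "closure {q. \<exists>ws\<in>tuples (ker_ds A B G q). a\<^sub>2 q ws \<noteq> 0}"
  have a2_0: "a\<^sub>2 q ws = 0" if "q \<notin> ?Z" "ws \<in> tuples (ker_ds A B G q)" for q ws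
  proof (rule ccontr)
    assume "a\<^sub>2 q ws \<noteq> 0"
    then have "q \<in> {q. \<exists>ws\<in>tuples (ker_ds A B G q). a\<^sub>2 q ws \<noteq> 0}" using that(2) by auto
    from subsetD[OF closure_subset this] show False using that(1) by contradiction
  qed
  \<comment> \<open>The second density has compact support and the fiber is closed, so local
    finiteness leaves finitely many patches. This set does not depend on the first factor
    \<open>f\<close>, which varies with the parameter.\<close>
  define L where "L = {i. \<exists>q\<in>?Z \<inter> ?S. \<rho> i q \<noteq> 0}"
  have "compact ?Z" using a2 unfolding convolution_algebra_def by (elim CollectE conjE)
  then have "compact (?Z \<inter> ?S)" by (rule compact_Int_closed[OF _ closed_src_fiber])
  then have "finite L" unfolding L_def by (rule finite_indices_meeting_compact[where S="?S"]) (use \<rho>(3) in auto)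
  have T0: "T f i = 0" if "i \<notin> L" for f i
  proof -
    have "\<rho> i (\<psi> i x) *\<^sub>R (f (\<psi> i x) * a\<^sub>2 (\<psi> i x) (?v i x)) = 0" if x: "x \<in> W i" for x
    proof (cases "\<psi> i x \<in> ?Z")
      case True
      then have "\<rho> i (\<psi> i x) = 0" using \<open>i \<notin> L\<close> WS[of i] x unfolding L_def by blast
      then show ?thesis by simp
    next
      case False
      then show ?thesis using a2_0[OF False param_velocity_tuples[OF W(1) WS W(4) cs(3) x]] by simp
    qed
    then have "indicator (W i) x *\<^sub>R \<rho> i (\<psi> i x) *\<^sub>R (f (\<psi> i x) * a\<^sub>2 (\<psi> i x) (?v i x)) = 0" for x
      by (cases "x \<in> W i") simp_all
    then show ?thesis unfolding T_def set_lebesgue_integral_def by (simp only: Bochner_Integration.integral_zero)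
  qed
  have sum: "fiber_integral A B G (src G g) (\<lambda>h ws. f h * a\<^sub>2 h ws) = (\<Sum>i\<in>L. T f i)" for f
    unfolding int by (rule suminf_finite[OF \<open>finite L\<close> T0])
  have "((\<lambda>\<epsilon>. T (integrand a\<^sub>1 g vs \<epsilon>) i) has_vector_derivative T (integrand_deriv a\<^sub>1 g vs) i) (at 0)" for i
  proof -
    obtain K where K: "K \<subseteq> W i" "compact K" "\<And>p. p \<in> ?S \<Longrightarrow> \<rho> i p \<noteq> 0 \<Longrightarrow> p \<in> \<psi> i ` K" using \<rho>(2) by meson
    have "\<rho> i (\<psi> i x) = 0" if "x \<in> W i" "x \<notin> K" for x
    proof (rule ccontr)
      assume "\<rho> i (\<psi> i x) \<noteq> 0"
      then have "\<psi> i x \<in> \<psi> i ` K" using K(3) WS that(1) by blast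
      then show False using inj_on_image_mem_iff[OF W(3) that(1) K(1)] that(2) by blast
    qed
    then show ?thesis unfolding T_def
      by (rule patch_has_derivative[OF a1 vs cs(1,2) WS param_continuous[OF W(4)]
            param_density_continuous[OF W(1) WS W(4) cs(3) a2] \<rho>(1) K(2,1)])
  qed
  then have "((\<lambda>\<epsilon>. \<Sum>i\<in>L. T (integrand a\<^sub>1 g vs \<epsilon>) i) has_vector_derivative (\<Sum>i\<in>L. T (integrand_deriv a\<^sub>1 g vs) i)) (at 0)"
    by (intro has_vector_derivative_sum)
  then show ?thesis
    unfolding convolution_def Phi2_def sum[symmetric] integrand_def integrand_deriv_def .
qed

end

theorem proposition2p6:
  fixes A :: "('g::{t2_space, second_countable_topology}, 'e::euclidean_space) smooth_structure"
    and B :: "('m::{t2_space, second_countable_topology}, 'f::euclidean_space) smooth_structure"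
    and G :: "('g, 'm) groupoid"
    and I :: "real set"
    and m :: "real \<Rightarrow> 'g \<Rightarrow> 'g \<Rightarrow> 'g"
  assumes "lie_groupoid A B G"
    and "s_constant_deformation A B G I m"
  shows "deformation_cocycle A G m \<in> Cdef2 A B G \<and>
    (\<forall>a\<^sub>1 \<in> convolution_algebra A B G. \<forall>a\<^sub>2 \<in> convolution_algebra A B G.
       \<forall>g. \<forall>vs \<in> tuples (ker_ds A B G g).
         (\<lambda>\<epsilon>. convolution A B G (m \<epsilon>) a\<^sub>1 a\<^sub>2 g vs :: 'k::{real_normed_field, euclidean_space})
            differentiable (at 0) \<and>
         Phi2 A B G (deformation_cocycle A G m) a\<^sub>1 a\<^sub>2 g vs = hochschild_cocycle A B G m a\<^sub>1 a\<^sub>2 g vs)"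
proof -
  interpret deformation A B G I m using assms by unfold_locales
  have "(\<lambda>\<epsilon>. convolution A B G (m \<epsilon>) a\<^sub>1 a\<^sub>2 g vs) differentiable (at 0) \<and>
      Phi2 A B G (deformation_cocycle A G m) a\<^sub>1 a\<^sub>2 g vs = hochschild_cocycle A B G m a\<^sub>1 a\<^sub>2 g vs"
    if "a\<^sub>1 \<in> convolution_algebra A B G" "a\<^sub>2 \<in> convolution_algebra A B G" "vs \<in> tuples (ker_ds A B G g)"
    for a\<^sub>1 a\<^sub>2 :: "'g \<Rightarrow> 'e list \<Rightarrow> 'k" and g vs
    using convolution_has_derivative[OF that]
    by (auto simp: hochschild_cocycle_def vector_derivative_at intro: differentiableI_vector)
  then show ?thesis using cocycle_in_Cdef2 by blast
qed

end
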